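(* Let $n\geq 2$. The following are equivalent: (1) There exists a proper class of $\Sigma_n$-strong cardinals. (2) There exists a proper class of $\Pi_{n-1}$-strong cardinals. (3) $\mathbf{\Sigma}_n$-$\mathrm{PRP}$. (4) $\mathbf{\Pi}_{n-1}$-$\mathrm{PRP}$. (5) $\mathbf{\Sigma}_n$-$\mathrm{SWVP}$. (6) $\mathbf{\Pi}_{n-1}$-$\mathrm{SWVP}$. (7) $\mathbf{\Sigma}_n$-$\mathrm{WVP}$. (8) $\mathbf{\Pi}_{n-1}$-$\mathrm{WVP}$.
   Context: We work in ZFC; $n$ is a fixed metatheoretic natural number, $\Sigma_n,\Pi_n$ refer to the Levy hierarchy, and "class" means definable class. Graphs. A graph is a structure $\langle G,E_G\rangle$ with $G$ a non-empty set and $E_G$ a binary relation on $G$. A homomorphism $h:G\to H$ is a map such that $xE_Gy$ implies $h(x)E_Hh(y)$. For a set $S$ of graphs, $\prod S$ is the structure whose universe is the set of all functions $f$ with domain $S$ such that $f(\mathcal{A})$ belongs to the universe of $\mathcal{A}$ for every $\mathcal{A}\in S$, with the relation defined pointwise. Boldface principles. Let $\Gamma$ be one of $\Sigma_m,\Pi_m$, $m>0$, and let $\mathbf{\Gamma}$ denote the corresponding boldface class: $\mathbf{\Gamma}$-definable means definable by a $\Gamma$ formula with arbitrary sets as parameters. - $\mathbf{\Gamma}$-$\mathrm{PRP}$ (Product Reflection Principle): for every $\mathbf{\Gamma}$-definable proper class $\mathcal{C}$ of graphs there is a subset $S$ of $\mathcal{C}$ such that for every $G$ in $\mathcal{C}$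 there is a homomorphism $\prod S\to G$. - $\mathbf{\Gamma}$-$\mathrm{WVP}$ (Weak Vopěnka Principle): there is no $\mathbf{\Gamma}$-definable sequence $\langle G_\alpha:\alpha\in\mathrm{OR}\rangle$ of graphs such that for every $\alpha\leq\beta$ there exists exactly one homomorphism $G_\beta\to G_\alpha$, and there is no homomorphism $G_\alpha\to G_\beta$ whenever $\alpha<\beta$. - $\mathbf{\Gamma}$-$\mathrm{SWVP}$ (Semi-Weak Vopěnka Principle): the same as $\mathbf{\Gamma}$-$\mathrm{WVP}$, with "exactly one homomorphism $G_\beta\to G_\alpha$" replaced by "at least one homomorphism $G_\beta\to G_\alpha$". $\Gamma$-strong cardinals. If $j:V\to M$ is elementary with $M$ transitive and $A$ is a class defined by a formula $\varphi$, put $j(A):=\{X\in M: M\models\varphi(X)\}$. A cardinal $\kappa$ is $\lambda$-$\Gamma$-strong if for every $\Gamma$-definable (without parameters) class $A$ there is an elementary embedding $j:V\to M$ with $M$ transitive, critical point $\kappa$, $V_\lambda\subseteq M$, and $A\cap V_\lambda\subseteq j(A)$. It is $\Gamma$-strong if it is $\lambda$-$\Gamma$-strong for every ordinal $\lambda$. *)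

theory Defs
  imports Main
begin

text \<open>
  ZFC is treated as a first-order theory, and a theorem of ZFC is rendered as a statement about
  an arbitrary model \<open>(V, E)\<close> of ZFC, where \<open>V\<close> is the whole type \<open>'a\<close>. The model need not be
  well-founded or \<open>\<omega>\<close>-standard, and classes are the subsets of \<open>V\<close> that are first-order
  definable from parameters. Formulas of the language of set theory are deeply embedded;
  they are the metatheoretic formulas, and so is the level \<open>n\<close> of the Levy hierarchy.
\<close>

datatype fm = Mem nat nat | Eq nat nat | Neg fm | And fm fm | Ex nat fm

abbreviation All :: "nat \<Rightarrow> fm \<Rightarrow> fm" where
  "All x \<phi> \<equiv> Neg (Ex x (Neg \<phi>))"

primrec fv :: "fm \<Rightarrow> nat set" where
  "fv (Mem x y) = {x, y}"
| "fv (Eq x y) = {x, y}"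
| "fv (Neg \<phi>) = fv \<phi>"
| "fv (And \<phi> \<psi>) = fv \<phi> \<union> fv \<psi>"
| "fv (Ex x \<phi>) = fv \<phi> - {x}"

text \<open>Satisfaction in the structure \<open>(D, E)\<close>; the quantifiers range over \<open>D\<close>.\<close>

primrec sat :: "('a \<Rightarrow> 'a \<Rightarrow> bool) \<Rightarrow> 'a set \<Rightarrow> (nat \<Rightarrow> 'a) \<Rightarrow> fm \<Rightarrow> bool" where
  "sat E D s (Mem x y) \<longleftrightarrow> E (s x) (s y)"
| "sat E D s (Eq x y) \<longleftrightarrow> s x = s y"
| "sat E D s (Neg \<phi>) \<longleftrightarrow> \<not> sat E D s \<phi>"
| "sat E D s (And \<phi> \<psi>) \<longleftrightarrow> sat E D s \<phi> \<and> sat E D s \<psi>"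
| "sat E D s (Ex x \<phi>) \<longleftrightarrow> (\<exists>a\<in>D. sat E D (s(x := a)) \<phi>)"

inductive_set Delta0_fm :: "fm set" where
  "Mem x y \<in> Delta0_fm"
| "Eq x y \<in> Delta0_fm"
| "\<phi> \<in> Delta0_fm \<Longrightarrow> Neg \<phi> \<in> Delta0_fm"
| "\<phi> \<in> Delta0_fm \<Longrightarrow> \<psi> \<in> Delta0_fm \<Longrightarrow> And \<phi> \<psi> \<in> Delta0_fm"
| "\<phi> \<in> Delta0_fm \<Longrightarrow> x \<noteq> y \<Longrightarrow> Ex x (And (Mem x y) \<phi>) \<in> Delta0_fm"

inductive_set Ex_block :: "fm set \<Rightarrow> fm set" for \<Gamma> where
  "\<phi> \<in> \<Gamma> \<Longrightarrow> \<phi> \<in> Ex_block \<Gamma>"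
| "\<phi> \<in> Ex_block \<Gamma> \<Longrightarrow> Ex x \<phi> \<in> Ex_block \<Gamma>"

inductive_set All_block :: "fm set \<Rightarrow> fm set" for \<Gamma> where
  "\<phi> \<in> \<Gamma> \<Longrightarrow> \<phi> \<in> All_block \<Gamma>"
| "\<phi> \<in> All_block \<Gamma> \<Longrightarrow> All x \<phi> \<in> All_block \<Gamma>"

fun Sigma_fm :: "nat \<Rightarrow> fm set" and Pi_fm :: "nat \<Rightarrow> fm set" where
  "Sigma_fm 0 = Delta0_fm"
| "Sigma_fm (Suc m) = Ex_block (Pi_fm m)"
| "Pi_fm 0 = Delta0_fm"
| "Pi_fm (Suc m) = All_block (Sigma_fm m)"

context
  fixes E :: "'a \<Rightarrow> 'a \<Rightarrow> bool"
begin

definition elts :: "'a \<Rightarrow> 'a set" where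
  "elts x = {y. E y x}"

definition is_set :: "'a set \<Rightarrow> bool" where
  "is_set A \<longleftrightarrow> (\<exists>x. elts x = A)"

text \<open>In Separation and Replacement the assignment \<open>s\<close> supplies the parameters.\<close>

definition ZFC :: bool where
  "ZFC \<longleftrightarrow>
    (\<forall>x y. elts x = elts y \<longrightarrow> x = y) \<and>
    (\<forall>x. elts x \<noteq> {} \<longrightarrow> (\<exists>y\<in>elts x. elts y \<inter> elts x = {})) \<and>
    (\<forall>x y. is_set {x, y}) \<and>
    (\<forall>x. is_set (\<Union>y\<in>elts x. elts y)) \<and>
    (\<forall>x. is_set {z. elts z \<subseteq> elts x}) \<and>
    (\<exists>x. (\<exists>e\<in>elts x. elts e = {}) \<and> (\<forall>y\<in>elts x. \<exists>z\<in>elts x. elts z = insert y (elts y))) \<and>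
    (\<forall>\<phi> s x. is_set {z \<in> elts x. sat E UNIV (s(0 := z)) \<phi>}) \<and>
    (\<forall>\<phi> s x. (\<forall>u\<in>elts x. \<exists>!v. sat E UNIV (s(0 := u, 1 := v)) \<phi>) \<longrightarrow>
       is_set {v. \<exists>u\<in>elts x. sat E UNIV (s(0 := u, 1 := v)) \<phi>}) \<and>
    (\<forall>x. (\<forall>y\<in>elts x. elts y \<noteq> {}) \<and>
         (\<forall>y\<in>elts x. \<forall>z\<in>elts x. y \<noteq> z \<longrightarrow> elts y \<inter> elts z = {}) \<longrightarrow>
       (\<exists>c. \<forall>y\<in>elts x. \<exists>!z. z \<in> elts c \<and> z \<in> elts y))"

text \<open>Definability by a formula in \<open>\<Gamma>\<close> from arbitrary sets as parameters (the boldface notion).\<close>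

definition definable :: "fm set \<Rightarrow> 'a set \<Rightarrow> bool" where
  "definable \<Gamma> A \<longleftrightarrow> (\<exists>\<phi>\<in>\<Gamma>. \<exists>s. A = {x. sat E UNIV (s(0 := x)) \<phi>})"

abbreviation is_class :: "'a set \<Rightarrow> bool" where
  "is_class A \<equiv> definable UNIV A"

text \<open>For a definable class, being contained in a set is the same as being a set, by Separation.\<close>

definition proper_class :: "'a set \<Rightarrow> bool" where
  "proper_class A \<longleftrightarrow> \<not> (\<exists>x. A \<subseteq> elts x)"

text \<open>The operators below that are defined by \<open>THE\<close> are only meaningful in a model of ZFC.\<close>

definition set_of :: "'a set \<Rightarrow> 'a" where
  "set_of A = (THE x. elts x = A)"

definition pair :: "'a \<Rightarrow> 'a \<Rightarrow> 'a" where
  "pair x y = set_of {set_of {x}, set_of {x, y}}"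

definition fun_on :: "'a \<Rightarrow> 'a \<Rightarrow> bool" where
  "fun_on f a \<longleftrightarrow>
    (\<forall>z\<in>elts f. \<exists>x\<in>elts a. \<exists>y. z = pair x y) \<and>
    (\<forall>x\<in>elts a. \<exists>!y. pair x y \<in> elts f)"

definition app :: "'a \<Rightarrow> 'a \<Rightarrow> 'a" where
  "app f x = (THE y. pair x y \<in> elts f)"

text \<open>Well-foundedness of the membership relation on an ordinal comes from Foundation.\<close>

definition Ord :: "'a \<Rightarrow> bool" where
  "Ord \<alpha> \<longleftrightarrow>
    (\<forall>x\<in>elts \<alpha>. elts x \<subseteq> elts \<alpha>) \<and>
    (\<forall>x\<in>elts \<alpha>. \<forall>y\<in>elts \<alpha>. x \<in> elts y \<or> x = y \<or> y \<in> elts x)"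

definition Card :: "'a \<Rightarrow> bool" where
  "Card \<kappa> \<longleftrightarrow> Ord \<kappa> \<and>
    \<not> (\<exists>\<beta>\<in>elts \<kappa>. \<exists>f. fun_on f \<beta> \<and> bij_betw (app f) (elts \<beta>) (elts \<kappa>))"

definition succ :: "'a \<Rightarrow> 'a" where
  "succ \<alpha> = set_of (insert \<alpha> (elts \<alpha>))"

text \<open>The cumulative hierarchy, from the recursion
  \<open>V\<^sub>\<beta> = \<Union>\<gamma><\<beta>. Pow V\<^sub>\<gamma>\<close> carried out inside the model.\<close>

definition hierarchy_upto :: "'a \<Rightarrow> 'a \<Rightarrow> bool" where
  "hierarchy_upto \<alpha> f \<longleftrightarrow> fun_on f (succ \<alpha>) \<and>
    (\<forall>\<beta>\<in>elts (succ \<alpha>).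
       elts (app f \<beta>) = (\<Union>\<gamma>\<in>elts \<beta>. {x. elts x \<subseteq> elts (app f \<gamma>)}))"

definition Vset :: "'a \<Rightarrow> 'a" where
  "Vset \<alpha> = (THE v. \<exists>f. hierarchy_upto \<alpha> f \<and> v = app f \<alpha>)"

text \<open>
  A graph is a set of the model of the form \<open>pair G R\<close>, and homomorphisms are elements
  of the model.
\<close>

definition is_graph :: "'a \<Rightarrow> bool" where
  "is_graph \<A> \<longleftrightarrow> (\<exists>G R. \<A> = pair G R \<and> elts G \<noteq> {} \<and>
     (\<forall>z\<in>elts R. \<exists>x\<in>elts G. \<exists>y\<in>elts G. z = pair x y))"

definition verts :: "'a \<Rightarrow> 'a" where
  "verts \<A> = (THE G. \<exists>R. \<A> = pair G R)"

definition edges :: "'a \<Rightarrow> 'a" where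
  "edges \<A> = (THE R. \<exists>G. \<A> = pair G R)"

definition hom :: "'a \<Rightarrow> 'a \<Rightarrow> 'a \<Rightarrow> bool" where
  "hom h \<A> \<B> \<longleftrightarrow> fun_on h (verts \<A>) \<and>
    (\<forall>x\<in>elts (verts \<A>). app h x \<in> elts (verts \<B>)) \<and>
    (\<forall>x\<in>elts (verts \<A>). \<forall>y\<in>elts (verts \<A>).
       pair x y \<in> elts (edges \<A>) \<longrightarrow> pair (app h x) (app h y) \<in> elts (edges \<B>))"

definition prod_verts :: "'a \<Rightarrow> 'a set" where
  "prod_verts S = {f. fun_on f S \<and> (\<forall>\<A>\<in>elts S. app f \<A> \<in> elts (verts \<A>))}"

definition prod_graph :: "'a \<Rightarrow> 'a" where
  "prod_graph S =
    pair (set_of (prod_verts S))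
      (set_of {pair f g | f g. f \<in> prod_verts S \<and> g \<in> prod_verts S \<and>
         (\<forall>\<A>\<in>elts S. pair (app f \<A>) (app g \<A>) \<in> elts (edges \<A>))})"

definition PRP :: "fm set \<Rightarrow> bool" where
  "PRP \<Gamma> \<longleftrightarrow> (\<forall>C. definable \<Gamma> C \<and> proper_class C \<and> (\<forall>\<A>\<in>C. is_graph \<A>) \<longrightarrow>
     (\<exists>S. elts S \<subseteq> C \<and> (\<forall>G\<in>C. \<exists>h. hom h (prod_graph S) G)))"

text \<open>
  A sequence indexed by \<open>OR\<close> is the class of pairs \<open>pair \<alpha> (G \<alpha>)\<close>; the values of the HOL
  function \<open>G\<close> outside the ordinals are irrelevant.
\<close>

definition definable_seq :: "fm set \<Rightarrow> ('a \<Rightarrow> 'a) \<Rightarrow> bool" where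
  "definable_seq \<Gamma> G \<longleftrightarrow> definable \<Gamma> {pair \<alpha> (G \<alpha>) | \<alpha>. Ord \<alpha>}"

definition WVP :: "fm set \<Rightarrow> bool" where
  "WVP \<Gamma> \<longleftrightarrow> \<not> (\<exists>G. definable_seq \<Gamma> G \<and> (\<forall>\<alpha>. Ord \<alpha> \<longrightarrow> is_graph (G \<alpha>)) \<and>
     (\<forall>\<alpha> \<beta>. Ord \<alpha> \<and> Ord \<beta> \<and> (\<alpha> \<in> elts \<beta> \<or> \<alpha> = \<beta>) \<longrightarrow> (\<exists>!h. hom h (G \<beta>) (G \<alpha>))) \<and>
     (\<forall>\<alpha> \<beta>. Ord \<alpha> \<and> Ord \<beta> \<and> \<alpha> \<in> elts \<beta> \<longrightarrow> \<not> (\<exists>h. hom h (G \<alpha>) (G \<beta>))))"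

definition SWVP :: "fm set \<Rightarrow> bool" where
  "SWVP \<Gamma> \<longleftrightarrow> \<not> (\<exists>G. definable_seq \<Gamma> G \<and> (\<forall>\<alpha>. Ord \<alpha> \<longrightarrow> is_graph (G \<alpha>)) \<and>
     (\<forall>\<alpha> \<beta>. Ord \<alpha> \<and> Ord \<beta> \<and> (\<alpha> \<in> elts \<beta> \<or> \<alpha> = \<beta>) \<longrightarrow> (\<exists>h. hom h (G \<beta>) (G \<alpha>))) \<and>
     (\<forall>\<alpha> \<beta>. Ord \<alpha> \<and> Ord \<beta> \<and> \<alpha> \<in> elts \<beta> \<longrightarrow> \<not> (\<exists>h. hom h (G \<alpha>) (G \<beta>))))"

text \<open>
  An elementary embedding of \<open>V\<close> into a transitive class \<open>M\<close>; as always in ZFC, both \<open>M\<close> and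
  (the graph of) \<open>j\<close> are classes, i.e. definable from parameters.
\<close>

definition elementary_embedding :: "('a \<Rightarrow> 'a) \<Rightarrow> 'a set \<Rightarrow> bool" where
  "elementary_embedding j M \<longleftrightarrow>
    is_class M \<and> (\<forall>x\<in>M. elts x \<subseteq> M) \<and>
    is_class {pair x (j x) | x. True} \<and> range j \<subseteq> M \<and>
    (\<forall>\<phi> s. sat E UNIV s \<phi> \<longleftrightarrow> sat E M (j \<circ> s) \<phi>)"

definition critical_point :: "('a \<Rightarrow> 'a) \<Rightarrow> 'a \<Rightarrow> bool" where
  "critical_point j \<kappa> \<longleftrightarrow> Ord \<kappa> \<and> j \<kappa> \<noteq> \<kappa> \<and> (\<forall>\<alpha>\<in>elts \<kappa>. j \<alpha> = \<alpha>)"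

text \<open>
  For a formula \<open>\<phi>\<close> whose only free variable is \<open>0\<close>, the subset of \<open>D\<close> it defines in
  \<open>(D, E)\<close>. So \<open>extension UNIV \<phi>\<close> is the class \<open>A\<close> defined by \<open>\<phi>\<close>, and \<open>extension M \<phi>\<close> is \<open>j(A)\<close>.
\<close>

definition extension :: "'a set \<Rightarrow> fm \<Rightarrow> 'a set" where
  "extension D \<phi> = {x \<in> D. sat E D (\<lambda>_. x) \<phi>}"

definition lam_strong :: "fm set \<Rightarrow> 'a \<Rightarrow> 'a \<Rightarrow> bool" where
  "lam_strong \<Gamma> \<mu> \<kappa> \<longleftrightarrow> Card \<kappa> \<and>
    (\<forall>\<phi>\<in>\<Gamma>. fv \<phi> \<subseteq> {0} \<longrightarrow>
       (\<exists>j M. elementary_embedding j M \<and> critical_point j \<kappa> \<and>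
          elts (Vset \<mu>) \<subseteq> M \<and>
          extension UNIV \<phi> \<inter> elts (Vset \<mu>) \<subseteq> extension M \<phi>))"

definition strong :: "fm set \<Rightarrow> 'a \<Rightarrow> bool" where
  "strong \<Gamma> \<kappa> \<longleftrightarrow> (\<forall>\<mu>. Ord \<mu> \<longrightarrow> lam_strong \<Gamma> \<mu> \<kappa>)"

end

end

theory Submission
  imports Defs
begin

text \<open>Let \<open>C\<close> be a \<open>\<Sigma>\<^sub>n\<close> class of graphs and \<open>\<kappa>\<close> a \<open>\<Pi>\<close>-strong cardinal of level \<open>n - 1\<close> above its parameters.
  Then \<open>C \<inter> V\<^sub>\<kappa>\<close> witnesses product reflection: a counterexample is reflected to some \<open>G\<close> in
  \<open>j (C \<inter> V\<^sub>\<kappa>)\<close>, for which \<open>f \<mapsto> j f G\<close> is a homomorphism. Product reflection refutes the sequences of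
  the weak Vopenka principles, as any set of members of such a sequence is dominated by a later member.

  Conversely, suppose that there are no \<open>\<Sigma>\<^sub>n\<close>-strong cardinals above \<open>\<rho>\<close>. Homomorphisms between suitable
  relational structures on the power sets of limit ranks \<open>V\<^sub>\<delta>\<close> are extenders, and their ultrapowers give
  strongness embeddings, so for every \<open>\<kappa> > \<rho>\<close> some limit rank containing \<open>\<kappa>\<close> has no endomorphism with
  critical point \<open>\<kappa>\<close>. Take ranks closed under these witnesses and correct for \<open>\<Sigma>\<close> formulas of level
  \<open>n - 1\<close>. By this closure and Kunen's theorem the only homomorphisms between their structures are the
  restrictions \<open>X \<mapsto> X \<inter> V\<^sub>\<delta>\<close>. Encoding the structures as graphs gives a \<open>\<Pi>\<close>-definable sequence of level
  \<open>n - 1\<close> which refutes both the weak Vopenka principle and product reflection.\<close>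

subsection \<open>Formulas and substitution\<close>

text \<open>The model need not be well-founded, so recursion, ultrapowers and collapses take place
  inside it, and each induction needs a proof that its predicate is definable. Hence two calculi of
  predicates: \<open>DP\<close> and \<open>DT\<close> record mere definability from parameters,
  while \<open>D0\<close>, \<open>SG\<close> and \<open>PI\<close> follow the complexity, which
  matters for transfer along embeddings and for the final sequence. A homomorphism is a set whereas
  strongness speaks of class embeddings. The structures live on power sets because a map on the
  subsets of a rank carries a whole extender. The bound below which strong cardinals may exist
  enters the structures as a constant relation, so that derived embeddings fix it: Kunen's theorem
  needs a fixed ordinal at or above the critical point. For critical points above the bound no such
  ordinal is at hand, and closure under witnesses of failure takes its place. The gain of one
  quantifier on the strongness side comes from coding an object, its parameters and its existential
  witnesses as one tuple; the class of these tuples has the complexity of the matrix.\<close>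

lemma finite_fv: "finite (fv \<phi>)"
  by (induction \<phi>) auto

lemma sat_cong: "(\<And>x. x \<in> fv \<phi> \<Longrightarrow> s x = t x) \<Longrightarrow> sat E D s \<phi> = sat E D t \<phi>"
proof (induction \<phi> arbitrary: s t)
  case (Neg \<phi>) then show ?case by (metis fv.simps(3) sat.simps(3))
next
  case (And \<phi> \<psi>) 
  have "sat E D s \<phi> = sat E D t \<phi>" "sat E D s \<psi> = sat E D t \<psi>"
    using And.prems by (auto intro!: And.IH)
  then show ?case by simp
next
  case (Ex x \<phi>)
  have "sat E D (s(x:=a)) \<phi> = sat E D (t(x:=a)) \<phi>" for a
    using Ex.prems by (intro Ex.IH) auto
  then show ?case by simp
qed auto

definition fresh :: "nat set \<Rightarrow> nat" where "fresh X = Suc (Max (insert 0 X))"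

lemma fresh: "finite X \<Longrightarrow> fresh X \<notin> X"
  unfolding fresh_def by (metis Max_ge finite_insert insertCI not_less_eq_eq order_refl)

text \<open>The map \<open>g\<close> may identify variables, so the bound variable is moved outside
  the image of the other free variables. This avoids capture, and in the bounded case it keeps the
  bound variable distinct from its bound.\<close>

primrec sub :: "fm \<Rightarrow> (nat \<Rightarrow> nat) \<Rightarrow> fm" where
  "sub (Mem x y) g = Mem (g x) (g y)"
| "sub (Eq x y) g = Eq (g x) (g y)"
| "sub (Neg \<phi>) g = Neg (sub \<phi> g)"
| "sub (And \<phi> \<psi>) g = And (sub \<phi> g) (sub \<psi> g)"
| "sub (Ex x \<phi>) g = Ex (fresh (g ` (fv \<phi> - {x}))) (sub \<phi> (g(x := fresh (g ` (fv \<phi> - {x})))))"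

lemma sat_sub: "sat E D s (sub \<phi> g) = sat E D (\<lambda>n. s (g n)) \<phi>"
proof (induction \<phi> arbitrary: s g)
  case (Ex x \<phi>)
  define y where "y = fresh (g ` (fv \<phi> - {x}))"
  have y: "y \<notin> g ` (fv \<phi> - {x})"
    unfolding y_def by (intro fresh) (simp add: finite_fv)
  have "sat E D (s(y := a)) (sub \<phi> (g(x:=y))) = sat E D ((\<lambda>n. s (g n))(x := a)) \<phi>" for a
    unfolding Ex.IH using y by (intro sat_cong) (auto simp: image_iff)
  then show ?case by (simp add: y_def)
qed auto

lemma sub_Delta0: "\<phi> \<in> Delta0_fm \<Longrightarrow> sub \<phi> g \<in> Delta0_fm"
proof (induction arbitrary: g rule: Delta0_fm.induct)
  case (5 \<phi> x y)
  define z where "z = fresh (g ` (fv (And (Mem x y) \<phi>) - {x}))"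
  have "z \<notin> g ` (fv (And (Mem x y) \<phi>) - {x})"
    unfolding z_def by (intro fresh) (simp only: finite_fv finite_imageI finite_Diff)
  then have "z \<noteq> g y" using 5(2) by auto
  then have "Ex z (And (Mem z (g y)) (sub \<phi> (g(x:=z)))) \<in> Delta0_fm"
    by (intro Delta0_fm.intros 5)
  then show ?case using 5(2) unfolding sub.simps z_def[symmetric] by simp
qed (auto intro: Delta0_fm.intros)

lemma sub_Ex_block:
  assumes "\<And>\<phi> g. \<phi> \<in> \<Gamma> \<Longrightarrow> sub \<phi> g \<in> \<Gamma>" "\<phi> \<in> Ex_block \<Gamma>" shows "sub \<phi> g \<in> Ex_block \<Gamma>"
  using assms(2) by (induction arbitrary: g rule: Ex_block.induct) (auto intro: assms Ex_block.intros)

lemma sub_All_block: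
  assumes "\<And>\<phi> g. \<phi> \<in> \<Gamma> \<Longrightarrow> sub \<phi> g \<in> \<Gamma>" "\<phi> \<in> All_block \<Gamma>" shows "sub \<phi> g \<in> All_block \<Gamma>"
  using assms(2) by (induction arbitrary: g rule: All_block.induct) (auto intro: assms All_block.intros)

lemma sub_Levy: "(\<phi> \<in> Sigma_fm k \<longrightarrow> sub \<phi> g \<in> Sigma_fm k) \<and> (\<psi> \<in> Pi_fm k \<longrightarrow> sub \<psi> h \<in> Pi_fm k)"
proof (induction k arbitrary: \<phi> \<psi> g h)
  case 0 show ?case by (auto intro: sub_Delta0)
next
  case (Suc k) 
  show ?case using sub_Ex_block[of "Pi_fm k"] sub_All_block[of "Sigma_fm k"] Suc by auto
qed

lemma Ex_block_mono: "\<Gamma> \<subseteq> \<Delta> \<Longrightarrow> Ex_block \<Gamma> \<subseteq> Ex_block \<Delta>"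
proof
  fix \<phi> assume s: "\<Gamma> \<subseteq> \<Delta>" and "\<phi> \<in> Ex_block \<Gamma>"
  from this(2) show "\<phi> \<in> Ex_block \<Delta>" by induction (use s in \<open>auto intro: Ex_block.intros\<close>)
qed

lemma All_block_mono: "\<Gamma> \<subseteq> \<Delta> \<Longrightarrow> All_block \<Gamma> \<subseteq> All_block \<Delta>"
proof
  fix \<phi> assume s: "\<Gamma> \<subseteq> \<Delta>" and "\<phi> \<in> All_block \<Gamma>"
  from this(2) show "\<phi> \<in> All_block \<Delta>" by induction (use s in \<open>auto intro: All_block.intros\<close>)
qed

lemma Levy_step: "Sigma_fm k \<subseteq> Sigma_fm (Suc k) \<and> Pi_fm k \<subseteq> Pi_fm (Suc k)"
proof (induction k)
  case 0 show ?case by (auto intro: Ex_block.intros All_block.intros)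
next
  case (Suc k) then show ?case
    using Ex_block_mono[of "Pi_fm k" "Pi_fm (Suc k)"] All_block_mono[of "Sigma_fm k" "Sigma_fm (Suc k)"] by auto
qed

lemma Sigma_mono: "k \<le> l \<Longrightarrow> Sigma_fm k \<subseteq> Sigma_fm l"
  by (rule lift_Suc_mono_le[of Sigma_fm]) (use Levy_step in auto)
lemma Pi_mono: "k \<le> l \<Longrightarrow> Pi_fm k \<subseteq> Pi_fm l"
  by (rule lift_Suc_mono_le[of Pi_fm]) (use Levy_step in auto)
lemma Pi_Sigma_Suc: "Pi_fm k \<subseteq> Sigma_fm (Suc k)" by (auto intro: Ex_block.intros)
lemma Sigma_Pi_Suc: "Sigma_fm k \<subseteq> Pi_fm (Suc k)" by (auto intro: All_block.intros)

section \<open>Relativisation to a set and absoluteness of bounded formulas\<close>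

primrec rlv :: "nat \<Rightarrow> fm \<Rightarrow> fm" where
  "rlv v (Mem x y) = Mem x y"
| "rlv v (Eq x y) = Eq x y"
| "rlv v (Neg \<phi>) = Neg (rlv v \<phi>)"
| "rlv v (And \<phi> \<psi>) = And (rlv v \<phi>) (rlv v \<psi>)"
| "rlv v (Ex x \<phi>) = Ex x (And (Mem x v) (rlv v \<phi>))"

text \<open>Shifting bound and free variables alike frees index \<open>0\<close> for the bounding
  set. Hence \<open>rlv 0 (bump \<phi>)\<close> has only bounded quantifiers, and none of them binds
  its own bound.\<close>

primrec bump :: "fm \<Rightarrow> fm" where
  "bump (Mem x y) = Mem (Suc x) (Suc y)"
| "bump (Eq x y) = Eq (Suc x) (Suc y)"
| "bump (Neg \<phi>) = Neg (bump \<phi>)"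
| "bump (And \<phi> \<psi>) = And (bump \<phi>) (bump \<psi>)"
| "bump (Ex x \<phi>) = Ex (Suc x) (bump \<phi>)"

lemma rlv_Delta0: "rlv 0 (bump \<phi>) \<in> Delta0_fm"
  by (induction \<phi>) (auto intro: Delta0_fm.intros)

lemma sat_rlv: "sat E D s (rlv 0 (bump \<phi>)) = sat E {a \<in> D. E a (s 0)} (\<lambda>n. s (Suc n)) \<phi>"
proof (induction \<phi> arbitrary: s)
  case (Ex x \<phi>)
  have "(\<lambda>n. (s(Suc x := a)) (Suc n)) = (\<lambda>n. s (Suc n))(x := a)" for a by auto
  then have "sat E D (s(Suc x := a)) (rlv 0 (bump \<phi>)) = sat E {a \<in> D. E a (s 0)} ((\<lambda>n. s (Suc n))(x := a)) \<phi>" for a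
    unfolding Ex by simp
  then show ?case by auto
qed auto

lemma Delta0_absolute:
  assumes "\<phi> \<in> Delta0_fm" "\<And>x y. x \<in> D \<Longrightarrow> E y x \<Longrightarrow> y \<in> D" "range s \<subseteq> D"
  shows "sat E D s \<phi> = sat E UNIV s \<phi>"
  using assms(1,3)
proof (induction arbitrary: s rule: Delta0_fm.induct)
  case (5 \<phi> x y)
  have "sat E D (s(x := a)) \<phi> = sat E UNIV (s(x := a)) \<phi>" if "a \<in> D" for a
    using 5 that by (intro 5) auto
  moreover have "a \<in> D" if "E a (s y)" for a using assms(2) that 5(4) by blast
  ultimately show ?case using 5(2) by auto
qed auto

subsection \<open>Definable predicates on assignments\<close>

locale mem = fixes E :: "'a \<Rightarrow> 'a \<Rightarrow> bool"
begin

text \<open>A predicate on assignments is the semantic counterpart of a formula. Under a binder, index \<open>0\<close> is the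
  bound variable and the assignment of the context is shifted up, so that the closure rules can be
  applied by \<open>intro\<close>.\<close>

definition FD :: "fm set \<Rightarrow> ((nat \<Rightarrow> 'a) \<Rightarrow> bool) \<Rightarrow> bool" where
  "FD \<Gamma> P \<longleftrightarrow> (\<exists>\<phi>\<in>\<Gamma>. \<forall>s. sat E UNIV s \<phi> = P s)"

definition subcl :: "fm set \<Rightarrow> bool" where "subcl \<Gamma> \<longleftrightarrow> (\<forall>\<phi>\<in>\<Gamma>. \<forall>g. sub \<phi> g \<in> \<Gamma>)"

lemma subcl: "subcl UNIV" "subcl Delta0_fm" "subcl (Sigma_fm k)" "subcl (Pi_fm k)"
  unfolding subcl_def using sub_Delta0 sub_Levy by auto

lemma subcl_blocks: "subcl \<Gamma> \<Longrightarrow> subcl (Ex_block \<Gamma>)" "subcl \<Gamma> \<Longrightarrow> subcl (All_block \<Gamma>)"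
  by (auto simp: subcl_def intro: sub_Ex_block sub_All_block)

lemma FD_fm: "\<phi> \<in> \<Gamma> \<Longrightarrow> FD \<Gamma> (\<lambda>s. sat E UNIV s \<phi>)" unfolding FD_def by auto

lemma FD_mono: "FD \<Gamma> P \<Longrightarrow> \<Gamma> \<subseteq> \<Delta> \<Longrightarrow> FD \<Delta> P" unfolding FD_def by auto

lemma FD_sub: assumes "FD \<Gamma> P" "subcl \<Gamma>" shows "FD \<Gamma> (\<lambda>s. P (\<lambda>n. s (g n)))"
  using assms sat_sub unfolding FD_def subcl_def by metis

text \<open>Passes from shifted indices to a named variable: index \<open>0\<close> becomes
  \<open>y\<close> and \<open>Suc n\<close> becomes \<open>n\<close>. Since \<open>y\<close> avoids
  the predecessors of the free variables, the renaming does not confuse the two; \<open>X\<close>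
  keeps \<open>y\<close> away from the bound of a bounded quantifier.\<close>

lemma FD_ex_gen:
  assumes "FD \<Gamma> (\<lambda>s. R (\<lambda>n. s (Suc n)) (s 0))" "subcl \<Gamma>" "finite X"
  shows "\<exists>y \<phi>. \<phi> \<in> \<Gamma> \<and> y \<notin> X \<and> (\<forall>s a. sat E UNIV (s(y := a)) \<phi> = R s a)"
proof -
  obtain \<phi> where \<phi>: "\<phi> \<in> \<Gamma>" "\<And>s. sat E UNIV s \<phi> = R (\<lambda>n. s (Suc n)) (s 0)"
    using assms(1) unfolding FD_def by auto
  define y where "y = fresh (X \<union> (\<lambda>n. n - 1) ` fv \<phi>)"
  have y: "y \<notin> X" "y \<notin> (\<lambda>n. n - 1) ` fv \<phi>"
    using fresh[of "X \<union> (\<lambda>n. n - 1) ` fv \<phi>"] assms(3) finite_fv unfolding y_def by auto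
  have "sat E UNIV (s(y := a)) (sub \<phi> (case_nat y id)) = R s a" for s a
  proof -
    have "sat E UNIV (s(y := a)) (sub \<phi> (case_nat y id)) = sat E UNIV (case_nat a s) \<phi>"
      unfolding sat_sub by (rule sat_cong) (use y(2) in \<open>auto split: nat.splits simp: image_iff\<close>)
    also have "\<dots> = R s a" by (simp add: \<phi>)
    finally show ?thesis .
  qed
  then show ?thesis using \<phi> assms(2) y(1) unfolding subcl_def by blast
qed

lemma FD_ex:
  assumes "FD \<Gamma> (\<lambda>s. R (\<lambda>n. s (Suc n)) (s 0))" "subcl \<Gamma>" "\<And>x \<phi>. \<phi> \<in> \<Gamma> \<Longrightarrow> Ex x \<phi> \<in> \<Delta>"
  shows "FD \<Delta> (\<lambda>s. \<exists>a. R s a)"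
proof -
  obtain y \<phi> where "\<phi> \<in> \<Gamma>" "\<forall>s a. sat E UNIV (s(y := a)) \<phi> = R s a"
    using FD_ex_gen[OF assms(1,2), of "{}"] by auto
  then show ?thesis unfolding FD_def using assms(3) by (intro bexI[of _ "Ex y \<phi>"]) auto
qed

lemma FD_all:
  assumes "FD \<Gamma> (\<lambda>s. R (\<lambda>n. s (Suc n)) (s 0))" "subcl \<Gamma>" "\<And>x \<phi>. \<phi> \<in> \<Gamma> \<Longrightarrow> All x \<phi> \<in> \<Delta>"
  shows "FD \<Delta> (\<lambda>s. \<forall>a. R s a)"
proof -
  obtain y \<phi> where "\<phi> \<in> \<Gamma>" "\<forall>s a. sat E UNIV (s(y := a)) \<phi> = R s a"
    using FD_ex_gen[OF assms(1,2), of "{}"] by auto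
  then show ?thesis unfolding FD_def using assms(3) by (intro bexI[of _ "All y \<phi>"]) auto
qed

abbreviation "D0 \<equiv> FD Delta0_fm"
abbreviation "SG k \<equiv> FD (Sigma_fm k)"
abbreviation "PI k \<equiv> FD (Pi_fm k)"

lemma FD_not_U: "FD UNIV P \<Longrightarrow> FD UNIV (\<lambda>s. \<not> P s)"
  unfolding FD_def by (metis UNIV_I sat.simps(3))
lemma FD_and_U: "FD UNIV P \<Longrightarrow> FD UNIV Q \<Longrightarrow> FD UNIV (\<lambda>s. P s \<and> Q s)"
  unfolding FD_def by (metis UNIV_I sat.simps(4))
lemma FD_ex_U: "FD UNIV (\<lambda>s. R (\<lambda>n. s (Suc n)) (s 0)) \<Longrightarrow> FD UNIV (\<lambda>s. \<exists>a. R s a)"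
  by (rule FD_ex) (auto simp: subcl)

lemma D0_not: "D0 P \<Longrightarrow> D0 (\<lambda>s. \<not> P s)"
  unfolding FD_def by (metis Delta0_fm.intros(3) sat.simps(3))
lemma D0_and: "D0 P \<Longrightarrow> D0 Q \<Longrightarrow> D0 (\<lambda>s. P s \<and> Q s)"
  unfolding FD_def by (metis Delta0_fm.intros(4) sat.simps(4))
lemma D0_or: "D0 P \<Longrightarrow> D0 Q \<Longrightarrow> D0 (\<lambda>s. P s \<or> Q s)"
  using D0_not[OF D0_and[OF D0_not D0_not, of P Q]] by simp
lemma D0_imp: "D0 P \<Longrightarrow> D0 Q \<Longrightarrow> D0 (\<lambda>s. P s \<longrightarrow> Q s)"
  unfolding imp_conv_disj by (intro D0_or D0_not)
lemma D0_iff: "D0 P \<Longrightarrow> D0 Q \<Longrightarrow> D0 (\<lambda>s. P s \<longleftrightarrow> Q s)"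
  unfolding iff_conv_conj_imp by (intro D0_and D0_imp)
lemma D0_sub: "D0 P \<Longrightarrow> D0 (\<lambda>s. P (\<lambda>n. s (g n)))"
  by (rule FD_sub) (auto simp: subcl)

lemma D0_bex_var:
  assumes "D0 (\<lambda>s. R (\<lambda>n. s (Suc n)) (s 0))" shows "D0 (\<lambda>s. \<exists>a\<in>elts E (s j). R s a)"
proof -
  obtain y \<phi> where y: "\<phi> \<in> Delta0_fm" "y \<noteq> j" "\<And>s a. sat E UNIV (s(y := a)) \<phi> = R s a"
    using FD_ex_gen[OF assms, of "{j}"] subcl by auto
  have "Ex y (And (Mem y j) \<phi>) \<in> Delta0_fm" using y by (intro Delta0_fm.intros)
  moreover have "sat E UNIV s (Ex y (And (Mem y j) \<phi>)) = (\<exists>a\<in>elts E (s j). R s a)" for s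
    using y by (auto simp: elts_def)
  ultimately show ?thesis unfolding FD_def by blast
qed

text \<open>Terms that may be substituted into \<open>\<Delta>\<^sub>0\<close> predicates.\<close>

definition TD :: "((nat \<Rightarrow> 'a) \<Rightarrow> 'a) \<Rightarrow> bool" where
  "TD f \<longleftrightarrow> (\<forall>Q g. D0 (\<lambda>s. Q (\<lambda>n. s (Suc n)) (s 0)) \<longrightarrow> D0 (\<lambda>s. Q s (f (\<lambda>n. s (g n)))))"

lemma TD_var: "TD (\<lambda>s. s i)"
  unfolding TD_def
proof (intro allI impI)
  fix Q :: "(nat \<Rightarrow> 'a) \<Rightarrow> 'a \<Rightarrow> bool" and g :: "nat \<Rightarrow> nat"
  assume "D0 (\<lambda>s. Q (\<lambda>n. s (Suc n)) (s 0))"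
  from D0_sub[OF this, of "case_nat (g i) id"] show "D0 (\<lambda>s. Q s (s (g i)))" by simp
qed

lemma TD_shift: "TD f \<Longrightarrow> TD (\<lambda>s. f (\<lambda>n. s (g n)))"
  unfolding TD_def
proof (intro allI impI)
  fix Q :: "(nat \<Rightarrow> 'a) \<Rightarrow> 'a \<Rightarrow> bool" and h :: "nat \<Rightarrow> nat"
  assume f: "\<forall>Q g. D0 (\<lambda>s. Q (\<lambda>n. s (Suc n)) (s 0)) \<longrightarrow> D0 (\<lambda>s. Q s (f (\<lambda>n. s (g n))))"
    and "D0 (\<lambda>s. Q (\<lambda>n. s (Suc n)) (s 0))"
  then show "D0 (\<lambda>s. Q s (f (\<lambda>n. s (h (g n)))))"
    by (elim allE[of _ Q] allE[of _ "\<lambda>n. h (g n)"] impE)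
qed

lemma TD_D: "TD f \<Longrightarrow> D0 (\<lambda>s. Q (\<lambda>n. s (Suc n)) (s 0)) \<Longrightarrow> D0 (\<lambda>s. Q s (f s))"
  unfolding TD_def by (elim allE[of _ Q] allE[of _ id]) simp

lemma D0_app1: assumes "D0 (\<lambda>s. R (s 0))" "TD f" shows "D0 (\<lambda>s. R (f s))"
  using TD_D[of f "\<lambda>s a. R a"] assms by simp

lemma D0_app2: assumes "D0 (\<lambda>s. R (s 0) (s 1))" "TD f" "TD g" shows "D0 (\<lambda>s. R (f s) (g s))"
proof (rule TD_D[OF assms(2), of "\<lambda>s a. R a (g s)"])
  show "D0 (\<lambda>s. R (s 0) (g (\<lambda>n. s (Suc n))))"
  proof (rule TD_D[OF TD_shift[OF assms(3)], of "\<lambda>s a. R (s 0) a"])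
    show "D0 (\<lambda>s. R (s (Suc 0)) (s 0))"
      using D0_sub[OF assms(1), of "\<lambda>n. if n = 0 then 1 else 0"] by simp
  qed
qed

lemma D0_app3: assumes "D0 (\<lambda>s. R (s 0) (s 1) (s 2))" "TD f" "TD g" "TD h" shows "D0 (\<lambda>s. R (f s) (g s) (h s))"
proof (rule TD_D[OF assms(2), of "\<lambda>s a. R a (g s) (h s)"])
  show "D0 (\<lambda>s. R (s 0) (g (\<lambda>n. s (Suc n))) (h (\<lambda>n. s (Suc n))))"
  proof (rule TD_D[OF TD_shift[OF assms(3)], of "\<lambda>s a. R (s 0) a (h (\<lambda>n. s (Suc n)))"])
    show "D0 (\<lambda>s. R (s (Suc 0)) (s 0) (h (\<lambda>n. s (Suc (Suc n)))))"
    proof (rule TD_D[OF TD_shift[OF assms(4)], of "\<lambda>s a. R (s (Suc 0)) (s 0) a"])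
      show "D0 (\<lambda>s. R (s (Suc (Suc 0))) (s (Suc 0)) (s 0))"
        using D0_sub[OF assms(1), of "\<lambda>n. if n = 0 then 2 else if n = 1 then 1 else 0"] by (simp add: numeral_2_eq_2)
    qed
  qed
qed

lemma D0_mem: "TD f \<Longrightarrow> TD g \<Longrightarrow> D0 (\<lambda>s. f s \<in> elts E (g s))"
  by (rule D0_app2) (auto simp: FD_def elts_def intro!: bexI[of _ "Mem 0 1"] Delta0_fm.intros)
lemma D0_eq: "TD f \<Longrightarrow> TD g \<Longrightarrow> D0 (\<lambda>s. f s = g s)"
  by (rule D0_app2) (auto simp: FD_def intro!: bexI[of _ "Eq 0 1"] Delta0_fm.intros)

lemma D0_bex:
  assumes "TD f" "D0 (\<lambda>s. R (\<lambda>n. s (Suc n)) (s 0))" shows "D0 (\<lambda>s. \<exists>a\<in>elts E (f s). R s a)"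
proof (rule TD_D[OF assms(1), of "\<lambda>s b. \<exists>a\<in>elts E b. R s a"])
  show "D0 (\<lambda>s. \<exists>a\<in>elts E (s 0). R (\<lambda>n. s (Suc n)) a)"
    using D0_bex_var[of "\<lambda>s a. R (\<lambda>n. s (Suc n)) a" 0] D0_sub[OF assms(2), of "case_nat 0 (\<lambda>n. Suc (Suc n))"] by simp
qed

lemma D0_ball:
  assumes "TD f" "D0 (\<lambda>s. R (\<lambda>n. s (Suc n)) (s 0))" shows "D0 (\<lambda>s. \<forall>a\<in>elts E (f s). R s a)"
  using D0_not[OF D0_bex[OF assms(1) D0_not[OF assms(2)]]] by simp

lemma D0_const: "D0 (\<lambda>s. True)" "D0 (\<lambda>s. False)"
proof -
  have "D0 (\<lambda>s. s 0 = s 0)" by (intro D0_eq TD_var)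
  then show "D0 (\<lambda>s. True)" by simp
  from D0_not[OF this] show "D0 (\<lambda>s. False)" by simp
qed

lemma D0_subset: "TD f \<Longrightarrow> TD g \<Longrightarrow> D0 (\<lambda>s. elts E (f s) \<subseteq> elts E (g s))"
  by (rule D0_app2, unfold subset_eq, intro D0_ball D0_mem TD_var)

text \<open>Truth of a fixed formula of any complexity in a set is a bounded statement about that
  set. Evaluating a class in a sufficiently correct set therefore costs no quantifiers, which is how
  the final definitions stay low in the hierarchy.\<close>

lemma D0_sat_elts:
  assumes "TD f" "TD h" shows "D0 (\<lambda>s. sat E (elts E (f s)) (\<lambda>_. h s) \<phi>)"
proof (rule D0_app2[OF _ assms])
  have "D0 (\<lambda>s. sat E (elts E (s 0)) (\<lambda>n. s (Suc n)) \<phi>)"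
    unfolding FD_def by (rule bexI[of _ "rlv 0 (bump \<phi>)"]) (auto simp: sat_rlv rlv_Delta0 elts_def)
  from D0_sub[OF this, of "case_nat 0 (\<lambda>_. 1)"] show "D0 (\<lambda>s. sat E (elts E (s 0)) (\<lambda>_. s 1) \<phi>)" by simp
qed

lemmas d0 = D0_not D0_and D0_or D0_imp D0_iff D0_mem D0_eq D0_bex D0_ball D0_const D0_subset TD_var D0_sat_elts

subsection \<open>The Levy hierarchy\<close>

lemma SG_ex: "SG (Suc k) (\<lambda>s. R (\<lambda>n. s (Suc n)) (s 0)) \<Longrightarrow> SG (Suc k) (\<lambda>s. \<exists>a. R s a)"
  by (rule FD_ex) (auto simp: subcl simp del: Sigma_fm.simps, auto intro: Ex_block.intros)
lemma PI_all: "PI (Suc k) (\<lambda>s. R (\<lambda>n. s (Suc n)) (s 0)) \<Longrightarrow> PI (Suc k) (\<lambda>s. \<forall>a. R s a)"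
  by (rule FD_all) (auto simp: subcl simp del: Pi_fm.simps, auto intro: All_block.intros)

lemma SG_sub: "SG k P \<Longrightarrow> SG k (\<lambda>s. P (\<lambda>n. s (g n)))" by (rule FD_sub) (auto simp: subcl)
lemma PI_sub: "PI k P \<Longrightarrow> PI k (\<lambda>s. P (\<lambda>n. s (g n)))" by (rule FD_sub) (auto simp: subcl)

lemma D0_SG: "D0 P \<Longrightarrow> SG k P" using FD_mono[of _ P "Sigma_fm k"] Sigma_mono[of 0 k] by auto
lemma D0_PI: "D0 P \<Longrightarrow> PI k P" using FD_mono[of _ P "Pi_fm k"] Pi_mono[of 0 k] by auto
lemma PI_le: "PI k P \<Longrightarrow> k \<le> l \<Longrightarrow> PI l P" using FD_mono Pi_mono by blast
lemma PI_SG: "PI k P \<Longrightarrow> SG (Suc k) P" using FD_mono Pi_Sigma_Suc by blast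
lemma SG_PI: "SG k P \<Longrightarrow> PI (Suc k) P" using FD_mono Sigma_Pi_Suc by blast

text \<open>Negation is pushed through the blocks. Both halves go by the same induction, since the
  matrix of one kind of block is negated into the matrix of the other; the result is a formula
  equivalent to the negation.\<close>

lemma Levy_neg: "(SG k P \<longrightarrow> PI k (\<lambda>s. \<not> P s)) \<and> (PI k Q \<longrightarrow> SG k (\<lambda>s. \<not> Q s))"
proof (induction k arbitrary: P Q)
  case 0 show ?case by (auto intro: D0_not)
next
  case (Suc k)
  have "PI (Suc k) (\<lambda>s. \<not> sat E UNIV s \<phi>)" if "\<phi> \<in> Ex_block (Pi_fm k)" for \<phi>
    using that
  proof induction
    case (1 \<phi>) then show ?case using Suc FD_fm SG_PI by blast
  next
    case (2 \<phi> x)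
    then obtain \<chi> where "\<chi> \<in> Pi_fm (Suc k)" "\<forall>s. sat E UNIV s \<chi> = (\<not> sat E UNIV s \<phi>)" unfolding FD_def by blast
    then show ?case unfolding FD_def by (intro bexI[of _ "All x \<chi>"]) (auto intro: All_block.intros)
  qed
  moreover have "SG (Suc k) (\<lambda>s. \<not> sat E UNIV s \<phi>)" if "\<phi> \<in> All_block (Sigma_fm k)" for \<phi>
    using that
  proof induction
    case (1 \<phi>) then show ?case using Suc FD_fm PI_SG by blast
  next
    case (2 \<phi> x)
    then obtain \<chi> where "\<chi> \<in> Sigma_fm (Suc k)" "\<forall>s. sat E UNIV s \<chi> = (\<not> sat E UNIV s \<phi>)" unfolding FD_def by blast
    then show ?case unfolding FD_def by (intro bexI[of _ "Ex x \<chi>"]) (auto intro: Ex_block.intros)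
  qed
  moreover have "FD \<Gamma> X \<Longrightarrow> \<exists>\<phi>\<in>\<Gamma>. X = (\<lambda>s. sat E UNIV s \<phi>)" for \<Gamma> X unfolding FD_def by blast
  ultimately show ?case by (metis Pi_fm.simps(2) Sigma_fm.simps(2))
qed

lemma SG_not: "PI k P \<Longrightarrow> SG k (\<lambda>s. \<not> P s)" and PI_not: "SG k P \<Longrightarrow> PI k (\<lambda>s. \<not> P s)"
  using Levy_neg by blast+

text \<open>Prenex form for one argument, treating conjunction and disjunction together: the
  connective \<open>c\<close> has to commute with an existential quantifier on its left. Each
  quantifier pulled out shifts the variables of \<open>Q\<close> by one.\<close>

lemma Ex_block_comb:
  assumes c: "\<And>P q. c (\<exists>a::'a. P a) q = (\<exists>a. c (P a) q)"
    and \<Gamma>: "subcl \<Gamma>2"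
    and base: "\<And>\<phi> g Q. \<phi> \<in> \<Gamma> \<Longrightarrow> FD \<Gamma>2 Q \<Longrightarrow> FD (Ex_block \<Delta>) (\<lambda>s. c (sat E UNIV (\<lambda>n. s (g n)) \<phi>) (Q s))"
    and "subcl \<Delta>" "\<phi> \<in> Ex_block \<Gamma>" "FD \<Gamma>2 Q"
  shows "FD (Ex_block \<Delta>) (\<lambda>s. c (sat E UNIV (\<lambda>n. s (g n)) \<phi>) (Q s))"
  using assms(5,6)
proof (induction arbitrary: g Q)
  case (1 \<phi>) then show ?case by (rule base)
next
  case (2 \<phi> x)
  let ?R = "\<lambda>s a. c (sat E UNIV ((\<lambda>n. s (g n))(x := a)) \<phi>) (Q s)"
  have "(\<lambda>n. s (Suc (g n)))(x := s 0) = (\<lambda>n. s (((\<lambda>n. Suc (g n))(x := 0)) n))" for s :: "nat \<Rightarrow> 'a" by auto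
  then have "FD (Ex_block \<Delta>) (\<lambda>s. ?R (\<lambda>n. s (Suc n)) (s 0))"
    using 2(2)[OF FD_sub[OF 2(3) \<Gamma>, of Suc], of "(\<lambda>n. Suc (g n))(x := 0)"] by simp
  then have "FD (Ex_block \<Delta>) (\<lambda>s. \<exists>a. ?R s a)"
    by (rule FD_ex) (auto intro: Ex_block.intros subcl_blocks \<open>subcl \<Delta>\<close>)
  then show ?case by (simp add: c)
qed

lemma Ex_block_comb2:
  assumes c: "\<And>P q. c (\<exists>a::'a. P a) q = (\<exists>a. c (P a) q)" "\<And>p q. c p q = c q p"
    and \<Gamma>: "subcl \<Gamma>"
    and base: "\<And>P Q. FD \<Gamma> P \<Longrightarrow> FD \<Gamma> Q \<Longrightarrow> FD \<Gamma> (\<lambda>s. c (P s) (Q s))"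
    and P: "FD (Ex_block \<Gamma>) P" and Q: "FD (Ex_block \<Gamma>) Q"
  shows "FD (Ex_block \<Gamma>) (\<lambda>s. c (P s) (Q s))"
proof -
  have blk: "FD \<Gamma> X \<Longrightarrow> FD (Ex_block \<Gamma>) X" for X using FD_mono[of \<Gamma>] Ex_block.intros(1) by blast
  have 1: "FD (Ex_block \<Gamma>) (\<lambda>s. c (sat E UNIV (\<lambda>n. s (g n)) \<phi>) (Q s))" if "\<phi> \<in> Ex_block \<Gamma>" "FD \<Gamma> Q" for \<phi> g Q
    by (rule Ex_block_comb[OF c(1) \<Gamma> _ \<Gamma> that]) (intro blk base FD_sub[OF FD_fm] \<Gamma>)
  have 2: "FD (Ex_block \<Gamma>) (\<lambda>s. c (sat E UNIV (\<lambda>n. s (g n)) \<phi>) (Q s))" if "\<phi> \<in> Ex_block \<Gamma>" "FD (Ex_block \<Gamma>) Q" for \<phi> g Q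
  proof (rule Ex_block_comb[OF c(1) subcl_blocks(1)[OF \<Gamma>] _ \<Gamma> that])
    fix \<phi> g Q assume \<phi>: "\<phi> \<in> \<Gamma>" "FD (Ex_block \<Gamma>) Q"
    then obtain \<psi> where \<psi>: "\<psi> \<in> Ex_block \<Gamma>" "\<And>s. sat E UNIV s \<psi> = Q s" unfolding FD_def by blast
    have "FD \<Gamma> (\<lambda>s. sat E UNIV (\<lambda>n. s (g n)) \<phi>)" by (intro FD_sub[OF FD_fm] \<Gamma> \<phi>)
    from 1[OF \<psi>(1) this, of id] show "FD (Ex_block \<Gamma>) (\<lambda>s. c (sat E UNIV (\<lambda>n. s (g n)) \<phi>) (Q s))"
      by (simp add: \<psi>(2) c(2))
  qed
  obtain \<psi> where "\<psi> \<in> Ex_block \<Gamma>" "\<And>s. sat E UNIV s \<psi> = P s" using P unfolding FD_def by blast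
  from 2[OF this(1) Q, of id] this(2) show ?thesis by simp
qed

lemma Levy_comb: "(SG k P \<longrightarrow> SG k Q \<longrightarrow> SG k (\<lambda>s. P s \<and> Q s) \<and> SG k (\<lambda>s. P s \<or> Q s)) \<and>
   (PI k P \<longrightarrow> PI k Q \<longrightarrow> PI k (\<lambda>s. P s \<and> Q s) \<and> PI k (\<lambda>s. P s \<or> Q s))"
proof (induction k arbitrary: P Q)
  case 0 show ?case by (auto intro: D0_and D0_or)
next
  case (Suc k)
  have 1: "SG (Suc k) (\<lambda>s. P s \<and> Q s)" if "SG (Suc k) P" "SG (Suc k) Q" for P Q
    using Ex_block_comb2[of "(\<and>)" "Pi_fm k" P Q] that Suc by (auto simp: subcl)
  have 2: "SG (Suc k) (\<lambda>s. P s \<or> Q s)" if "SG (Suc k) P" "SG (Suc k) Q" for P Q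
    using Ex_block_comb2[of "(\<or>)" "Pi_fm k" P Q] that Suc by (auto simp: subcl)
  show ?case using 1 2 PI_not[OF 2[OF SG_not SG_not], of P Q] PI_not[OF 1[OF SG_not SG_not], of P Q] by simp
qed

lemma SG_and: "SG k P \<Longrightarrow> SG k Q \<Longrightarrow> SG k (\<lambda>s. P s \<and> Q s)"
  and SG_or: "SG k P \<Longrightarrow> SG k Q \<Longrightarrow> SG k (\<lambda>s. P s \<or> Q s)"
  and PI_and: "PI k P \<Longrightarrow> PI k Q \<Longrightarrow> PI k (\<lambda>s. P s \<and> Q s)"
  and PI_or: "PI k P \<Longrightarrow> PI k Q \<Longrightarrow> PI k (\<lambda>s. P s \<or> Q s)"
  using Levy_comb by blast+

lemma PI_imp: "SG k P \<Longrightarrow> PI k Q \<Longrightarrow> PI k (\<lambda>s. P s \<longrightarrow> Q s)"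
  unfolding imp_conv_disj by (intro PI_or PI_not)

end

subsection \<open>Definability with parameters\<close>

text \<open>Even indices carry the assignment, odd indices the hidden parameters.\<close>

definition mix :: "(nat \<Rightarrow> 'b) \<Rightarrow> (nat \<Rightarrow> 'b) \<Rightarrow> nat \<Rightarrow> 'b" where
  "mix s r n = (if even n then s (n div 2) else r (n div 2))"

lemma mix_simps[simp]: "mix s r (2 * n) = s n" "mix s r (Suc (2 * n)) = r n" "mix s r 0 = s 0"
  by (auto simp: mix_def)

lemma mix_comp: "(\<lambda>n. t (mix f g n)) = mix (\<lambda>n. t (f n)) (\<lambda>n. t (g n))"
  by (auto simp: mix_def)

definition (in mem) DP :: "((nat \<Rightarrow> 'a) \<Rightarrow> bool) \<Rightarrow> bool" where
  "DP P \<longleftrightarrow> (\<exists>Q r. FD UNIV Q \<and> (\<forall>s. P s = Q (mix s r)))"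

definition (in mem) DT :: "((nat \<Rightarrow> 'a) \<Rightarrow> 'a) \<Rightarrow> bool" where
  "DT f \<longleftrightarrow> DP (\<lambda>s. f (\<lambda>n. s (Suc n)) = s 0)"

named_theorems dfn

context mem
begin

abbreviation "El \<equiv> elts E"
abbreviation "isS \<equiv> is_set E"
abbreviation "mk \<equiv> set_of E"
abbreviation "pr \<equiv> pair E"
abbreviation "fn \<equiv> fun_on E"
abbreviation "sc \<equiv> succ E"
abbreviation "Od \<equiv> Ord E"

lemma FD_subU: "FD UNIV P \<Longrightarrow> FD UNIV (\<lambda>s. P (\<lambda>n. s (g n)))"
  by (rule FD_sub) (auto simp: subcl)

lemma DP_FD: assumes "FD UNIV P" shows "DP P"
  unfolding DP_def using FD_subU[OF assms, of "\<lambda>n. 2 * n"]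
  by (intro exI[of _ "\<lambda>t. P (\<lambda>n. t (2 * n))"]) simp

lemma DP_not[dfn]: "DP P \<Longrightarrow> DP (\<lambda>s. \<not> P s)"
  unfolding DP_def using FD_not_U by blast

lemma DP_and[dfn]: assumes "DP P" "DP Q" shows "DP (\<lambda>s. P s \<and> Q s)"
proof -
  obtain Q1 r1 where 1: "FD UNIV Q1" "\<And>s. P s = Q1 (mix s r1)"
    using assms(1) unfolding DP_def by blast
  obtain Q2 r2 where 2: "FD UNIV Q2" "\<And>s. Q s = Q2 (mix s r2)"
    using assms(2) unfolding DP_def by blast
  define Q1' where "Q1' = (\<lambda>t. Q1 (\<lambda>n. t (mix (\<lambda>k. 2 * k) (\<lambda>k. Suc (2 * (2 * k))) n)))"
  define Q2' where "Q2' = (\<lambda>t. Q2 (\<lambda>n. t (mix (\<lambda>k. 2 * k) (\<lambda>k. Suc (2 * Suc (2 * k))) n)))"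
  have "FD UNIV (\<lambda>t. Q1' t \<and> Q2' t)"
    unfolding Q1'_def Q2'_def by (intro FD_and_U FD_subU[OF 1(1)] FD_subU[OF 2(1)])
  moreover have "Q1' (mix s (mix r1 r2)) = P s" "Q2' (mix s (mix r1 r2)) = Q s" for s
    unfolding 1 2 Q1'_def Q2'_def mix_comp mix_simps by simp_all
  ultimately show ?thesis unfolding DP_def by (intro exI[of _ "\<lambda>t. Q1' t \<and> Q2' t"] exI[of _ "mix r1 r2"]) auto
qed

lemma DP_or[dfn]: "DP P \<Longrightarrow> DP Q \<Longrightarrow> DP (\<lambda>s. P s \<or> Q s)"
  using DP_not[OF DP_and[OF DP_not DP_not, of P Q]] by simp
lemma DP_imp[dfn]: "DP P \<Longrightarrow> DP Q \<Longrightarrow> DP (\<lambda>s. P s \<longrightarrow> Q s)"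
  unfolding imp_conv_disj by (intro DP_or DP_not)
lemma DP_iff[dfn]: "DP P \<Longrightarrow> DP Q \<Longrightarrow> DP (\<lambda>s. P s \<longleftrightarrow> Q s)"
  unfolding iff_conv_conj_imp by (intro DP_and DP_imp)

lemma DP_sub: assumes "DP P" shows "DP (\<lambda>s. P (\<lambda>n. s (g n)))"
proof -
  obtain Q r where 1: "FD UNIV Q" "\<And>s. P s = Q (mix s r)"
    using assms(1) unfolding DP_def by blast
  have "FD UNIV (\<lambda>t. Q (\<lambda>n. t (mix (\<lambda>k. 2 * g k) (\<lambda>k. Suc (2 * k)) n)))" by (rule FD_subU[OF 1(1)])
  moreover have "P (\<lambda>n. s (g n)) = Q (\<lambda>n. mix s r (mix (\<lambda>k. 2 * g k) (\<lambda>k. Suc (2 * k)) n))" for s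
    unfolding 1(2) mix_comp by simp
  ultimately show ?thesis unfolding DP_def by (intro exI[of _ "\<lambda>t. Q (\<lambda>n. t (mix (\<lambda>k. 2 * g k) (\<lambda>k. Suc (2 * k)) n))"] exI[of _ r]) simp
qed

lemma case_nat_env: "case_nat (s 0) (\<lambda>n. s (Suc n)) = s"
  by (auto simp: fun_eq_iff split: nat.splits)

lemma DP_ex[dfn]: assumes "DP (\<lambda>s. R (\<lambda>n. s (Suc n)) (s 0))" shows "DP (\<lambda>s. \<exists>a. R s a)"
proof -
  obtain Q r where 1: "FD UNIV Q" "\<And>s. R (\<lambda>n. s (Suc n)) (s 0) = Q (mix s r)"
    using assms unfolding DP_def by blast
  let ?g = "mix (case_nat 0 (\<lambda>k. Suc (2 * k))) (\<lambda>k. Suc (Suc (2 * k)))"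
  define R' where "R' = (\<lambda>t a. Q (\<lambda>n. case_nat a t (?g n)))"
  have "FD UNIV (\<lambda>t. R' (\<lambda>n. t (Suc n)) (t 0))" unfolding R'_def case_nat_env by (rule FD_subU[OF 1(1)])
  then have "FD UNIV (\<lambda>t. \<exists>a. R' t a)" by (rule FD_ex_U)
  moreover have "R' (mix s r) a = R s a" for s a
  proof -
    have "R s a = Q (mix (case_nat a s) r)"
      using 1(2)[of "case_nat a s"] by simp
    also have "mix (case_nat a s) r = (\<lambda>n. case_nat a (mix s r) (?g n))"
      unfolding mix_comp by (intro arg_cong2[of _ _ _ _ mix] ext) (auto split: nat.splits)
    finally show ?thesis by (simp add: R'_def)
  qed
  ultimately show ?thesis unfolding DP_def by (intro exI[of _ "\<lambda>t. \<exists>a. R' t a"] exI[of _ r]) auto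
qed

lemma DP_inst: assumes "DP (\<lambda>s. R (\<lambda>n. s (Suc n)) (s 0))" shows "DP (\<lambda>s. R s c)"
proof -
  obtain Q r where 1: "FD UNIV Q" "\<And>s. R (\<lambda>n. s (Suc n)) (s 0) = Q (mix s r)"
    using assms unfolding DP_def by blast
  let ?g = "mix (case_nat 1 (\<lambda>k. 2 * k)) (\<lambda>k. Suc (2 * Suc k))"
  have "R s c = Q (mix (case_nat c s) r)" for s
    using 1(2)[of "case_nat c s"] by simp
  moreover have "mix (case_nat c s) r = (\<lambda>n. mix s (case_nat c r) (?g n))" for s
    unfolding mix_comp by (intro arg_cong2[of _ _ _ _ mix] ext) (auto split: nat.splits simp: mix_def simp del: mult_Suc_right)
  moreover have "FD UNIV (\<lambda>t. Q (\<lambda>n. t (?g n)))" by (rule FD_subU[OF 1(1)])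
  ultimately show ?thesis unfolding DP_def
    by (intro exI[of _ "\<lambda>t. Q (\<lambda>n. t (?g n))"] exI[of _ "case_nat c r"]) simp
qed

text \<open>All variables but the first become parameters. Infinitely many can be stored because the
  hidden parameters form a whole assignment, into which \<open>t\<close> and the old parameters are
  interleaved.\<close>

lemma DP_fix: assumes "DP P" shows "DP (\<lambda>s. P (case_nat (s 0) t))"
proof -
  obtain Q r where 1: "FD UNIV Q" "\<And>s. P s = Q (mix s r)"
    using assms unfolding DP_def by blast
  let ?g = "mix (case_nat 0 (\<lambda>k. Suc (2 * (2 * k)))) (\<lambda>k. Suc (2 * Suc (2 * k)))"
  have [simp]: "mix s (mix t r) (Suc (4 * k)) = t k" for s k
    using mix_simps(2)[of s "mix t r" "2 * k"] by (simp del: mix_simps(2)) 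
  have "mix (case_nat (s 0) t) r = (\<lambda>n. mix s (mix t r) (?g n))" for s
    unfolding mix_comp mix_simps by (intro arg_cong2[of _ _ _ _ mix] ext) (auto split: nat.splits simp del: mult_Suc_right)
  moreover have "FD UNIV (\<lambda>t. Q (\<lambda>n. t (?g n)))" by (rule FD_subU[OF 1(1)])
  ultimately show ?thesis unfolding DP_def
    by (intro exI[of _ "\<lambda>t. Q (\<lambda>n. t (?g n))"] exI[of _ "mix t r"]) (simp add: 1)
qed

lemma DP_subst: assumes "DP (\<lambda>s. R (\<lambda>n. s (Suc n)) (s 0))" "DT f" shows "DP (\<lambda>s. R s (f s))"
proof -
  have "DP (\<lambda>s. \<exists>a. f s = a \<and> R s a)"
    by (intro DP_ex DP_and assms(1)) (use assms(2) in \<open>simp add: DT_def\<close>)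
  then show ?thesis by simp
qed

lemma DT_sub: assumes "DT f" shows "DT (\<lambda>s. f (\<lambda>n. s (g n)))"
  using DP_sub[OF assms[unfolded DT_def], of "case_nat 0 (\<lambda>n. Suc (g n))"] by (simp add: DT_def)

lemma DP_mem0: "DP (\<lambda>s. s i \<in> El (s j))"
  by (rule DP_FD) (auto simp: FD_def elts_def intro!: exI[of _ "Mem i j"])
lemma DP_eq0: "DP (\<lambda>s. s i = s j)"
  by (rule DP_FD) (auto simp: FD_def elts_def intro!: exI[of _ "Eq i j"])

lemma DT_var[dfn]: "DT (\<lambda>s. s i)" unfolding DT_def by (rule DP_eq0)
lemma DT_const[dfn]: "DT (\<lambda>s. c)"
  unfolding DT_def using DP_inst[of "\<lambda>s a. a = s 0", OF DP_eq0] .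

lemma DP_app1: assumes "DP (\<lambda>s. R (s 0))" "DT f" shows "DP (\<lambda>s. R (f s))"
  using DP_subst[of "\<lambda>s a. R a" f] assms by simp

lemma DP_app2: assumes "DP (\<lambda>s. R (s 0) (s 1))" "DT f" "DT g" shows "DP (\<lambda>s. R (f s) (g s))"
proof (rule DP_subst[of "\<lambda>s a. R a (g s)", OF _ assms(2)])
  show "DP (\<lambda>s. R (s 0) (g (\<lambda>n. s (Suc n))))"
  proof (rule DP_subst[of "\<lambda>s a. R (s 0) a", OF _ DT_sub[OF assms(3)]])
    show "DP (\<lambda>s. R (s (Suc 0)) (s 0))"
      using DP_sub[OF assms(1), of "\<lambda>n. if n = 0 then 1 else 0"] by simp
  qed
qed

lemma DP_app3: assumes "DP (\<lambda>s. R (s 0) (s 1) (s 2))" "DT f" "DT g" "DT h" shows "DP (\<lambda>s. R (f s) (g s) (h s))"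
proof (rule DP_subst[of "\<lambda>s a. R a (g s) (h s)", OF _ assms(2)])
  show "DP (\<lambda>s. R (s 0) (g (\<lambda>n. s (Suc n))) (h (\<lambda>n. s (Suc n))))"
  proof (rule DP_subst[of "\<lambda>s a. R (s 0) a (h (\<lambda>n. s (Suc n)))", OF _ DT_sub[OF assms(3)]])
    show "DP (\<lambda>s. R (s (Suc 0)) (s 0) (h (\<lambda>n. s (Suc (Suc n)))))"
    proof (rule DP_subst[of "\<lambda>s a. R (s (Suc 0)) (s 0) a", OF _ DT_sub[OF DT_sub[OF assms(4)]]])
      show "DP (\<lambda>s. R (s (Suc (Suc 0))) (s (Suc 0)) (s 0))"
        using DP_sub[OF assms(1), of "\<lambda>n. if n = 0 then 2 else if n = 1 then 1 else 0"] by (simp add: numeral_2_eq_2)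
    qed
  qed
qed

lemma DP_app4: assumes "DP (\<lambda>s. R (s 0) (s 1) (s 2) (s 3))" "DT f" "DT g" "DT h" "DT k"
  shows "DP (\<lambda>s. R (f s) (g s) (h s) (k s))"
proof (rule DP_subst[OF _ assms(5)])
  show "DP (\<lambda>s. R (f (\<lambda>n. s (Suc n))) (g (\<lambda>n. s (Suc n))) (h (\<lambda>n. s (Suc n))) (s 0))"
  proof (rule DP_subst[of "\<lambda>s a. R (f (\<lambda>n. s (Suc n))) (g (\<lambda>n. s (Suc n))) a (s 0)", OF _ DT_sub[OF assms(4)]])
    show "DP (\<lambda>s. R (f (\<lambda>n. s (Suc (Suc n)))) (g (\<lambda>n. s (Suc (Suc n)))) (s 0) (s (Suc 0)))"
    proof (rule DP_subst[of "\<lambda>s a. R (f (\<lambda>n. s (Suc (Suc n)))) a (s 0) (s (Suc 0))", OF _ DT_sub[OF assms(3)]])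
      show "DP (\<lambda>s. R (f (\<lambda>n. s (Suc (Suc (Suc n))))) (s 0) (s (Suc 0)) (s (Suc (Suc 0))))"
      proof (rule DP_subst[of "\<lambda>s a. R a (s 0) (s (Suc 0)) (s (Suc (Suc 0)))", OF _ DT_sub[OF assms(2)]])
        show "DP (\<lambda>s. R (s 0) (s (Suc 0)) (s (Suc (Suc 0))) (s (Suc (Suc (Suc 0)))))"
          using assms(1) by (simp add: numeral_2_eq_2 numeral_3_eq_3)
      qed
    qed
  qed
qed

lemma DT_app1: assumes "DT (\<lambda>s. F (s 0))" "DT f" shows "DT (\<lambda>s. F (f s))"
  using DP_app2[of "\<lambda>x y. F x = y", OF _ DT_sub[OF assms(2), of Suc] DT_var[of 0]]
    DP_sub[OF assms(1)[unfolded DT_def], of "\<lambda>n. if n = 0 then 1 else 0"] by (simp add: DT_def)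

lemma DT_app2: assumes "DT (\<lambda>s. F (s 0) (s 1))" "DT f" "DT g" shows "DT (\<lambda>s. F (f s) (g s))"
  using DP_app3[of "\<lambda>x y z. F x y = z", OF _ DT_sub[OF assms(2), of Suc] DT_sub[OF assms(3), of Suc] DT_var[of 0]]
    DP_sub[OF assms(1)[unfolded DT_def], of "\<lambda>n. if n = 0 then 2 else n - 1"] by (simp add: DT_def)

lemma DP_mem[dfn]: "DT f \<Longrightarrow> DT g \<Longrightarrow> DP (\<lambda>s. f s \<in> El (g s))"
  by (rule DP_app2[of "\<lambda>x y. x \<in> El y"]) (auto simp: DP_mem0)
lemma DP_eq[dfn]: "DT f \<Longrightarrow> DT g \<Longrightarrow> DP (\<lambda>s. f s = g s)"
  by (rule DP_app2[of "\<lambda>x y. x = y"]) (auto simp: DP_eq0)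
lemma DP_E: "DT f \<Longrightarrow> DT g \<Longrightarrow> DP (\<lambda>s. E (f s) (g s))"
  using DP_mem by (simp add: elts_def)

lemma DP_all[dfn]: "DP (\<lambda>s. R (\<lambda>n. s (Suc n)) (s 0)) \<Longrightarrow> DP (\<lambda>s. \<forall>a. R s a)"
  using DP_not[OF DP_ex[of "\<lambda>s a. \<not> R s a"]] DP_not by simp
lemma DP_bexg[dfn]: "DP (\<lambda>s. s 0 \<in> X (\<lambda>n. s (Suc n))) \<Longrightarrow> DP (\<lambda>s. R (\<lambda>n. s (Suc n)) (s 0)) \<Longrightarrow> DP (\<lambda>s. \<exists>a\<in>X s. R s a)"
  unfolding Bex_def by (intro DP_ex DP_and)
lemma DP_ballg[dfn]: "DP (\<lambda>s. s 0 \<in> X (\<lambda>n. s (Suc n))) \<Longrightarrow> DP (\<lambda>s. R (\<lambda>n. s (Suc n)) (s 0)) \<Longrightarrow> DP (\<lambda>s. \<forall>a\<in>X s. R s a)"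
  unfolding Ball_def by (intro DP_all DP_imp)
lemma DP_true[dfn]: "DP (\<lambda>s. c)"
proof -
  have "DP (\<lambda>s. s 0 = s 0)" by (rule DP_eq0)
  from this DP_not[OF this] show ?thesis by (cases c) auto
qed
lemma DP_ex1[dfn]: "DP (\<lambda>s. R (\<lambda>n. s (Suc n)) (s 0)) \<Longrightarrow> DP (\<lambda>s. \<exists>!a. R s a)"
proof -
  assume a: "DP (\<lambda>s. R (\<lambda>n. s (Suc n)) (s 0))"
  have "DP (\<lambda>s. \<exists>a. R s a \<and> (\<forall>b. R s b \<longrightarrow> b = a))"
    by (intro dfn a) (use DP_sub[OF a, of "\<lambda>n. if n = 0 then 0 else Suc n"] in simp)
  then show ?thesis by (simp add: Ex1_def)
qed
lemma DP_subset[dfn]: "DT f \<Longrightarrow> DT g \<Longrightarrow> DP (\<lambda>s. El (f s) \<subseteq> El (g s))"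
  by (rule DP_app2[of "\<lambda>x y. El x \<subseteq> El y"], unfold subset_eq, intro dfn)
lemma DT_if[dfn]: assumes "DP c" "DT f" "DT g" shows "DT (\<lambda>s. if c s then f s else g s)"
proof -
  have "DP (\<lambda>s. (c (\<lambda>n. s (Suc n)) \<and> f (\<lambda>n. s (Suc n)) = s 0) \<or> (\<not> c (\<lambda>n. s (Suc n)) \<and> g (\<lambda>n. s (Suc n)) = s 0))"
    by (intro DP_or DP_and DP_not DP_sub[OF assms(1)] assms(2,3)[unfolded DT_def])
  then show ?thesis unfolding DT_def by (rule back_subst[of DP]) auto
qed
lemma DP_Collect[dfn]: "DP (\<lambda>s. R s (f s)) \<Longrightarrow> DP (\<lambda>s. f s \<in> {x. R s x})" by simp

lemma DT_by: assumes "\<And>s a. (f s = a) = R s a" "DP (\<lambda>s. R (\<lambda>n. s (Suc n)) (s 0))" shows "DT f"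
  unfolding DT_def assms(1) by fact

text \<open>The induction runs over the metatheoretic formula, so no truth predicate inside the
  model is involved. The terms \<open>F n\<close> let the assignment depend definably on the
  context, in particular below a quantifier.\<close>

lemma DP_satM:
  assumes M: "DP (\<lambda>s. s 0 \<in> M)" and F: "\<And>n. DT (F n)"
  shows "DP (\<lambda>s. sat E M (\<lambda>n. F n s) \<phi>)"
  using F
proof (induction \<phi> arbitrary: F)
  case (Mem x1 x2) then show ?case by (simp, intro DP_E)
next
  case (Eq x1 x2) then show ?case by (simp, intro dfn)
next
  case (Neg \<phi>)
  have "DP (\<lambda>s. sat E M (\<lambda>n. F n s) \<phi>)" by (rule Neg.IH) (rule Neg.prems)
  then show ?case by (simp add: DP_not)
next
  case (And \<phi>1 \<phi>2)
  have "DP (\<lambda>s. sat E M (\<lambda>n. F n s) \<phi>1)" by (rule And.IH(1)) (rule And.prems)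
  moreover have "DP (\<lambda>s. sat E M (\<lambda>n. F n s) \<phi>2)" by (rule And.IH(2)) (rule And.prems)
  ultimately show ?case by (simp add: DP_and)
next
  case (Ex x \<phi>)
  have "DP (\<lambda>s. \<exists>a\<in>M. sat E M ((\<lambda>n. F n s)(x := a)) \<phi>)"
  proof (intro dfn)
    show "DP (\<lambda>s. s 0 \<in> M)" by fact
    have "DP (\<lambda>s. sat E M (\<lambda>n. (if n = x then (\<lambda>s. s 0) else (\<lambda>s. F n (\<lambda>n. s (Suc n)))) s) \<phi>)"
      by (rule Ex.IH) (auto intro: DT_var DT_sub Ex.prems)
    then show "DP (\<lambda>s. sat E M ((\<lambda>n. F n (\<lambda>n. s (Suc n)))(x := s 0)) \<phi>)"
      by (rule back_subst[of DP]) (auto intro!: ext arg_cong[where f="\<lambda>u. sat E M u \<phi>"])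
  qed
  then show ?case by simp
qed

text \<open>The way back to the axiom schemes, which display the variables \<open>0\<close> and
  \<open>1\<close> and leave the rest to parameters: the hidden parameters move to the indices from
  \<open>2\<close> on.\<close>

lemma DP_fm2: assumes "DP (\<lambda>s. R (s 0) (s 1))" shows "\<exists>\<phi> s. \<forall>u v. sat E UNIV (s(0:=u,1:=v)) \<phi> = R u v"
proof -
  obtain Q r where 1: "FD UNIV Q" "\<And>s. R (s 0) (s 1) = Q (mix s r)"
    using assms(1) unfolding DP_def by blast
  obtain \<phi> where \<phi>: "\<And>s. sat E UNIV s \<phi> = Q s" using 1 unfolding FD_def by auto
  define s where "s n = r (n - 2)" for n
  let ?g = "mix (case_nat 0 (\<lambda>k. 1)) (\<lambda>k. Suc (Suc k))"
  have "sat E UNIV (s(0:=u,1:=v)) (sub \<phi> ?g) = R u v" for u v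
  proof -
    have "mix (case_nat u (\<lambda>_. v)) r = (\<lambda>n. (s(0:=u,1:=v)) (?g n))"
      unfolding mix_comp by (intro arg_cong2[of _ _ _ _ mix] ext) (auto split: nat.splits simp: s_def)
    then show ?thesis using 1(2)[of "case_nat u (\<lambda>_. v)"] unfolding sat_sub \<phi> by simp
  qed
  then show ?thesis by blast
qed

lemma DP_fm1: assumes "DP (\<lambda>s. P (s 0))" shows "\<exists>\<phi> s. \<forall>u. sat E UNIV (s(0:=u)) \<phi> = P u"
  using DP_fm2[of "\<lambda>u v. P v"] DP_sub[OF assms, of "\<lambda>n. 1"] 
proof -
  obtain \<phi> s where a: "\<forall>u v. sat E UNIV (s(0:=u,1:=v)) \<phi> = P v"
    using DP_fm2[of "\<lambda>u v. P v"] DP_sub[OF assms, of "\<lambda>n. 1"] by auto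
  have "sat E UNIV ((\<lambda>n. s (n - 1))(0 := u)) (sub \<phi> (\<lambda>n. if n = 1 then 0 else Suc n)) = P u" for u
    using a[rule_format, of "s 0" u] unfolding sat_sub 
    by (rule back_subst[of "\<lambda>b. b = P u"]) (auto intro!: arg_cong[where f="\<lambda>u. sat E UNIV u \<phi>"])
  then show ?thesis by blast
qed

lemma definable_DP: "definable E UNIV A \<longleftrightarrow> DP (\<lambda>s. s 0 \<in> A)"
proof
  assume "definable E UNIV A"
  then obtain \<phi> s where a: "A = {x. sat E UNIV (s(0 := x)) \<phi>}" unfolding definable_def by blast
  have "DP (\<lambda>t. sat E UNIV (\<lambda>n. (if n = 0 then (\<lambda>t. t 0) else (\<lambda>t. s n)) t) \<phi>)"
    by (rule DP_satM) (auto intro: DT_var DT_const DP_true)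
  moreover have "(\<lambda>n. (if n = 0 then (\<lambda>t. t 0) else (\<lambda>t. s n)) t) = s(0 := t 0)" for t :: "nat \<Rightarrow> 'a" by auto
  ultimately show "DP (\<lambda>s. s 0 \<in> A)" unfolding a mem_Collect_eq by (simp only:)
next
  assume "DP (\<lambda>s. s 0 \<in> A)" 
  from DP_fm1[OF this] show "definable E UNIV A" unfolding definable_def by blast
qed

end

subsection \<open>Basic set theory inside a model of ZFC\<close>

locale zfc = mem E for E :: "'a \<Rightarrow> 'a \<Rightarrow> bool" +
  assumes ZFC: "ZFC E"
begin

lemma ZFC_axioms:
  shows ext0: "\<forall>x y. El x = El y \<longrightarrow> x = y"
    and found0: "\<forall>x. El x \<noteq> {} \<longrightarrow> (\<exists>y\<in>El x. El y \<inter> El x = {})"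
    and isS_upair0: "\<forall>x y. isS {x, y}"
    and isS_Union00: "\<forall>x. isS (\<Union>y\<in>El x. El y)"
    and isS_Pow00: "\<forall>x. isS {z. El z \<subseteq> El x}"
    and inf: "\<exists>x. (\<exists>e\<in>El x. El e = {}) \<and> (\<forall>y\<in>El x. \<exists>z\<in>El x. El z = insert y (El y))"
    and sep00: "\<forall>\<phi> s x. isS {z \<in> El x. sat E UNIV (s(0 := z)) \<phi>}"
    and repl00: "\<forall>\<phi> s x. (\<forall>u\<in>El x. \<exists>!v. sat E UNIV (s(0 := u, 1 := v)) \<phi>) \<longrightarrow>
       isS {v. \<exists>u\<in>El x. sat E UNIV (s(0 := u, 1 := v)) \<phi>}"
    and AC00: "\<forall>x. (\<forall>y\<in>El x. El y \<noteq> {}) \<and>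
         (\<forall>y\<in>El x. \<forall>z\<in>El x. y \<noteq> z \<longrightarrow> El y \<inter> El z = {}) \<longrightarrow>
       (\<exists>c. \<forall>y\<in>El x. \<exists>!z. z \<in> El c \<and> z \<in> El y)"
  using ZFC unfolding ZFC_def by - (elim conjE, assumption)+

lemma El_ext: "El x = El y \<Longrightarrow> x = y" using ext0 by simp

lemma El_mk[simp]: "isS A \<Longrightarrow> El (mk A) = A"
  unfolding is_set_def set_of_def by (elim exE, rule theI) (auto intro: El_ext)

lemma isS_El[simp, intro]: "isS (El x)" unfolding is_set_def by blast
lemma mk_El[simp]: "mk (El x) = x" by (rule El_ext) simp

lemma found: "El x \<noteq> {} \<Longrightarrow> \<exists>y\<in>El x. El y \<inter> El x = {}" using found0 by simp
lemma isS_upair: "isS {x, y}" using isS_upair0 by simp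
lemma isS_sng[simp, intro]: "isS {x}" using isS_upair[of x x] by simp
lemma isS_Union0: "isS (\<Union>y\<in>El x. El y)" using isS_Union00 by simp
lemma isS_Pow0: "isS {z. El z \<subseteq> El x}" using isS_Pow00 by simp

lemma isS_Collect: assumes "isS A" "DP (\<lambda>s. P (s 0))" shows "isS {z\<in>A. P z}"
proof -
  obtain x where x: "A = El x" using assms(1) unfolding is_set_def by auto
  obtain \<phi> s where "\<forall>u. sat E UNIV (s(0:=u)) \<phi> = P u" using DP_fm1[OF assms(2)] by auto
  then show ?thesis using sep00[rule_format, of x s \<phi>] x by simp
qed

lemma isS_subset: assumes "isS A" "B \<subseteq> A" "DP (\<lambda>s. s 0 \<in> B)" shows "isS B"
  using isS_Collect[OF assms(1,3)] assms(2) by (metis Collect_conj_eq Collect_mem_eq inf.absorb_iff2)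

lemma isS_image: assumes "isS A" "DT (\<lambda>s. F (s 0))" shows "isS (F ` A)"
proof -
  obtain x where x: "A = El x" using assms(1) unfolding is_set_def by auto
  have "DP (\<lambda>s. F (s 0) = s 1)"
    using DP_sub[OF assms(2)[unfolded DT_def], of "\<lambda>n. if n = 0 then 1 else 0"] by simp
  then obtain \<phi> s where "\<forall>u v. sat E UNIV (s(0:=u,1:=v)) \<phi> = (F u = v)" using DP_fm2[of "\<lambda>u v. F u = v"] by auto
  then have "isS {v. \<exists>u\<in>El x. F u = v}" using repl00[rule_format, of x s \<phi>] by simp
  moreover have "{v. \<exists>u\<in>El x. F u = v} = F ` A" unfolding x by auto
  ultimately show ?thesis by simp
qed

lemma isS_UNe: "isS A \<Longrightarrow> isS (\<Union>y\<in>A. El y)"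
  using isS_Union0 unfolding is_set_def by blast
lemma isS_empty[simp, intro]: "isS {}"
  using isS_Collect[of "{undefined}" "\<lambda>_. False"] by (simp add: dfn)
lemma isS_Un: assumes "isS A" "isS B" shows "isS (A \<union> B)"
  using isS_UNe[OF isS_upair[of "mk A" "mk B"]] assms by simp
lemma isS_insert[simp, intro]: "isS A \<Longrightarrow> isS (insert x A)"
  using isS_Un[of "{x}" A] by simp
lemma isS_finite: "finite A \<Longrightarrow> isS A" by (induction rule: finite_induct) auto
lemma DT_mk[dfn]:
  assumes "\<And>s. isS {x. R s x}" "DP (\<lambda>s. R (\<lambda>n. s (Suc n)) (s 0))"
  shows "DT (\<lambda>s. mk {x. R s x})"
proof (rule DT_by)
  show "(mk {x. R s x} = a) = (\<forall>x. x \<in> El a \<longleftrightarrow> R s x)" for s a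
  proof
    assume "\<forall>x. x \<in> El a \<longleftrightarrow> R s x"
    then have "El a = {x. R s x}" by auto
    then show "mk {x. R s x} = a" by (metis mk_El)
  qed (use El_mk[OF assms(1)[of s]] in auto)
  show "DP (\<lambda>s. \<forall>x. x \<in> El (s 0) \<longleftrightarrow> R (\<lambda>n. s (Suc n)) x)"
    by (intro dfn) (use DP_sub[OF assms(2), of "\<lambda>n. if n = 0 then 0 else Suc n"] in simp)
qed

definition "emp = mk {}"
lemma El_emp[simp]: "El emp = {}" unfolding emp_def by simp
lemma emp_eq: "El x = {} \<longleftrightarrow> x = emp" using El_ext[of x emp] by auto

definition "upr x y = mk {z. z = x \<or> z = y}"
lemma upr: "upr x y = mk {x, y}" unfolding upr_def by (rule arg_cong[of _ _ mk]) auto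
lemma El_upr[simp]: "El (upr x y) = {x, y}" unfolding upr by (simp add: isS_upair)
lemma DT_upr[dfn]: "DT f \<Longrightarrow> DT g \<Longrightarrow> DT (\<lambda>s. upr (f s) (g s))"
  by (rule DT_app2, unfold upr_def, intro dfn) (simp add: isS_upair[simplified insert_def] isS_finite)

lemma pr_upr: "pr x y = upr (upr x x) (upr x y)" unfolding pair_def upr by simp
lemma DT_pr[dfn]: "DT f \<Longrightarrow> DT g \<Longrightarrow> DT (\<lambda>s. pr (f s) (g s))" unfolding pr_upr by (intro dfn)

lemma upr_eq: "upr x y = upr u v \<longleftrightarrow> {x, y} = {u, v}" by (metis El_upr upr)
lemma pr_inj[simp]: "pr x y = pr u v \<longleftrightarrow> x = u \<and> y = v"
  unfolding pr_upr by (auto simp: upr_eq doubleton_eq_iff)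
lemma El_pr: "El (pr x y) = {upr x x, upr x y}" by (simp add: pr_upr)

definition "Unn x = mk {z. \<exists>y\<in>El x. z \<in> El y}"
lemma El_Unn[simp]: "El (Unn x) = (\<Union>y\<in>El x. El y)"
  using isS_Union0[of x] unfolding Unn_def by (simp add: UNION_eq)
lemma DT_Unn[dfn]: "DT f \<Longrightarrow> DT (\<lambda>s. Unn (f s))"
  by (rule DT_app1, unfold Unn_def, intro dfn) (use isS_Union0 in \<open>simp add: UNION_eq\<close>)

definition "un x y = mk {z. z \<in> El x \<or> z \<in> El y}"
lemma El_un[simp]: "El (un x y) = El x \<union> El y"
  using isS_Un[of "El x" "El y"] unfolding un_def by (simp add: Un_def)
lemma DT_un[dfn]: "DT f \<Longrightarrow> DT g \<Longrightarrow> DT (\<lambda>s. un (f s) (g s))"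
  by (rule DT_app2, unfold un_def, intro dfn) (use isS_Un[OF isS_El isS_El] in \<open>simp add: Un_def\<close>)

definition "Pw x = mk {z. El z \<subseteq> El x}"
lemma El_Pw[simp]: "El (Pw x) = {z. El z \<subseteq> El x}"
  using isS_Pow0[of x] unfolding Pw_def by simp
lemma DT_Pw[dfn]: "DT f \<Longrightarrow> DT (\<lambda>s. Pw (f s))"
  by (rule DT_app1, unfold Pw_def, intro dfn) (rule isS_Pow0)

lemma sc_un: "sc x = un x (upr x x)" unfolding succ_def by (rule El_ext) simp
lemma El_sc[simp]: "El (sc x) = insert x (El x)" by (simp add: sc_un)
lemma DT_sc[dfn]: "DT f \<Longrightarrow> DT (\<lambda>s. sc (f s))" unfolding sc_un
  by (rule DT_app1, intro dfn)

definition "sep A P = mk {z. z \<in> El A \<and> P z}"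
lemma El_sep: "DP (\<lambda>s. P (s 0)) \<Longrightarrow> El (sep A P) = {z \<in> El A. P z}"
  unfolding sep_def using isS_Collect[of "El A" P] by simp

lemma DP_fix2: "DP (\<lambda>s. R (\<lambda>n. s (Suc n)) (s 0)) \<Longrightarrow> DP (\<lambda>s. R t (s 0))"
  using DP_fix[of "\<lambda>s. R (\<lambda>n. s (Suc n)) (s 0)" t] by simp
lemma DP_fixK: assumes "DP P" shows "DP (\<lambda>s. P (\<lambda>n. if n < K then s n else t n))"
proof -
  obtain Q r where 1: "FD UNIV Q" "\<And>s. P s = Q (mix s r)"
    using assms unfolding DP_def by blast
  let ?g = "mix (\<lambda>k. if k < K then 2 * k else Suc (2 * (2 * k))) (\<lambda>k. Suc (2 * Suc (2 * k)))"
  have [simp]: "mix s (mix t r) (Suc (4 * k)) = t k" for s k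
    using mix_simps(2)[of s "mix t r" "2 * k"] by (simp del: mix_simps(2)) 
  have "mix (\<lambda>n. if n < K then s n else t n) r = (\<lambda>n. mix s (mix t r) (?g n))" for s
    unfolding mix_comp mix_simps by (intro arg_cong2[of _ _ _ _ mix] HOL.ext) (auto simp del: mult_Suc_right)
  moreover have "FD UNIV (\<lambda>t. Q (\<lambda>n. t (?g n)))" by (rule FD_subU[OF 1(1)])
  ultimately show ?thesis unfolding DP_def
    by (intro exI[of _ "\<lambda>t. Q (\<lambda>n. t (?g n))"] exI[of _ "mix t r"]) (simp add: 1)
qed

lemma DT_fix2: assumes "DT (\<lambda>s. F (\<lambda>n. s (Suc n)) (s 0))" shows "DT (\<lambda>s. F t (s 0))"
  using DP_fixK[OF assms[unfolded DT_def], of 2 "\<lambda>n. t (n - 2)"] by (simp add: DT_def)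

lemma DT_sep[dfn]: assumes "DT f" "DP (\<lambda>s. R (\<lambda>n. s (Suc n)) (s 0))" shows "DT (\<lambda>s. sep (f s) (R s))"
  unfolding sep_def
proof (rule DT_mk)
  show "isS {z. z \<in> El (f s) \<and> R s z}" for s by (rule isS_Collect[OF isS_El DP_fix2[OF assms(2)]])
qed (intro dfn DT_sub[OF assms(1)] assms(2))

definition "rep A F = mk {y. \<exists>x\<in>El A. y = F x}"
lemma El_rep: "DT (\<lambda>s. F (s 0)) \<Longrightarrow> El (rep A F) = F ` El A"
  unfolding rep_def using isS_image[of "El A" F] by (simp add: image_def)
lemma DT_rep[dfn]: assumes "DT f" "DT (\<lambda>s. F (\<lambda>n. s (Suc n)) (s 0))" shows "DT (\<lambda>s. rep (f s) (F s))"
  unfolding rep_def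
proof (rule DT_mk)
  show "isS {y. \<exists>x\<in>El (f s). y = F s x}" for s 
    using isS_image[OF isS_El[of "f s"] DT_fix2[OF assms(2), of s]] by (simp add: image_def)
qed (intro dfn DT_sub[OF assms(1)] DT_sub[OF assms(2), of "\<lambda>n. if n = 0 then 0 else Suc n", simplified])

definition "tms A B = Unn (rep A (\<lambda>x. rep B (\<lambda>y. pr x y)))"
lemma El_tms[simp]: "El (tms A B) = {pr x y |x y. x \<in> El A \<and> y \<in> El B}"
  unfolding tms_def by (auto simp: El_rep dfn)
lemma DT_tms[dfn]: "DT f \<Longrightarrow> DT g \<Longrightarrow> DT (\<lambda>s. tms (f s) (g s))"
  by (rule DT_app2, unfold tms_def, intro dfn)

text \<open>Projections, the identity outside ordered pairs.\<close>

definition "p1 z = (if \<exists>x y. z = pr x y then THE x. \<exists>y. z = pr x y else z)"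
definition "p2 z = (if \<exists>x y. z = pr x y then THE y. \<exists>x. z = pr x y else z)"
lemma p1[simp]: "p1 (pr x y) = x" and p2[simp]: "p2 (pr x y) = y" unfolding p1_def p2_def by auto
lemma p1_eq: "(p1 z = a) = ((\<exists>y. z = pr a y) \<or> (\<not> (\<exists>x y. z = pr x y) \<and> a = z))"
  by (cases "\<exists>x y. z = pr x y") (auto simp: p1_def)
lemma p2_eq: "(p2 z = a) = ((\<exists>y. z = pr y a) \<or> (\<not> (\<exists>x y. z = pr x y) \<and> a = z))"
  by (cases "\<exists>x y. z = pr x y") (auto simp: p2_def)
lemma DT_p1[dfn]: "DT f \<Longrightarrow> DT (\<lambda>s. p1 (f s))" by (rule DT_app1, rule DT_by, rule p1_eq, intro dfn)
lemma DT_p2[dfn]: "DT f \<Longrightarrow> DT (\<lambda>s. p2 (f s))" by (rule DT_app1, rule DT_by, rule p2_eq, intro dfn)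

subsection \<open>Functions\<close>

definition "lam a F = rep a (\<lambda>x. pr x (F x))"
text \<open>The default \<open>emp\<close> makes application total and definable without conditions
  on \<open>f\<close>. It agrees with \<open>app\<close> on functions, see
  \<open>app_ap\<close>.\<close>

definition "ap f x = (if \<exists>!y. pr x y \<in> El f then THE y. pr x y \<in> El f else emp)"

lemma DT_lam[dfn]: assumes "DT f" "DT (\<lambda>s. F (\<lambda>n. s (Suc n)) (s 0))" shows "DT (\<lambda>s. lam (f s) (F s))"
  unfolding lam_def by (intro dfn assms)
lemma El_lam: "DT (\<lambda>s. F (s 0)) \<Longrightarrow> El (lam a F) = {pr x (F x) |x. x \<in> El a}"
  unfolding lam_def by (subst El_rep) (auto intro: dfn)
lemma fn_lam: "DT (\<lambda>s. F (s 0)) \<Longrightarrow> fn (lam a F) a"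
  unfolding fun_on_def by (auto simp: El_lam)
lemma ap_lam[simp]: "DT (\<lambda>s. F (s 0)) \<Longrightarrow> x \<in> El a \<Longrightarrow> ap (lam a F) x = F x"
  unfolding ap_def by (auto simp: El_lam)
lemma ap_eq: "(ap f x = a) = ((pr x a \<in> El f \<and> (\<forall>b. pr x b \<in> El f \<longrightarrow> b = a)) \<or> (\<not> (\<exists>!y. pr x y \<in> El f) \<and> a = emp))"
proof (cases "\<exists>!y. pr x y \<in> El f")
  case True
  from theI'[OF True] show ?thesis unfolding ap_def using True by auto
qed (auto simp: ap_def)
lemma DT_ap[dfn]: "DT f \<Longrightarrow> DT g \<Longrightarrow> DT (\<lambda>s. ap (f s) (g s))"
  by (rule DT_app2, rule DT_by, rule ap_eq, intro dfn)

lemma fn_ex1: "fn f a \<Longrightarrow> x \<in> El a \<Longrightarrow> \<exists>!y. pr x y \<in> El f"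
  unfolding fun_on_def by simp
lemma app_ap: "fn f a \<Longrightarrow> x \<in> El a \<Longrightarrow> app E f x = ap f x"
  unfolding app_def ap_def using fn_ex1 by simp
lemma fn_pr: assumes "fn f a" shows "pr x y \<in> El f \<longleftrightarrow> x \<in> El a \<and> y = ap f x"
proof -
  have 1: "pr x (ap f x) \<in> El f" if "x \<in> El a"
    unfolding ap_def using theI'[OF fn_ex1[OF assms that]] fn_ex1[OF assms that] by simp
  have "x \<in> El a" if "pr x y \<in> El f" using assms that unfolding fun_on_def by force
  then show ?thesis using 1 fn_ex1[OF assms] by metis
qed
lemma fn_El: "fn f a \<Longrightarrow> El f = {pr x (ap f x) |x. x \<in> El a}"
proof -
  assume f: "fn f a"
  have "\<exists>x y. z = pr x y" if "z \<in> El f" for z using f that unfolding fun_on_def by blast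
  then show ?thesis using fn_pr[OF f] by (auto; metis)
qed
lemma fn_eqI: "fn f a \<Longrightarrow> fn g a \<Longrightarrow> (\<And>x. x \<in> El a \<Longrightarrow> ap f x = ap g x) \<Longrightarrow> f = g"
  by (rule El_ext) (auto simp: fn_El)
lemma DP_fn[dfn]: "DT f \<Longrightarrow> DT g \<Longrightarrow> DP (\<lambda>s. fn (f s) (g s))"
  by (rule DP_app2, unfold fun_on_def, intro dfn)

definition "fun_sp a b = mk {f. fn f a \<and> (\<forall>x\<in>El a. ap f x \<in> El b)}"
lemma isS_fun_sp: "isS {f. fn f a \<and> (\<forall>x\<in>El a. ap f x \<in> El b)}"
proof (rule isS_subset[of "El (Pw (tms a b))"])
  show "{f. fn f a \<and> (\<forall>x\<in>El a. ap f x \<in> El b)} \<subseteq> El (Pw (tms a b))" by (auto simp: fn_El)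
qed (intro isS_El dfn)+
lemma El_fun_sp[simp]: "El (fun_sp a b) = {f. fn f a \<and> (\<forall>x\<in>El a. ap f x \<in> El b)}"
  unfolding fun_sp_def by (simp add: isS_fun_sp)
lemma DT_fun_sp[dfn]: "DT f \<Longrightarrow> DT g \<Longrightarrow> DT (\<lambda>s. fun_sp (f s) (g s))"
  by (rule DT_app2, unfold fun_sp_def, intro dfn) (rule isS_fun_sp)

end

context zfc
begin

subsection \<open>Natural numbers and iteration\<close>

lemma irrefl[simp]: "x \<notin> El x" using found[of "upr x x"] by auto
lemma no2: "x \<in> El y \<Longrightarrow> y \<notin> El x" using found[of "upr x y"] by auto
lemma no3: "x \<in> El y \<Longrightarrow> y \<in> El z \<Longrightarrow> z \<notin> El x"
  using found[of "un (upr x y) (upr y z)"] by auto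

lemma sc_inj[simp]: "sc x = sc y \<longleftrightarrow> x = y"
proof
  assume "sc x = sc y"
  then have "insert x (El x) = insert y (El y)" by (metis El_sc)
  then have "x \<in> insert y (El y)" "y \<in> insert x (El x)" by (metis insertI1)+
  then have "x = y \<or> x \<in> El y \<and> y \<in> El x" by auto
  then show "x = y" using no2[of x y] by blast
qed simp
lemma sc_ne[simp]: "sc x \<noteq> emp" "emp \<noteq> sc x" using El_sc[of x] by (metis El_emp insert_not_empty)+

definition ind where "ind I \<longleftrightarrow> emp \<in> El I \<and> (\<forall>y\<in>El I. sc y \<in> El I)"
lemma DP_ind[dfn]: "DT f \<Longrightarrow> DP (\<lambda>s. ind (f s))" by (rule DP_app1, unfold ind_def, intro dfn)

lemma ex_ind: "\<exists>I. ind I"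
proof -
  obtain x e where x: "e \<in> El x" "El e = {}" "\<And>y. y \<in> El x \<Longrightarrow> \<exists>z\<in>El x. El z = insert y (El y)" using inf by metis
  have "sc y \<in> El x" if "y \<in> El x" for y
  proof -
    obtain z where "z \<in> El x" "El z = insert y (El y)" using x(3) \<open>y \<in> El x\<close> by blast
    then show ?thesis using El_ext[of z "sc y"] by simp
  qed
  moreover have "e = emp" using x(2) emp_eq by simp
  ultimately have "ind x" unfolding ind_def using x(1) by simp
  then show ?thesis by blast
qed

definition "om = sep (SOME I. ind I) (\<lambda>n. \<forall>I. ind I \<longrightarrow> n \<in> El I)"
lemma om_iff: "n \<in> El om \<longleftrightarrow> (\<forall>I. ind I \<longrightarrow> n \<in> El I)"
proof -
  have "El om = {n \<in> El (SOME I. ind I). \<forall>I. ind I \<longrightarrow> n \<in> El I}" unfolding om_def by (rule El_sep) (intro dfn)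
  then show ?thesis using someI_ex[OF ex_ind] by auto
qed
lemma om_emp[simp]: "emp \<in> El om" and om_sc[simp]: "n \<in> El om \<Longrightarrow> sc n \<in> El om"
  unfolding om_iff by (auto simp: ind_def)

text \<open>\<open>om\<close> may contain nonstandard numbers, so induction is available for
  definable predicates only: they separate a subset of \<open>om\<close> that is inductive
  again.\<close>

lemma om_induct[consumes 1, case_names D emp sc]:
  assumes "n \<in> El om" "DP (\<lambda>s. P (s 0))" "P emp" "\<And>n. n \<in> El om \<Longrightarrow> P n \<Longrightarrow> P (sc n)"
  shows "P n"
proof -
  have "ind (sep om P)" unfolding ind_def using assms by (simp add: El_sep)
  then have "n \<in> El (sep om P)" using assms(1) om_iff[of n] by blast
  then show ?thesis using assms(2) by (simp add: El_sep)
qed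

lemma om_trans: "n \<in> El om \<Longrightarrow> m \<in> El n \<Longrightarrow> El m \<subseteq> El n"
proof -
  assume "n \<in> El om"
  then have "\<forall>m\<in>El n. El m \<subseteq> El n" by (induction rule: om_induct) (intro dfn, auto)
  then show "m \<in> El n \<Longrightarrow> El m \<subseteq> El n" by auto
qed
lemma om_sub: "n \<in> El om \<Longrightarrow> El n \<subseteq> El om"
  by (induction rule: om_induct) (intro dfn, auto)
lemma om_sc_mem: "n \<in> El om \<Longrightarrow> m \<in> El n \<Longrightarrow> sc m \<in> El (sc n)"
proof -
  assume "n \<in> El om"
  then have "\<forall>m\<in>El n. sc m \<in> El (sc n)" by (induction rule: om_induct) (intro dfn, auto)
  then show "m \<in> El n \<Longrightarrow> sc m \<in> El (sc n)" by auto
qed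
lemma om_0_mem: "n \<in> El om \<Longrightarrow> emp \<in> El (sc n)"
  by (induction rule: om_induct) (intro dfn, auto)
lemma om_cases: "n \<in> El om \<Longrightarrow> n = emp \<or> (\<exists>m\<in>El om. n = sc m)"
  by (induction rule: om_induct) (intro dfn, auto)

lemma choose_fun:
  assumes "\<And>x. \<exists>!y. R x y" "DP (\<lambda>s. R (s 0) (s 1))"
  shows "\<exists>F. DT (\<lambda>s. F (s 0)) \<and> (\<forall>x y. F x = y \<longleftrightarrow> R x y)"
proof -
  have 1: "((THE y. R x y) = y) = R x y" for x y using theI'[OF assms(1)[of x]] assms(1)[of x] by auto
  have "DT (\<lambda>s. THE y. R (s 0) y)"
    unfolding DT_def 1 using DP_sub[OF assms(2), of "\<lambda>n. if n = 0 then 1 else 0"] by simp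
  then show ?thesis using 1 by (intro exI[of _ "\<lambda>x. THE y. R x y"]) auto
qed

lemma iterate:
  assumes G[dfn]: "\<And>f. DT f \<Longrightarrow> DT (\<lambda>s. G (f s))"
  obtains F where "DT (\<lambda>s. F (s 0))" "F emp = a" "\<And>n. n \<in> El om \<Longrightarrow> F (sc n) = G (F n)"
proof -
  define A where "A f n \<longleftrightarrow> n \<in> El om \<and> fn f (sc n) \<and> ap f emp = a \<and> (\<forall>m\<in>El n. ap f (sc m) = G (ap f m))" for f n
  have DA: "DP (\<lambda>s. A (s i) (s j))" for i j unfolding A_def by (intro dfn)
  have uniq: "ap f m = ap g m" if "A f n" "A g k" "m \<in> El (sc n)" "m \<in> El (sc k)" "m \<in> El om" for f g n k m
  proof -
    have "m \<in> El (sc n) \<and> m \<in> El (sc k) \<longrightarrow> ap f m = ap g m"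
      using that(5)
    proof (induction rule: om_induct)
      case (sc m)
      have *: "m \<in> El n" if "sc m \<in> El (sc n)" "n \<in> El om" for n
        using that om_trans[of n "sc m"] by auto
      show ?case
      proof
        assume h: "sc m \<in> El (sc n) \<and> sc m \<in> El (sc k)"
        have "m \<in> El n" "m \<in> El k" using h * that(1,2) unfolding A_def by blast+
        then show "ap f (sc m) = ap g (sc m)" using sc that(1,2) unfolding A_def by auto
      qed
    qed (intro dfn, use that(1,2) in \<open>auto simp: A_def\<close>)
    then show ?thesis using that by auto
  qed
  have ex: "\<exists>f. A f n" if "n \<in> El om" for n
    using that
  proof (induction rule: om_induct)
    case D show ?case by (intro dfn DA)
  next
    case emp show ?case by (rule exI[of _ "lam (sc emp) (\<lambda>_. a)"]) (auto simp: A_def fn_lam dfn)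
  next
    case (sc n)
    then obtain f where f: "A f n" by auto
    define f' where "f' = lam (sc (sc n)) (\<lambda>m. if m = sc n then G (ap f n) else ap f m)"
    have d: "DT (\<lambda>s. if s 0 = sc n then G (ap f n) else ap f (s 0))" by (intro dfn)
    have 1: "ap f' (sc n) = G (ap f n)" unfolding f'_def using ap_lam[OF d, of "sc n"] by simp
    have 2: "ap f' m = ap f m" if "m \<in> El (sc n)" for m
    proof -
      have "m \<noteq> sc n" "m \<in> El (sc (sc n))" using that irrefl[of "sc n"] by (auto simp del: irrefl)
      then show ?thesis unfolding f'_def by (simp only: ap_lam[OF d] if_False)
    qed
    have "A f' (sc n)" unfolding A_def
    proof (intro conjI ballI)
      show "fn f' (sc (sc n))" unfolding f'_def by (rule fn_lam[OF d])
      show "ap f' emp = a" using f sc om_0_mem[of n] 2[of emp] by (simp add: A_def)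
      fix m assume m: "m \<in> El (sc n)"
      show "ap f' (sc m) = G (ap f' m)"
      proof (cases "m = n")
        case True then show ?thesis using 1 2[of n] by simp
      next
        case False 
        then have "m \<in> El n" using m by simp
        moreover have "sc m \<in> El (sc n)" using om_sc_mem[OF sc(1) \<open>m \<in> El n\<close>] .
        ultimately show ?thesis using 2[of "sc m"] 2[of m] f m by (simp add: A_def del: El_sc)
      qed
    qed (use sc in auto)
    then show ?case by blast
  qed
  have "\<exists>F. DT (\<lambda>s. F (s 0)) \<and> (\<forall>x y. F x = y \<longleftrightarrow> (if x \<in> El om then \<exists>f. A f x \<and> y = ap f x else y = emp))"
  proof (rule choose_fun[of "\<lambda>x y. if x \<in> El om then \<exists>f. A f x \<and> y = ap f x else y = emp"])
    show "\<exists>!y. if x \<in> El om then \<exists>f. A f x \<and> y = ap f x else y = emp" for x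
      using ex[of x] uniq[of _ x _ x x] by (cases "x \<in> El om") auto
    show "DP (\<lambda>s. if s 0 \<in> El om then \<exists>f. A f (s 0) \<and> s 1 = ap f (s 0) else s 1 = emp)"
      unfolding if_bool_eq_conj by (intro dfn DA)
  qed
  then obtain F where F: "DT (\<lambda>s. F (s 0))" "\<And>x y. F x = y \<longleftrightarrow> (if x \<in> El om then \<exists>f. A f x \<and> y = ap f x else y = emp)"
    by (elim exE conjE) simp
  have Fap: "F m = ap f m" if h: "A f n" "m \<in> El (sc n)" "m \<in> El om" for f n m
  proof -
    obtain g where "A g m" using ex h(3) by auto
    then show ?thesis using F(2)[of m "ap g m"] h uniq[of g m f n m] by auto
  qed
  show thesis
  proof (rule that[OF F(1)])
    obtain f where "A f emp" using ex[of emp] by auto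
    then show "F emp = a" using Fap[of f emp emp] by (auto simp: A_def)
    fix n assume n: "n \<in> El om"
    obtain f where f: "A f (sc n)" using ex[of "sc n"] n by auto
    then show "F (sc n) = G (F n)" using Fap[OF f, of "sc n"] Fap[OF f, of n] n by (auto simp: A_def)
  qed
qed

subsection \<open>Well-founded induction and recursion\<close>

text \<open>Minimal elements are demanded of sets of the model only, since from outside the relation
  may have infinite descents. Set-likeness extends induction and recursion to definable
  classes.\<close>

definition wfs where
  "wfs R \<longleftrightarrow> DP (\<lambda>s. R (s 0) (s 1)) \<and> (\<forall>x. isS {y. R y x}) \<and> (\<forall>X. El X \<noteq> {} \<longrightarrow> (\<exists>m\<in>El X. \<forall>y\<in>El X. \<not> R y m))"

lemma wfs_DP: "wfs R \<Longrightarrow> DT f \<Longrightarrow> DT g \<Longrightarrow> DP (\<lambda>s. R (f s) (g s))"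
  unfolding wfs_def by (elim conjE, rule DP_app2)

lemma wfs_DT_ext: "wfs R \<Longrightarrow> DT f \<Longrightarrow> DT (\<lambda>s. mk {y. R y (f s)})"
  by (rule DT_app1[of "\<lambda>x. mk {y. R y x}"], intro DT_mk wfs_DP DT_var) (simp_all add: wfs_def)

text \<open>The set of everything below a point, obtained by iterating predecessors along
  \<open>om\<close>. Inductions look for minimal counterexamples inside it.\<close>

lemma wfs_trcl:
  assumes R: "wfs R"
  obtains T where "DT (\<lambda>s. T (s 0))" "\<And>x. x \<in> El (T x)" "\<And>x y z. y \<in> El (T x) \<Longrightarrow> R z y \<Longrightarrow> z \<in> El (T x)"
    "\<And>x t. x \<in> El t \<Longrightarrow> (\<And>y z. y \<in> El t \<Longrightarrow> R z y \<Longrightarrow> z \<in> El t) \<Longrightarrow> El (T x) \<subseteq> El t"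
proof -
  note [dfn] = wfs_DT_ext[OF R] wfs_DP[OF R]
  have Rs: "isS {y. R y x}" for x using R unfolding wfs_def by blast
  define Q where "Q x t \<longleftrightarrow> x \<in> El t \<and> (\<forall>y\<in>El t. \<forall>z. R z y \<longrightarrow> z \<in> El t)" for x t
  have Q[dfn]: "DT f \<Longrightarrow> DT g \<Longrightarrow> DP (\<lambda>s. Q (f s) (g s))" for f g
    by (rule DP_app2, unfold Q_def, intro dfn)
  have ex: "\<exists>t. Q x t" for x
  proof -
    obtain F where F[dfn]: "DT (\<lambda>s. F (s 0))" "F emp = upr x x" "\<And>n. n \<in> El om \<Longrightarrow> F (sc n) = Unn (rep (F n) (\<lambda>y. mk {z. R z y}))"
      by (rule iterate[of "\<lambda>t. Unn (rep t (\<lambda>y. mk {z. R z y}))" "upr x x"]) (intro dfn, auto)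
    have "Q x (Unn (rep om F))" unfolding Q_def
    proof (intro conjI ballI allI impI)
      show "x \<in> El (Unn (rep om F))" using F(2) by (auto simp: El_rep F(1) intro!: bexI[of _ emp])
      fix y z assume "y \<in> El (Unn (rep om F))" "R z y"
      then obtain n where n: "n \<in> El om" "y \<in> El (F n)" by (auto simp: El_rep F(1))
      have "z \<in> El (F (sc n))" using F(3)[OF n(1)] n(2) \<open>R z y\<close>
        by (auto simp: El_rep[of "\<lambda>y. mk {z. R z y}"] dfn Rs)
      then show "z \<in> El (Unn (rep om F))" using n by (auto simp: El_rep F(1) intro!: bexI[of _ "sc n"])
    qed
    then show ?thesis by blast
  qed
  define T where "T x = mk {z. \<forall>t. Q x t \<longrightarrow> z \<in> El t}" for x
  have S: "isS {z. \<forall>t. Q x t \<longrightarrow> z \<in> El t}" for x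
  proof -
    obtain t where "Q x t" using ex by auto
    then show ?thesis by (intro isS_subset[of "El t" "{z. \<forall>t. Q x t \<longrightarrow> z \<in> El t}"]) (auto, intro dfn)
  qed
  show thesis
  proof (rule that[of T])
    show "DT (\<lambda>s. T (s 0))" unfolding T_def by (intro dfn S)
    show "x \<in> El (T x)" for x unfolding T_def by (simp add: S) (simp add: Q_def)
    show "z \<in> El (T x)" if "y \<in> El (T x)" "R z y" for x y z
      using that unfolding T_def by (simp add: S) (auto simp: Q_def)
    show "El (T x) \<subseteq> El t" if "x \<in> El t" "\<And>y z. y \<in> El t \<Longrightarrow> R z y \<Longrightarrow> z \<in> El t" for x t
    proof -
      have "Q x t" using that unfolding Q_def by blast
      then show ?thesis unfolding T_def by (auto simp: S)
    qed
  qed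
qed

lemma wfs_induct:
  assumes R: "wfs R" and P: "DP (\<lambda>s. P (s 0))" and step: "\<And>x. (\<And>y. R y x \<Longrightarrow> P y) \<Longrightarrow> P x"
  shows "P x"
proof (rule ccontr)
  assume "\<not> P x"
  obtain T where dT: "DT (\<lambda>s. T (s 0))" and T: "\<And>x. x \<in> El (T x)" "\<And>x y z. y \<in> El (T x) \<Longrightarrow> R z y \<Longrightarrow> z \<in> El (T x)"
    "\<And>x t. x \<in> El t \<Longrightarrow> (\<And>y z. y \<in> El t \<Longrightarrow> R z y \<Longrightarrow> z \<in> El t) \<Longrightarrow> El (T x) \<subseteq> El t"
    by (fact wfs_trcl[OF R])
  have S: "El (sep (T x) (\<lambda>z. \<not> P z)) = {z \<in> El (T x). \<not> P z}" by (rule El_sep) (intro dfn P)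
  then have "El (sep (T x) (\<lambda>z. \<not> P z)) \<noteq> {}" using T \<open>\<not> P x\<close> by auto
  then obtain m where "m \<in> El (T x)" "\<not> P m" "\<And>y. y \<in> El (T x) \<Longrightarrow> \<not> P y \<Longrightarrow> \<not> R y m"
    using R S unfolding wfs_def by (metis (no_types, lifting) mem_Collect_eq)
  then show False using step[of m] T(2) by blast
qed

lemma lam_cong: "(\<And>x. x \<in> El a \<Longrightarrow> F x = G x) \<Longrightarrow> lam a F = lam a G"
  unfolding lam_def rep_def by (rule arg_cong[of _ _ mk]) auto

lemma wfs_rec:
  assumes R: "wfs R" and G[dfn]: "\<And>f g. DT f \<Longrightarrow> DT g \<Longrightarrow> DT (\<lambda>s. G (f s) (g s))"
  obtains F where "DT (\<lambda>s. F (s 0))" "\<And>x. F x = G x (lam (mk {y. R y x}) F)"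
proof -
  note [dfn] = wfs_DT_ext[OF R] wfs_DP[OF R]
  have Rs[simp]: "isS {y. R y x}" for x using R unfolding wfs_def by blast
  obtain T where T[dfn]: "DT (\<lambda>s. T (s 0))" and T: "\<And>x. x \<in> El (T x)" "\<And>x y z. y \<in> El (T x) \<Longrightarrow> R z y \<Longrightarrow> z \<in> El (T x)"
    "\<And>x t. x \<in> El t \<Longrightarrow> (\<And>y z. y \<in> El t \<Longrightarrow> R z y \<Longrightarrow> z \<in> El t) \<Longrightarrow> El (T x) \<subseteq> El t"
    by (fact wfs_trcl[OF R])
  define A where "A f t \<longleftrightarrow> (\<forall>y\<in>El t. (\<forall>z. R z y \<longrightarrow> z \<in> El t) \<and> ap f y = G y (lam (mk {z. R z y}) (ap f)))" for f t
  have DA[dfn]: "DT f \<Longrightarrow> DT g \<Longrightarrow> DP (\<lambda>s. A (f s) (g s))" for f g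
    by (rule DP_app2, unfold A_def, intro dfn)
  have uniq: "\<forall>f t g u. A f t \<and> A g u \<and> x \<in> El t \<and> x \<in> El u \<longrightarrow> ap f x = ap g x" for x
  proof (rule wfs_induct[OF R, of "\<lambda>x. \<forall>f t g u. A f t \<and> A g u \<and> x \<in> El t \<and> x \<in> El u \<longrightarrow> ap f x = ap g x"])
    show "DP (\<lambda>s. \<forall>f t g u. A f t \<and> A g u \<and> s 0 \<in> El t \<and> s 0 \<in> El u \<longrightarrow> ap f (s 0) = ap g (s 0))" by (intro dfn)
    fix x assume IH: "\<And>y. R y x \<Longrightarrow> \<forall>f t g u. A f t \<and> A g u \<and> y \<in> El t \<and> y \<in> El u \<longrightarrow> ap f y = ap g y"
    show "\<forall>f t g u. A f t \<and> A g u \<and> x \<in> El t \<and> x \<in> El u \<longrightarrow> ap f x = ap g x"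
    proof (intro allI impI, elim conjE)
      fix f t g u assume a: "A f t" "A g u" "x \<in> El t" "x \<in> El u"
      have "lam (mk {z. R z x}) (ap f) = lam (mk {z. R z x}) (ap g)"
        by (rule lam_cong) (use IH a in \<open>simp add: A_def, blast\<close>)
      moreover have "ap f x = G x (lam (mk {z. R z x}) (ap f))" "ap g x = G x (lam (mk {z. R z x}) (ap g))"
        using a unfolding A_def by blast+
      ultimately show "ap f x = ap g x" by simp
    qed
  qed
  have "\<exists>F. DT (\<lambda>s. F (s 0)) \<and> (\<forall>x y. F x = y \<longleftrightarrow> (if \<exists>f t. A f t \<and> x \<in> El t then \<exists>f t. A f t \<and> x \<in> El t \<and> y = ap f x else y = emp))"
  proof (rule choose_fun[of "\<lambda>x y. if \<exists>f t. A f t \<and> x \<in> El t then \<exists>f t. A f t \<and> x \<in> El t \<and> y = ap f x else y = emp"])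
    show "\<exists>!y. if \<exists>f t. A f t \<and> x \<in> El t then \<exists>f t. A f t \<and> x \<in> El t \<and> y = ap f x else y = emp" for x
    proof (cases "\<exists>f t. A f t \<and> x \<in> El t")
      case True
      then obtain f t where "A f t \<and> x \<in> El t" by blast
      then have "\<exists>!y. \<exists>f t. A f t \<and> x \<in> El t \<and> y = ap f x" using uniq by blast
      then show ?thesis using True by simp
    next
      case False then show ?thesis unfolding if_not_P[OF False] by simp
    qed
    show "DP (\<lambda>s. if \<exists>f t. A f t \<and> s 0 \<in> El t then \<exists>f t. A f t \<and> s 0 \<in> El t \<and> s 1 = ap f (s 0) else s 1 = emp)"
      unfolding if_bool_eq_conj by (intro dfn)
  qed
  then obtain F where Fd[dfn]: "DT (\<lambda>s. F (s 0))" and F: "\<And>x y. F x = y \<longleftrightarrow> (if \<exists>f t. A f t \<and> x \<in> El t then \<exists>f t. A f t \<and> x \<in> El t \<and> y = ap f x else y = emp)"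
    by (elim exE conjE) simp
  have Fap: "F x = ap f x" if "A f t" "x \<in> El t" for f t x using F[of x "ap f x"] that by auto
  have FA: "F x = G x (lam (mk {z. R z x}) F)" if "A f t" "x \<in> El t" for f t x
  proof -
    have "lam (mk {z. R z x}) (ap f) = lam (mk {z. R z x}) F"
      by (rule lam_cong) (use Fap[OF that(1)] that in \<open>simp add: A_def\<close>)
    then show ?thesis using Fap[OF that] that unfolding A_def by simp
  qed
  have ex: "\<exists>f t. A f t \<and> x \<in> El t" for x
  proof (rule wfs_induct[OF R, of "\<lambda>x. \<exists>f t. A f t \<and> x \<in> El t"])
    show "DP (\<lambda>s. \<exists>f t. A f t \<and> s 0 \<in> El t)" by (intro dfn)
    fix x assume IH: "\<And>y. R y x \<Longrightarrow> \<exists>f t. A f t \<and> y \<in> El t"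
    show "\<exists>f t. A f t \<and> x \<in> El t"
    proof (rule ccontr)
      assume no: "\<not> (\<exists>f t. A f t \<and> x \<in> El t)"
      \<comment> \<open>If \<open>x\<close> lay in the domain of no approximation, \<open>F\<close>
        would still be correct on everything below \<open>x\<close>, and adding the value at
        \<open>x\<close> would give an approximation after all.\<close>
      define U where "U = Unn (rep (mk {y. R y x}) T)"
      have U: "El U = (\<Union>y\<in>{y. R y x}. El (T y))" unfolding U_def by (simp add: El_rep dfn)
      have U2: "\<exists>f t. A f t \<and> z \<in> El t" if "z \<in> El U" for z
      proof -
        obtain y where y: "R y x" "z \<in> El (T y)" using \<open>z \<in> El U\<close> U by auto
        then obtain f t where "A f t" "y \<in> El t" using IH by blast
        then show ?thesis using T(3)[of y t] y(2) unfolding A_def by blast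
      qed
      have xU: "x \<notin> El U" using no U2 by blast
      define H where "H z = (if z = x then G x (lam (mk {y. R y x}) F) else F z)" for z
      have H[dfn]: "DT (\<lambda>s. H (s 0))" unfolding H_def by (intro dfn)
      define t where "t = un U (upr x x)"
      have apt: "ap (lam t H) z = H z" if "z \<in> El t" for z using that by (simp add: H)
      have HF: "H z = F z" if "z \<in> El U" for z using that xU by (auto simp: H_def)
      have sub: "{y. R y x} \<subseteq> El U" unfolding U using T(1) by blast
      have "A (lam t H) t" unfolding A_def
      proof (intro ballI conjI allI impI)
        fix y assume y: "y \<in> El t"
        have cl: "z \<in> El U" if "R z y" for z
          using y that sub T(2) unfolding t_def by (auto simp: U)
        then show cl2: "R z y \<Longrightarrow> z \<in> El t" for z unfolding t_def by simp
        have "lam (mk {z. R z y}) (ap (lam t H)) = lam (mk {z. R z y}) F"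
          by (rule lam_cong) (simp add: apt[OF cl2] HF[OF cl])
        moreover have "H y = G y (lam (mk {z. R z y}) F)"
        proof (cases "y = x")
          case False
          then have "y \<in> El U" using y unfolding t_def by simp
          then show ?thesis using HF FA U2 by metis
        qed (simp add: H_def)
        ultimately show "ap (lam t H) y = G y (lam (mk {z. R z y}) (ap (lam t H)))" by (simp add: apt y)
      qed
      moreover have "x \<in> El t" unfolding t_def by simp
      ultimately show False using no by blast
    qed
  qed
  show thesis by (rule that[OF Fd]) (use FA ex in metis)
qed

lemma wfs_mem: "wfs (\<lambda>y x. y \<in> El x)" unfolding wfs_def using found by (auto simp: dfn) blast

lemma eps_induct[case_names D step]:
  assumes "DP (\<lambda>s. P (s 0))" "\<And>x. (\<And>y. y \<in> El x \<Longrightarrow> P y) \<Longrightarrow> P x" shows "P x"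
  by (rule wfs_induct[OF wfs_mem]) (use assms in auto)

lemma eps_rec:
  assumes "\<And>f g. DT f \<Longrightarrow> DT g \<Longrightarrow> DT (\<lambda>s. G (f s) (g s))"
  obtains F where "DT (\<lambda>s. F (s 0))" "\<And>x. F x = G x (lam x F)"
  using wfs_rec[OF wfs_mem, of G] assms by auto

end

context zfc
begin

subsection \<open>Ordinals\<close>

lemma DP_Od[dfn]: "DT f \<Longrightarrow> DP (\<lambda>s. Od (f s))" by (rule DP_app1, unfold Ord_def, intro dfn)

lemma Od_trans: "Od a \<Longrightarrow> b \<in> El a \<Longrightarrow> El b \<subseteq> El a" unfolding Ord_def by blast
lemma Od_cmp: "Od a \<Longrightarrow> x \<in> El a \<Longrightarrow> y \<in> El a \<Longrightarrow> x \<in> El y \<or> x = y \<or> y \<in> El x" unfolding Ord_def by blast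

lemma Od_mem: assumes "Od a" "b \<in> El a" shows "Od b"
  unfolding Ord_def
proof (intro conjI ballI subsetI)
  fix y z assume yz: "y \<in> El b" "z \<in> El y"
  then have "y \<in> El a" "z \<in> El a" using Od_trans[OF assms(1)] assms(2) by blast+
  then show "z \<in> El b" using Od_cmp[OF assms(1) \<open>z \<in> El a\<close> assms(2)] yz no2 no3 by metis
next
  fix x y assume "x \<in> El b" "y \<in> El b"
  then show "x \<in> El y \<or> x = y \<or> y \<in> El x" using Od_trans[OF assms] Od_cmp[OF assms(1)] by blast
qed

lemma Od_sub: assumes "Od a" "Od b" "El a \<subseteq> El b" shows "a = b \<or> a \<in> El b"
proof (rule disjCI)
  assume "a \<notin> El b"
  show "a = b"
  proof (rule ccontr)
    assume ne: "a \<noteq> b"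
    have S: "El (sep b (\<lambda>z. z \<notin> El a)) = {z \<in> El b. z \<notin> El a}" by (rule El_sep) (intro dfn)
    have "El b \<noteq> El a" using ne El_ext by metis
    then have "El (sep b (\<lambda>z. z \<notin> El a)) \<noteq> {}" using S assms(3) by auto
    from found[OF this] obtain m where m: "m \<in> El b" "m \<notin> El a" "El m \<inter> {z \<in> El b. z \<notin> El a} = {}" using S by auto
    have "El m = El a"
    proof (intro equalityI subsetI)
      fix z assume "z \<in> El m" then show "z \<in> El a" using m(3) Od_trans[OF assms(2) m(1)] by blast
    next
      fix z assume z: "z \<in> El a"
      then have "z \<in> El m \<or> z = m \<or> m \<in> El z" using Od_cmp[OF assms(2) _ m(1)] assms(3) by blast
      then show "z \<in> El m" using m(2) z Od_trans[OF assms(1) z] by blast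
    qed
    then show False using El_ext m(1) \<open>a \<notin> El b\<close> by metis
  qed
qed

lemma Od_lin: assumes "Od a" "Od b" shows "a \<in> El b \<or> a = b \<or> b \<in> El a"
proof -
  let ?c = "sep a (\<lambda>z. z \<in> El b)"
  have S: "El ?c = {z \<in> El a. z \<in> El b}" by (rule El_sep) (intro dfn)
  have "Od ?c" unfolding Ord_def S using Od_trans[OF assms(1)] Od_trans[OF assms(2)] Od_cmp[OF assms(1)] by blast
  have "?c = a \<or> ?c \<in> El a" "?c = b \<or> ?c \<in> El b" using Od_sub[OF \<open>Od ?c\<close>] assms S by auto
  then show ?thesis using irrefl[of ?c] S by (metis (no_types, lifting) mem_Collect_eq)
qed

lemma Od_emp[simp]: "Od emp" unfolding Ord_def by simp
lemma Od_sc[simp]: "Od a \<Longrightarrow> Od (sc a)" unfolding Ord_def by auto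
lemma Od_Unn: assumes "\<And>x. x \<in> El A \<Longrightarrow> Od x" shows "Od (Unn A)"
  unfolding Ord_def
proof (intro conjI ballI subsetI)
  fix x z assume "x \<in> El (Unn A)" "z \<in> El x" then show "z \<in> El (Unn A)" using Od_trans[OF assms] by auto
next
  fix x y assume "x \<in> El (Unn A)" "y \<in> El (Unn A)"
  then have "Od x" "Od y" using Od_mem assms by auto
  then show "x \<in> El y \<or> x = y \<or> y \<in> El x" by (rule Od_lin)
qed

lemma Od_least:
  assumes "DP (\<lambda>s. P (s 0))" "Od a" "P a" shows "\<exists>b. Od b \<and> P b \<and> (\<forall>c\<in>El b. \<not> P c)"
proof -
  have "Od a \<and> P a \<longrightarrow> (\<exists>b. Od b \<and> P b \<and> (\<forall>c\<in>El b. \<not> P c))"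
  proof (induction a rule: eps_induct)
    case D show ?case
      by (intro dfn assms(1) DP_app1[OF assms(1)])
  next
    case (step x) then show ?case using Od_mem by blast
  qed
  then show ?thesis using assms by blast
qed

lemma Od_induct[consumes 1, case_names D step]:
  assumes "Od a" "DP (\<lambda>s. P (s 0))" "\<And>x. Od x \<Longrightarrow> (\<And>y. y \<in> El x \<Longrightarrow> P y) \<Longrightarrow> P x" shows "P a"
proof -
  have "Od a \<longrightarrow> P a"
    by (induction a rule: eps_induct) (intro dfn assms, use assms(3) Od_mem in blast)
  then show ?thesis using assms by simp
qed

lemma no_Od_set: "\<exists>a. Od a \<and> a \<notin> El X"
proof (rule ccontr)
  assume a: "\<not> (\<exists>a. Od a \<and> a \<notin> El X)"
  have S: "El (sep X Od) = {x \<in> El X. Od x}" by (rule El_sep) (intro dfn)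
  have "Od (Unn (sep X Od))" by (rule Od_Unn) (simp add: S)
  then have "Od (sc (Unn (sep X Od)))" by simp
  then have "sc (Unn (sep X Od)) \<in> El (sep X Od)" using a S by auto
  then have "Unn (sep X Od) \<in> El (Unn (sep X Od))" unfolding El_Unn by (rule UN_I) simp
  then show False by (simp only: irrefl)
qed

lemma Od_bound: "(\<And>x. x \<in> El A \<Longrightarrow> Od x) \<Longrightarrow> \<exists>b. Od b \<and> (\<forall>x\<in>El A. x \<in> El b)"
  by (rule exI[of _ "sc (Unn A)"]) (metis El_Unn El_sc Od_Unn Od_sc Od_sub UN_upper insert_iff)

lemma om_Od[simp]: "n \<in> El om \<Longrightarrow> Od n" by (induction rule: om_induct) (intro dfn, auto)
lemma Od_om[simp]: "Od om" unfolding Ord_def using om_sub Od_lin[OF om_Od om_Od] by blast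

lemma Od_le: "Od a \<Longrightarrow> Od b \<Longrightarrow> \<not> a \<in> El b \<Longrightarrow> El b \<subseteq> El a" using Od_lin Od_trans by blast
lemma Od_sub_mem: "Od a \<Longrightarrow> Od c \<Longrightarrow> El a \<subseteq> El b \<Longrightarrow> b \<in> El c \<Longrightarrow> a \<in> El c"
  using Od_sub[of a b] Od_mem[of c b] Od_trans[of c b] by blast

subsection \<open>The cumulative hierarchy\<close>

text \<open>The recursion runs over all sets and not only over ordinals, so \<open>Vs x\<close> is
  the level at the rank of \<open>x\<close>. This gives most closure facts for arbitrary
  indices.\<close>

definition "Vs_rec F \<longleftrightarrow> DT (\<lambda>s. F (s 0)) \<and> (\<forall>x. F x = Unn (rep x (\<lambda>y. Pw (F y))))"

lemma ex_Vs: "\<exists>F. Vs_rec F"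
proof -
  have G: "DT f \<Longrightarrow> DT g \<Longrightarrow> DT (\<lambda>s. Unn (rep (f s) (\<lambda>y. Pw (ap (g s) y))))" for f g
    by (rule DT_app2[of "\<lambda>x g. Unn (rep x (\<lambda>y. Pw (ap g y)))"], intro dfn)
  obtain F where F: "DT (\<lambda>s. F (s 0))" "\<And>x. F x = Unn (rep x (\<lambda>y. Pw (ap (lam x F) y)))"
    using eps_rec[of "\<lambda>x g. Unn (rep x (\<lambda>y. Pw (ap g y)))", OF G] by blast
  have "rep x (\<lambda>y. Pw (ap (lam x F) y)) = rep x (\<lambda>y. Pw (F y))" for x
    unfolding rep_def by (rule arg_cong[of _ _ mk]) (auto simp: F(1))
  then have "F x = Unn (rep x (\<lambda>y. Pw (F y)))" for x using F(2)[of x] by simp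
  then show ?thesis unfolding Vs_rec_def using F(1) by blast
qed

definition "Vs = (SOME F. Vs_rec F)"

lemma Vs_rec: "Vs_rec Vs" unfolding Vs_def by (rule someI_ex[OF ex_Vs])

lemma DT_Vs[dfn]: "DT f \<Longrightarrow> DT (\<lambda>s. Vs (f s))"
  by (rule DT_app1[of Vs, OF conjunct1[OF Vs_rec[unfolded Vs_rec_def]]])
lemma El_Vs: "El (Vs x) = {z. \<exists>y\<in>El x. El z \<subseteq> El (Vs y)}"
proof -
  have "Vs x = Unn (rep x (\<lambda>y. Pw (Vs y)))" by (rule spec[OF conjunct2[OF Vs_rec[unfolded Vs_rec_def]]])
  then have "El (Vs x) = (\<Union>y\<in>El (rep x (\<lambda>y. Pw (Vs y))). El y)" by (rule trans[OF arg_cong[of _ _ El] El_Unn])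
  then show ?thesis by (subst (asm) El_rep) (auto intro!: dfn)
qed

lemma Vs_sub: "z \<in> El (Vs x) \<Longrightarrow> El w \<subseteq> El z \<Longrightarrow> w \<in> El (Vs x)" unfolding El_Vs[of x] by blast
lemma Vs_trans: "z \<in> El (Vs x) \<Longrightarrow> El z \<subseteq> El (Vs x)"
proof -
  have "\<forall>z\<in>El (Vs x). El z \<subseteq> El (Vs x)"
  proof (induction x rule: eps_induct)
    case D show ?case by (intro dfn)
  next
    case (step x) then show ?case unfolding El_Vs[of x] by blast
  qed
  then show "z \<in> El (Vs x) \<Longrightarrow> El z \<subseteq> El (Vs x)" by blast
qed
lemma sub_Vs: "El x \<subseteq> El (Vs x)"
  by (induction x rule: eps_induct) (intro dfn, subst El_Vs, blast)
lemma Vs_mem: "x \<in> El y \<Longrightarrow> Vs x \<in> El (Vs y)" unfolding El_Vs[of y] by blast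
lemma Vs_mono: "El x \<subseteq> El y \<Longrightarrow> El (Vs x) \<subseteq> El (Vs y)" unfolding El_Vs[of x] El_Vs[of y] by blast
lemma Vs_Od: "Od a \<Longrightarrow> Od b \<Longrightarrow> b \<in> El (Vs a) \<longleftrightarrow> b \<in> El a"
proof -
  assume "Od a"
  then have "\<forall>b. Od b \<and> b \<in> El (Vs a) \<longrightarrow> b \<in> El a"
  proof (induction a rule: Od_induct)
    case D show ?case by (intro dfn)
  next
    case (step a)
    show ?case
    proof (intro allI impI, elim conjE)
      fix b assume b: "Od b" "b \<in> El (Vs a)"
      then obtain c where c: "c \<in> El a" "El b \<subseteq> El (Vs c)" unfolding El_Vs[of a] by blast
      then have "El b \<subseteq> El c" using step(2)[OF c(1)] Od_mem[OF b(1)] by blast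
      then show "b \<in> El a" using Od_sub_mem[OF b(1) step(1) _ c(1)] by blast
    qed
  qed
  then show "Od b \<Longrightarrow> b \<in> El (Vs a) \<longleftrightarrow> b \<in> El a" using sub_Vs[of a] by blast
qed

definition "rk_rec F \<longleftrightarrow> DT (\<lambda>s. F (s 0)) \<and> (\<forall>x. F x = Unn (rep x (\<lambda>y. sc (F y))))"

lemma ex_rk: "\<exists>F. rk_rec F"
proof -
  have G: "DT f \<Longrightarrow> DT g \<Longrightarrow> DT (\<lambda>s. Unn (rep (f s) (\<lambda>y. sc (ap (g s) y))))" for f g
    by (rule DT_app2[of "\<lambda>x g. Unn (rep x (\<lambda>y. sc (ap g y)))"], intro dfn)
  obtain F where F: "DT (\<lambda>s. F (s 0))" "\<And>x. F x = Unn (rep x (\<lambda>y. sc (ap (lam x F) y)))"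
    using eps_rec[of "\<lambda>x g. Unn (rep x (\<lambda>y. sc (ap g y)))", OF G] by blast
  have "rep x (\<lambda>y. sc (ap (lam x F) y)) = rep x (\<lambda>y. sc (F y))" for x
    unfolding rep_def by (rule arg_cong[of _ _ mk]) (auto simp: F(1))
  then have "F x = Unn (rep x (\<lambda>y. sc (F y)))" for x using F(2)[of x] by simp
  then show ?thesis unfolding rk_rec_def using F(1) by blast
qed

definition "rk = (SOME F. rk_rec F)"

lemma rk_rec: "rk_rec rk" unfolding rk_def by (rule someI_ex[OF ex_rk])

lemma DT_rk[dfn]: "DT f \<Longrightarrow> DT (\<lambda>s. rk (f s))"
  by (rule DT_app1[of rk, OF conjunct1[OF rk_rec[unfolded rk_rec_def]]])
lemma El_rk: "El (rk x) = (\<Union>y\<in>El x. insert (rk y) (El (rk y)))"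
proof -
  have "rk x = Unn (rep x (\<lambda>y. sc (rk y)))" by (rule spec[OF conjunct2[OF rk_rec[unfolded rk_rec_def]]])
  then have "El (rk x) = (\<Union>y\<in>El (rep x (\<lambda>y. sc (rk y))). El y)" by (rule trans[OF arg_cong[of _ _ El] El_Unn])
  then show ?thesis by (subst (asm) El_rep) (auto intro!: dfn)
qed

lemma Od_rk[simp]: "Od (rk x)"
proof (induction x rule: eps_induct)
  case D show ?case by (intro dfn)
next
  case (step x)
  have "rk x = Unn (rep x (\<lambda>y. sc (rk y)))" by (rule spec[OF conjunct2[OF rk_rec[unfolded rk_rec_def]]])
  moreover have "Od z" if "z \<in> El (rep x (\<lambda>y. sc (rk y)))" for z
  proof -
    have "El (rep x (\<lambda>y. sc (rk y))) = (\<lambda>y. sc (rk y)) ` El x" by (rule El_rep) (intro dfn)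
    then show ?thesis using that step by auto
  qed
  ultimately show ?case using Od_Unn[of "rep x (\<lambda>y. sc (rk y))"] by simp
qed

lemma Vs_rk: "Vs (rk x) = Vs x"
proof (induction x rule: eps_induct)
  case D show ?case by (intro dfn)
next
  case (step x)
  show ?case
  proof (rule El_ext, intro equalityI subsetI)
    fix z assume "z \<in> El (Vs (rk x))"
    then obtain u y where "y \<in> El x" "u = rk y \<or> u \<in> El (rk y)" "El z \<subseteq> El (Vs u)" unfolding El_Vs[of "rk x"] El_rk[of x] by blast
    then have "El z \<subseteq> El (Vs y)" using step[of y] Vs_mono[OF Od_trans[OF Od_rk], of u y] by auto
    then show "z \<in> El (Vs x)" unfolding El_Vs[of x] using \<open>y \<in> El x\<close> by blast
  next
    fix z assume "z \<in> El (Vs x)"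
    then obtain y where "y \<in> El x" "El z \<subseteq> El (Vs y)" unfolding El_Vs[of x] by blast
    then show "z \<in> El (Vs (rk x))" unfolding El_Vs[of "rk x"] El_rk[of x] using step[of y] by (intro CollectI bexI[of _ "rk y"]) auto
  qed
qed

lemma rk_mem: "x \<in> El y \<Longrightarrow> rk x \<in> El (rk y)" unfolding El_rk[of y] by blast

lemma Vs_rk_iff: assumes "Od a" shows "x \<in> El (Vs a) \<longleftrightarrow> rk x \<in> El a"
proof
  assume "x \<in> El (Vs a)"
  then obtain b where b: "b \<in> El a" "El x \<subseteq> El (Vs b)" unfolding El_Vs[of a] by blast
  have "\<forall>x. El x \<subseteq> El (Vs b) \<longrightarrow> El (rk x) \<subseteq> El b" if "Od b" for b
    using that
  proof (induction b rule: Od_induct)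
    case D show ?case by (intro dfn)
  next
    case (step b)
    show ?case
    proof (intro allI impI subsetI)
      fix x z assume x: "El x \<subseteq> El (Vs b)" "z \<in> El (rk x)"
      then obtain y where y: "y \<in> El x" "z = rk y \<or> z \<in> El (rk y)" unfolding El_rk[of x] by blast
      then obtain c where c: "c \<in> El b" "El y \<subseteq> El (Vs c)" using x(1) unfolding El_Vs[of b] by blast
      then have "El (rk y) \<subseteq> El c" using step(2) by blast
      then have "rk y \<in> El b" using Od_sub_mem[OF Od_rk step(1) _ c(1)] by blast
      then show "z \<in> El b" using y(2) Od_trans[OF step(1)] by blast
    qed
  qed
  then have "El (rk x) \<subseteq> El b" using b(2) Od_mem[OF assms b(1)] by blast
  then show "rk x \<in> El a" using Od_sub_mem[OF Od_rk assms _ b(1)] by blast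
next
  assume "rk x \<in> El a"
  then show "x \<in> El (Vs a)" unfolding El_Vs[of a] mem_Collect_eq
    by (intro bexI[of _ "rk x"]) (simp_all add: Vs_rk sub_Vs)
qed

lemma rk_Od: "Od a \<Longrightarrow> rk a = a"
proof (induction a rule: Od_induct)
  case D show ?case by (intro dfn)
next
  case (step a)
  have "El (rk a) = (\<Union>y\<in>El a. insert y (El y))" unfolding El_rk[of a] using step(2) by auto
  also have "\<dots> = El a" using Od_trans[OF step(1)] by blast
  finally show ?case by (rule El_ext)
qed

lemma ex_Vs_mem: "\<exists>a. Od a \<and> x \<in> El (Vs a)"
  by (rule exI[of _ "sc (rk x)"]) (simp add: Vs_rk_iff)

lemma Vset_Vs: assumes "Od a" shows "Vset E a = Vs a"
  unfolding Vset_def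
proof (rule the_equality)
  have "hierarchy_upto E a (lam (sc a) Vs)" unfolding hierarchy_upto_def
  proof (intro conjI ballI)
    show f: "fn (lam (sc a) Vs) (sc a)" by (intro fn_lam dfn)
    fix b assume b: "b \<in> El (sc a)"
    have 1: "app E (lam (sc a) Vs) c = Vs c" if "c \<in> El (sc a)" for c
      using app_ap[OF f that] that by (simp add: ap_lam dfn)
    have "El b \<subseteq> El (sc a)" using Od_trans[OF Od_sc[OF assms] b] .
    then have c: "app E (lam (sc a) Vs) c = Vs c" if "c \<in> El b" for c using 1 that by blast
    have "El (app E (lam (sc a) Vs) b) = (\<Union>c\<in>El b. {x. El x \<subseteq> El (Vs c)})"
      unfolding 1[OF b] El_Vs[of b] by auto
    also have "\<dots> = (\<Union>c\<in>El b. {x. El x \<subseteq> El (app E (lam (sc a) Vs) c)})"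
      by (rule SUP_cong) (simp_all add: c)
    finally show "El (app E (lam (sc a) Vs) b) = (\<Union>c\<in>El b. {x. El x \<subseteq> El (app E (lam (sc a) Vs) c)})" .
  qed
  moreover have "app E (lam (sc a) Vs) a = Vs a"
    using app_ap[OF fn_lam, of "\<lambda>x. Vs x" a "sc a"] by (simp add: ap_lam dfn)
  ultimately show "\<exists>f. hierarchy_upto E a f \<and> Vs a = app E f a" by auto
next
  fix v assume "\<exists>f. hierarchy_upto E a f \<and> v = app E f a"
  then obtain f where f: "fn f (sc a)" "v = app E f a"
    and h: "\<And>b. b \<in> El (sc a) \<Longrightarrow> El (app E f b) = (\<Union>c\<in>El b. {x. El x \<subseteq> El (app E f c)})"
    unfolding hierarchy_upto_def by blast
  have "b \<in> El (sc a) \<longrightarrow> ap f b = Vs b" if "Od b" for b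
    using that
  proof (induction b rule: Od_induct)
    case D show ?case by (intro dfn)
  next
    case (step b)
    show ?case
    proof
      assume b: "b \<in> El (sc a)"
      have c: "c \<in> El (sc a)" if "c \<in> El b" for c using Od_trans[OF Od_sc[OF assms] b] that by blast
      have "El (ap f b) = (\<Union>c\<in>El b. {x. El x \<subseteq> El (ap f c)})"
        using h[OF b] app_ap[OF f(1) b] app_ap[OF f(1) c] by simp
      also have "\<dots> = (\<Union>d\<in>El b. {x. El x \<subseteq> El (Vs d)})" proof (rule SUP_cong)
        fix d assume "d \<in> El b" then show "{x. El x \<subseteq> El (ap f d)} = {x. El x \<subseteq> El (Vs d)}" using step(2)[of d] c[of d] by fastforce
      qed simp
      also have "\<dots> = El (Vs b)" unfolding El_Vs[of b] by auto
      finally show "ap f b = Vs b" by (rule El_ext)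
    qed
  qed
  then show "v = Vs a" using f app_ap[OF f(1), of a] assms by simp
qed

subsection \<open>Collection, choice and well-orderings\<close>

text \<open>Collection by Scott's trick: each \<open>x\<close> is sent to the least level that
  contains a witness, and Replacement collects these levels.\<close>

lemma collect:
  assumes R: "DP (\<lambda>s. R (s 0) (s 1))" shows "\<exists>B. \<forall>x\<in>El a. (\<exists>y. R x y) \<longrightarrow> (\<exists>y\<in>El B. R x y)"
proof -
  note [dfn] = DP_app2[OF R]
  define Q where "Q x b \<longleftrightarrow> Od b \<and> (\<exists>y\<in>El (Vs b). R x y)" for x b
  have Q[dfn]: "DT f \<Longrightarrow> DT g \<Longrightarrow> DP (\<lambda>s. Q (f s) (g s))" for f g
    by (rule DP_app2, unfold Q_def, intro dfn)
  define L where "L x b \<longleftrightarrow> (Q x b \<and> (\<forall>c\<in>El b. \<not> Q x c)) \<or> (\<not> (\<exists>y. R x y) \<and> b = emp)" for x b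
  have L1: "\<exists>!b. L x b" for x
  proof (cases "\<exists>y. R x y")
    case True
    then obtain y where "R x y" by blast
    moreover obtain b where "Od b" "y \<in> El (Vs b)" using ex_Vs_mem by blast
    ultimately have "Q x b" unfolding Q_def by blast
    have "DP (\<lambda>s. Q x (s 0))" by (intro dfn)
    from Od_least[OF this \<open>Od b\<close> \<open>Q x b\<close>] obtain b where b: "Q x b" "\<forall>c\<in>El b. \<not> Q x c" by blast
    show ?thesis
    proof (rule ex1I[of _ b])
      show "L x b" using b unfolding L_def by blast
      fix c assume "L x c" then have "Q x c" "\<forall>d\<in>El c. \<not> Q x d" using True unfolding L_def by blast+
      then show "c = b" using b Od_lin[of c b] unfolding Q_def by blast
    qed
  qed (auto simp: L_def Q_def)
  have "DP (\<lambda>s. L (s 0) (s 1))" unfolding L_def by (intro dfn)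
  from choose_fun[OF L1 this] obtain F where F: "DT (\<lambda>s. F (s 0))" "\<And>x. L x (F x)" by metis
  note [dfn] = DT_app1[OF F(1)]
  have "\<exists>y\<in>El (Unn (rep a (\<lambda>x. Vs (F x)))). R x y" if "x \<in> El a" "\<exists>y. R x y" for x
  proof -
    have "Q x (F x)" using F(2)[of x] that(2) unfolding L_def by blast
    then obtain y where "y \<in> El (Vs (F x))" "R x y" unfolding Q_def by blast
    moreover have "El (rep a (\<lambda>x. Vs (F x))) = (\<lambda>x. Vs (F x)) ` El a" by (rule El_rep) (intro dfn)
    ultimately show ?thesis using that(1) by auto
  qed
  then show ?thesis by blast
qed

text \<open>The axiom provides choice sets for disjoint families only. Tagging every candidate with
  its index \<open>x\<close> makes the family disjoint and turns the choice set into a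
  function.\<close>

lemma AC_rel:
  assumes R: "DP (\<lambda>s. R (s 0) (s 1))" and ex: "\<And>x. x \<in> El a \<Longrightarrow> \<exists>y. R x y"
  shows "\<exists>f. fn f a \<and> (\<forall>x\<in>El a. R x (ap f x))"
proof -
  note [dfn] = DP_app2[OF R]
  obtain B where B: "\<And>x. x \<in> El a \<Longrightarrow> \<exists>y\<in>El B. R x y" using collect[OF R, of a] ex by blast
  define fam where "fam x = rep (sep B (R x)) (\<lambda>y. pr x y)" for x
  have S: "El (sep B (R x)) = {y \<in> El B. R x y}" for x by (rule El_sep) (intro dfn)
  have F: "El (fam x) = {pr x y |y. y \<in> El B \<and> R x y}" for x
    unfolding fam_def by (subst El_rep) (auto simp: S intro!: dfn)
  have [dfn]: "DT (\<lambda>s. fam (s 0))" unfolding fam_def by (intro dfn)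
  define X where "X = rep a fam"
  have X: "El X = fam ` El a" unfolding X_def by (rule El_rep) (intro dfn)
  have "\<exists>c. \<forall>y\<in>El X. \<exists>!z. z \<in> El c \<and> z \<in> El y"
  proof (rule AC00[rule_format], intro conjI ballI impI)
    fix y assume "y \<in> El X" then obtain x where "x \<in> El a" "y = fam x" unfolding X by auto
    then show "El y \<noteq> {}" using B[of x] by (auto simp: F)
  next
    fix y z assume "y \<in> El X" "z \<in> El X" "y \<noteq> z" then show "El y \<inter> El z = {}" unfolding X by (auto simp: F)
  qed
  then obtain c where c: "\<And>x. x \<in> El a \<Longrightarrow> \<exists>!z. z \<in> El c \<and> z \<in> El (fam x)" unfolding X by blast
  define f where "f = sep c (\<lambda>z. \<exists>x\<in>El a. z \<in> El (fam x))"
  have f: "El f = {z \<in> El c. \<exists>x\<in>El a. z \<in> El (fam x)}" unfolding f_def by (rule El_sep) (intro dfn DT_app1[of fam])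
  have f2: "pr x y \<in> El f \<longleftrightarrow> x \<in> El a \<and> pr x y \<in> El c \<and> y \<in> El B \<and> R x y" for x y unfolding f by (auto simp: F)
  have ex1: "\<exists>!y. pr x y \<in> El f" if h: "x \<in> El a" for x
  proof -
    obtain z where z: "z \<in> El c" "z \<in> El (fam x)" "\<And>z'. z' \<in> El c \<Longrightarrow> z' \<in> El (fam x) \<Longrightarrow> z' = z" using c[OF h] by blast
    then obtain y where y: "z = pr x y" "y \<in> El B" "R x y" unfolding F by blast
    show ?thesis
    proof (rule ex1I[of _ y])
      show "pr x y \<in> El f" using f2 h z(1) y by blast
      fix y' assume "pr x y' \<in> El f"
      then have "pr x y' \<in> El c" "y' \<in> El B" "R x y'" using f2 by blast+
      then have "pr x y' = z" by (intro z(3)) (auto simp: F)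
      then show "y' = y" using y by simp
    qed
  qed
  have fn: "fn f a" unfolding fun_on_def
  proof (intro conjI ballI)
    fix z assume "z \<in> El f" then show "\<exists>x\<in>El a. \<exists>y. z = pr x y" unfolding f by (auto simp: F)
  qed (rule ex1)
  moreover have "R x (ap f x)" if "x \<in> El a" for x
    using fn_pr[OF fn, of x "ap f x"] that f2[of x "ap f x"] by blast
  ultimately show ?thesis by blast
qed

lemma well_order: "\<exists>\<mu> f. Od \<mu> \<and> fn f \<mu> \<and> inj_on (ap f) (El \<mu>) \<and> ap f ` El \<mu> = El a"
proof -
  have "\<exists>c. fn c (Pw a) \<and> (\<forall>y\<in>El (Pw a). y \<noteq> emp \<longrightarrow> ap c y \<in> El y)"
    using AC_rel[of "\<lambda>y z. y \<noteq> emp \<longrightarrow> z \<in> El y" "Pw a"] by (auto simp: dfn) (metis emp_eq equals0I)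
  then obtain c where c: "\<And>y. El y \<subseteq> El a \<Longrightarrow> y \<noteq> emp \<Longrightarrow> ap c y \<in> El y" by auto
  \<comment> \<open>Zermelo's recursion picks a new element of \<open>a\<close> at each stage; the
    value \<open>a\<close> is a mere default once nothing is left.\<close>
  define G where "G x g = (if sep a (\<lambda>z. \<forall>y\<in>El x. z \<noteq> ap g y) = emp then a else ap c (sep a (\<lambda>z. \<forall>y\<in>El x. z \<noteq> ap g y)))" for x g
  have dG: "DT f \<Longrightarrow> DT g \<Longrightarrow> DT (\<lambda>s. G (f s) (g s))" for f g by (rule DT_app2, unfold G_def, intro dfn)
  obtain F where F[dfn]: "DT (\<lambda>s. F (s 0))" and F2: "\<And>x. F x = G x (lam x F)"
    using eps_rec[of G, OF dG] by blast
  define D where "D x = sep a (\<lambda>z. \<forall>y\<in>El x. z \<noteq> F y)" for x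
  have D: "El (D x) = {z \<in> El a. \<forall>y\<in>El x. z \<noteq> F y}" for x unfolding D_def by (rule El_sep) (intro dfn DT_app1[OF F])
  have D2: "sep a (\<lambda>z. \<forall>y\<in>El x. z \<noteq> ap (lam x F) y) = D x" for x
    unfolding D_def sep_def by (rule arg_cong[of _ _ mk]) (auto simp: F)
  have F3: "F x \<in> El (D x)" if "D x \<noteq> emp" for x
    using F2[of x] that c[of "D x"] unfolding G_def D2 by (auto simp: D)
  have [dfn]: "DT f \<Longrightarrow> DT (\<lambda>s. D (f s))" for f by (rule DT_app1, unfold D_def, intro dfn DT_app1[OF F])
  have inj: "F b \<noteq> F e" if "b \<in> El e" "D e \<noteq> emp" for b e using F3[OF that(2)] that(1) unfolding D by auto
  \<comment> \<open>If the recursion never ended, it would embed all ordinals into \<open>a\<close>,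
    and collecting preimages would give a set containing all ordinals.\<close>
  have "\<exists>e. Od e \<and> D e = emp"
  proof (rule ccontr)
    assume "\<not> (\<exists>e. Od e \<and> D e = emp)"
    then have n: "\<And>e. Od e \<Longrightarrow> D e \<noteq> emp" by blast
    obtain B where B: "\<And>z. z \<in> El a \<Longrightarrow> \<exists>b. Od b \<and> F b = z \<Longrightarrow> \<exists>b\<in>El B. Od b \<and> F b = z"
      using collect[of "\<lambda>z b. Od b \<and> F b = z" a] by (auto simp: dfn DT_app1[OF F])
    have "b \<in> El B" if "Od b" for b
    proof -
      obtain e where e: "e \<in> El B" "Od e" "F e = F b" using B[of "F b"] F3[OF n[OF \<open>Od b\<close>]] \<open>Od b\<close> unfolding D by blast
      then have "e = b" using Od_lin[OF e(2) \<open>Od b\<close>] inj[OF _ n] \<open>Od b\<close> by metis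
      then show ?thesis using e by simp
    qed
    then show False using no_Od_set[of B] by blast
  qed
  then obtain e0 where "Od e0" "D e0 = emp" by blast
  have "DP (\<lambda>s. D (s 0) = emp)" by (intro dfn)
  from Od_least[of "\<lambda>e. D e = emp", OF this \<open>Od e0\<close> \<open>D e0 = emp\<close>]
  obtain e where e: "Od e" "D e = emp" "\<And>b. b \<in> El e \<Longrightarrow> D b \<noteq> emp" by blast
  have "inj_on F (El e)"
  proof (rule inj_onI)
    fix x y assume xy: "x \<in> El e" "y \<in> El e" "F x = F y"
    then show "x = y" using Od_cmp[OF e(1) xy(1,2)] inj e(3) by metis
  qed
  moreover have "F ` El e = El a"
  proof (intro equalityI subsetI)
    fix z assume "z \<in> F ` El e" then show "z \<in> El a" using F3 e(3) D by blast
  next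
    fix z assume "z \<in> El a" 
    moreover have "El (D e) = {}" using e(2) by simp
    ultimately show "z \<in> F ` El e" unfolding D by blast
  qed
  ultimately show ?thesis using e(1)
    by (intro exI[of _ e] exI[of _ "lam e F"]) (auto simp: fn_lam F inj_on_def image_def)
qed

end

named_theorems dz

context mem
begin
declare d0[dz]
end

context zfc
begin

subsection \<open>Absolute notions\<close>

lemma D0_upr: "TD f \<Longrightarrow> TD g \<Longrightarrow> TD h \<Longrightarrow> D0 (\<lambda>s. f s = upr (g s) (h s))"
proof (rule D0_app3[of "\<lambda>z x y. z = upr x y"])
  have "z = upr x y \<longleftrightarrow> x \<in> El z \<and> y \<in> El z \<and> (\<forall>a\<in>El z. a = x \<or> a = y)" for z x y
    using El_upr[of x y] El_ext[of z "upr x y"] by auto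
  then show "D0 (\<lambda>s. s 0 = upr (s 1) (s 2))" by (simp only:) (intro dz)
qed
lemmas [dz] = D0_upr

lemma D0_pr: "TD f \<Longrightarrow> TD g \<Longrightarrow> TD h \<Longrightarrow> D0 (\<lambda>s. f s = pr (g s) (h s))"
proof (rule D0_app3[of "\<lambda>z x y. z = pr x y"])
  have "z = pr x y \<longleftrightarrow> (\<exists>a\<in>El z. a = upr x x) \<and> (\<exists>a\<in>El z. a = upr x y) \<and> (\<forall>a\<in>El z. a = upr x x \<or> a = upr x y)" for z x y
    using El_pr[of x y] El_ext[of z "pr x y"] by auto
  then show "D0 (\<lambda>s. s 0 = pr (s 1) (s 2))" by (simp only:) (intro dz)
qed
lemmas [dz] = D0_pr

lemma D0_pr_mem[dz]: "TD f \<Longrightarrow> TD g \<Longrightarrow> TD h \<Longrightarrow> D0 (\<lambda>s. pr (f s) (g s) \<in> El (h s))"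
proof (rule D0_app3[of "\<lambda>x y z. pr x y \<in> El z"])
  have "pr x y \<in> El z \<longleftrightarrow> (\<exists>a\<in>El z. a = pr x y)" for z x y by auto
  then show "D0 (\<lambda>s. pr (s 0) (s 1) \<in> El (s 2))" by (simp only:) (intro dz)
qed

definition "ispr z \<longleftrightarrow> (\<exists>x y. z = pr x y)"
lemma ispr_pr[simp]: "ispr (pr x y)" unfolding ispr_def by auto
lemma ispr_D: "ispr z \<Longrightarrow> z = pr (p1 z) (p2 z)" unfolding ispr_def by auto
lemma p1_not: "\<not> ispr z \<Longrightarrow> p1 z = z" "\<not> ispr z \<Longrightarrow> p2 z = z" unfolding ispr_def p1_def p2_def by auto
lemma DP_ispr[dfn]: "DT f \<Longrightarrow> DP (\<lambda>s. ispr (f s))" by (rule DP_app1, unfold ispr_def, intro dfn)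

text \<open>The components of a pair lie in members of the pair, so a search for them is bounded.
  This is what makes the projections admissible terms of the \<open>D0\<close> calculus.\<close>

lemma ispr_bex: "(ispr z \<and> Q (p1 z) (p2 z)) = (\<exists>a\<in>El z. \<exists>x\<in>El a. \<exists>b\<in>El z. \<exists>y\<in>El b. z = pr x y \<and> Q x y)"
proof
  assume a: "ispr z \<and> Q (p1 z) (p2 z)"
  then have z: "El z = {upr (p1 z) (p1 z), upr (p1 z) (p2 z)}" using ispr_D[of z] El_pr[of "p1 z" "p2 z"] by simp
  show "\<exists>a\<in>El z. \<exists>x\<in>El a. \<exists>b\<in>El z. \<exists>y\<in>El b. z = pr x y \<and> Q x y"
    by (rule bexI[of _ "upr (p1 z) (p1 z)"], rule bexI[of _ "p1 z"], rule bexI[of _ "upr (p1 z) (p2 z)"], rule bexI[of _ "p2 z"])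
      (use a ispr_D[of z] z in auto)
qed auto

lemma D0_ispr[dz]: "TD f \<Longrightarrow> D0 (\<lambda>s. ispr (f s))"
  by (rule D0_app1[of ispr], unfold ispr_bex[of _ "\<lambda>x y. True", simplified], intro dz)

lemma TD_p1[dz]: assumes "TD f" shows "TD (\<lambda>s. p1 (f s))"
  unfolding TD_def
proof (intro allI impI)
  fix Q :: "(nat \<Rightarrow> 'a) \<Rightarrow> 'a \<Rightarrow> bool" and g :: "nat \<Rightarrow> nat"
  assume Q: "D0 (\<lambda>s. Q (\<lambda>n. s (Suc n)) (s 0))"
  have "Q s (p1 z) = ((\<exists>a\<in>El z. \<exists>x\<in>El a. \<exists>b\<in>El z. \<exists>y\<in>El b. z = pr x y \<and> Q s x) \<or> \<not> ispr z \<and> Q s z)" for s z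
    using ispr_bex[of z "\<lambda>x y. Q s x"] p1_not[of z] by metis
  moreover have "D0 (\<lambda>s. (\<exists>a\<in>El (s 0). \<exists>x\<in>El a. \<exists>b\<in>El (s 0). \<exists>y\<in>El b. s 0 = pr x y \<and> Q (\<lambda>n. s (Suc n)) x) \<or> \<not> ispr (s 0) \<and> Q (\<lambda>n. s (Suc n)) (s 0))"
    by (intro dz) (use D0_sub[OF Q, of "\<lambda>n. if n = 0 then 2 else n + 4"] Q in \<open>simp_all add: eval_nat_numeral\<close>)
  ultimately have "D0 (\<lambda>s. Q (\<lambda>n. s (Suc n)) (p1 (s 0)))" by simp
  from TD_D[OF TD_shift[OF assms, of g] this] show "D0 (\<lambda>s. Q s (p1 (f (\<lambda>n. s (g n)))))" .
qed

lemma TD_p2[dz]: assumes "TD f" shows "TD (\<lambda>s. p2 (f s))"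
  unfolding TD_def
proof (intro allI impI)
  fix Q :: "(nat \<Rightarrow> 'a) \<Rightarrow> 'a \<Rightarrow> bool" and g :: "nat \<Rightarrow> nat"
  assume Q: "D0 (\<lambda>s. Q (\<lambda>n. s (Suc n)) (s 0))"
  have "Q s (p2 z) = ((\<exists>a\<in>El z. \<exists>x\<in>El a. \<exists>b\<in>El z. \<exists>y\<in>El b. z = pr x y \<and> Q s y) \<or> \<not> ispr z \<and> Q s z)" for s z
    using ispr_bex[of z "\<lambda>x y. Q s y"] p1_not[of z] by metis
  moreover have "D0 (\<lambda>s. (\<exists>a\<in>El (s 0). \<exists>x\<in>El a. \<exists>b\<in>El (s 0). \<exists>y\<in>El b. s 0 = pr x y \<and> Q (\<lambda>n. s (Suc n)) y) \<or> \<not> ispr (s 0) \<and> Q (\<lambda>n. s (Suc n)) (s 0))"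
    by (intro dz) (use D0_sub[OF Q, of "\<lambda>n. if n = 0 then 0 else n + 4"] Q in \<open>simp_all add: eval_nat_numeral\<close>)
  ultimately have "D0 (\<lambda>s. Q (\<lambda>n. s (Suc n)) (p2 (s 0)))" by simp
  from TD_D[OF TD_shift[OF assms, of g] this] show "D0 (\<lambda>s. Q s (p2 (f (\<lambda>n. s (g n)))))" .
qed

lemma D0_emp[dz]: "TD f \<Longrightarrow> D0 (\<lambda>s. f s = emp)"
proof (rule D0_app1[of "\<lambda>x. x = emp"])
  have "x = emp \<longleftrightarrow> (\<forall>y\<in>El x. False)" for x using emp_eq[of x] by auto
  then show "D0 (\<lambda>s. s 0 = emp)" by (simp only:) (intro dz)
qed

lemma D0_sc[dz]: "TD f \<Longrightarrow> TD g \<Longrightarrow> D0 (\<lambda>s. f s = sc (g s))"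
proof (rule D0_app2[of "\<lambda>x y. x = sc y"])
  have "x = sc y \<longleftrightarrow> y \<in> El x \<and> El y \<subseteq> El x \<and> (\<forall>z\<in>El x. z \<in> El y \<or> z = y)" for x y
    using El_sc[of y] El_ext[of x "sc y"] by auto
  then show "D0 (\<lambda>s. s 0 = sc (s 1))" by (simp only:) (intro dz)
qed

lemma D0_Od[dz]: "TD f \<Longrightarrow> D0 (\<lambda>s. Od (f s))"
  by (rule D0_app1[of Od], unfold Ord_def, intro dz)

text \<open>Here every quantifier ranges over \<open>f\<close> or \<open>a\<close>, whereas the
  defining form quantifies over arbitrary second components and is not visibly bounded.\<close>

lemma fn_alt: "fn f a \<longleftrightarrow> (\<forall>z\<in>El f. ispr z \<and> p1 z \<in> El a) \<and> (\<forall>x\<in>El a. \<exists>z\<in>El f. p1 z = x) \<and> (\<forall>z\<in>El f. \<forall>w\<in>El f. p1 z = p1 w \<longrightarrow> z = w)"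
proof
  assume "fn f a" then show "(\<forall>z\<in>El f. ispr z \<and> p1 z \<in> El a) \<and> (\<forall>x\<in>El a. \<exists>z\<in>El f. p1 z = x) \<and> (\<forall>z\<in>El f. \<forall>w\<in>El f. p1 z = p1 w \<longrightarrow> z = w)"
    using fn_El[of f a] by auto
next
  assume a: "(\<forall>z\<in>El f. ispr z \<and> p1 z \<in> El a) \<and> (\<forall>x\<in>El a. \<exists>z\<in>El f. p1 z = x) \<and> (\<forall>z\<in>El f. \<forall>w\<in>El f. p1 z = p1 w \<longrightarrow> z = w)"
  show "fn f a" unfolding fun_on_def
  proof (intro conjI ballI)
    fix z assume "z \<in> El f" then show "\<exists>x\<in>El a. \<exists>y. z = pr x y" using a ispr_D[of z] by blast
  next
    fix x assume "x \<in> El a"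
    then obtain z where "z \<in> El f" "p1 z = x" using a by blast
    then have "pr x (p2 z) \<in> El f" using a ispr_D[of z] by metis
    then show "\<exists>!y. pr x y \<in> El f" using a by (metis p1 p2)
  qed
qed

lemma D0_fn[dz]: "TD f \<Longrightarrow> TD g \<Longrightarrow> D0 (\<lambda>s. fn (f s) (g s))"
  by (rule D0_app2[of fn], unfold fn_alt, intro dz)

lemma om_notsc: "om \<noteq> sc y" using om_sc[of y] El_sc[of y] irrefl[of "sc y"] by (metis insertI1)

end

subsection \<open>Elementary embeddings\<close>

locale emb = zfc E for E :: "'a \<Rightarrow> 'a \<Rightarrow> bool" +
  fixes j :: "'a \<Rightarrow> 'a" and M :: "'a set"
  assumes ee: "elementary_embedding E j M"
begin

lemma DP_M: "DP (\<lambda>s. s 0 \<in> M)" using ee unfolding elementary_embedding_def definable_DP by blast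
lemma M_trans: "x \<in> M \<Longrightarrow> El x \<subseteq> M" using ee unfolding elementary_embedding_def by blast
lemma jM[simp]: "j x \<in> M" using ee unfolding elementary_embedding_def by blast
lemma elem: "sat E UNIV s \<phi> = sat E M (j \<circ> s) \<phi>" using ee unfolding elementary_embedding_def by blast

lemma DT_j[dfn]: "DT f \<Longrightarrow> DT (\<lambda>s. j (f s))"
proof (rule DT_app1[of j])
  have "DP (\<lambda>s. s 0 \<in> {pr x (j x) | x. True})" using ee unfolding elementary_embedding_def definable_DP by blast
  from DP_app1[OF this, of "\<lambda>s. pr (s 1) (s 0)"] have "DP (\<lambda>s. j (s 1) = s 0)" by (simp add: dfn eq_commute)
  then show "DT (\<lambda>s. j (s 0))" by (simp add: DT_def)
qed

text \<open>Bounded statements mean the same in the transitive class \<open>M\<close> and in the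
  universe, so elementarity can be used without relativising anything. Notions are brought into
  \<open>D0\<close> form for this purpose.\<close>

lemma j0: assumes "D0 P" shows "P (\<lambda>n. j (s n)) = P s"
proof -
  obtain \<phi> where \<phi>: "\<phi> \<in> Delta0_fm" "\<And>s. sat E UNIV s \<phi> = P s" using assms unfolding FD_def by blast
  have "P s = sat E M (j \<circ> s) \<phi>" using elem \<phi> by blast
  also have "\<dots> = sat E UNIV (j \<circ> s) \<phi>"
    by (rule Delta0_absolute[OF \<phi>(1)]) (use M_trans in \<open>auto simp: elts_def\<close>)
  finally show ?thesis using \<phi> by (simp add: comp_def)
qed

lemma j0_1: assumes "D0 (\<lambda>s. P (s 0))" shows "P (j x) = P x"
  using j0[OF assms, of "\<lambda>_. x"] .
lemma j0_2: assumes "D0 (\<lambda>s. P (s 0) (s 1))" shows "P (j x) (j y) = P x y"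
  using j0[OF assms, of "\<lambda>n. if n = 0 then x else y"] by simp
lemma j0_3: assumes "D0 (\<lambda>s. P (s 0) (s 1) (s 2))" shows "P (j x) (j y) (j z) = P x y z"
  using j0[OF assms, of "\<lambda>n. if n = 0 then x else if n = 1 then y else z"] by simp
lemma j0_4: assumes "D0 (\<lambda>s. P (s 0) (s 1) (s 2) (s 3))" shows "P (j x) (j y) (j z) (j w) = P x y z w"
  using j0[OF assms, of "\<lambda>n. if n = 0 then x else if n = 1 then y else if n = 2 then z else w"] by simp

text \<open>A universal law of the universe becomes one about all members of \<open>M\<close>,
  including those outside the range of \<open>j\<close>; only the parameters are moved.\<close>

lemma j_all:
  assumes "D0 P" "\<And>x. P (case_nat x s)" "x \<in> M" shows "P (case_nat x (\<lambda>n. j (s n)))"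
proof -
  obtain \<phi> where \<phi>: "\<phi> \<in> Delta0_fm" "\<And>s. sat E UNIV s \<phi> = P s" using assms(1) unfolding FD_def by blast
  define u where "u = case_nat undefined s"
  have eq: "u(0 := x) = case_nat x s" for x by (auto simp: fun_eq_iff u_def split: nat.splits)
  have eq2: "(j \<circ> u)(0 := x) = case_nat x (\<lambda>n. j (s n))" for x by (auto simp: fun_eq_iff u_def split: nat.splits)
  have "sat E UNIV u (All 0 \<phi>)" using assms(2) by (simp add: \<phi> eq)
  then have "sat E M (j \<circ> u) (All 0 \<phi>)" using elem by blast
  then have "sat E M ((j \<circ> u)(0 := x)) \<phi>" using assms(3) by simp
  moreover have "sat E M ((j \<circ> u)(0 := x)) \<phi> = sat E UNIV ((j \<circ> u)(0 := x)) \<phi>"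
    by (rule Delta0_absolute[OF \<phi>(1)]) (use M_trans assms(3) in \<open>auto simp: elts_def\<close>)
  ultimately show ?thesis by (simp add: \<phi> eq2)
qed

lemma j_all2: assumes "D0 (\<lambda>s. P (s 0) (s 1) (s 2))" "\<And>x. P x y z" "x \<in> M" shows "P x (j y) (j z)"
  using j_all[OF assms(1), of "case_nat y (\<lambda>_. z)" x] assms(2,3) by (simp add: numeral_2_eq_2)

lemma j_inj[simp]: "j x = j y \<longleftrightarrow> x = y" by (rule j0_2[of "\<lambda>x y. x = y"]) (intro dz)
lemma j_mem[simp]: "j x \<in> El (j y) \<longleftrightarrow> x \<in> El y" by (rule j0_2[of "\<lambda>x y. x \<in> El y"]) (intro dz)
lemma j_sub[simp]: "El (j x) \<subseteq> El (j y) \<longleftrightarrow> El x \<subseteq> El y" by (rule j0_2[of "\<lambda>x y. El x \<subseteq> El y"]) (intro dz)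
lemma j_pr: "j (pr x y) = pr (j x) (j y)"
  using j0_3[of "\<lambda>z x y. z = pr x y" "pr x y" x y] by (simp add: dz)
lemma j_upr: "j (upr x y) = upr (j x) (j y)"
  using j0_3[of "\<lambda>z x y. z = upr x y" "upr x y" x y] by (simp add: dz)
lemma j_emp[simp]: "j emp = emp" using j0_1[of "\<lambda>x. x = emp" emp] by (simp add: dz)
lemma j_sc: "j (sc x) = sc (j x)" using j0_2[of "\<lambda>x y. x = sc y" "sc x" x] by (simp add: dz)
lemma j_Od[simp]: "Od (j x) = Od x" by (rule j0_1) (intro dz)
lemma j_fn[simp]: "fn (j f) (j a) = fn f a" by (rule j0_2[of fn]) (intro dz)
lemma j_p1: "j (p1 x) = p1 (j x)" using j0_2[of "\<lambda>x y. x = p1 y" "p1 x" x] by (simp add: dz)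
lemma j_p2: "j (p2 x) = p2 (j x)" using j0_2[of "\<lambda>x y. x = p2 y" "p2 x" x] by (simp add: dz)
lemma j_ap: assumes "fn f a" "x \<in> El a" shows "ap (j f) (j x) = j (ap f x)"
proof -
  have "pr x (ap f x) \<in> El f" using fn_pr[OF assms(1)] assms(2) by simp
  then have "pr (j x) (j (ap f x)) \<in> El (j f)" by (metis j_mem j_pr)
  moreover have "fn (j f) (j a)" using assms(1) by simp
  ultimately show ?thesis using fn_pr by metis
qed

lemma j_om_el: "n \<in> El om \<Longrightarrow> j n = n"
  by (induction rule: om_induct) (intro dfn, auto simp: j_sc)
lemma j_om[simp]: "j om = om"
proof -
  have s: "El om \<subseteq> El (j om)" using j_om_el j_mem by (metis subsetI)
  \<comment> \<open>If \<open>j om\<close> were larger it would have the member \<open>om\<close>,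
    but its members are again \<open>emp\<close> or successors.\<close>
  have "\<forall>z\<in>El om. z = emp \<or> (\<exists>y\<in>El om. z = sc y)" using om_cases by blast
  then have c: "\<forall>z\<in>El (j om). z = emp \<or> (\<exists>y\<in>El (j om). z = sc y)"
    by (subst j0_1[of "\<lambda>x. \<forall>z\<in>El x. z = emp \<or> (\<exists>y\<in>El x. z = sc y)"]) (intro dz, simp)
  have "om = j om \<or> om \<in> El (j om)" using Od_sub[of om "j om"] s by simp
  then show ?thesis using c om_notsc om_emp by (metis El_emp empty_iff)
qed

lemma j_le: "Od a \<Longrightarrow> a \<in> El (sc (j a))"
proof (induction a rule: Od_induct)
  case D show ?case by (intro dfn)
next
  case (step a)
  show ?case
  proof (rule ccontr)
    assume "a \<notin> El (sc (j a))"
    then have "j a \<in> El a" using Od_lin[of a "j a"] step(1) by auto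
    then have "j a = j (j a) \<or> j a \<in> El (j (j a))" "j (j a) \<in> El (j a)" using step(2)[of "j a"] by (simp_all del: j_inj j_mem, simp)
    then show False using no2[of "j a" "j (j a)"] irrefl[of "j a"] by metis
  qed
qed

text \<open>The rule that subsets of \<open>Vs b\<close> belong to \<open>Vs a\<close> for
  \<open>b\<close> below \<open>a\<close> is preserved by \<open>j\<close> for members of
  \<open>M\<close>, which allows an induction along the levels contained in
  \<open>M\<close>.\<close>

lemma j_Vs_sub: assumes "Od a" "El (Vs a) \<subseteq> M" shows "El (Vs a) \<subseteq> El (j (Vs a))"
proof -
  have "El (Vs a) \<subseteq> M \<longrightarrow> El (Vs a) \<subseteq> El (j (Vs a))"
    using assms(1)
  proof (induction a rule: Od_induct)
    case D show ?case
      unfolding subset_eq by (intro dfn DP_app1[OF DP_M])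
  next
    case (step a)
    show ?case
    proof (intro impI subsetI)
      fix z assume M: "El (Vs a) \<subseteq> M" and z: "z \<in> El (Vs a)"
      then obtain b where b: "b \<in> El a" "El z \<subseteq> El (Vs b)" unfolding El_Vs[of a] by blast
      have "El (Vs b) \<subseteq> El (Vs a)" using Vs_mono Od_trans[OF step(1) b(1)] by blast
      then have "El z \<subseteq> El (j (Vs b))" using step(2)[OF b(1)] M b(2) by blast
      moreover have "El x \<subseteq> El (j (Vs b)) \<longrightarrow> x \<in> El (j (Vs a))" if "x \<in> M" for x
      proof (rule j_all2[of "\<lambda>x y z. El x \<subseteq> El y \<longrightarrow> x \<in> El z", OF _ _ that])
        show "D0 (\<lambda>s. El (s 0) \<subseteq> El (s 1) \<longrightarrow> s 0 \<in> El (s 2))" by (intro dz)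
        show "El x \<subseteq> El (Vs b) \<longrightarrow> x \<in> El (Vs a)" for x unfolding El_Vs[of a] using b(1) by blast
      qed
      ultimately show "z \<in> El (j (Vs a))" using M z by blast
    qed
  qed
  then show ?thesis using assms(2) by simp
qed

text \<open>The rank function of \<open>Vs a\<close> is a set. Its image under \<open>j\<close>
  still increases along membership and has values below \<open>j a\<close>, so these values dominate
  the true ranks.\<close>

lemma j_Vs_le: assumes "Od a" shows "El (j (Vs a)) \<subseteq> El (Vs (j a))"
proof -
  define f where "f = lam (Vs a) rk"
  define P where "P f v a \<longleftrightarrow> (\<forall>x\<in>El v. \<exists>p\<in>El f. p1 p = x \<and> p2 p \<in> El a) \<and> (\<forall>x\<in>El v. El x \<subseteq> El v) \<and> (\<forall>p\<in>El f. \<forall>q\<in>El f. p1 p \<in> El (p1 q) \<longrightarrow> p2 p \<in> El (p2 q))" for f v a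
  have "P f (Vs a) a" unfolding P_def f_def
  proof (intro conjI ballI impI)
    fix x assume "x \<in> El (Vs a)"
    then show "\<exists>p\<in>El (lam (Vs a) rk). p1 p = x \<and> p2 p \<in> El a"
      by (intro bexI[of _ "pr x (rk x)"]) (auto simp: El_lam dfn Vs_rk_iff[OF assms])
  qed (auto simp: El_lam dfn rk_mem dest: Vs_trans)
  then have P: "P (j f) (j (Vs a)) (j a)" by (subst j0_3[of P]) (unfold P_def, intro dz)
  have "x \<in> El (j (Vs a)) \<longrightarrow> (\<forall>p\<in>El (j f). p1 p = x \<and> p2 p \<in> El (j a) \<longrightarrow> El (rk x) \<subseteq> El (p2 p))" for x
  proof (induction x rule: eps_induct)
    case D show ?case by (intro dfn)
  next
    case (step x)
    show ?case
    proof (intro impI ballI subsetI, elim conjE)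
      fix p z assume h: "x \<in> El (j (Vs a))" "p \<in> El (j f)" "p1 p = x" "p2 p \<in> El (j a)" "z \<in> El (rk x)"
      from h(5) obtain y where y: "y \<in> El x" "z = rk y \<or> z \<in> El (rk y)" unfolding El_rk[of x] by blast
      have yv: "y \<in> El (j (Vs a))" using P h(1) y(1) unfolding P_def by blast
      then obtain q where q: "q \<in> El (j f)" "p1 q = y" "p2 q \<in> El (j a)" using P unfolding P_def by blast
      then have qp: "p2 q \<in> El (p2 p)" using P h y(1) unfolding P_def by blast
      have oa: "Od (j a)" using assms by simp
      have "El (rk y) \<subseteq> El (p2 q)" using step[OF y(1)] yv q by blast
      then have "rk y \<in> El (p2 p)" using Od_sub_mem[OF Od_rk Od_mem[OF oa h(4)] _ qp] by blast
      then show "z \<in> El (p2 p)" using y(2) Od_trans[OF Od_mem[OF oa h(4)]] by blast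
    qed
  qed
  then have "rk x \<in> El (j a)" if "x \<in> El (j (Vs a))" for x
  proof -
    obtain q where q: "q \<in> El (j f)" "p1 q = x" "p2 q \<in> El (j a)" using P \<open>x \<in> El (j (Vs a))\<close> unfolding P_def by blast
    then have "El (rk x) \<subseteq> El (p2 q)" using \<open>x \<in> El (j (Vs a)) \<longrightarrow> _\<close> that by blast
    then show ?thesis using Od_sub_mem[OF Od_rk _ _ q(3)] assms by simp
  qed
  then show ?thesis using Vs_rk_iff[of "j a"] assms by auto
qed

lemma j_fix: assumes "Od a" "\<And>b. b \<in> El a \<Longrightarrow> j b = b" "x \<in> El (Vs a)" shows "j x = x"
proof -
  have "r \<in> El a \<longrightarrow> (\<forall>x. rk x = r \<longrightarrow> j x = x)" if "Od r" for r
    using that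
  proof (induction r rule: Od_induct)
    case D show ?case by (intro dfn)
  next
    case (step r)
    show ?case
    proof (intro impI allI)
      fix x assume r: "r \<in> El a" "rk x = r"
      have *: "j y = y" if "y \<in> El (Vs r)" for y
        using that Vs_rk_iff[OF step(1)] step(2)[of "rk y"] Od_trans[OF assms(1) r(1)] by blast
      have x: "El x \<subseteq> El (Vs r)" using sub_Vs[of x] Vs_rk[of x] r(2) by simp
      then have jx: "El (j x) \<subseteq> El (Vs r)"
        using order_trans[OF iffD2[OF j_sub x] j_Vs_le[OF step(1)]] assms(2)[OF r(1)] by simp
      show "j x = x"
      proof (rule El_ext, intro equalityI subsetI)
        fix y assume y: "y \<in> El (j x)" 
        then have "j y = y" using * jx by blast
        then show "y \<in> El x" using y j_mem[of y x] by metis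
      next
        fix y assume y: "y \<in> El x" 
        then have "j y = y" using * x by blast
        then show "y \<in> El (j x)" using y j_mem[of y x] by metis
      qed
    qed
  qed
  then show ?thesis using assms Vs_rk_iff Od_rk by blast
qed

end

subsection \<open>Kunen's theorem\<close>

context zfc
begin

definition "Lim d \<longleftrightarrow> Od d \<and> emp \<in> El d \<and> (\<forall>a\<in>El d. sc a \<in> El d)"
lemma DP_Lim[dfn]: "DT f \<Longrightarrow> DP (\<lambda>s. Lim (f s))" by (rule DP_app1, unfold Lim_def, intro dfn)

lemma Lim_seq:
  assumes K: "DT (\<lambda>s. K (s 0))" and up: "\<And>n. n \<in> El om \<Longrightarrow> Od (K n) \<and> K n \<in> El (K (sc n))"
  shows "\<exists>d. Lim d \<and> El d = (\<Union>n\<in>El om. El (K n))"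
proof -
  define d where "d = Unn (rep om K)"
  have d: "El d = (\<Union>n\<in>El om. El (K n))" unfolding d_def by (simp add: El_rep K)
  have step: "a \<in> El d" if "n \<in> El om" "Od a" "El a \<subseteq> El (K n)" for a n
  proof -
    have "a \<in> El (K (sc n))" by (rule Od_sub_mem[OF that(2) _ that(3)]) (use up that(1) om_sc in blast)+
    then show ?thesis unfolding d using om_sc[OF that(1)] by blast
  qed
  have "Lim d" unfolding Lim_def
  proof (intro conjI ballI)
    show "Od d" unfolding d_def by (rule Od_Unn) (use up in \<open>auto simp: El_rep K\<close>)
    show "emp \<in> El d" by (rule step[OF om_emp]) simp_all
    fix a assume "a \<in> El d"
    then obtain n where n: "n \<in> El om" "a \<in> El (K n)" unfolding d by blast
    show "sc a \<in> El d"
      by (rule step[OF n(1)]) (use n Od_mem[of "K n" a] Od_trans[of "K n" a] up[OF n(1)] in auto)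
  qed
  then show ?thesis using d by blast
qed

lemma Od_max: assumes "Od a" "Od b" obtains c where "c = a \<or> c = b" "El a \<subseteq> El c" "El b \<subseteq> El c"
  using Od_lin[OF assms] Od_trans[OF assms(1)] Od_trans[OF assms(2)] by blast

lemma Vs_upr: assumes "Lim d" "x \<in> El (Vs d)" "y \<in> El (Vs d)" shows "upr x y \<in> El (Vs d)"
proof -
  obtain a b where ab: "a \<in> El d" "El x \<subseteq> El (Vs a)" "b \<in> El d" "El y \<subseteq> El (Vs b)"
    using assms(2,3) unfolding El_Vs[of d] by blast
  then obtain c where c: "c = a \<or> c = b" "El a \<subseteq> El c" "El b \<subseteq> El c"
    using Od_max Od_mem assms(1) unfolding Lim_def by metis
  have "El (upr x y) \<subseteq> El (Vs (sc c))" using ab(2,4) Vs_mono[OF c(2)] Vs_mono[OF c(3)] unfolding El_Vs[of "sc c"] by auto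
  moreover have "sc c \<in> El d" using ab c assms(1) unfolding Lim_def by auto
  ultimately show ?thesis unfolding El_Vs[of d] by blast
qed

lemma Vs_pr: "Lim d \<Longrightarrow> x \<in> El (Vs d) \<Longrightarrow> y \<in> El (Vs d) \<Longrightarrow> pr x y \<in> El (Vs d)"
  unfolding pr_upr by (intro Vs_upr)

text \<open>A bounded rendering of "\<open>u\<close> is \<open>t\<close> followed by
  \<open>e\<close>" for functions given as sets of pairs: each point of \<open>t\<close> is matched
  with a point of \<open>e\<close> and one of \<open>u\<close>.\<close>

definition "cmp e t u \<longleftrightarrow> (\<forall>a\<in>El t. \<exists>b\<in>El e. \<exists>c\<in>El u. p1 c = p1 a \<and> p2 a = p1 b \<and> p2 b = p2 c)"

definition "inj_sp v = sep (fun_sp v v) (\<lambda>e. \<forall>x\<in>El v. \<forall>y\<in>El v. ap e x = ap e y \<longrightarrow> x = y)"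
lemma El_inj_sp: "El (inj_sp v) = {e. fn e v \<and> (\<forall>x\<in>El v. ap e x \<in> El v) \<and> (\<forall>x\<in>El v. \<forall>y\<in>El v. ap e x = ap e y \<longrightarrow> x = y)}"
  unfolding inj_sp_def by (subst El_sep) (intro dfn, auto)

text \<open>The Erdos-Hajnal function, by diagonalisation along a well-ordering of minimal length. Writing
  a subset \<open>e\<close> of \<open>V\<^sub>d\<close> as the sequence of its pieces \<open>e \<inter> V\<^bsub>K n\<^esub>\<close> shows that there are no more tasks than
  sequences.\<close>

lemma erdos_hajnal:
  assumes d: "Lim d" and K[dfn]: "\<And>f. DT f \<Longrightarrow> DT (\<lambda>s. K (f s))"
    and K1: "\<And>n. n \<in> El om \<Longrightarrow> K n \<in> El d" and K2: "\<And>a. a \<in> El d \<Longrightarrow> \<exists>n\<in>El om. a \<in> El (K n)"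
  obtains F where "\<And>p. p \<in> El F \<Longrightarrow> ispr p \<and> fn (p1 p) om"
    "\<And>p q. p \<in> El F \<Longrightarrow> q \<in> El F \<Longrightarrow> p1 p = p1 q \<Longrightarrow> p = q"
    "\<And>e g. e \<in> El (inj_sp (Vs d)) \<Longrightarrow> g \<in> El (Vs d) \<Longrightarrow> \<exists>p\<in>El F. p2 p = g \<and> (\<exists>t\<in>El (fun_sp om (Vs d)). cmp e t (p1 p))"
proof -
  define v where "v = Vs d"
  define T where "T = fun_sp om v"
  define Z where "Z = tms (inj_sp v) v"
  \<comment> \<open>Length is measured by surjections onto the set \<open>Z\<close> of tasks; a task
    is an injection together with a prescribed value.\<close>
  define P where "P m \<longleftrightarrow> (\<exists>f. \<forall>z\<in>El Z. \<exists>x\<in>El m. ap f x = z)" for m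
  have DP[dfn]: "DT f \<Longrightarrow> DP (\<lambda>s. P (f s))" for f by (rule DP_app1, unfold P_def, intro dfn)
  obtain m0 f0 where "Od m0" "ap f0 ` El m0 = El Z" using well_order[of Z] by blast
  then have "\<forall>z\<in>El Z. \<exists>x\<in>El m0. ap f0 x = z" by (metis imageE)
  then have "Od m0" "P m0" unfolding P_def using \<open>Od m0\<close> by blast+
  from Od_least[of P, OF _ this] DP obtain \<mu> where \<mu>: "Od \<mu>" "P \<mu>" "\<And>x. x \<in> El \<mu> \<Longrightarrow> \<not> P x" by (auto simp: dfn)
  then obtain f where f: "\<And>z. z \<in> El Z \<Longrightarrow> \<exists>x\<in>El \<mu>. ap f x = z" unfolding P_def by blast
  have od: "Od d" using d unfolding Lim_def by blast
  define pc where "pc e n = sep e (\<lambda>z. z \<in> El (Vs (K n)))" for e n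
  have pc: "El (pc e n) = {z \<in> El e. z \<in> El (Vs (K n))}" for e n unfolding pc_def by (rule El_sep) (intro dfn)
  have [dfn]: "DT f \<Longrightarrow> DT g \<Longrightarrow> DT (\<lambda>s. pc (f s) (g s))" for f g by (rule DT_app2, unfold pc_def, intro dfn)
  define cd where "cd i = lam om (\<lambda>n. pr (pc (p1 i) n) (p2 i))" for i
  define cm where "cm e t = lam om (\<lambda>n. ap e (ap t n))" for e t
  have [dfn]: "DT f \<Longrightarrow> DT (\<lambda>s. cd (f s))" for f by (rule DT_app1, unfold cd_def, intro dfn)
  have [dfn]: "DT f \<Longrightarrow> DT g \<Longrightarrow> DT (\<lambda>s. cm (f s) (g s))" for f g by (rule DT_app2, unfold cm_def, intro dfn)
  have ap_cd: "ap (cd i) n = pr (pc (p1 i) n) (p2 i)" if "n \<in> El om" for i n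
    unfolding cd_def by (rule ap_lam[OF _ that]) (intro dfn)
  have ap_cm: "ap (cm e t) n = ap e (ap t n)" if "n \<in> El om" for e t n
    unfolding cm_def by (rule ap_lam[OF _ that]) (intro dfn)
  have fn_cm: "fn (cm e t) om" for e t unfolding cm_def by (rule fn_lam) (intro dfn)
  have cdT: "cd i \<in> El T" if "i \<in> El Z" for i
  proof -
    have "pr (pc (p1 i) n) (p2 i) \<in> El v" if "n \<in> El om" for n
    proof -
      have "pc (p1 i) n \<in> El (Vs d)" using K1[OF that] pc unfolding El_Vs[of d] by blast
      then show ?thesis unfolding v_def using \<open>i \<in> El Z\<close> by (intro Vs_pr[OF d]) (auto simp: Z_def v_def)
    qed
    moreover have "fn (cd i) om" unfolding cd_def by (rule fn_lam) (intro dfn)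
    ultimately show ?thesis unfolding T_def by (simp add: ap_cd)
  qed
  have cd_inj: "i = k" if i: "i \<in> El Z" and k: "k \<in> El Z" and eq: "cd i = cd k" for i k
  proof -
    have n: "pc (p1 i) n = pc (p1 k) n \<and> p2 i = p2 k" if "n \<in> El om" for n
      using ap_cd[OF that, of i] ap_cd[OF that, of k] eq by simp
    have sub: "El e \<subseteq> El v" if "e \<in> El (inj_sp v)" for e
      using that Vs_pr[OF d] unfolding El_inj_sp v_def by (auto simp: fn_El)
    have piece: "\<exists>n\<in>El om. z \<in> El (Vs (K n))" if "z \<in> El v" for z
    proof -
      have "rk z \<in> El d" using that od unfolding v_def by (simp add: Vs_rk_iff)
      then obtain n where "n \<in> El om" "rk z \<in> El (K n)" using K2 by blast
      moreover have "Od (K n)" using K1[OF \<open>n \<in> El om\<close>] od Od_mem by blast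
      ultimately show ?thesis using Vs_rk_iff[of "K n" z] by blast
    qed
    have "p1 i = p1 k"
    proof (rule El_ext, intro equalityI subsetI)
      fix z assume z: "z \<in> El (p1 i)"
      then have "z \<in> El v" using sub[of "p1 i"] i unfolding Z_def by auto
      then obtain m where m: "m \<in> El om" "z \<in> El (Vs (K m))" using piece by blast
      then have "z \<in> El (pc (p1 i) m)" using z pc by simp
      then show "z \<in> El (p1 k)" using n[OF m(1)] pc[of "p1 i" m] pc[of "p1 k" m] by auto
    next
      fix z assume z: "z \<in> El (p1 k)"
      then have "z \<in> El v" using sub[of "p1 k"] k unfolding Z_def by auto
      then obtain m where m: "m \<in> El om" "z \<in> El (Vs (K m))" using piece by blast
      then have "z \<in> El (pc (p1 k) m)" using z pc by simp
      then show "z \<in> El (p1 i)" using n[OF m(1)] pc[of "p1 i" m] pc[of "p1 k" m] by auto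
    qed
    then show ?thesis using n[OF om_emp] i k unfolding Z_def by auto
  qed
  have cm_inj: "t = u" if e: "e \<in> El (inj_sp v)" and "t \<in> El T" "u \<in> El T" "cm e t = cm e u" for e t u
  proof (rule fn_eqI[of _ om])
    fix n assume n: "n \<in> El om"
    then have "ap e (ap t n) = ap e (ap u n)" using ap_cm[OF n, of e t] ap_cm[OF n, of e u] \<open>cm e t = cm e u\<close> by simp
    moreover have "ap t n \<in> El v" "ap u n \<in> El v" using that(2,3) n unfolding T_def by auto
    ultimately show "ap t n = ap u n" using e unfolding El_inj_sp by blast
  qed (use that(2,3) in \<open>auto simp: T_def\<close>)
  have cmT: "cm e t \<in> El T" if "e \<in> El (inj_sp v)" "t \<in> El T" for e t
    using that fn_cm unfolding El_inj_sp T_def by (auto simp: ap_cm)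
  obtain c where c: "\<And>y. El y \<subseteq> El T \<Longrightarrow> y \<noteq> emp \<Longrightarrow> ap c y \<in> El y"
  proof -
    have "DP (\<lambda>s. s 0 \<noteq> emp \<longrightarrow> s 1 \<in> El (s 0))" by (intro dfn)
    moreover have "\<exists>z. y \<noteq> emp \<longrightarrow> z \<in> El y" for y using emp_eq[of y] by blast
    ultimately have "\<exists>c. fn c (Pw T) \<and> (\<forall>y\<in>El (Pw T). y \<noteq> emp \<longrightarrow> ap c y \<in> El y)" by (rule AC_rel)
    then show thesis using that by auto
  qed
  \<comment> \<open>The candidates at stage \<open>x\<close>: sequences composed with the injection
    of the task that no earlier stage has used. Their being new makes the resulting function
    single-valued.\<close>
  define A where "A x s = sep T (\<lambda>u. (\<exists>t\<in>El T. u = cm (p1 (ap f x)) t) \<and> (\<forall>y\<in>El x. u \<noteq> ap s y))" for x s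
  have G: "DT f \<Longrightarrow> DT g \<Longrightarrow> DT (\<lambda>s. ap c (A (f s) (g s)))" for f g
    by (rule DT_app2, unfold A_def, intro dfn)
  obtain S where S: "DT (\<lambda>s. S (s 0))" "\<And>x. S x = ap c (A x (lam x S))" 
    using eps_rec[of "\<lambda>x s. ap c (A x s)", OF G] by blast
  note [dfn] = DT_app1[OF S(1)]
  have A: "El (A x (lam x S)) = {u \<in> El T. (\<exists>t\<in>El T. u = cm (p1 (ap f x)) t) \<and> (\<forall>y\<in>El x. u \<noteq> S y)}" for x
    unfolding A_def by (subst El_sep) (intro dfn, auto simp: S(1))
  have ne: "A x (lam x S) \<noteq> emp" if x: "x \<in> El \<mu>" "ap f x \<in> El Z" for x
  proof
    assume "A x (lam x S) = emp"
    then have em: "El (A x (lam x S)) = {}" by simp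
    define e where "e = p1 (ap f x)"
    have e: "e \<in> El (inj_sp v)" using x(2) unfolding Z_def e_def by auto
    have hit: "\<exists>y\<in>El x. cm e t = S y" if "t \<in> El T" for t
      using em cmT[OF e that] that unfolding A e_def by blast
    let ?R = "\<lambda>y i. (\<exists>k\<in>El Z. cm e (cd k) = S y) \<longrightarrow> i \<in> El Z \<and> cm e (cd i) = S y"
    have "DP (\<lambda>s. ?R (s 0) (s 1))" by (intro dfn)
    moreover have "\<exists>i. ?R y i" for y by blast
    ultimately have "\<exists>h. fn h x \<and> (\<forall>y\<in>El x. ?R y (ap h y))" by (rule AC_rel)
    then obtain h where h: "\<And>y. y \<in> El x \<Longrightarrow> ?R y (ap h y)" by blast
    \<comment> \<open>If no candidate were left, the stages before \<open>x\<close> would have used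
      all \<open>cm e (cd z)\<close>. Since \<open>cd\<close> and \<open>cm e\<close> are injective,
      these stages would map onto \<open>Z\<close>, against the minimality of
      \<open>\<mu>\<close>.\<close>
    have "P x" unfolding P_def
    proof (intro exI ballI)
      fix z assume z: "z \<in> El Z"
      obtain y where y: "y \<in> El x" "cm e (cd z) = S y" using hit[OF cdT[OF z]] by blast
      then have "ap h y \<in> El Z" "cm e (cd (ap h y)) = cm e (cd z)" using h[OF y(1)] z by auto
      then have "ap h y = z" using cd_inj[OF _ z] cm_inj[OF e cdT cdT[OF z]] by blast
      then show "\<exists>y\<in>El x. ap h y = z" using y(1) by blast
    qed
    then show False using \<mu>(3) x(1) by blast
  qed
  have SA: "S x \<in> El (A x (lam x S))" if "x \<in> El \<mu>" "ap f x \<in> El Z" for x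
    using c[of "A x (lam x S)"] ne[OF that] S(2)[of x] A[of x] by (metis (no_types, lifting) mem_Collect_eq subsetI)
  define F where "F = rep (sep \<mu> (\<lambda>x. ap f x \<in> El Z)) (\<lambda>x. pr (S x) (p2 (ap f x)))"
  have "El (sep \<mu> (\<lambda>x. ap f x \<in> El Z)) = {x \<in> El \<mu>. ap f x \<in> El Z}" by (rule El_sep) (intro dfn)
  then have F: "El F = (\<lambda>x. pr (S x) (p2 (ap f x))) ` {x \<in> El \<mu>. ap f x \<in> El Z}"
    unfolding F_def by (subst El_rep) (intro dfn, simp)
  show thesis
  proof (rule that)
    fix p assume "p \<in> El F"
    then obtain x where "x \<in> El \<mu>" "ap f x \<in> El Z" "p = pr (S x) (p2 (ap f x))" unfolding F by auto
    then show "ispr p \<and> fn (p1 p) om" using SA[of x] A fn_cm by auto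
  next
    fix p q assume "p \<in> El F" "q \<in> El F" and eq: "p1 p = p1 q"
    then obtain x y where x: "x \<in> El \<mu>" "ap f x \<in> El Z" "p = pr (S x) (p2 (ap f x))"
      and y: "y \<in> El \<mu>" "ap f y \<in> El Z" "q = pr (S y) (p2 (ap f y))" unfolding F by auto
    have "S x = S y" using eq x y by simp
    moreover have "y \<notin> El x" "x \<notin> El y" using SA[OF x(1,2)] SA[OF y(1,2)] \<open>S x = S y\<close> unfolding A by auto
    ultimately have "x = y" using Od_cmp[OF \<mu>(1) x(1) y(1)] by blast
    then show "p = q" using x y by simp
  next
    fix e g assume e: "e \<in> El (inj_sp (Vs d))" and g: "g \<in> El (Vs d)"
    then have "pr e g \<in> El Z" unfolding Z_def v_def by simp
    then obtain x where x: "x \<in> El \<mu>" "ap f x = pr e g" using f by blast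
    then have Sx: "S x \<in> El (A x (lam x S))" using SA \<open>pr e g \<in> El Z\<close> by simp
    then obtain t where t: "t \<in> El T" "S x = cm e t" unfolding A using x by auto
    have "cmp e t (S x)" unfolding cmp_def
    proof
      fix a assume "a \<in> El t"
      have ft: "fn t om" using t(1) unfolding T_def by simp
      then obtain n where n: "n \<in> El om" "a = pr n (ap t n)" using \<open>a \<in> El t\<close> fn_El by blast
      have "ap t n \<in> El v" using t(1) n unfolding T_def by simp
      then have "pr (ap t n) (ap e (ap t n)) \<in> El e" using e fn_pr unfolding El_inj_sp v_def by blast
      moreover have "pr n (ap e (ap t n)) \<in> El (S x)" using fn_pr[OF fn_cm, of n _ e t] n ap_cm t(2) by simp
      ultimately show "\<exists>b\<in>El e. \<exists>c\<in>El (S x). p1 c = p1 a \<and> p2 a = p1 b \<and> p2 b = p2 c"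
        using n(2) by (intro bexI[of _ "pr (ap t n) (ap e (ap t n))"] bexI[of _ "pr n (ap e (ap t n))"]) auto
    qed
    moreover have "pr (S x) g \<in> El F" unfolding F using x \<open>pr e g \<in> El Z\<close> by force
    ultimately show "\<exists>p\<in>El F. p2 p = g \<and> (\<exists>t\<in>El (fun_sp om (Vs d)). cmp e t (p1 p))"
      using t(1) unfolding T_def v_def by (intro bexI[of _ "pr (S x) g"]) auto
  qed
qed

end

context emb
begin

text \<open>The supremum \<open>d\<close> of the critical sequence is a fixed point of
  \<open>j\<close> and at most \<open>r\<close>. The restriction \<open>e0\<close> of
  \<open>j\<close> to \<open>Vs d\<close> is a subset of \<open>Vs d\<close>, hence in
  \<open>M\<close>. For the task \<open>e0\<close> and \<open>k\<close>, the \<open>j\<close>-image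
  of the Erdos-Hajnal function takes the value \<open>k\<close> at some \<open>t\<close> followed by
  \<open>e0\<close>, which is \<open>j t\<close>. But its value at \<open>j t\<close> is in the
  range of \<open>j\<close>, and \<open>k\<close> is not.\<close>

theorem kunen:
  assumes cr: "critical_point E j k" and r: "Od r" "j r = r" "k \<in> El (sc r)" and VM: "El (Vs (sc r)) \<subseteq> M"
  shows False
proof -
  have k: "Od k" "j k \<noteq> k" "\<And>a. a \<in> El k \<Longrightarrow> j a = a" using cr unfolding critical_point_def by auto
  have kj: "k \<in> El (j k)" using j_le[OF k(1)] k(2) by auto
  obtain K where K: "DT (\<lambda>s. K (s 0))" "K emp = k" "\<And>n. n \<in> El om \<Longrightarrow> K (sc n) = j (K n)"
    using iterate[of j k, OF DT_j] by blast
  note [dfn] = DT_app1[OF K(1)]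
  have K1: "Od (K n) \<and> K n \<in> El (K (sc n)) \<and> K n \<in> El (sc r)" if "n \<in> El om" for n
    using that
  proof (induction n rule: om_induct)
    case D show ?case by (intro dfn)
  next
    case emp then show ?case using K k kj r by auto
  next
    case (sc n)
    have "j (K n) \<in> El (j (sc r))" using sc by (simp only: j_mem)
    then show ?case using sc K(3)[of n] K(3)[of "sc n"] r(2) by (simp add: j_sc)
  qed
  define f where "f = lam om K"
  have f: "fn f om" unfolding f_def by (rule fn_lam) (rule K(1))
  have apf: "ap f n = K n" if "n \<in> El om" for n unfolding f_def by (rule ap_lam[OF K(1) that])
  obtain d where lim: "Lim d" and d: "El d = (\<Union>n\<in>El om. El (K n))" using Lim_seq[OF K(1)] K1 by blast
  have od: "Od d" using lim unfolding Lim_def by blast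
  have Kd: "K n \<in> El d" if "n \<in> El om" for n unfolding d using K1[OF that] om_sc[OF that] by blast
  have jf: "fn (j f) om" using f j_fn[of f om] by simp
  have apjf: "ap (j f) n = K (sc n)" if "n \<in> El om" for n
    using j_ap[OF f that] apf[OF that] K(3)[OF that] j_om_el[OF that] by simp
  \<comment> \<open>\<open>j\<close> merely drops the first term of the critical sequence, which
    does not change the supremum.\<close>
  have jd: "j d = d"
  proof -
    let ?P = "\<lambda>d f. (\<forall>a\<in>El d. \<exists>p\<in>El f. a \<in> El (p2 p)) \<and> (\<forall>p\<in>El f. El (p2 p) \<subseteq> El d)"
    have "?P d f" using fn_El[OF f] unfolding d by (auto simp: apf)
    then have "?P (j d) (j f)" by (subst j0_2[of ?P]) (intro dz)
    then have P: "\<forall>a\<in>El (j d). \<exists>p\<in>El (j f). a \<in> El (p2 p)" "\<forall>p\<in>El (j f). El (p2 p) \<subseteq> El (j d)" by blast+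
    have e: "El (j d) = (\<Union>n\<in>El om. El (K (sc n)))"
    proof (intro equalityI subsetI)
      fix a assume "a \<in> El (j d)"
      then obtain p where "p \<in> El (j f)" "a \<in> El (p2 p)" using P(1) by blast
      then show "a \<in> (\<Union>n\<in>El om. El (K (sc n)))" using fn_El[OF jf] by (auto simp: apjf)
    next
      fix a assume "a \<in> (\<Union>n\<in>El om. El (K (sc n)))"
      then obtain n where n: "n \<in> El om" "a \<in> El (K (sc n))" by blast
      then have "pr n (K (sc n)) \<in> El (j f)" using fn_pr[OF jf] apjf by simp
      then show "a \<in> El (j d)" using P(2) n(2) by force
    qed
    have "El d = (\<Union>n\<in>El om. El (K (sc n)))" unfolding d
    proof (intro equalityI subsetI)
      fix a assume "a \<in> (\<Union>n\<in>El om. El (K n))"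
      then obtain n where n: "n \<in> El om" "a \<in> El (K n)" by blast
      then have "a \<in> El (K (sc n))" using K1[OF n(1)] K1[OF om_sc[OF n(1)]] Od_trans by blast
      then show "a \<in> (\<Union>n\<in>El om. El (K (sc n)))" using n by blast
    qed (use om_sc in blast)
    then show ?thesis using e by (intro El_ext) simp
  qed
  have dr: "El d \<subseteq> El r"
  proof
    fix a assume "a \<in> El d"
    then obtain n where "n \<in> El om" "a \<in> El (K n)" unfolding d by blast
    then show "a \<in> El r" using K1[of n] Od_trans[OF r(1), of "K n"] by auto
  qed
  define v where "v = Vs d"
  have VsM: "El (Vs (sc d)) \<subseteq> M"
  proof -
    have "d = r \<or> d \<in> El r" using Od_sub[OF od r(1) dr] .
    then have "El (sc d) \<subseteq> El (sc r)" using dr by auto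
    then show ?thesis using Vs_mono VM by blast
  qed
  have vM: "El v \<subseteq> M" using VsM Vs_mono[of d "sc d"] unfolding v_def by auto
  have jv: "j v = v"
    unfolding v_def by (rule El_ext) (use j_Vs_sub[OF od] j_Vs_le[OF od] vM jd in \<open>auto simp: v_def\<close>)
  obtain F where F: "\<And>p. p \<in> El F \<Longrightarrow> ispr p \<and> fn (p1 p) om"
    "\<And>p q. p \<in> El F \<Longrightarrow> q \<in> El F \<Longrightarrow> p1 p = p1 q \<Longrightarrow> p = q"
    "\<And>e g. e \<in> El (inj_sp v) \<Longrightarrow> g \<in> El v \<Longrightarrow> \<exists>p\<in>El F. p2 p = g \<and> (\<exists>t\<in>El (fun_sp om v). cmp e t (p1 p))"
  proof -
    have "\<exists>n\<in>El om. a \<in> El (K n)" if "a \<in> El d" for a using d that by blast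
    from erdos_hajnal[OF lim DT_app1[OF K(1)] Kd this, folded v_def] that show thesis by blast
  qed
  define T where "T = fun_sp om v"
  define I where "I = inj_sp v"
  define e0 where "e0 = lam v j"
  have e0: "e0 \<in> El (inj_sp v)" "fn e0 v" "\<And>x. x \<in> El v \<Longrightarrow> ap e0 x = j x"
  proof -
    have dj: "DT (\<lambda>s. j (s 0))" by (intro dfn)
    show 1: "fn e0 v" unfolding e0_def by (rule fn_lam[OF dj])
    show 2: "\<And>x. x \<in> El v \<Longrightarrow> ap e0 x = j x" unfolding e0_def by (rule ap_lam[OF dj])
    have "j x \<in> El v" if "x \<in> El v" for x using that j_mem[of x v] jv by simp
    then show "e0 \<in> El (inj_sp v)" unfolding El_inj_sp using 1 2 by simp
  qed
  have e0sub: "El e0 \<subseteq> El v"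
    using fn_El[OF e0(2)] Vs_pr[OF lim] e0(1) unfolding El_inj_sp v_def by auto
  then have e0M: "e0 \<in> M" using VsM unfolding El_Vs[of "sc d"] v_def by auto
  have e0I: "e0 \<in> El (j I)"
  proof -
    let ?P = "\<lambda>e v I. fn e v \<and> (\<forall>p\<in>El e. p2 p \<in> El v) \<and> (\<forall>p\<in>El e. \<forall>q\<in>El e. p2 p = p2 q \<longrightarrow> p = q) \<longrightarrow> e \<in> El I"
    have "?P e0 (j v) (j I)"
    proof (rule j_all2[of ?P, OF _ _ e0M])
      show "D0 (\<lambda>s. ?P (s 0) (s 1) (s 2))" by (intro dz)
      fix e show "?P e v I"
      proof
        assume h: "fn e v \<and> (\<forall>p\<in>El e. p2 p \<in> El v) \<and> (\<forall>p\<in>El e. \<forall>q\<in>El e. p2 p = p2 q \<longrightarrow> p = q)"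
        then have fe: "fn e v" by blast
        have p: "pr x (ap e x) \<in> El e" if "x \<in> El v" for x using fn_pr[OF fe] that by simp
        have "ap e x \<in> El v" if "x \<in> El v" for x using p[OF that] h by (metis p2)
        moreover have "x = y" if "x \<in> El v" "y \<in> El v" "ap e x = ap e y" for x y
          using p[OF that(1)] p[OF that(2)] that(3) h by (metis p2 pr_inj)
        ultimately show "e \<in> El I" unfolding I_def El_inj_sp using fe by blast
      qed
    qed
    moreover have "fn e0 v \<and> (\<forall>p\<in>El e0. p2 p \<in> El v) \<and> (\<forall>p\<in>El e0. \<forall>q\<in>El e0. p2 p = p2 q \<longrightarrow> p = q)"
      using e0 fn_El[OF e0(2)] unfolding El_inj_sp by auto
    ultimately show ?thesis using jv by simp
  qed
  have "\<forall>e\<in>El (j I). \<forall>g\<in>El (j v). \<exists>p\<in>El (j F). p2 p = g \<and> (\<exists>t\<in>El (j T). cmp e t (p1 p))"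
  proof (subst j0_4[of "\<lambda>I v F T. \<forall>e\<in>El I. \<forall>g\<in>El v. \<exists>p\<in>El F. p2 p = g \<and> (\<exists>t\<in>El T. cmp e t (p1 p))"])
    show "D0 (\<lambda>s. \<forall>e\<in>El (s 0). \<forall>g\<in>El (s 1). \<exists>p\<in>El (s 2). p2 p = g \<and> (\<exists>t\<in>El (s 3). cmp e t (p1 p)))"
      unfolding cmp_def by (intro dz)
    show "\<forall>e\<in>El I. \<forall>g\<in>El v. \<exists>p\<in>El F. p2 p = g \<and> (\<exists>t\<in>El T. cmp e t (p1 p))"
      unfolding I_def T_def using F(3) by blast
  qed
  moreover have "k \<in> El (j v)" using Kd[OF om_emp] K(2) sub_Vs[of d] jv unfolding v_def by auto
  ultimately obtain p t where p: "p \<in> El (j F)" "p2 p = k" "t \<in> El (j T)" "cmp e0 t (p1 p)" using e0I by blast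
  have "\<forall>t\<in>El (j T). fn t (j om) \<and> (\<forall>a\<in>El t. p2 a \<in> El (j v))"
  proof (subst j0_3[of "\<lambda>T w v. \<forall>t\<in>El T. fn t w \<and> (\<forall>a\<in>El t. p2 a \<in> El v)"])
    show "D0 (\<lambda>s. \<forall>t\<in>El (s 0). fn t (s 1) \<and> (\<forall>a\<in>El t. p2 a \<in> El (s 2)))" by (intro dz)
    show "\<forall>t\<in>El T. fn t om \<and> (\<forall>a\<in>El t. p2 a \<in> El v)" unfolding T_def by (auto simp: fn_El)
  qed
  then have t: "fn t om" "\<And>a. a \<in> El t \<Longrightarrow> p2 a \<in> El v" using p(3) jv by auto
  have "\<forall>p\<in>El (j F). ispr p \<and> fn (p1 p) (j om)"
  proof (subst j0_2[of "\<lambda>F w. \<forall>p\<in>El F. ispr p \<and> fn (p1 p) w"])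
    show "D0 (\<lambda>s. \<forall>p\<in>El (s 0). ispr p \<and> fn (p1 p) (s 1))" by (intro dz)
  qed (use F(1) in blast)
  then have u: "ispr p" "fn (p1 p) om" using p(1) by auto
  have jt: "fn (j t) om" using t(1) j_fn[of t om] by simp
  have "p1 p = j t"
  proof (rule fn_eqI[OF u(2) jt])
    fix n assume n: "n \<in> El om"
    then have tn: "pr n (ap t n) \<in> El t" using fn_pr[OF t(1)] by simp
    then obtain b c where bc: "b \<in> El e0" "c \<in> El (p1 p)" "p1 c = n" "ap t n = p1 b" "p2 b = p2 c"
      using p(4) unfolding cmp_def by force
    have "p2 b = j (ap t n)" using bc(1,4) fn_El[OF e0(2)] e0(3) by auto
    moreover have "c = pr n (ap (p1 p) n)" using bc(2,3) fn_El[OF u(2)] by auto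
    ultimately have "ap (p1 p) n = j (ap t n)" using bc(5) by simp
    then show "ap (p1 p) n = ap (j t) n" using j_ap[OF t(1) n] j_om_el[OF n] by simp
  qed
  \<comment> \<open>\<open>j t\<close> is in the domain of \<open>j F\<close>, so elementarity pulls
    \<open>t\<close> itself back into the domain of \<open>F\<close>.\<close>
  then have 1: "\<exists>q\<in>El (j F). p1 q = j t" using p(1) by blast
  have 2: "(\<exists>q\<in>El (j F). p1 q = j t) = (\<exists>q\<in>El F. p1 q = t)" by (rule j0_2[of "\<lambda>F t. \<exists>q\<in>El F. p1 q = t"]) (intro dz)
  have "\<exists>q\<in>El F. p1 q = t" by (rule iffD1[OF 2 1])
  then obtain q where q: "q \<in> El F" "p1 q = t" by blast
  have sv: "\<forall>p\<in>El (j F). \<forall>q\<in>El (j F). p1 p = p1 q \<longrightarrow> p = q"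
  proof (subst j0_1[of "\<lambda>F. \<forall>p\<in>El F. \<forall>q\<in>El F. p1 p = p1 q \<longrightarrow> p = q"])
    show "D0 (\<lambda>s. \<forall>p\<in>El (s 0). \<forall>q\<in>El (s 0). p1 p = p1 q \<longrightarrow> p = q)" by (intro dz)
  qed (use F(2) in blast)
  have jq: "j q \<in> El (j F)" "p1 (j q) = j t" using q by (auto simp: j_p1[symmetric])
  have "p = j q" using bspec[OF bspec[OF sv p(1)] jq(1)] \<open>p1 p = j t\<close> jq(2) by simp
  then have jk: "k = j (p2 q)" using p(2) by (simp add: j_p2)
  then have oq: "Od (p2 q)" using k(1) j_Od by metis
  have "p2 q \<in> El k \<or> p2 q = k \<or> k \<in> El (p2 q)" using Od_lin[OF oq k(1)] .
  then show False
  proof (elim disjE)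
    assume "p2 q \<in> El k" then show False using k(3) jk irrefl by metis
  next
    assume "p2 q = k" then show False using jk k(2) by simp
  next
    assume "k \<in> El (p2 q)" 
    then have "j k \<in> El k" using jk j_mem by metis
    then show False using kj no2 by blast
  qed
qed

end

subsection \<open>Coding assignments by tuples\<close>

primrec Alls :: "nat list \<Rightarrow> fm \<Rightarrow> fm" where
  "Alls [] \<phi> = \<phi>" | "Alls (x # xs) \<phi> = All x (Alls xs \<phi>)"

lemma sat_Alls: "sat E D u (Alls xs \<phi>) \<longleftrightarrow> (\<forall>t. (\<forall>x. x \<notin> set xs \<longrightarrow> t x = u x) \<and> (\<forall>x\<in>set xs. t x \<in> D) \<longrightarrow> sat E D t \<phi>)"
proof (induction xs arbitrary: u)
  case Nil
  have "(\<forall>x. t x = u x) \<longleftrightarrow> t = u" for t by auto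
  then show ?case by auto
next
  case (Cons y ys)
  show ?case
  proof
    assume l: "sat E D u (Alls (y # ys) \<phi>)"
    show "\<forall>t. (\<forall>x. x \<notin> set (y # ys) \<longrightarrow> t x = u x) \<and> (\<forall>x\<in>set (y # ys). t x \<in> D) \<longrightarrow> sat E D t \<phi>"
    proof (intro allI impI, elim conjE)
      fix t assume t: "\<forall>x. x \<notin> set (y # ys) \<longrightarrow> t x = u x" "\<forall>x\<in>set (y # ys). t x \<in> D"
      then have "sat E D (u(y := t y)) (Alls ys \<phi>)" using l by simp
      then show "sat E D t \<phi>" unfolding Cons.IH using t by auto
    qed
  next
    assume r: "\<forall>t. (\<forall>x. x \<notin> set (y # ys) \<longrightarrow> t x = u x) \<and> (\<forall>x\<in>set (y # ys). t x \<in> D) \<longrightarrow> sat E D t \<phi>"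
    have "sat E D (u(y := a)) (Alls ys \<phi>)" if "a \<in> D" for a
      unfolding Cons.IH
    proof (intro allI impI, elim conjE)
      fix t assume t: "\<forall>x. x \<notin> set ys \<longrightarrow> t x = (u(y := a)) x" "\<forall>x\<in>set ys. t x \<in> D"
      have "t y \<in> D" using t that by (cases "y \<in> set ys") auto
      then show "sat E D t \<phi>" using r t by (auto split: if_splits)
    qed
    then show "sat E D u (Alls (y # ys) \<phi>)" by simp
  qed
qed

lemma fv_bound: "\<exists>N. fv \<phi> \<subseteq> {..<N}"
  using finite_fv[of \<phi>] finite_nat_set_iff_bounded by auto

lemma fv_sub: "fv (sub \<phi> g) \<subseteq> g ` fv \<phi>"
proof (induction \<phi> arbitrary: g)
  case (Ex x \<phi>)
  let ?y = "fresh (g ` (fv \<phi> - {x}))"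
  have "fv (sub \<phi> (g(x := ?y))) \<subseteq> (g(x := ?y)) ` fv \<phi>" by (rule Ex.IH)
  then show ?case by auto
next
  case (And \<phi> \<psi>) then show ?case by (simp add: image_Un) blast
qed auto

text \<open>A block of quantifiers becomes a single choice of values on a finite set
  \<open>X\<close> of variables. Matrix and \<open>X\<close> depend on the formula alone, so they
  serve for the universe, for \<open>M\<close> and for sets at once.\<close>

lemma Ex_block_witness:
  assumes "\<phi> \<in> Ex_block \<Gamma>"
  shows "\<exists>\<psi>\<in>\<Gamma>. \<exists>X. finite X \<and> (\<forall>E (D :: 'b set) s. sat E D s \<phi> \<longleftrightarrow> (\<exists>t. (\<forall>i. i \<notin> X \<longrightarrow> t i = s i) \<and> (\<forall>i\<in>X. t i \<in> D) \<and> sat E D t \<psi>))"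
  using assms
proof induction
  case (1 \<phi>)
  have "(\<forall>i. t i = s i) \<longleftrightarrow> t = s" for t s :: "nat \<Rightarrow> 'b" by auto
  then show ?case using 1 by (intro bexI[of _ \<phi>] exI[of _ "{}"]) auto
next
  case (2 \<phi> x)
  then obtain \<psi> X where X: "\<psi> \<in> \<Gamma>" "finite X" 
    and *: "\<And>E (D :: 'b set) s. sat E D s \<phi> \<longleftrightarrow> (\<exists>t. (\<forall>i. i \<notin> X \<longrightarrow> t i = s i) \<and> (\<forall>i\<in>X. t i \<in> D) \<and> sat E D t \<psi>)" by blast
  have "sat E D s (Ex x \<phi>) \<longleftrightarrow> (\<exists>t. (\<forall>i. i \<notin> insert x X \<longrightarrow> t i = s i) \<and> (\<forall>i\<in>insert x X. t i \<in> D) \<and> sat E D t \<psi>)" for E and D :: "'b set" and s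
  proof
    assume "sat E D s (Ex x \<phi>)"
    then obtain a t where a: "a \<in> D" "\<forall>i. i \<notin> X \<longrightarrow> t i = (s(x := a)) i" "\<forall>i\<in>X. t i \<in> D" "sat E D t \<psi>"
      using * by auto
    have "t x \<in> D" using a by (cases "x \<in> X") auto
    then show "\<exists>t. (\<forall>i. i \<notin> insert x X \<longrightarrow> t i = s i) \<and> (\<forall>i\<in>insert x X. t i \<in> D) \<and> sat E D t \<psi>"
      using a by (intro exI[of _ t]) auto
  next
    assume "\<exists>t. (\<forall>i. i \<notin> insert x X \<longrightarrow> t i = s i) \<and> (\<forall>i\<in>insert x X. t i \<in> D) \<and> sat E D t \<psi>"
    then obtain t where t: "\<forall>i. i \<notin> insert x X \<longrightarrow> t i = s i" "\<forall>i\<in>insert x X. t i \<in> D" "sat E D t \<psi>" by blast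
    then have "sat E D (s(x := t x)) \<phi>" unfolding * by (intro exI[of _ t]) auto
    then show "sat E D s (Ex x \<phi>)" using t by auto
  qed
  then show ?case using X by (intro bexI[of _ \<psi>] exI[of _ "insert x X"]) auto
qed

context zfc
begin

lemma PI_TD: assumes "PI (Suc k) (\<lambda>s. Q (\<lambda>n. s (Suc n)) (s 0))" "TD f" shows "PI (Suc k) (\<lambda>s. Q s (f s))"
proof -
  have "PI (Suc k) (\<lambda>s. \<forall>a. f s = a \<longrightarrow> Q s a)"
    by (intro PI_all PI_imp assms(1) D0_SG D0_eq TD_shift[OF assms(2)] TD_var)
  then show ?thesis by simp
qed

lemma TDs:
  assumes ren: "\<And>P g. C P \<Longrightarrow> C (\<lambda>s. P (\<lambda>n. s (g n)))"
    and subst: "\<And>Q f. C (\<lambda>s. Q (\<lambda>n. s (Suc n)) (s 0)) \<Longrightarrow> TD f \<Longrightarrow> C (\<lambda>s. Q s (f s))"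
    and P: "C P" and f: "\<And>i. TD (f i)"
  shows "C (\<lambda>s. P (\<lambda>i. if i < N then f i (\<lambda>n. s (h n)) else s (g i)))"
proof (induction N arbitrary: g h)
  case 0 show ?case using ren[OF P] by simp
next
  case (Suc N)
  define Q where "Q s a = P (\<lambda>i. if i < N then f i (\<lambda>n. s (h n)) else if i = N then a else s (g i))" for s a
  have "Q (\<lambda>n. s (Suc n)) (s 0) = P (\<lambda>i. if i < N then f i (\<lambda>n. s ((\<lambda>n. Suc (h n)) n)) else s ((\<lambda>i. if i = N then 0 else Suc (g i)) i))" for s
    unfolding Q_def by (rule arg_cong[of _ _ P]) auto
  then have "C (\<lambda>s. Q (\<lambda>n. s (Suc n)) (s 0))" using Suc.IH[of "\<lambda>n. Suc (h n)" "\<lambda>i. if i = N then 0 else Suc (g i)"] by simp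
  from subst[OF this TD_shift[OF f, of N h]]
  have "C (\<lambda>s. Q s (f N (\<lambda>n. s (h n))))" .
  moreover have "Q s (f N (\<lambda>n. s (h n))) = P (\<lambda>i. if i < Suc N then f i (\<lambda>n. s (h n)) else s (g i))" for s
    unfolding Q_def by (rule arg_cong[of _ _ P]) (auto simp: less_Suc_eq)
  ultimately show ?case by simp
qed
lemma PI_TDs: assumes "PI (Suc k) P" "\<And>i. TD (f i)"
  shows "PI (Suc k) (\<lambda>s. P (\<lambda>i. if i < N then f i (\<lambda>n. s (h n)) else s (g i)))"
proof (rule TDs[of "PI (Suc k)", OF _ _ assms])
  show "PI (Suc k) (\<lambda>s. P (\<lambda>n. s (g n)))" if "PI (Suc k) P" for P g by (rule PI_sub[OF that])
  show "PI (Suc k) (\<lambda>s. Q s (f s))" if "PI (Suc k) (\<lambda>s. Q (\<lambda>n. s (Suc n)) (s 0))" "TD f" for Q f by (rule PI_TD[OF that])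
qed
lemma D0_TDs: assumes "D0 P" "\<And>i. TD (f i)"
  shows "D0 (\<lambda>s. P (\<lambda>i. if i < N then f i (\<lambda>n. s (h n)) else s (g i)))"
proof (rule TDs[of "D0", OF _ _ assms])
  show "D0 (\<lambda>s. P (\<lambda>n. s (g n)))" if "D0 P" for P g by (rule D0_sub[OF that])
  show "D0 (\<lambda>s. Q s (f s))" if "D0 (\<lambda>s. Q (\<lambda>n. s (Suc n)) (s 0))" "TD f" for Q f by (rule TD_D[OF that(2,1)])
qed

lemma D0_app4:
  assumes P: "D0 (\<lambda>s. P (s 0) (s 1) (s 2) (s 3))" and f: "TD f" "TD g" "TD h" "TD k"
  shows "D0 (\<lambda>s. P (f s) (g s) (h s) (k s))"
proof -
  have "TD (if i = 0 then f else if i = 1 then g else if i = 2 then h else k)" for i :: nat using f by simp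
  from D0_TDs[OF P this, of 4 id id] show ?thesis by simp
qed

primrec tup :: "nat \<Rightarrow> (nat \<Rightarrow> 'a) \<Rightarrow> 'a" where
  "tup 0 t = emp" | "tup (Suc N) t = pr (t 0) (tup N (\<lambda>n. t (Suc n)))"
primrec cp :: "nat \<Rightarrow> 'a \<Rightarrow> 'a" where
  "cp 0 q = p1 q" | "cp (Suc i) q = cp i (p2 q)"

lemma cp_tup[simp]: "i < N \<Longrightarrow> cp i (tup N t) = t i"
  by (induction N arbitrary: t i) (auto simp: less_Suc_eq_0_disj)

lemma TD_cp[dz]: "TD f \<Longrightarrow> TD (\<lambda>s. cp i (f s))"
  by (induction i arbitrary: f) (auto intro: dz)

text \<open>Strongness concerns classes defined without parameters by a formula in one variable, so
  objects, parameters and witnesses are packed into one tuple. The coordinates are substituted under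
  a universal quantifier, which keeps the complexity.\<close>

lemma code_formula:
  assumes "\<psi> \<in> Pi_fm (Suc k)"
  obtains \<chi> where "\<chi> \<in> Pi_fm (Suc k)" "fv \<chi> \<subseteq> {0}" "\<And>s. sat E UNIV s \<chi> \<longleftrightarrow> sat E UNIV (\<lambda>i. cp i (s 0)) \<psi>"
proof -
  obtain N where N: "fv \<psi> \<subseteq> {..<N}" using fv_bound by blast
  have "PI (Suc k) (\<lambda>s. sat E UNIV (\<lambda>i. if i < N then cp i (s 0) else s i) \<psi>)"
    using PI_TDs[OF FD_fm[OF assms], of "\<lambda>i s. cp i (s 0)" N id id, unfolded id_apply] by (simp only: TD_cp TD_var)
  then obtain \<chi> where \<chi>: "\<chi> \<in> Pi_fm (Suc k)" "\<And>s. sat E UNIV s \<chi> = sat E UNIV (\<lambda>i. if i < N then cp i (s 0) else s i) \<psi>"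
    unfolding FD_def by blast
  have c: "sat E UNIV (\<lambda>i. if i < N then cp i q else u i) \<psi> = sat E UNIV (\<lambda>i. cp i q) \<psi>" for q u
    by (rule sat_cong) (use N in auto)
  show thesis
  proof (rule that[of "sub \<chi> (\<lambda>_. 0)"])
    show "sub \<chi> (\<lambda>_. 0) \<in> Pi_fm (Suc k)" using \<chi>(1) sub_Levy by blast
    show "fv (sub \<chi> (\<lambda>_. 0)) \<subseteq> {0}" using fv_sub[of \<chi> "\<lambda>_. 0"] by auto
    show "sat E UNIV s (sub \<chi> (\<lambda>_. 0)) = sat E UNIV (\<lambda>i. cp i (s 0)) \<psi>" for s
      unfolding sat_sub \<chi>(2) c ..
  qed
qed

end

context emb
begin

text \<open>Elementarity speaks of assignments in the range of \<open>j\<close>. Passing to the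
  universal closure over all free variables reaches every assignment in \<open>M\<close>.\<close>

lemma valid_transfer:
  assumes "\<And>s. sat E UNIV s \<theta>" "range s \<subseteq> M" shows "sat E M s \<theta>"
proof -
  obtain N where N: "fv \<theta> \<subseteq> {..<N}" using fv_bound by blast
  let ?u = "\<lambda>_::nat. emp"
  have "sat E UNIV ?u (Alls [0..<N] \<theta>)" unfolding sat_Alls using assms(1) by blast
  then have "sat E M (j \<circ> ?u) (Alls [0..<N] \<theta>)" using elem by blast
  then have "sat E M (\<lambda>i. if i < N then s i else (j \<circ> ?u) i) \<theta>"
    unfolding sat_Alls using assms(2) by (elim allE[of _ "\<lambda>i. if i < N then s i else (j \<circ> ?u) i"]) (auto simp: image_subset_iff)
  moreover have "sat E M (\<lambda>i. if i < N then s i else (j \<circ> ?u) i) \<theta> = sat E M s \<theta>"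
    by (rule sat_cong) (use N in auto)
  ultimately show ?thesis by simp
qed

lemma p_in_M: "x \<in> M \<Longrightarrow> p1 x \<in> M" "x \<in> M \<Longrightarrow> p2 x \<in> M"
proof -
  have *: "p1 x \<in> M \<and> p2 x \<in> M" if "x \<in> M" for x
  proof (cases "ispr x")
    case True
    then have "x = pr (p1 x) (p2 x)" by (rule ispr_D)
    then have "upr (p1 x) (p2 x) \<in> El x" using El_pr[of "p1 x" "p2 x"] by auto
    then show ?thesis using M_trans[OF that] M_trans[of "upr (p1 x) (p2 x)"] by auto
  next
    case False then show ?thesis using p1_not that by simp
  qed
  then show "x \<in> M \<Longrightarrow> p1 x \<in> M" "x \<in> M \<Longrightarrow> p2 x \<in> M" by auto
qed

lemma cp_in_M: "x \<in> M \<Longrightarrow> cp i x \<in> M" by (induction i arbitrary: x) (auto simp: p_in_M)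

text \<open>The equivalence of \<open>\<chi>\<close> with \<open>\<psi>\<close> at the coordinates
  is a law of the universe, so it also holds in \<open>M\<close>; the coordinates themselves are
  computed alike in both.\<close>

lemma code_transfer:
  assumes \<chi>: "\<And>s. sat E UNIV s \<chi> \<longleftrightarrow> sat E UNIV (\<lambda>i. cp i (s 0)) \<psi>" and q: "q \<in> M" "sat E M (\<lambda>_. q) \<chi>" "fv \<chi> \<subseteq> {0}"
  shows "sat E M (\<lambda>i. cp i q) \<psi>"
proof -
  obtain N where N: "fv \<psi> \<subseteq> {..<N}" using fv_bound by blast
  have "D0 (\<lambda>s. \<forall>i<N. s (Suc i) = cp i (s 0))"
  proof (induction N)
    case (Suc N)
    have "D0 (\<lambda>s. (\<forall>i<N. s (Suc i) = cp i (s 0)) \<and> s (Suc N) = cp N (s 0))" by (intro dz Suc.IH)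
    then show ?case by (simp add: less_Suc_eq all_conj_distrib conj_commute imp_disjL)
  qed (simp add: D0_const)
  then obtain \<delta> where \<delta>: "\<delta> \<in> Delta0_fm" "\<And>s. sat E UNIV s \<delta> = (\<forall>i<N. s (Suc i) = cp i (s 0))" unfolding FD_def by blast
  define \<theta> where "\<theta> = Neg (And (And \<delta> \<chi>) (Neg (sub \<psi> Suc)))"
  have "sat E UNIV s \<theta>" for s
  proof -
    have "sat E UNIV (\<lambda>n. s (Suc n)) \<psi> = sat E UNIV (\<lambda>i. cp i (s 0)) \<psi>" if "\<forall>i<N. s (Suc i) = cp i (s 0)"
      by (rule sat_cong) (use N that in auto)
    then show ?thesis unfolding \<theta>_def by (auto simp: \<delta> \<chi> sat_sub)
  qed
  define s where "s = case_nat q (\<lambda>i. cp i q)"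
  have s: "range s \<subseteq> M" unfolding s_def using q cp_in_M by (auto split: nat.splits)
  have "sat E M s \<theta>" by (rule valid_transfer) fact+
  moreover have "sat E M s \<delta>"
    using Delta0_absolute[OF \<delta>(1), of M E s] s M_trans \<delta>(2)[of s] by (auto simp: elts_def s_def)
  moreover have "sat E M s \<chi> = sat E M (\<lambda>_. q) \<chi>" by (rule sat_cong) (use q(3) in \<open>auto simp: s_def\<close>)
  ultimately show ?thesis using q unfolding \<theta>_def by (simp add: sat_sub s_def)
qed

text \<open>\<open>j (Vs b)\<close> is the level at \<open>j b\<close> as computed in
  \<open>M\<close>, which may be much higher than \<open>b\<close>. To reach the levels in between,
  the induction runs along the image of the whole hierarchy up to \<open>b\<close>.\<close>

lemma j_Vs_sub2: assumes "Od b" "Od a" "El a \<subseteq> El (j b)" "El (Vs a) \<subseteq> M" shows "El (Vs a) \<subseteq> El (j (Vs b))"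
proof -
  define h where "h = lam (sc b) Vs"
  have f: "fn h (sc b)" and ap: "\<And>x. x \<in> El (sc b) \<Longrightarrow> ap h x = Vs x" unfolding h_def by (auto intro!: fn_lam ap_lam dfn simp del: El_sc)
  have jf: "fn (j h) (j (sc b))" using f by simp
  have mem: "pr x (ap (j h) x) \<in> El (j h)" if "x \<in> El (sc (j b))" for x using fn_pr[OF jf] that by (simp add: j_sc)
  have top: "ap (j h) (j b) = j (Vs b)" using j_ap[OF f, of b] ap[of b] by simp
  have P: "\<forall>p\<in>El (j h). \<forall>q\<in>El (j h). p1 p \<in> El (p1 q) \<and> El x \<subseteq> El (p2 p) \<longrightarrow> x \<in> El (p2 q)" if "x \<in> M" for x
  proof (rule j_all2[of "\<lambda>x h y. \<forall>p\<in>El h. \<forall>q\<in>El h. p1 p \<in> El (p1 q) \<and> El x \<subseteq> El (p2 p) \<longrightarrow> x \<in> El (p2 q)", OF _ _ that])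
    show "D0 (\<lambda>s. \<forall>p\<in>El (s 1). \<forall>q\<in>El (s 1). p1 p \<in> El (p1 q) \<and> El (s 0) \<subseteq> El (p2 p) \<longrightarrow> s 0 \<in> El (p2 q))" by (intro dz)
    fix x show "\<forall>p\<in>El h. \<forall>q\<in>El h. p1 p \<in> El (p1 q) \<and> El x \<subseteq> El (p2 p) \<longrightarrow> x \<in> El (p2 q)"
    proof (intro ballI impI, elim conjE)
      fix p q assume pq: "p \<in> El h" "q \<in> El h" and m: "p1 p \<in> El (p1 q)" and x: "El x \<subseteq> El (p2 p)"
      have "p2 p = Vs (p1 p)" "p2 q = Vs (p1 q)" using pq fn_El[OF f] ap by auto
      then show "x \<in> El (p2 q)" unfolding El_Vs[of "p1 q"] using m x by (metis (no_types, lifting) El_Vs mem_Collect_eq)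
    qed
  qed
  have "c \<in> El (sc (j b)) \<and> El (Vs c) \<subseteq> M \<longrightarrow> El (Vs c) \<subseteq> El (ap (j h) c)" if "Od c" for c
    using that
  proof (induction c rule: Od_induct)
    case D show ?case unfolding subset_eq by (intro dfn DP_app1[OF DP_M])
  next
    case (step c)
    show ?case
    proof (intro impI subsetI, elim conjE)
      fix x assume c: "c \<in> El (sc (j b))" and M: "El (Vs c) \<subseteq> M" and x: "x \<in> El (Vs c)"
      then obtain d where d: "d \<in> El c" "El x \<subseteq> El (Vs d)" unfolding El_Vs[of c] by blast
      have dm: "d \<in> El (sc (j b))" using Od_trans[OF Od_sc _] c d(1) assms(1) by (metis j_Od subsetD)
      have "El (Vs d) \<subseteq> El (Vs c)" using Vs_mono[OF Od_trans[OF step(1) d(1)]] .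
      then have "El x \<subseteq> El (ap (j h) d)" using step(2)[OF d(1)] dm M d(2) by blast
      then show "x \<in> El (ap (j h) c)" using P[of x] M x mem[OF dm] mem[OF c] d(1) by (metis p1 p2 subsetD)
    qed
  qed
  note * = this
  show ?thesis
  proof
    fix x assume x: "x \<in> El (Vs a)"
    then obtain d where d: "d \<in> El a" "El x \<subseteq> El (Vs d)" unfolding El_Vs[of a] by blast
    have od: "Od d" using Od_mem[OF assms(2) d(1)] .
    have dm: "d \<in> El (sc (j b))" using assms(3) d(1) by auto
    have "El (Vs d) \<subseteq> El (Vs a)" using Vs_mono[OF Od_trans[OF assms(2) d(1)]] .
    then have "El x \<subseteq> El (ap (j h) d)" using *[OF od] dm assms(4) d(2) by blast
    then have "x \<in> El (ap (j h) (j b))" using P[of x] assms(3,4) x mem[OF dm] mem[of "j b"] d(1) by (metis El_sc insertI1 p1 p2 subsetD)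
    then show "x \<in> El (j (Vs b))" by (simp add: top)
  qed
qed

end

subsection \<open>Graphs\<close>

context zfc
begin

text \<open>The notion \<open>hom\<close> with all quantifiers bounded by the sets involved, so that
  it passes through elementary embeddings; \<open>hom_hm\<close> shows that the two agree on
  pairs.\<close>

definition "hm h A B \<longleftrightarrow> fn h (p1 A) \<and> (\<forall>z\<in>El h. p2 z \<in> El (p1 B)) \<and>
  (\<forall>z\<in>El h. \<forall>w\<in>El h. pr (p1 z) (p1 w) \<in> El (p2 A) \<longrightarrow> pr (p2 z) (p2 w) \<in> El (p2 B))"
lemma D0_hm[dz]: "TD f \<Longrightarrow> TD g \<Longrightarrow> TD h \<Longrightarrow> D0 (\<lambda>s. hm (f s) (g s) (h s))"
  by (rule D0_app3[of hm], unfold hm_def, intro dz)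
lemma DP_hm[dfn]: "DT f \<Longrightarrow> DT g \<Longrightarrow> DT h \<Longrightarrow> DP (\<lambda>s. hm (f s) (g s) (h s))"
  by (rule DP_app3[of hm], unfold hm_def, intro dfn)

lemma verts_pr[simp]: "verts E (pr G R) = G" and edges_pr[simp]: "edges E (pr G R) = R"
  unfolding verts_def edges_def by auto
lemma graph_pr: "is_graph E A \<Longrightarrow> A = pr (p1 A) (p2 A)" unfolding is_graph_def by auto
lemma graph_ve: "is_graph E A \<Longrightarrow> verts E A = p1 A \<and> edges E A = p2 A" using graph_pr verts_pr edges_pr by metis

lemma hm_iff: "hm h A B \<longleftrightarrow> fn h (p1 A) \<and> (\<forall>x\<in>El (p1 A). ap h x \<in> El (p1 B)) \<and>
  (\<forall>x\<in>El (p1 A). \<forall>y\<in>El (p1 A). pr x y \<in> El (p2 A) \<longrightarrow> pr (ap h x) (ap h y) \<in> El (p2 B))"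
proof (cases "fn h (p1 A)")
  case True show ?thesis unfolding hm_def fn_El[OF True] by fastforce
qed (simp add: hm_def)

lemma hom_hm: assumes "A = pr (p1 A) (p2 A)" "B = pr (p1 B) (p2 B)" shows "hom E h A B \<longleftrightarrow> hm h A B"
proof -
  have "verts E A = p1 A" "edges E A = p2 A" "verts E B = p1 B" "edges E B = p2 B"
    using assms verts_pr edges_pr by metis+
  then show ?thesis unfolding hom_def hm_iff using app_ap[of h "p1 A"] by auto
qed

lemma hm_comp: assumes "hm h A B" "hm k B C" shows "\<exists>l. hm l A C"
proof -
  let ?l = "lam (p1 A) (\<lambda>x. ap k (ap h x))"
  have d: "DT (\<lambda>s. ap k (ap h (s 0)))" by (intro dfn)
  have "hm ?l A C" unfolding hm_iff using assms[unfolded hm_iff] by (auto simp: ap_lam[OF d] fn_lam[OF d])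
  then show ?thesis by blast
qed

definition "pv S = sep (fun_sp S (Unn (rep S p1))) (\<lambda>f. \<forall>A\<in>El S. ap f A \<in> El (p1 A))"
definition "pe S = sep (tms (pv S) (pv S)) (\<lambda>z. \<forall>A\<in>El S. pr (ap (p1 z) A) (ap (p2 z) A) \<in> El (p2 A))"
definition "pg S = pr (pv S) (pe S)"

lemma DT_pv[dfn]: "DT f \<Longrightarrow> DT (\<lambda>s. pv (f s))" by (rule DT_app1, unfold pv_def, intro dfn)
lemma DT_pe[dfn]: "DT f \<Longrightarrow> DT (\<lambda>s. pe (f s))" by (rule DT_app1, unfold pe_def, intro dfn)
lemma DT_pg[dfn]: "DT f \<Longrightarrow> DT (\<lambda>s. pg (f s))" by (rule DT_app1, unfold pg_def, intro dfn)

lemma El_pv: "El (pv S) = {f. fn f S \<and> (\<forall>A\<in>El S. ap f A \<in> El (p1 A))}"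
proof -
  have "El (rep S p1) = p1 ` El S" by (rule El_rep) (intro dfn)
  then show ?thesis unfolding pv_def by (subst El_sep) (intro dfn, auto)
qed
lemma El_pe: "El (pe S) = {pr f g |f g. f \<in> El (pv S) \<and> g \<in> El (pv S) \<and> (\<forall>A\<in>El S. pr (ap f A) (ap g A) \<in> El (p2 A))}"
  unfolding pe_def by (subst El_sep) (intro dfn, auto)

lemma prod_graph_pg: assumes "\<And>A. A \<in> El S \<Longrightarrow> is_graph E A" shows "prod_graph E S = pg S"
proof -
  have ve: "verts E A = p1 A" "edges E A = p2 A" if "A \<in> El S" for A using graph_ve[OF assms[OF that]] by auto
  have v: "prod_verts E S = El (pv S)" unfolding prod_verts_def El_pv using ve app_ap by auto
  have "{pr f g | f g. f \<in> prod_verts E S \<and> g \<in> prod_verts E S \<and> (\<forall>A\<in>El S. pr (app E f A) (app E g A) \<in> El (edges E A))} = El (pe S)"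
    unfolding El_pe v using ve app_ap unfolding El_pv by fastforce
  then show ?thesis unfolding prod_graph_def pg_def v by simp
qed

section \<open>Closure of limit levels under set operations and products\<close>

lemma Vs_Pw: "Lim d \<Longrightarrow> x \<in> El (Vs d) \<Longrightarrow> Pw x \<in> El (Vs d)"
proof -
  assume d: "Lim d" and "x \<in> El (Vs d)"
  then obtain b where b: "b \<in> El d" "El x \<subseteq> El (Vs b)" unfolding El_Vs[of d] by blast
  then have "El (Pw x) \<subseteq> El (Vs (sc b))" unfolding El_Vs[of "sc b"] by auto
  then show ?thesis unfolding El_Vs[of d] using b d unfolding Lim_def by blast
qed
lemma Vs_Unn: assumes "x \<in> El (Vs d)" shows "Unn x \<in> El (Vs d)"
proof -
  obtain b where b: "b \<in> El d" "El x \<subseteq> El (Vs b)" using assms unfolding El_Vs[of d] by blast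
  then have "El (Unn x) \<subseteq> El (Vs b)" using Vs_trans[of _ b] by auto
  then show ?thesis unfolding El_Vs[of d] using b by blast
qed
lemma Vs_un: assumes "Lim d" "x \<in> El (Vs d)" "y \<in> El (Vs d)" shows "un x y \<in> El (Vs d)"
proof -
  have "un x y = Unn (upr x y)" by (rule El_ext) auto
  then show ?thesis using Vs_Unn[OF Vs_upr[OF assms]] by simp
qed
lemma Vs_tms: assumes "Lim d" "x \<in> El (Vs d)" "y \<in> El (Vs d)" shows "tms x y \<in> El (Vs d)"
proof (rule Vs_sub)
  show "Pw (Pw (un x y)) \<in> El (Vs d)" by (intro Vs_Pw Vs_un assms)
  show "El (tms x y) \<subseteq> El (Pw (Pw (un x y)))" by (auto simp: El_pr)
qed
lemma Vs_p1: assumes "z \<in> El (Vs d)" shows "p1 z \<in> El (Vs d)" "p2 z \<in> El (Vs d)"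
proof -
  have "p1 z \<in> El (Vs d) \<and> p2 z \<in> El (Vs d)"
  proof (cases "ispr z")
    case True
    then have "upr (p1 z) (p2 z) \<in> El z" using El_pr[of "p1 z" "p2 z"] ispr_D[of z] by auto
    then have "upr (p1 z) (p2 z) \<in> El (Vs d)" using Vs_trans assms by blast
    then show ?thesis using Vs_trans[of "upr (p1 z) (p2 z)" d] by auto
  qed (simp add: p1_not assms)
  then show "p1 z \<in> El (Vs d)" "p2 z \<in> El (Vs d)" by auto
qed

lemma Vs_pg: assumes d: "Lim d" and S: "S \<in> El (Vs d)" shows "pg S \<in> El (Vs d)"
proof -
  have "Unn (Unn (Unn S)) \<in> El (Vs d)" by (intro Vs_Unn S)
  moreover have "un S (Unn (Unn (Unn S))) \<in> El (Vs d)" by (intro Vs_un Vs_Unn S d)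
  moreover have "El (p1 A) \<subseteq> El (un (Unn S) (Unn (Unn (Unn S))))" if "A \<in> El S" for A
  proof (cases "ispr A")
    case True
    then have "upr (p1 A) (p2 A) \<in> El A" using El_pr[of "p1 A" "p2 A"] ispr_D[of A] by auto
    then have "upr (p1 A) (p2 A) \<in> El (Unn S)" using that by auto
    then have "p1 A \<in> El (Unn (Unn S))" unfolding El_Unn[of "Unn S"] by (rule UN_I) simp
    then have "El (p1 A) \<subseteq> El (Unn (Unn (Unn S)))" unfolding El_Unn[of "Unn (Unn S)"] by (rule UN_upper)
    then show ?thesis by auto
  qed (use that in \<open>auto simp: p1_not\<close>)
  then have "El (pv S) \<subseteq> El (Pw (tms S (un (Unn S) (Unn (Unn (Unn S))))))"
    unfolding El_pv by (auto simp: fn_El; blast)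
  moreover have "Pw (tms S (un (Unn S) (Unn (Unn (Unn S))))) \<in> El (Vs d)"
    by (intro Vs_Pw Vs_tms Vs_un Vs_Unn S d)
  ultimately have pv: "pv S \<in> El (Vs d)" using Vs_sub by blast
  have "El (pe S) \<subseteq> El (tms (pv S) (pv S))" unfolding El_pe by auto
  then have "pe S \<in> El (Vs d)" using Vs_sub Vs_tms[OF d pv pv] by blast
  then show ?thesis unfolding pg_def using Vs_pr[OF d pv] by blast
qed

end

subsection \<open>Strong cardinals give product reflection\<close>

context zfc
begin

text \<open>A closing-off argument: \<open>Q a b\<close> asks for a level \<open>b\<close> above
  \<open>a\<close> with witnesses for all of \<open>Vs a\<close>, least choices make this a
  function, and iterating it along \<open>om\<close> reaches a limit that is closed.\<close>

lemma reflect: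
  assumes R: "DP (\<lambda>s. R (s 0) (s 1))" and ex: "\<And>c. \<exists>y. R c y"
  shows "\<exists>d. Lim d \<and> om \<in> El d \<and> x \<in> El (Vs d) \<and> (\<forall>c\<in>El (Vs d). \<exists>y\<in>El (Vs d). R c y)"
proof -
  note [dfn] = DP_app2[OF R]
  define Q where "Q a b \<longleftrightarrow> Od b \<and> a \<in> El b \<and> (\<forall>c\<in>El (Vs a). \<exists>y\<in>El (Vs b). R c y)" for a b
  have DQ[dfn]: "DT f \<Longrightarrow> DT g \<Longrightarrow> DP (\<lambda>s. Q (f s) (g s))" for f g by (rule DP_app2[of Q], unfold Q_def, intro dfn)
  have exQ: "\<exists>b. Q a b" if a: "Od a" for a
  proof -
    obtain B where B: "\<forall>c\<in>El (Vs a). (\<exists>y. R c y) \<longrightarrow> (\<exists>y\<in>El B. R c y)" using collect[OF R, of "Vs a"] by blast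
    obtain b where b: "Od b" "upr a B \<in> El (Vs b)" using ex_Vs_mem by blast
    have u: "a \<in> El (Vs b)" "B \<in> El (Vs b)" using Vs_trans[OF b(2)] by simp_all
    have "a \<in> El b" using Vs_Od[OF b(1) a] u(1) by simp
    then have "Q a b" unfolding Q_def using b(1) B ex Vs_trans[OF u(2)] by blast
    then show ?thesis by blast
  qed
  define Q' where "Q' a b \<longleftrightarrow> (Od a \<longrightarrow> Q a b \<and> (\<forall>c\<in>El b. \<not> Q a c)) \<and> (\<not> Od a \<longrightarrow> b = emp)" for a b
  have "\<exists>!b. Q' a b" for a
  proof (cases "Od a")
    case True
    obtain b0 where b0: "Q a b0" using exQ[OF True] by blast
    have "\<exists>b. Od b \<and> Q a b \<and> (\<forall>c\<in>El b. \<not> Q a c)"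
      by (rule Od_least[of _ b0]) (intro dfn, use b0 Q_def in auto)
    then obtain b where b: "Od b" "Q a b" "\<forall>c\<in>El b. \<not> Q a c" by blast
    show ?thesis
    proof (rule ex1I[of _ b])
      show "Q' a b" unfolding Q'_def using True b by blast
      fix c assume c: "Q' a c"
      then have "Od c" unfolding Q'_def Q_def using True by blast
      then show "c = b" using Od_lin[of b c] b c True unfolding Q'_def by blast
    qed
  next
    case False then show ?thesis unfolding Q'_def by blast
  qed
  moreover have "DP (\<lambda>s. Q' (s 0) (s 1))" unfolding Q'_def by (intro dfn)
  ultimately obtain G where G: "DT (\<lambda>s. G (s 0))" "\<And>x y. G x = y \<longleftrightarrow> Q' x y" using choose_fun[of Q'] by blast
  obtain a where a: "Od a" "upr x om \<in> El (Vs a)" using ex_Vs_mem by blast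
  have xa: "x \<in> El (Vs a)" "om \<in> El (Vs a)" using Vs_trans[OF a(2)] by simp_all
  have oa: "om \<in> El a" using Vs_Od[OF a(1) Od_om] xa(2) by simp
  obtain K where K: "DT (\<lambda>s. K (s 0))" "K emp = a" "\<And>n. n \<in> El om \<Longrightarrow> K (sc n) = G (K n)"
    using iterate[of G a, OF DT_app1[OF G(1)]] by blast
  have GQ: "Q c (G c)" if "Od c" for c using G(2)[of c "G c"] that unfolding Q'_def by blast
  have K1: "Od (K n)" if "n \<in> El om" for n
    using that
  proof (induction n rule: om_induct)
    case D show ?case by (intro dfn DT_app1[OF K(1)])
  next
    case emp show ?case using K a by simp
  next
    case (sc n) then show ?case using GQ[of "K n"] K(3)[of n] unfolding Q_def by simp
  qed
  have K2: "Q (K n) (K (sc n))" if "n \<in> El om" for n using GQ[OF K1[OF that]] K(3)[OF that] by simp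
  have "Od (K n) \<and> K n \<in> El (K (sc n))" if "n \<in> El om" for n using K1[OF that] K2[OF that] unfolding Q_def by blast
  then obtain d where lim: "Lim d" and d: "El d = (\<Union>n\<in>El om. El (K n))" using Lim_seq[OF K(1)] by blast
  have Kd: "El (K n) \<subseteq> El d" if "n \<in> El om" for n unfolding d using that by blast
  have "x \<in> El (Vs d)" using Vs_mono[OF Kd[OF om_emp]] K(2) xa by auto
  moreover have "\<exists>y\<in>El (Vs d). R c y" if "c \<in> El (Vs d)" for c
  proof -
    obtain e where e: "e \<in> El d" "El c \<subseteq> El (Vs e)" using \<open>c \<in> El (Vs d)\<close> unfolding El_Vs[of d] by blast
    then obtain n where n: "n \<in> El om" "e \<in> El (K n)" unfolding d by blast
    have "c \<in> El (Vs (K n))" unfolding El_Vs[of "K n"] using n(2) e(2) by blast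
    then obtain y where "y \<in> El (Vs (K (sc n)))" "R c y" using K2[OF n(1)] unfolding Q_def by blast
    then show ?thesis using Vs_mono[OF Kd[OF om_sc[OF n(1)]]] by blast
  qed
  moreover have "om \<in> El d" using oa Kd[OF om_emp] K(2) by auto
  ultimately show ?thesis using lim by blast
qed

lemma ex_Lim: "\<exists>d. Lim d \<and> w \<in> El (Vs d)"
proof -
  have "DP (\<lambda>s. s 0 = s 0)" by (intro dfn)
  then show ?thesis using reflect[of "\<lambda>c y. c = c" w] by blast
qed

lemma DP_ball_lt: "(\<And>i. DP (P i)) \<Longrightarrow> DP (\<lambda>s. \<forall>i<(N::nat). P i s)"
proof (induction N)
  case (Suc N)
  have "DP (\<lambda>s. (\<forall>i<N. P i s) \<and> P N s)" by (intro dfn Suc)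
  then show ?case by (rule back_subst[of DP]) (auto simp: less_Suc_eq)
qed (simp add: DP_true)

lemma DT_cp[dfn]: "DT f \<Longrightarrow> DT (\<lambda>s. cp i (f s))"
  by (induction i arbitrary: f) (auto intro: dfn)

lemma DP_UNIV[dfn]: "DP (\<lambda>s. f s \<in> UNIV)" by (simp add: DP_true)

text \<open>Asks only that \<open>P\<close> consist of some vertices and some edges of the product
  of \<open>S\<close>. This is a bounded condition, hence inherited by the images under
  \<open>j\<close>, and it suffices for evaluation at a coordinate.\<close>

definition "PV P S \<longleftrightarrow> (\<forall>f\<in>El (p1 P). fn f S \<and> (\<forall>A\<in>El S. \<exists>z\<in>El f. p1 z = A \<and> p2 z \<in> El (p1 A))) \<and>
  (\<forall>z\<in>El (p2 P). ispr z \<and> p1 z \<in> El (p1 P) \<and> p2 z \<in> El (p1 P) \<and>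
    (\<forall>A\<in>El S. \<exists>u\<in>El (p1 z). \<exists>w\<in>El (p2 z). p1 u = A \<and> p1 w = A \<and> pr (p2 u) (p2 w) \<in> El (p2 A)))"
lemma D0_PV[dz]: "TD f \<Longrightarrow> TD g \<Longrightarrow> D0 (\<lambda>s. PV (f s) (g s))"
  by (rule D0_app2[of PV], unfold PV_def, intro dz)

lemma fn_el: "fn f a \<Longrightarrow> x \<in> El a \<Longrightarrow> pr x (ap f x) \<in> El f" using fn_pr by blast
lemma fn_ex: assumes "fn f a" "x \<in> El a" shows "(\<exists>z\<in>El f. p1 z = x \<and> Q (p2 z)) \<longleftrightarrow> Q (ap f x)"
  using fn_El[OF assms(1)] assms(2) by auto

lemma ex_ap2: assumes "fn f a" "x \<in> El a" "fn g b" "y \<in> El b"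
  shows "(\<exists>u\<in>El f. \<exists>w\<in>El g. p1 u = x \<and> p1 w = y \<and> R (p2 u) (p2 w)) \<longleftrightarrow> R (ap f x) (ap g y)"
  using fn_ex[OF assms(1,2), of "\<lambda>c. \<exists>w\<in>El g. p1 w = y \<and> R c (p2 w)"] fn_ex[OF assms(3,4), of "R (ap f x)"] by blast

lemma PV_iff: "PV P S \<longleftrightarrow> (\<forall>f\<in>El (p1 P). fn f S \<and> (\<forall>A\<in>El S. ap f A \<in> El (p1 A))) \<and>
  (\<forall>z\<in>El (p2 P). ispr z \<and> p1 z \<in> El (p1 P) \<and> p2 z \<in> El (p1 P) \<and>
    (\<forall>A\<in>El S. pr (ap (p1 z) A) (ap (p2 z) A) \<in> El (p2 A)))" (is "?L \<longleftrightarrow> ?R")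
proof -
  have 1: "(\<forall>f\<in>El (p1 P). fn f S \<and> (\<forall>A\<in>El S. \<exists>z\<in>El f. p1 z = A \<and> p2 z \<in> El (p1 A))) \<longleftrightarrow>
    (\<forall>f\<in>El (p1 P). fn f S \<and> (\<forall>A\<in>El S. ap f A \<in> El (p1 A)))" (is "?a \<longleftrightarrow> ?b")
    using fn_ex[of _ S _ "\<lambda>x. x \<in> El (p1 _)"] by blast
  have 2: "(\<exists>u\<in>El f. \<exists>w\<in>El g. p1 u = A \<and> p1 w = A \<and> pr (p2 u) (p2 w) \<in> El (p2 A)) \<longleftrightarrow> pr (ap f A) (ap g A) \<in> El (p2 A)"
    if "fn f S" "fn g S" "A \<in> El S" for f g A by (rule ex_ap2[OF that(1,3,2,3)])
  show ?thesis unfolding PV_def 1 using 2 by blast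
qed

lemma PV_pg: "PV (pg S) S"
  unfolding PV_iff pg_def by (auto simp: El_pe El_pv)

end

lemma (in emb) eval_hom: assumes "PV P S" "G \<in> El (j S)" shows "hm (lam (p1 P) (\<lambda>f. ap (j f) G)) P G"
proof -
  have d: "DT (\<lambda>s. ap (j (s 0)) G)" by (intro dfn)
  have "PV (j P) (j S)" using assms(1) by (subst j0_2[of PV]) (intro dz)
  then have "(\<forall>f\<in>El (p1 (j P)). ap f G \<in> El (p1 G)) \<and> (\<forall>z\<in>El (p2 (j P)). pr (ap (p1 z) G) (ap (p2 z) G) \<in> El (p2 G))"
    unfolding PV_iff using assms(2) by blast
  moreover have "j f \<in> El (p1 (j P))" if "f \<in> El (p1 P)" for f using that by (simp add: j_p1[symmetric])
  moreover have "pr (j f) (j g) \<in> El (p2 (j P))" if "pr f g \<in> El (p2 P)" for f g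
    using that by (simp add: j_p2[symmetric] j_pr[symmetric])
  ultimately show ?thesis unfolding hm_iff using fn_lam[OF d] ap_lam[OF d] by (auto; metis p1 p2)
qed

text \<open>\<open>v\<close> and \<open>S\<close> are passed as values of two variables above those
  of \<open>\<phi>\<close>, which makes "every point of \<open>v\<close> in the class lies in
  \<open>S\<close>" a single formula; in \<open>M\<close> it speaks of the class as defined
  there.\<close>

lemma (in emb) cut_transfer:
  assumes N: "fv \<phi> \<subseteq> {..<N}" and "\<And>x. x \<in> El v \<Longrightarrow> sat E UNIV (s(0:=x)) \<phi> \<Longrightarrow> x \<in> El S"
    and x: "x \<in> M" "sat E M ((j \<circ> s)(0:=x)) \<phi>" "x \<in> El (j v)"
  shows "x \<in> El (j S)"
proof -
  define u where "u = s(Suc N := v, Suc (Suc N) := S)"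
  have c: "sat E D (u'(0:=y)) \<phi> = sat E D (s'(0:=y)) \<phi>" if "u' = s'(Suc N := a, Suc (Suc N) := b)" for D u' s' a b y
    unfolding that by (rule sat_cong) (use N in auto)
  let ?f = "All 0 (Neg (And \<phi> (And (Mem 0 (Suc N)) (Neg (Mem 0 (Suc (Suc N)))))))"
  have "sat E UNIV u ?f" using assms(2) by (simp add: c[OF u_def]) (auto simp: u_def elts_def)
  then have "sat E M (j \<circ> u) ?f" using elem by blast
  moreover have "j \<circ> u = (j \<circ> s)(Suc N := j v, Suc (Suc N) := j S)" by (auto simp: u_def)
  ultimately show ?thesis using x by (auto simp: c elts_def)
qed

context zfc
begin

text \<open>Otherwise let \<open>bad a G\<close> say that \<open>G\<close> in \<open>C\<close> has no homomorphism from the product over \<open>C \<inter> V\<^sub>a\<close>. For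
  \<open>a < k\<close> the least rank of such a \<open>G\<close> is fixed by \<open>j\<close>, hence below \<open>k\<close> by Kunen's theorem. By
  elementarity some \<open>G\<close> in \<open>j (C \<inter> V\<^sub>k)\<close> is bad at \<open>k\<close> in the sense of \<open>M\<close>, but evaluation
  \<open>f \<mapsto> j f G\<close> is a homomorphism in \<open>M\<close>.\<close>

theorem strong_PRP:
  assumes pc: "proper_class E {\<kappa>. strong E (Pi_fm (Suc m)) \<kappa>}"
  shows "PRP E (Sigma_fm (Suc (Suc m)))"
  unfolding PRP_def
proof (intro allI impI, elim conjE, rule ccontr)
  fix C assume "definable E (Sigma_fm (Suc (Suc m))) C" and gr: "\<forall>\<A>\<in>C. is_graph E \<A>"
    and noS: "\<not> (\<exists>S. El S \<subseteq> C \<and> (\<forall>G\<in>C. \<exists>h. hom E h (prod_graph E S) G))"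
  then obtain \<phi> s where phi: "\<phi> \<in> Ex_block (Pi_fm (Suc m))" and C: "C = {x. sat E UNIV (s(0 := x)) \<phi>}"
    unfolding definable_def by auto
  obtain \<psi> X where \<psi>: "\<psi> \<in> Pi_fm (Suc m)"
    and "\<forall>E (D :: 'a set) s. sat E D s \<phi> \<longleftrightarrow> (\<exists>t. (\<forall>i. i \<notin> X \<longrightarrow> t i = s i) \<and> (\<forall>i\<in>X. t i \<in> D) \<and> sat E D t \<psi>)"
    using Ex_block_witness[OF phi, where 'b='a] by (elim bexE exE conjE) (assumption | rule that)+
  then have wit: "\<And>E (D :: 'a set) s. sat E D s \<phi> \<longleftrightarrow> (\<exists>t. (\<forall>i. i \<notin> X \<longrightarrow> t i = s i) \<and> (\<forall>i\<in>X. t i \<in> D) \<and> sat E D t \<psi>)" by simp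
  obtain N1 N2 where "fv \<phi> \<subseteq> {..<N1}" "fv \<psi> \<subseteq> {..<N2}" using fv_bound by metis
  then obtain N where N: "fv \<phi> \<subseteq> {..<N}" "fv \<psi> \<subseteq> {..<N}" by (meson lessThan_subset_iff max.cobounded1 max.cobounded2 order_trans)
  obtain \<chi> where \<chi>: "\<chi> \<in> Pi_fm (Suc m)" "fv \<chi> \<subseteq> {0}" "\<And>s. sat E UNIV s \<chi> \<longleftrightarrow> sat E UNIV (\<lambda>i. cp i (s 0)) \<psi>"
    using code_formula[OF \<psi>] by blast
  have "DP (\<lambda>s. s 0 \<in> C)" unfolding definable_DP[symmetric] definable_def C by blast
  note [dfn] = DP_app1[OF this]
  \<comment> \<open>The parameters lie below \<open>r\<close> and hence below \<open>k\<close>, so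
    \<open>j\<close> will fix them.\<close>
  obtain r where r: "Od r" "\<And>i. i < N \<Longrightarrow> s i \<in> El (Vs r)"
  proof -
    obtain a where "Od a" "mk (s ` {..<N}) \<in> El (Vs a)" using ex_Vs_mem by blast
    moreover have "El (mk (s ` {..<N})) = s ` {..<N}" by (intro El_mk isS_finite) simp
    ultimately show thesis using that[of a] Vs_trans[of "mk (s ` {..<N})" a] by (simp add: image_subset_iff)
  qed
  obtain k where k: "strong E (Pi_fm (Suc m)) k" "k \<notin> El (sc r)"
    using pc unfolding proper_class_def by blast
  then have ok: "Od k" using Od_emp unfolding strong_def lam_strong_def Card_def by blast
  have rk: "r \<in> El k" using Od_lin[OF ok r(1)] k(2) by auto
  define cut where "cut a = sep (Vs a) (\<lambda>G. G \<in> C)" for a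
  have cut: "El (cut a) = {G \<in> El (Vs a). G \<in> C}" for a unfolding cut_def by (rule El_sep) (intro dfn)
  have [dfn]: "DT f \<Longrightarrow> DT (\<lambda>s. cut (f s))" for f by (rule DT_app1, unfold cut_def, intro dfn)
  define bad where "bad a G \<longleftrightarrow> G \<in> C \<and> \<not> (\<exists>h. hm h (pg (cut a)) G)" for a G
  have [dfn]: "DT f \<Longrightarrow> DT g \<Longrightarrow> DP (\<lambda>s. bad (f s) (g s))" for f g by (rule DP_app2, unfold bad_def, intro dfn)
  have ex_bad: "\<exists>G. bad a G" for a
  proof -
    have "El (cut a) \<subseteq> C" using cut by auto
    then obtain G where G: "G \<in> C" "\<not> (\<exists>h. hom E h (prod_graph E (cut a)) G)" using noS by blast
    have "prod_graph E (cut a) = pg (cut a)" by (rule prod_graph_pg) (use gr cut in blast)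
    then have "\<not> (\<exists>h. hm h (pg (cut a)) G)" using G hom_hm[of "pg (cut a)" G] graph_pr gr by (auto simp: pg_def)
    then show ?thesis unfolding bad_def using G by blast
  qed
  define mb where "mb a G \<longleftrightarrow> bad a G \<and> (\<forall>H. bad a H \<longrightarrow> rk H \<notin> El (rk G))" for a G
  have ex_mb: "\<exists>G. mb a G" for a
  proof -
    obtain G where "bad a G" using ex_bad by blast
    then have "\<exists>H. bad a H \<and> rk H = rk G" by blast
    from Od_least[of "\<lambda>b. \<exists>H. bad a H \<and> rk H = b", OF _ Od_rk this]
    show ?thesis unfolding mb_def by (auto simp: dfn)
  qed
  have "DP (\<lambda>s. mb (s 0) (s 1))" unfolding mb_def by (intro dfn)
  from collect[OF this, of "sc k"] obtain B where B: "\<And>a. a \<in> El (sc k) \<Longrightarrow> \<exists>G\<in>El B. mb a G" using ex_mb by blast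
  \<comment> \<open>\<open>q\<close> codes an assignment that witnesses membership of
    \<open>G\<close> in \<open>C\<close>: the variables in \<open>X\<close> are free to choose, the
    others keep \<open>G\<close> and the parameters.\<close>
  define R where "R G q \<longleftrightarrow> sat E UNIV (\<lambda>i. cp i q) \<psi> \<and> (\<forall>i<N. i \<notin> X \<longrightarrow> cp i q = (if i = 0 then G else s i))" for G q
  have "DP (\<lambda>s. R (s 0) (s 1))" unfolding R_def by (intro DP_and DP_ball_lt DP_imp DP_satM dfn)
  from collect[OF this, of B] obtain B2 where B2: "\<And>G q. G \<in> El B \<Longrightarrow> R G q \<Longrightarrow> \<exists>q\<in>El B2. R G q" by blast
  have exR: "\<exists>q. R G q" if "G \<in> C" for G
  proof -
    have "sat E UNIV (s(0 := G)) \<phi>" using that unfolding C by simp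
    then obtain t where t: "\<forall>i. i \<notin> X \<longrightarrow> t i = (s(0 := G)) i" "sat E UNIV t \<psi>" using wit[of E UNIV "s(0 := G)"] by blast
    have "sat E UNIV (\<lambda>i. cp i (tup N t)) \<psi> = sat E UNIV t \<psi>" by (rule sat_cong) (use N in auto)
    then have "R G (tup N t)" unfolding R_def using t by auto
    then show ?thesis by blast
  qed
  \<comment> \<open>\<open>l\<close> is above \<open>k\<close>, the collected minimal
    counterexamples and their witness tuples. Strongness at \<open>l\<close> for the class of
    \<open>\<chi>\<close> keeps these tuples valid in \<open>M\<close>.\<close>
  obtain l where l: "Lim l" "upr k (upr B B2) \<in> El (Vs l)" using ex_Lim by blast
  have ol: "Od l" using l(1) unfolding Lim_def by blast
  have kl: "k \<in> El (Vs l)" "upr B B2 \<in> El (Vs l)" using Vs_trans[OF l(2)] by auto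
  have Bl: "El B \<subseteq> El (Vs l)" "El B2 \<subseteq> El (Vs l)" using Vs_trans[OF kl(2)] Vs_trans[of B l] Vs_trans[of B2 l] by simp_all
  have "\<exists>j M. elementary_embedding E j M \<and> critical_point E j k \<and> El (Vset E l) \<subseteq> M \<and>
          extension E UNIV \<chi> \<inter> El (Vset E l) \<subseteq> extension E M \<chi>"
    using k(1) ol \<chi>(1,2) unfolding strong_def lam_strong_def by blast
  then obtain j M where em: "elementary_embedding E j M" and cr: "critical_point E j k" and VM: "El (Vs l) \<subseteq> M"
    and ext: "extension E UNIV \<chi> \<inter> El (Vs l) \<subseteq> extension E M \<chi>" unfolding Vset_Vs[OF ol] by blast
  interpret emb E j M by unfold_locales (rule em)
  have kj: "j k \<noteq> k" "\<And>a. a \<in> El k \<Longrightarrow> j a = a" using cr unfolding critical_point_def by auto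
  have fixk: "j x = x" if "x \<in> El (Vs k)" for x using j_fix[OF ok kj(2) that] by blast
  have kjk: "k \<in> El (j k)" using j_le[OF ok] kj(1) by auto
  have Limk: "Lim k" unfolding Lim_def
  proof (intro conjI ballI)
    show "emp \<in> El k" using rk Od_lin[of emp k] ok by auto
    fix a assume a: "a \<in> El k"
    have "sc a \<noteq> k" using kj a j_sc by metis
    moreover have "El (sc a) \<subseteq> El k" using a Od_trans[OF ok a] by simp
    ultimately show "sc a \<in> El k" using Od_sub[of "sc a" k] Od_mem[OF ok a] ok by simp
  qed (rule ok)
  have sj: "j (s i) = s i" if "i < N" for i
  proof -
    have "s i \<in> El (Vs k)" using r(2)[OF that] Vs_mono[OF Od_trans[OF ok rk]] by blast
    then show ?thesis by (rule fixk)
  qed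
  define CM where "CM = {x \<in> M. sat E M ((j \<circ> s)(0 := x)) \<phi>}"
  have GCM: "G \<in> CM" if G: "G \<in> El B" "G \<in> C" for G
  proof -
    obtain q where q: "q \<in> El B2" "R G q" using exR[OF G(2)] B2[OF G(1)] by blast
    have "q \<in> El (Vs l)" "G \<in> M" using q Bl VM G by auto
    then have qM: "q \<in> M" "sat E M (\<lambda>_. q) \<chi>"
      using subsetD[OF ext, of q] q(2) \<chi>(3)[of "\<lambda>_. q"] unfolding R_def extension_def by simp_all
    have 1: "sat E M (\<lambda>i. cp i q) \<psi>" using code_transfer[OF \<chi>(3) qM \<chi>(2)] .
    let ?t = "\<lambda>i. if i < N then cp i q else ((j \<circ> s)(0 := G)) i"
    have "sat E M ?t \<psi> = sat E M (\<lambda>i. cp i q) \<psi>" by (rule sat_cong) (use N in auto)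
    moreover have "\<forall>i. i \<notin> X \<longrightarrow> ?t i = ((j \<circ> s)(0 := G)) i" using q(2) sj unfolding R_def by auto
    moreover have "\<forall>i\<in>X. ?t i \<in> M" using cp_in_M[OF qM(1)] \<open>G \<in> M\<close> by auto
    ultimately have "sat E M ((j \<circ> s)(0 := G)) \<phi>" unfolding wit[of E M "(j \<circ> s)(0 := G)"] using 1 by (intro exI[of _ ?t] conjI) simp_all
    then show ?thesis unfolding CM_def using \<open>G \<in> M\<close> by blast
  qed
  have CMcut: "G \<in> El (j (cut a))" if "G \<in> CM" "G \<in> El (j (Vs a))" for G a
    by (rule cut_transfer[OF N(1), of "Vs a" s]) (use that in \<open>auto simp: CM_def cut C\<close>)
  have VlM: "El (Vs a) \<subseteq> M" if "a \<in> El l" for a using Vs_mono[OF Od_trans[OF ol that]] VM by blast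
  have closed: "\<exists>G\<in>El (cut k). bad a G" if a: "a \<in> El k" for a
  proof -
    have "a \<in> El (sc k)" using a by simp
    then obtain G where G: "G \<in> El B" "mb a G" using B by blast
    then have GC: "G \<in> C" unfolding mb_def bad_def by blast
    define b where "b = rk G"
    have bl: "b \<in> El l" using Bl(1) G(1) Vs_rk_iff[OF ol] unfolding b_def by blast
    have sbl: "sc b \<in> El l" using bl l(1) unfolding Lim_def by blast
    have cutV: "cut a \<in> El (Vs k)" unfolding El_Vs[of k] using a cut by blast
    then have jP: "j (pg (cut a)) = pg (cut a)" using fixk Vs_pg[OF Limk] by blast
    \<comment> \<open>If \<open>b\<close> moved up, \<open>G\<close> would be in
      \<open>j (cut b)\<close>. By minimality all members of \<open>cut b\<close> receive
      homomorphisms from the product of \<open>cut a\<close>, a set fixed by \<open>j\<close>, so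
      \<open>G\<close> would receive one too.\<close>
    have "j b = b"
    proof (rule ccontr)
      assume "j b \<noteq> b"
      then have "b \<in> El (j b)" using j_le[of b] by (simp add: b_def)
      then have "El (sc b) \<subseteq> El (j b)" using Od_trans[of "j b" b] by (simp add: b_def)
      then have "El (Vs (sc b)) \<subseteq> El (j (Vs b))" using j_Vs_sub2[of b "sc b"] VlM[OF sbl] by (simp add: b_def)
      then have Gb: "G \<in> El (j (Vs b))" using Vs_rk_iff[of "sc b" G] by (auto simp: b_def)
      have "\<exists>h. hm h (pg (cut a)) H" if "H \<in> El (cut b)" for H
      proof -
        have "rk H \<in> El b" "H \<in> C" using that Vs_rk_iff[of b H] unfolding cut by (auto simp: b_def)
        then show ?thesis using G(2) unfolding mb_def b_def bad_def by blast
      qed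
      moreover have "DP (\<lambda>s. hm (s 1) (pg (cut a)) (s 0))" by (intro dfn)
      ultimately obtain Hs where "\<forall>H\<in>El (cut b). \<exists>h\<in>El Hs. hm h (pg (cut a)) H"
        using collect[of "\<lambda>H h. hm h (pg (cut a)) H" "cut b"] by blast
      then have "\<forall>H\<in>El (j (cut b)). \<exists>h\<in>El (j Hs). hm h (j (pg (cut a))) H"
        by (subst j0_3[of "\<lambda>x y z. \<forall>H\<in>El x. \<exists>h\<in>El y. hm h z H"]) (intro dz)
      then show False using CMcut[OF GCM[OF G(1) GC] Gb] G(2) jP unfolding mb_def bad_def by auto
    qed
    then have "k \<notin> El (sc b)" using kunen[OF cr _ _ _ VlM[OF sbl]] by (auto simp: b_def)
    then have "b \<in> El k" using Od_lin[OF ok, of b] by (auto simp: b_def)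
    then have "G \<in> El (cut k)" unfolding cut using Vs_rk_iff[OF ok] GC by (auto simp: b_def)
    then show ?thesis using G(2) unfolding mb_def by blast
  qed
  obtain G0 where G0: "G0 \<in> El B" "bad k G0" using B[of k] unfolding mb_def by auto
  \<comment> \<open>Evaluation keeps \<open>G0\<close> out of \<open>j (cut k)\<close>, so its rank
    is at least \<open>j k\<close>. Hence \<open>j k\<close> is below \<open>l\<close> and the level
    \<open>Vs (j k)\<close> lies in \<open>M\<close>, which at the end places the evaluation map
    inside \<open>j (Vs k)\<close>.\<close>
  have "G0 \<notin> El (j (Vs k))"
  proof
    assume "G0 \<in> El (j (Vs k))"
    then have "G0 \<in> El (j (cut k))" using CMcut GCM G0 unfolding bad_def by blast
    then show False using eval_hom[OF PV_pg] G0(2) unfolding bad_def by blast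
  qed
  have "rk G0 \<notin> El (j k)"
  proof
    assume h: "rk G0 \<in> El (j k)"
    have "rk G0 \<in> El l" using Bl(1) G0(1) Vs_rk_iff[OF ol] by blast
    then have "El (Vs (sc (rk G0))) \<subseteq> M" using VlM l(1) unfolding Lim_def by blast
    moreover have "El (sc (rk G0)) \<subseteq> El (j k)" using h Od_trans[of "j k" "rk G0"] ok by simp
    ultimately have "El (Vs (sc (rk G0))) \<subseteq> El (j (Vs k))" using j_Vs_sub2[OF ok, of "sc (rk G0)"] by simp
    then show False using \<open>G0 \<notin> El (j (Vs k))\<close> Vs_rk_iff[of "sc (rk G0)" G0] by auto
  qed
  then have "El (j k) \<subseteq> El (rk G0)" using Od_le[of "rk G0" "j k"] ok by simp
  moreover have "rk G0 \<in> El l" using Bl(1) G0(1) Vs_rk_iff[OF ol] by blast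
  ultimately have jkl: "j k \<in> El l" using Od_sub_mem[of "j k" l "rk G0"] ok ol by simp
  have Limjk: "Lim (j k)"
  proof -
    have "(\<exists>e\<in>El (j k). e = emp) \<and> (\<forall>a\<in>El (j k). \<exists>b\<in>El (j k). b = sc a)"
      by (subst j0_1[of "\<lambda>k. (\<exists>e\<in>El k. e = emp) \<and> (\<forall>a\<in>El k. \<exists>b\<in>El k. b = sc a)"]) (intro dz, use Limk in \<open>auto simp: Lim_def\<close>)
    then show ?thesis unfolding Lim_def using ok by auto
  qed
  define pf where "pf = lam k (\<lambda>a. pg (cut a))"
  define cf where "cf = lam k cut"
  have dd: "DT (\<lambda>s. pg (cut (s 0)))" "DT (\<lambda>s. cut (s 0))" by (intro dfn)+
  have fpf: "fn pf k" "\<And>a. a \<in> El k \<Longrightarrow> ap pf a = pg (cut a)" unfolding pf_def by (rule fn_lam[OF dd(1)], rule ap_lam[OF dd(1)])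
  have fcf: "fn cf k" "\<And>a. a \<in> El k \<Longrightarrow> ap cf a = cut a" unfolding cf_def by (rule fn_lam[OF dd(2)], rule ap_lam[OF dd(2)])
  note Epf = fn_El[OF fpf(1)] note Ecf = fn_El[OF fcf(1)]
  \<comment> \<open>Entry \<open>k\<close> in the images of the two sequences: what \<open>M\<close>
    takes for the product at \<open>k\<close> and for its set of factors. Of \<open>S\<close> it is
    only used that it contains \<open>cut k\<close>.\<close>
  define P where "P = ap (j pf) k"
  define S where "S = ap (j cf) k"
  have Pp: "pr k P \<in> El (j pf)" unfolding P_def using fn_el[of "j pf" "j k" k] fpf(1) kjk by simp
  have Sp: "pr k S \<in> El (j cf)" unfolding S_def using fn_el[of "j cf" "j k" k] fcf(1) kjk by simp
  have "\<forall>p\<in>El (j pf). \<forall>q\<in>El (j cf). p1 p = p1 q \<longrightarrow> PV (p2 p) (p2 q)"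
    by (subst j0_2[of "\<lambda>x y. \<forall>p\<in>El x. \<forall>q\<in>El y. p1 p = p1 q \<longrightarrow> PV (p2 p) (p2 q)"], intro dz)
      (auto simp: Epf Ecf fpf(2) fcf(2) PV_pg)
  then have PVPS: "PV P S" using Pp Sp by (metis p1 p2)
  have "\<forall>q\<in>El (j cf). \<forall>r\<in>El (j cf). p1 q \<in> El (p1 r) \<longrightarrow> El (p2 q) \<subseteq> El (p2 r)"
  proof (subst j0_1[of "\<lambda>x. \<forall>q\<in>El x. \<forall>r\<in>El x. p1 q \<in> El (p1 r) \<longrightarrow> El (p2 q) \<subseteq> El (p2 r)"])
    have cm: "El (cut a) \<subseteq> El (cut b)" if "a \<in> El b" "b \<in> El k" for a b
      using Vs_mono[OF Od_trans[OF Od_mem[OF ok that(2)] that(1)]] unfolding cut by auto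
    show "\<forall>q\<in>El cf. \<forall>r\<in>El cf. p1 q \<in> El (p1 r) \<longrightarrow> El (p2 q) \<subseteq> El (p2 r)"
    proof (intro ballI impI)
      fix q r assume "q \<in> El cf" "r \<in> El cf" "p1 q \<in> El (p1 r)"
      moreover from this have "p2 q = cut (p1 q)" "p2 r = cut (p1 r)" "p1 r \<in> El k" by (auto simp: Ecf fcf(2))
      ultimately show "El (p2 q) \<subseteq> El (p2 r)" using cm by simp
    qed
  qed (intro dz)
  then have mono: "El c \<subseteq> El S" if "pr a c \<in> El (j cf)" "a \<in> El k" for a c using that Sp by (metis p1 p2)
  have cutS: "El (cut k) \<subseteq> El S"
  proof
    fix x assume x: "x \<in> El (cut k)"
    define a where "a = sc (rk x)"
    have ak: "a \<in> El k" using x Vs_rk_iff[OF ok] Limk unfolding cut a_def Lim_def by blast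
    have "x \<in> El (cut a)" using x Vs_rk_iff[of a x] unfolding cut by (auto simp: a_def)
    moreover have "j (cut a) = cut a" by (rule fixk) (use ak cut in \<open>auto simp: El_Vs[of k]\<close>)
    then have "pr a (cut a) \<in> El (j cf)" using j_mem[of "pr a (cut a)" cf] fn_el[OF fcf(1) ak] fcf(2)[OF ak] kj(2)[OF ak] by (metis j_pr)
    ultimately show "x \<in> El S" using mono ak by blast
  qed
  have "\<forall>p\<in>El (j pf). p2 p \<in> El (j (Vs k))"
  proof (subst j0_2[of "\<lambda>x y. \<forall>p\<in>El x. p2 p \<in> El y"])
    have "pg (cut a) \<in> El (Vs k)" if "a \<in> El k" for a
      by (rule Vs_pg[OF Limk]) (use that cut in \<open>auto simp: El_Vs[of k]\<close>)
    then show "\<forall>p\<in>El pf. p2 p \<in> El (Vs k)" by (auto simp: Epf fpf(2))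
  qed (intro dz)
  then have PV1: "P \<in> El (Vs (j k))" using Pp j_Vs_le[OF ok] by force
  \<comment> \<open>Homomorphisms are searched for in \<open>Vs k\<close> only, to keep the
    statement bounded.\<close>
  have "\<forall>a\<in>El (j k). \<exists>G\<in>El (j (cut k)). \<forall>h\<in>El (j (Vs k)). \<forall>p\<in>El (j pf). p1 p = a \<longrightarrow> \<not> hm h (p2 p) G"
  proof (subst j0_4[of "\<lambda>k c v f. \<forall>a\<in>El k. \<exists>G\<in>El c. \<forall>h\<in>El v. \<forall>p\<in>El f. p1 p = a \<longrightarrow> \<not> hm h (p2 p) G"])
    show "\<forall>a\<in>El k. \<exists>G\<in>El (cut k). \<forall>h\<in>El (Vs k). \<forall>p\<in>El pf. p1 p = a \<longrightarrow> \<not> hm h (p2 p) G"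
    proof
      fix a assume a: "a \<in> El k"
      obtain G where "G \<in> El (cut k)" "bad a G" using closed[OF a] by blast
      then show "\<exists>G\<in>El (cut k). \<forall>h\<in>El (Vs k). \<forall>p\<in>El pf. p1 p = a \<longrightarrow> \<not> hm h (p2 p) G"
        using fpf(2)[OF a] unfolding bad_def Epf by (intro bexI[of _ G]) auto
    qed
  qed (intro dz)
  then obtain G where G: "G \<in> El (j (cut k))" "\<And>h. h \<in> El (j (Vs k)) \<Longrightarrow> \<not> hm h P G" using kjk Pp by force
  define h where "h = lam (p1 P) (\<lambda>f. ap (j f) G)"
  have "G \<in> El (j S)" using G(1) cutS j_sub by blast
  then have hh: "hm h P G" unfolding h_def by (rule eval_hom[OF PVPS])
  have "El (cut k) \<subseteq> El (Vs k)" using cut by auto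
  then have "G \<in> El (Vs (j k))" using G(1) j_Vs_le[OF ok] j_sub[of "cut k" "Vs k"] by blast
  then have "tms (p1 P) (p1 G) \<in> El (Vs (j k))" by (intro Vs_tms[OF Limjk] Vs_p1 PV1)
  moreover have "El h \<subseteq> El (tms (p1 P) (p1 G))" using hh fn_El[of h "p1 P"] unfolding hm_iff by auto
  ultimately have "h \<in> El (Vs (j k))" using Vs_sub by blast
  then have "h \<in> El (j (Vs k))" using j_Vs_sub2[OF ok, of "j k"] ok VlM[OF jkl] by auto
  then show False using G(2) hh by blast
qed

subsection \<open>Product reflection refutes descending sequences\<close>

text \<open>With \<open>b\<close> above the indices of \<open>S\<close>, chosen homomorphisms from
  \<open>G b\<close> to the members of \<open>S\<close> are the coordinates of one into the product.
  Composed with a homomorphism from the product to \<open>G (sc b)\<close>, it climbs from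
  \<open>b\<close> to its successor.\<close>

lemma no_descending_sequence:
  assumes dG: "DP (\<lambda>s. Od (s 0) \<and> G (s 0) = s 1)" and gr: "\<And>a. Od a \<Longrightarrow> is_graph E (G a)"
    and dn: "\<And>a b. Od a \<Longrightarrow> Od b \<Longrightarrow> a \<in> El b \<Longrightarrow> \<exists>h. hom E h (G b) (G a)"
    and up: "\<And>a b. Od a \<Longrightarrow> Od b \<Longrightarrow> a \<in> El b \<Longrightarrow> \<not> (\<exists>h. hom E h (G a) (G b))"
    and S: "El S \<subseteq> {G a |a. Od a}" "\<And>x. x \<in> {G a |a. Od a} \<Longrightarrow> \<exists>h. hom E h (prod_graph E S) x"
  shows False
proof -
  have hh: "hom E h (G a) (G b) \<longleftrightarrow> hm h (G a) (G b)" if "Od a" "Od b" for h a b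
    using hom_hm graph_pr gr that by blast
  have "DP (\<lambda>s. Od (s 1) \<and> G (s 1) = s 0)" using DP_sub[OF dG, of "\<lambda>n. if n = 0 then 1 else 0"] by simp
  from collect[OF this, of S] obtain B where B: "\<And>A. A \<in> El S \<Longrightarrow> \<exists>a\<in>El B. Od a \<and> G a = A" using S(1) by blast
  have "El (sep B Od) = {a \<in> El B. Od a}" by (rule El_sep) (intro dfn)
  then obtain b where b: "Od b" "\<And>a. a \<in> El B \<Longrightarrow> Od a \<Longrightarrow> a \<in> El b" using Od_bound[of "sep B Od"] by auto
  have "DP (\<lambda>s. hm (s 1) (G b) (s 0))" by (intro dfn)
  moreover have "\<exists>h. hm h (G b) A" if A: "A \<in> El S" for A
  proof -
    obtain a where "a \<in> El B" "Od a" "G a = A" using B[OF A] by blast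
    then show ?thesis using dn[of a b] b hh[of b a] by blast
  qed
  ultimately have "\<exists>f. fn f S \<and> (\<forall>A\<in>El S. hm (ap f A) (G b) A)" by (rule AC_rel)
  then obtain f where f: "\<And>A. A \<in> El S \<Longrightarrow> hm (ap f A) (G b) A" by blast
  let ?l = "\<lambda>x. lam S (\<lambda>A. ap (ap f A) x)"
  have d: "DT (\<lambda>s. ap (ap f (s 0)) x)" for x by (intro dfn)
  have d2: "DT (\<lambda>s. ?l (s 0))" by (intro dfn)
  have lv: "?l x \<in> El (pv S)" if "x \<in> El (p1 (G b))" for x
    using that f unfolding El_pv hm_iff by (auto simp: fn_lam[OF d] ap_lam[OF d])
  have hb: "hm (lam (p1 (G b)) ?l) (G b) (pg S)"
    unfolding hm_iff pg_def p1 p2 El_pe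
  proof (intro conjI ballI impI)
    show "fn (lam (p1 (G b)) ?l) (p1 (G b))" by (rule fn_lam[OF d2])
    fix x assume x: "x \<in> El (p1 (G b))"
    show "ap (lam (p1 (G b)) ?l) x \<in> El (pv S)" unfolding ap_lam[OF d2 x] by (rule lv[OF x])
    fix y assume y: "y \<in> El (p1 (G b))" and e: "pr x y \<in> El (p2 (G b))"
    have "pr (ap (?l x) A) (ap (?l y) A) \<in> El (p2 A)" if "A \<in> El S" for A
      unfolding ap_lam[OF d that] using f[OF that] x y e unfolding hm_iff by blast
    then show "pr (ap (lam (p1 (G b)) ?l) x) (ap (lam (p1 (G b)) ?l) y) \<in> {pr f g |f g. f \<in> El (pv S) \<and> g \<in> El (pv S) \<and> (\<forall>A\<in>El S. pr (ap f A) (ap g A) \<in> El (p2 A))}"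
      unfolding ap_lam[OF d2 x] ap_lam[OF d2 y] using lv x y by blast
  qed
  have "Od (sc b)" using b(1) by simp
  then obtain h where "hom E h (prod_graph E S) (G (sc b))" using S(2) by blast
  moreover have "prod_graph E S = pg S" by (rule prod_graph_pg) (use S(1) gr in blast)
  ultimately have "hm h (pg S) (G (sc b))"
    using hom_hm[of "pg S" "G (sc b)"] graph_pr[OF gr[OF \<open>Od (sc b)\<close>]] by (simp add: pg_def)
  then obtain l where "hm l (G b) (G (sc b))" using hm_comp[OF hb] by blast
  then show False using up[of b "sc b"] hh[of b "sc b"] b(1) by auto
qed

text \<open>Otherwise Collection would gather an index for each member in one set, and injectivity
  would put all ordinals into it.\<close>

lemma sequence_proper_class:
  assumes dG: "DP (\<lambda>s. Od (s 0) \<and> G (s 0) = s 1)"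
    and up: "\<And>a b. Od a \<Longrightarrow> Od b \<Longrightarrow> a \<in> El b \<Longrightarrow> G a \<noteq> G b"
  shows "proper_class E {G a |a. Od a}"
  unfolding proper_class_def
proof
  assume "\<exists>x. {G a |a. Od a} \<subseteq> El x"
  then obtain X where X: "\<And>a. Od a \<Longrightarrow> G a \<in> El X" by blast
  have "DP (\<lambda>s. Od (s 1) \<and> G (s 1) = s 0)" using DP_sub[OF dG, of "\<lambda>n. if n = 0 then 1 else 0"] by simp
  from collect[OF this, of X] obtain B where B: "\<And>a. Od a \<Longrightarrow> \<exists>b\<in>El B. Od b \<and> G b = G a" using X by blast
  have "a \<in> El B" if a: "Od a" for a
  proof -
    obtain b where "b \<in> El B" "Od b" "G b = G a" using B[OF a] by blast
    then show ?thesis using up a Od_lin[of a b] by metis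
  qed
  then show False using no_Od_set by blast
qed

lemma seq_DP: assumes "definable_seq E \<Gamma> G" shows "DP (\<lambda>s. Od (s 0) \<and> G (s 0) = s 1)"
proof -
  have "DP (\<lambda>s. s 0 \<in> {pr a (G a) |a. Od a})"
    using assms unfolding definable_DP[symmetric] definable_seq_def definable_def by blast
  from DP_app1[OF this, of "\<lambda>s. pr (s 0) (s 1)"] show ?thesis by (simp add: dfn conj_commute eq_commute)
qed

lemma id_hm: "A = pr (p1 A) (p2 A) \<Longrightarrow> \<exists>h. hom E h A A"
proof -
  assume A: "A = pr (p1 A) (p2 A)"
  have d: "DT (\<lambda>s. s 0)" by (intro dfn)
  have "hm (lam (p1 A) (\<lambda>x. x)) A A" unfolding hm_iff by (simp add: fn_lam[OF d] ap_lam[OF d])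
  then show ?thesis using hom_hm A by blast
qed

theorem PRP_SWVP: assumes "PRP E (Sigma_fm (Suc k))" shows "SWVP E (Sigma_fm (Suc k))"
  unfolding SWVP_def
proof (rule notI, elim exE conjE)
  fix G assume sq: "definable_seq E (Sigma_fm (Suc k)) G" and gr: "\<forall>a. Od a \<longrightarrow> is_graph E (G a)"
    and dn: "\<forall>a b. Od a \<and> Od b \<and> (a \<in> El b \<or> a = b) \<longrightarrow> (\<exists>h. hom E h (G b) (G a))"
    and up: "\<forall>a b. Od a \<and> Od b \<and> a \<in> El b \<longrightarrow> \<not> (\<exists>h. hom E h (G a) (G b))"
  let ?C = "{G a |a. Od a}"
  note d = seq_DP[OF sq]
  have "G a \<noteq> G b" if "Od a" "Od b" "a \<in> El b" for a b
    using up that id_hm[OF graph_pr] gr by metis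
  then have pc: "proper_class E ?C" by (rule sequence_proper_class[OF d])
  obtain \<phi> s where \<phi>: "\<phi> \<in> Sigma_fm (Suc k)" "{pr a (G a) |a. Od a} = {x. sat E UNIV (s(0 := x)) \<phi>}"
    using sq unfolding definable_seq_def definable_def by blast
  \<comment> \<open>The range of the sequence is a projection of its graph. The additional
    existential quantifiers are absorbed on the Sigma side only, so this route does not serve the Pi
    principles.\<close>
  have "SG (Suc k) (\<lambda>t. \<exists>z a. z = pr a (t 0) \<and> sat E UNIV (t(0 := z)) \<phi>)"
  proof (intro SG_ex SG_and)
    show "SG (Suc k) (\<lambda>s. s (Suc 0) = pr (s 0) (s (Suc (Suc 0))))" by (intro D0_SG dz)
    have "SG (Suc k) (\<lambda>s. sat E UNIV (\<lambda>n. s (if n = 0 then Suc 0 else Suc (Suc n))) \<phi>)"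
      by (rule SG_sub[OF FD_fm[OF \<phi>(1)]])
    moreover have "(\<lambda>n. s (if n = 0 then Suc 0 else Suc (Suc n))) = (\<lambda>n. s (Suc (Suc n)))(0 := s (Suc 0))" for s :: "nat \<Rightarrow> 'a" by auto
    ultimately show "SG (Suc k) (\<lambda>s. sat E UNIV ((\<lambda>n. s (Suc (Suc n)))(0 := s (Suc 0))) \<phi>)" by (simp only:)
  qed
  then obtain \<chi> where \<chi>: "\<chi> \<in> Sigma_fm (Suc k)" "\<And>t. sat E UNIV t \<chi> = (\<exists>z a. z = pr a (t 0) \<and> sat E UNIV (t(0 := z)) \<phi>)" unfolding FD_def by blast
  have "?C = {x. sat E UNIV (s(0 := x)) \<chi>}"
  proof -
    have "sat E UNIV (s(0 := z)) \<phi> \<longleftrightarrow> z \<in> {pr a (G a) |a. Od a}" for z using \<phi>(2) by blast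
    then show ?thesis unfolding \<chi>(2) by auto
  qed
  then have "definable E (Sigma_fm (Suc k)) ?C" unfolding definable_def using \<chi>(1) by blast
  moreover have "\<forall>\<A>\<in>?C. is_graph E \<A>" using gr by blast
  ultimately obtain S where S: "El S \<subseteq> ?C" "\<forall>x\<in>?C. \<exists>h. hom E h (prod_graph E S) x"
    using assms pc unfolding PRP_def by blast
  show False by (rule no_descending_sequence[OF d _ _ _ S(1)]) (use gr dn up S(2) in blast)+
qed

end

subsection \<open>Extenders from homomorphisms of power set structures\<close>

context zfc
begin

text \<open>A map \<open>f\<close> from the subsets of \<open>b\<close> to those of \<open>v\<close> is read as the extender \<open>X \<mapsto> j X \<inter> v\<close>. The
  relations preserved by a good map are what the ultrapower needs: pullbacks along \<open>um\<close>, \<open>R_nand\<close> and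
  \<open>R_ex\<close> give the clauses of the theorem of Los, \<open>R_wf\<close> makes the ultrapower well-founded, and
  \<open>R_const\<close> says that \<open>f\<close> maps the trace of a class on \<open>b\<close> to its trace on \<open>v\<close>.\<close>

definition um :: "('a \<Rightarrow> 'a) list" where
  "um = [\<lambda>x. pr emp x, \<lambda>x. pr (sc emp) x, p1, p2, \<lambda>x. pr x x, \<lambda>x. pr (p2 x) (p1 x),
    \<lambda>x. pr (p1 x) (p1 (p2 x)), \<lambda>x. pr (p1 x) (p2 (p2 x)), \<lambda>x. pr (p1 x) x, \<lambda>x. pr (p2 x) x]"

definition "R_pull u v X Y \<longleftrightarrow> (\<forall>x\<in>El v. x \<in> El Y \<longleftrightarrow> u x \<in> El X)" for u :: "'a \<Rightarrow> 'a"
definition "R_nand v X Y \<longleftrightarrow> (\<forall>x\<in>El v. x \<in> El Y \<longleftrightarrow> \<not> (pr emp x \<in> El X \<and> pr (sc emp) x \<in> El X))"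
definition "R_ex v X Y \<longleftrightarrow> (\<forall>p\<in>El v. p \<in> El Y \<longleftrightarrow> (\<exists>z\<in>El (p2 p). pr (p1 p) z \<in> El X))"
definition "R_const B v X Y \<longleftrightarrow> X = Y \<and> (\<forall>x\<in>El v. x \<in> El X \<longleftrightarrow> B x)"
definition "R_wf v X Y \<longleftrightarrow> X = Y \<and> (\<forall>S. El S \<subseteq> El v \<and> S \<noteq> emp \<longrightarrow> (\<exists>m\<in>El S. \<forall>y\<in>El S. pr y m \<notin> El X))"

text \<open>The relation for membership lets the points of \<open>v\<close> represent themselves,
  the one for successors does this for numerals, and the one for \<open>r\<close> makes the derived
  embedding fix \<open>r\<close>.\<close>

definition "rels A r = map R_pull um @ [R_nand, R_ex, R_wf, R_const (\<lambda>p. p1 p \<in> El (p2 p)),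
   R_const (\<lambda>p. p2 p = sc (p1 p)), R_const A, R_const (\<lambda>x. x = r)]"

definition "good A r f b v \<longleftrightarrow> fn f (Pw b) \<and> (\<forall>X\<in>El (Pw b). ap f X \<in> El (Pw v)) \<and>
  (\<forall>R\<in>set (rels A r). \<forall>X\<in>El (Pw b). \<forall>Y\<in>El (Pw b). R b X Y \<longrightarrow> R v (ap f X) (ap f Y))"

definition "LR v \<longleftrightarrow> (\<exists>d. Lim d \<and> om \<in> El d \<and> v = Vs d)"

lemma um_cases: "u \<in> set um \<Longrightarrow> (P (\<lambda>x. pr emp x)) \<Longrightarrow> P (\<lambda>x. pr (sc emp) x) \<Longrightarrow> P p1 \<Longrightarrow> P p2 \<Longrightarrow> P (\<lambda>x. pr x x) \<Longrightarrow>
   P (\<lambda>x. pr (p2 x) (p1 x)) \<Longrightarrow> P (\<lambda>x. pr (p1 x) (p1 (p2 x))) \<Longrightarrow> P (\<lambda>x. pr (p1 x) (p2 (p2 x))) \<Longrightarrow> P (\<lambda>x. pr (p1 x) x) \<Longrightarrow>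
   P (\<lambda>x. pr (p2 x) x) \<Longrightarrow> P u"
  unfolding um_def by (simp, elim disjE) simp_all

lemma DT_um: "u \<in> set um \<Longrightarrow> DT (\<lambda>s. u (s 0))"
  by (erule um_cases) (intro dfn)+

lemma LR_trans: "LR v \<Longrightarrow> x \<in> El v \<Longrightarrow> El x \<subseteq> El v" unfolding LR_def using Vs_trans by blast
lemma LR_sub: "LR v \<Longrightarrow> y \<in> El v \<Longrightarrow> El x \<subseteq> El y \<Longrightarrow> x \<in> El v" unfolding LR_def using Vs_sub by blast
lemma LR_pr: "LR v \<Longrightarrow> x \<in> El v \<Longrightarrow> y \<in> El v \<Longrightarrow> pr x y \<in> El v" unfolding LR_def using Vs_pr by blast
lemma LR_p1: "LR v \<Longrightarrow> x \<in> El v \<Longrightarrow> p1 x \<in> El v" "LR v \<Longrightarrow> x \<in> El v \<Longrightarrow> p2 x \<in> El v" unfolding LR_def using Vs_p1 by blast+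
lemma LR_omsub: assumes "LR v" shows "om \<in> El v" "El om \<subseteq> El v"
proof -
  show "om \<in> El v" using assms sub_Vs unfolding LR_def by blast
  then show "El om \<subseteq> El v" using LR_trans[OF assms] by blast
qed
lemma LR_emp: "LR v \<Longrightarrow> emp \<in> El v" "LR v \<Longrightarrow> sc emp \<in> El v" using LR_omsub om_emp om_sc by blast+
lemma LR_um: "u \<in> set um \<Longrightarrow> LR v \<Longrightarrow> x \<in> El v \<Longrightarrow> u x \<in> El v"
  by (erule um_cases[of u "\<lambda>u. u x \<in> El v"]) (auto intro: LR_pr LR_p1 LR_emp)

end

locale extender = zfc E for E :: "'a \<Rightarrow> 'a \<Rightarrow> bool" +
  fixes A :: "'a \<Rightarrow> bool" and r f b v
  assumes DA: "DP (\<lambda>s. A (s 0))" and LRb: "LR b" and LRv: "LR v" and gd: "good A r f b v"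
begin

section \<open>Truth at a seed\<close>

lemma kS: "El X \<subseteq> El b \<Longrightarrow> El (ap f X) \<subseteq> El v" using gd unfolding good_def by auto
lemma kR: "R \<in> set (rels A r) \<Longrightarrow> El X \<subseteq> El b \<Longrightarrow> El Y \<subseteq> El b \<Longrightarrow> R b X Y \<Longrightarrow> R v (ap f X) (ap f Y)"
  using gd unfolding good_def by (metis El_Pw mem_Collect_eq)

text \<open>For fixed \<open>a\<close>, the sets \<open>sep b P\<close> with \<open>FO a P\<close>
  form the ultrafilter derived from the seed \<open>a\<close>.\<close>

definition "FO a P \<longleftrightarrow> a \<in> El (ap f (sep b P))"

lemma DP_FO[dfn]: assumes "DT g" "DP (\<lambda>s. P (\<lambda>n. s (Suc n)) (s 0))" shows "DP (\<lambda>s. FO (g s) (P s))"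
  unfolding FO_def by (intro dfn assms)

lemma sepb: "DP (\<lambda>s. P (s 0)) \<Longrightarrow> El (sep b P) = {x \<in> El b. P x}" by (rule El_sep)

lemma FO_cong: "(\<And>x. x \<in> El b \<Longrightarrow> P x = Q x) \<Longrightarrow> FO a P = FO a Q"
  unfolding FO_def sep_def by (intro arg_cong[of _ _ "\<lambda>X. a \<in> El (ap f (mk X))"]) auto

lemma FO_map: assumes u: "u \<in> set um" and P: "DP (\<lambda>s. P (s 0))" and a: "a \<in> El v"
  shows "FO (u a) P = FO a (\<lambda>x. P (u x))"
proof -
  have Pu: "DP (\<lambda>s. P (u (s 0)))" by (rule DP_app1[OF P DT_um[OF u]])
  have "R_pull u b (sep b P) (sep b (\<lambda>x. P (u x)))"
    unfolding R_pull_def sepb[OF P] sepb[OF Pu] using LR_um[OF u LRb] by auto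
  moreover have "R_pull u \<in> set (rels A r)" unfolding rels_def using u by auto
  ultimately have "R_pull u v (ap f (sep b P)) (ap f (sep b (\<lambda>x. P (u x))))"
    by (intro kR[of "R_pull u"]) (use sepb[OF P] sepb[OF Pu] in auto)
  then show ?thesis unfolding R_pull_def FO_def using a by auto
qed

lemma in_um: "p1 \<in> set um" "p2 \<in> set um" "(\<lambda>x. pr x x) \<in> set um" "(\<lambda>x. pr (p2 x) (p1 x)) \<in> set um"
  "(\<lambda>x. pr (p1 x) (p1 (p2 x))) \<in> set um" "(\<lambda>x. pr (p1 x) (p2 (p2 x))) \<in> set um" "(\<lambda>x. pr (p1 x) x) \<in> set um" "(\<lambda>x. pr (p2 x) x) \<in> set um"
  "(\<lambda>x. pr emp x) \<in> set um" "(\<lambda>x. pr (sc emp) x) \<in> set um"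
  unfolding um_def by simp_all

text \<open>The relations of the structures are binary, so the two arguments of the connective are
  packed into a single set, tagged by \<open>emp\<close> and \<open>sc emp\<close>. The other
  connectives are derived from this one.\<close>

lemma FO_nand:
  assumes P: "DP (\<lambda>s. P (s 0))" and Q: "DP (\<lambda>s. Q (s 0))" and a: "a \<in> El v"
  shows "FO a (\<lambda>x. \<not> (P x \<and> Q x)) \<longleftrightarrow> \<not> (FO a P \<and> FO a Q)"
proof -
  define T where "T z \<longleftrightarrow> (\<exists>x. z = pr emp x \<and> P x) \<or> (\<exists>x. z = pr (sc emp) x \<and> Q x)" for z
  have T: "DP (\<lambda>s. T (s 0))" unfolding T_def by (intro dfn DP_app1[OF P] DP_app1[OF Q])
  have N: "DP (\<lambda>s. \<not> (P (s 0) \<and> Q (s 0)))" by (intro dfn P Q)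
  have "R_nand b (sep b T) (sep b (\<lambda>x. \<not> (P x \<and> Q x)))"
    unfolding R_nand_def sepb[OF T] sepb[OF N] T_def using LR_pr[OF LRb] LR_emp[OF LRb] by auto
  moreover have "R_nand \<in> set (rels A r)" unfolding rels_def by simp
  ultimately have "R_nand v (ap f (sep b T)) (ap f (sep b (\<lambda>x. \<not> (P x \<and> Q x))))"
    by (intro kR[of R_nand]) (use sepb[OF T] sepb[OF N] in auto)
  then have 1: "FO a (\<lambda>x. \<not> (P x \<and> Q x)) \<longleftrightarrow> \<not> (FO (pr emp a) T \<and> FO (pr (sc emp) a) T)"
    unfolding R_nand_def FO_def using a by auto
  have 2: "FO (pr emp a) T = FO a (\<lambda>x. T (pr emp x))" by (rule FO_map[OF in_um(9) T a])
  have 3: "FO (pr (sc emp) a) T = FO a (\<lambda>x. T (pr (sc emp) x))" by (rule FO_map[OF in_um(10) T a])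
  have "T (pr emp x) = P x" "T (pr (sc emp) x) = Q x" for x unfolding T_def by auto
  then show ?thesis using 1 2 3 by simp
qed

lemma FO_not: "DP (\<lambda>s. P (s 0)) \<Longrightarrow> a \<in> El v \<Longrightarrow> FO a (\<lambda>x. \<not> P x) \<longleftrightarrow> \<not> FO a P"
  using FO_nand[of P P a] by simp
lemma FO_and: assumes "DP (\<lambda>s. P (s 0))" "DP (\<lambda>s. Q (s 0))" "a \<in> El v"
  shows "FO a (\<lambda>x. P x \<and> Q x) \<longleftrightarrow> FO a P \<and> FO a Q"
  using FO_nand[OF assms] FO_not[OF _ assms(3), of "\<lambda>x. \<not> (P x \<and> Q x)"] assms by (simp add: dfn)
lemma FO_neq: assumes "DP (\<lambda>s. P (s 0))" "DP (\<lambda>s. Q (s 0))" "a \<in> El v"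
  shows "FO a (\<lambda>x. P x \<noteq> Q x) \<longleftrightarrow> FO a P \<noteq> FO a Q"
proof -
  have "FO a (\<lambda>x. P x \<noteq> Q x) = FO a (\<lambda>x. \<not> (P x \<and> Q x) \<and> \<not> (\<not> P x \<and> \<not> Q x))" by (rule FO_cong) blast
  also have "\<dots> = (FO a (\<lambda>x. \<not> (P x \<and> Q x)) \<and> FO a (\<lambda>x. \<not> (\<not> P x \<and> \<not> Q x)))" by (intro FO_and dfn assms)
  finally show ?thesis
    using FO_nand[OF assms] FO_nand[OF DP_not[OF assms(1)] DP_not[OF assms(2)] assms(3)] FO_not[OF _ assms(3)] assms(1,2) by (simp, blast)
qed
lemma FO_mono: assumes "DP (\<lambda>s. P (s 0))" "DP (\<lambda>s. Q (s 0))" "a \<in> El v" "FO a P" "\<And>x. x \<in> El b \<Longrightarrow> P x \<Longrightarrow> Q x"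
  shows "FO a Q"
proof -
  have "FO a P = FO a (\<lambda>x. P x \<and> Q x)" by (rule FO_cong) (use assms(5) in auto)
  then show ?thesis using FO_and[OF assms(1-3)] assms(4) by simp
qed
lemma FO_all: assumes "a \<in> El v" "\<And>x. x \<in> El b \<Longrightarrow> P x" shows "FO a P"
proof -
  have "FO a P = FO a (\<lambda>x. \<not> (x = x \<and> \<not> (x = x)))" by (rule FO_cong) (use assms(2) in auto)
  moreover have "DP (\<lambda>s. s 0 = s 0)" "DP (\<lambda>s. \<not> (s 0 = s 0))" by (intro dfn)+
  note FO_nand[OF this assms(1)] FO_not[OF this(1) assms(1)]
  ultimately show ?thesis by blast
qed

text \<open>A normality property: an existential over the members of the second component is
  witnessed by a genuine member. It later shows that the ultrapower adds no members to the points of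
  \<open>v\<close>.\<close>

lemma FO_ex:
  assumes Z: "DP (\<lambda>s. Z (s 0))" and p: "p \<in> El v" and "FO p (\<lambda>p. \<exists>z\<in>El (p2 p). Z (pr (p1 p) z))"
  shows "\<exists>z\<in>El (p2 p). FO (pr (p1 p) z) Z"
proof -
  let ?Q = "\<lambda>p. \<exists>z\<in>El (p2 p). Z (pr (p1 p) z)"
  have Q: "DP (\<lambda>s. ?Q (s 0))" by (intro dfn DP_app1[OF Z])
  have "R_ex b (sep b Z) (sep b ?Q)"
    unfolding R_ex_def sepb[OF Z] sepb[OF Q] using LR_pr[OF LRb] LR_p1[OF LRb] LR_trans[OF LRb] by blast
  moreover have "R_ex \<in> set (rels A r)" unfolding rels_def by simp
  ultimately have "R_ex v (ap f (sep b Z)) (ap f (sep b ?Q))"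
    by (intro kR[of R_ex]) (use sepb[OF Z] sepb[OF Q] in auto)
  then show ?thesis using p assms(3) unfolding R_ex_def FO_def by blast
qed

lemma FO_const:
  assumes B: "DP (\<lambda>s. B (s 0))" "R_const B \<in> set (rels A r)" and a: "a \<in> El v" shows "FO a B = B a"
proof -
  have "R_const B b (sep b B) (sep b B)" unfolding R_const_def sepb[OF B(1)] by simp
  then have "R_const B v (ap f (sep b B)) (ap f (sep b B))" by (intro kR[of "R_const B"] B(2)) (use sepb[OF B(1)] in auto)
  then show ?thesis using a unfolding R_const_def FO_def by blast
qed

lemma FO_Mem: "a \<in> El v \<Longrightarrow> FO a (\<lambda>p. p1 p \<in> El (p2 p)) \<longleftrightarrow> p1 a \<in> El (p2 a)"
  by (rule FO_const) (intro dfn, simp add: rels_def)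
lemma FO_SUC: "a \<in> El v \<Longrightarrow> FO a (\<lambda>p. p2 p = sc (p1 p)) \<longleftrightarrow> p2 a = sc (p1 a)"
  by (rule FO_const) (intro dfn, simp add: rels_def)
lemma FO_A: "a \<in> El v \<Longrightarrow> FO a A \<longleftrightarrow> A a"
  by (rule FO_const) (rule DA, simp add: rels_def)
lemma FO_r: "a \<in> El v \<Longrightarrow> FO a (\<lambda>x. x = r) \<longleftrightarrow> a = r"
  by (rule FO_const) (intro dfn, simp add: rels_def)

lemma v_pr: "x \<in> El v \<Longrightarrow> y \<in> El v \<Longrightarrow> pr x y \<in> El v" by (rule LR_pr[OF LRv])
lemma b_p1: "x \<in> El b \<Longrightarrow> p1 x \<in> El b" "x \<in> El b \<Longrightarrow> p2 x \<in> El b" using LR_p1[OF LRb] by blast+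

text \<open>Numerals are represented by themselves, which makes sequences of functions accessible to a single function.\<close>

lemma FO_num: "n \<in> El om \<Longrightarrow> FO n (\<lambda>x. x = n)"
proof (induction n rule: om_induct)
  case D show ?case by (intro dfn)
next
  case emp
  have e: "emp \<in> El v" "pr emp emp \<in> El v" using LR_emp[OF LRv] v_pr by auto
  have d: "DP (\<lambda>s. p2 (s 0) \<noteq> emp)" "DP (\<lambda>s. s 0 = emp)" "DP (\<lambda>s. s 0 \<in> El b)" by (intro dfn)+
  \<comment> \<open>With lying in \<open>b\<close> as a trivial predicate, \<open>FO_ex\<close>
    would otherwise produce a member of \<open>emp\<close>.\<close>
  have "\<not> FO (pr emp emp) (\<lambda>p. p2 p \<noteq> emp)"
  proof
    assume "FO (pr emp emp) (\<lambda>p. p2 p \<noteq> emp)"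
    moreover have "FO (pr emp emp) (\<lambda>p. p2 p \<noteq> emp) = FO (pr emp emp) (\<lambda>p. \<exists>z\<in>El (p2 p). pr (p1 p) z \<in> El b)"
    proof (rule FO_cong)
      fix p assume p: "p \<in> El b"
      have "pr (p1 p) z \<in> El b" if "z \<in> El (p2 p)" for z
        using LR_pr[OF LRb b_p1(1)[OF p]] LR_trans[OF LRb b_p1(2)[OF p]] that by blast
      then show "(p2 p \<noteq> emp) = (\<exists>z\<in>El (p2 p). pr (p1 p) z \<in> El b)" using emp_eq[of "p2 p"] by blast
    qed
    ultimately show False using FO_ex[OF d(3) e(2)] by auto
  qed
  then have "FO (pr emp emp) (\<lambda>p. p2 p = emp)" using FO_not[OF d(1) e(2)] by simp
  then show ?case using FO_map[OF in_um(2) d(2) e(2)] by simp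
next
  case (sc n)
  have n: "n \<in> El v" "sc n \<in> El v" "pr n (sc n) \<in> El v" using LR_omsub[OF LRv] sc(1) om_sc v_pr by blast+
  have d: "DP (\<lambda>s. p1 (s 0) = n)" "DP (\<lambda>s. p2 (s 0) = sc (p1 (s 0)))" "DP (\<lambda>s. p2 (s 0) = sc n)" "DP (\<lambda>s. s 0 = n)" "DP (\<lambda>s. s 0 = sc n)" by (intro dfn)+
  have "FO (pr n (sc n)) (\<lambda>p. p1 p = n)" using FO_map[OF in_um(1) d(4) n(3)] sc(2) by simp
  moreover have "FO (pr n (sc n)) (\<lambda>p. p2 p = sc (p1 p))" using FO_SUC[OF n(3)] by simp
  ultimately have "FO (pr n (sc n)) (\<lambda>p. p1 p = n \<and> p2 p = sc (p1 p))" using FO_and[OF d(1,2) n(3)] by simp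
  from FO_mono[OF DP_and[OF d(1,2)] d(3) n(3) this] have "FO (pr n (sc n)) (\<lambda>p. p2 p = sc n)" by simp
  then show ?case using FO_map[OF in_um(2) d(5) n(3)] by simp
qed

text \<open>A pair of a seed \<open>a\<close> and a function \<open>g\<close> stands for the element \<open>[a, g]\<close> of the ultrapower.\<close>

definition "TR Q p q \<longleftrightarrow> FO (pr (p1 p) (p1 q)) (\<lambda>z. Q (ap (p2 p) (p1 z)) (ap (p2 q) (p2 z)))"
definition "U p \<longleftrightarrow> p1 p \<in> El v"

abbreviation "TE \<equiv> TR (\<lambda>x y. x \<in> El y)"
abbreviation "TQ \<equiv> TR (\<lambda>x y. x = y)"

definition D2 where "D2 Q \<longleftrightarrow> DP (\<lambda>s. Q (s 0) (s 1))"
lemma D2_mem: "D2 (\<lambda>x y. x \<in> El y)" "D2 (\<lambda>x y. x = y)" "D2 (\<lambda>x y. x \<notin> El y)" "D2 (\<lambda>x y. x \<noteq> y)" "D2 (\<lambda>x y. y \<in> El x)"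
  unfolding D2_def by (intro dfn)+
lemma D2_app: "D2 Q \<Longrightarrow> DT g \<Longrightarrow> DT h \<Longrightarrow> DP (\<lambda>s. Q (g s) (h s))" unfolding D2_def by (rule DP_app2)

lemma DP_TR: assumes "D2 Q" "DT g" "DT h" shows "DP (\<lambda>s. TR Q (g s) (h s))"
proof (rule DP_app2[OF _ assms(2,3)])
  show "DP (\<lambda>s. TR Q (s 0) (s 1))" unfolding TR_def by (intro dfn D2_app[OF assms(1)])
qed
lemma DP_U[dfn]: "DT g \<Longrightarrow> DP (\<lambda>s. U (g s))" unfolding U_def by (intro dfn)
lemmas DP_TEQ[dfn] = DP_TR[OF D2_mem(1)] DP_TR[OF D2_mem(2)]

text \<open>Three seeds are packed into the seed \<open>pr a (pr c e)\<close>, where a statement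
  about two of them is a pullback along one of the maps in \<open>um\<close>. Transitivity and
  congruence are then pointwise.\<close>

lemma TR_comp:
  assumes "D2 Q" "D2 R" "D2 S" "U p" "U q" "U t" "TR Q p q" "TR R q t" "\<And>x y z. Q x y \<Longrightarrow> R y z \<Longrightarrow> S x z"
  shows "TR S p t"
proof -
  define a c e where "a = p1 p" "c = p1 q" "e = p1 t"
  define g h k where "g = p2 p" "h = p2 q" "k = p2 t"
  note defs = a_c_e_def g_h_k_def
  have s: "pr a (pr c e) \<in> El v" using assms(4-6) v_pr unfolding U_def defs by blast
  note dd = D2_app[OF assms(1)] D2_app[OF assms(2)] D2_app[OF assms(3)]
  have dQ: "DP (\<lambda>s. Q (ap g (p1 (s 0))) (ap h (p2 (s 0))))" "DP (\<lambda>s. R (ap h (p1 (s 0))) (ap k (p2 (s 0))))" "DP (\<lambda>s. S (ap g (p1 (s 0))) (ap k (p2 (s 0))))"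
    by (intro dd dfn)+
  have eQ: "DP (\<lambda>s. Q (ap g (p1 (s 0))) (ap h (p1 (p2 (s 0)))))" "DP (\<lambda>s. R (ap h (p1 (p2 (s 0)))) (ap k (p2 (p2 (s 0)))))" "DP (\<lambda>s. S (ap g (p1 (s 0))) (ap k (p2 (p2 (s 0)))))"
    by (intro dd dfn)+
  have 1: "FO (pr a (pr c e)) (\<lambda>x. Q (ap g (p1 x)) (ap h (p1 (p2 x))))"
    using FO_map[OF in_um(5) dQ(1) s] assms(7) unfolding TR_def defs by simp
  have 2: "FO (pr a (pr c e)) (\<lambda>x. R (ap h (p1 (p2 x))) (ap k (p2 (p2 x))))"
    using FO_map[OF in_um(2) dQ(2) s] assms(8) unfolding TR_def defs by simp
  have "FO (pr a (pr c e)) (\<lambda>x. Q (ap g (p1 x)) (ap h (p1 (p2 x))) \<and> R (ap h (p1 (p2 x))) (ap k (p2 (p2 x))))"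
    using FO_and[OF eQ(1,2) s] 1 2 by simp
  from FO_mono[OF DP_and[OF eQ(1,2)] eQ(3) s this]
  have "FO (pr a (pr c e)) (\<lambda>x. S (ap g (p1 x)) (ap k (p2 (p2 x))))" using assms(9) by blast
  then show ?thesis using FO_map[OF in_um(6) dQ(3) s] unfolding TR_def defs by simp
qed

lemma TR_sym: assumes "D2 Q" "D2 R" "U p" "U q" "TR Q p q" "\<And>x y. Q x y \<Longrightarrow> R y x" shows "TR R q p"
proof -
  have s: "pr (p1 p) (p1 q) \<in> El v" using assms(3,4) v_pr unfolding U_def by blast
  have d: "DP (\<lambda>s. Q (ap (p2 p) (p1 (s 0))) (ap (p2 q) (p2 (s 0))))" "DP (\<lambda>s. R (ap (p2 q) (p2 (s 0))) (ap (p2 p) (p1 (s 0))))"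
    "DP (\<lambda>s. R (ap (p2 q) (p1 (s 0))) (ap (p2 p) (p2 (s 0))))"
    by (intro D2_app[OF assms(1)] D2_app[OF assms(2)] dfn)+
  have "FO (pr (p1 p) (p1 q)) (\<lambda>z. R (ap (p2 q) (p2 z)) (ap (p2 p) (p1 z)))"
    by (rule FO_mono[OF d(1,2) s]) (use assms(5,6) in \<open>auto simp: TR_def\<close>)
  then show ?thesis using FO_map[OF in_um(4) d(3) s] unfolding TR_def by simp
qed

lemma TR_same: assumes "D2 Q" "a \<in> El v" shows "TR Q (pr a g) (pr a h) \<longleftrightarrow> FO a (\<lambda>x. Q (ap g x) (ap h x))"
proof -
  have d: "DP (\<lambda>s. Q (ap g (p1 (s 0))) (ap h (p2 (s 0))))" by (intro D2_app[OF assms(1)] dfn)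
  show ?thesis using FO_map[OF in_um(3) d assms(2)] unfolding TR_def by simp
qed

lemma TR_left: assumes "D2 Q" "a \<in> El v" "c \<in> El v"
  shows "TR Q (pr a g) (pr (pr a c) h) \<longleftrightarrow> FO (pr a c) (\<lambda>z. Q (ap g (p1 z)) (ap h z))"
proof -
  have d: "DP (\<lambda>s. Q (ap g (p1 (s 0))) (ap h (p2 (s 0))))" by (intro D2_app[OF assms(1)] dfn)
  show ?thesis using FO_map[OF in_um(7) d v_pr[OF assms(2,3)]] unfolding TR_def by simp
qed
lemma TR_right: assumes "D2 Q" "a \<in> El v" "c \<in> El v"
  shows "TR Q (pr c g) (pr (pr a c) h) \<longleftrightarrow> FO (pr a c) (\<lambda>z. Q (ap g (p2 z)) (ap h z))"
proof -
  have d: "DP (\<lambda>s. Q (ap g (p1 (s 0))) (ap h (p2 (s 0))))" by (intro D2_app[OF assms(1)] dfn)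
  show ?thesis using FO_map[OF in_um(8) d v_pr[OF assms(2,3)]] unfolding TR_def by simp
qed

lemma TQ_sym: "U p \<Longrightarrow> U q \<Longrightarrow> TQ p q \<Longrightarrow> TQ q p" by (rule TR_sym[OF D2_mem(2,2)]) auto
lemma TQ_trans: "U p \<Longrightarrow> U q \<Longrightarrow> U t \<Longrightarrow> TQ p q \<Longrightarrow> TQ q t \<Longrightarrow> TQ p t" by (rule TR_comp[OF D2_mem(2,2,2)]) auto
lemma TE_left: "U p \<Longrightarrow> U q \<Longrightarrow> U t \<Longrightarrow> TQ p q \<Longrightarrow> TE q t \<Longrightarrow> TE p t" by (rule TR_comp[OF D2_mem(2,1,1)]) auto
lemma TE_right: "U p \<Longrightarrow> U q \<Longrightarrow> U t \<Longrightarrow> TE p q \<Longrightarrow> TQ q t \<Longrightarrow> TE p t" by (rule TR_comp[OF D2_mem(1,2,1)]) auto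
lemma TQ_refl: "U p \<Longrightarrow> TQ p p"
proof -
  assume "U p"
  have d: "DP (\<lambda>s. ap (p2 p) (p1 (s 0)) = ap (p2 p) (p2 (s 0)))" by (intro dfn)
  show "TQ p p" using FO_map[OF in_um(3) d, of "p1 p"] FO_all[of "p1 p" "\<lambda>x. True"] \<open>U p\<close> unfolding TR_def U_def by simp
qed
lemma U_pr[simp]: "U (pr a g) \<longleftrightarrow> a \<in> El v" unfolding U_def by simp

section \<open>Well-foundedness and collapse of the ultrapower\<close>

definition "BD q = un (Unn (rep b (ap (p2 q)))) (upr emp emp)"
lemma El_BD: "El (BD q) = insert emp (\<Union>x\<in>El b. El (ap (p2 q) x))"
proof -
  have "El (rep b (ap (p2 q))) = ap (p2 q) ` El b" by (rule El_rep) (intro dfn)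
  then show ?thesis unfolding BD_def by auto
qed
lemma DT_BD[dfn]: "DT g \<Longrightarrow> DT (\<lambda>s. BD (g s))" by (rule DT_app1, unfold BD_def, intro dfn)

text \<open>Membership restricted to normalised representatives, which makes it set-like.\<close>

definition "Rn p q \<longleftrightarrow> p \<in> El (tms v (fun_sp b (BD q))) \<and> U q \<and> TE p q"
lemma DP_Rn[dfn]: "DT g \<Longrightarrow> DT h \<Longrightarrow> DP (\<lambda>s. Rn (g s) (h s))" by (rule DP_app2, unfold Rn_def, intro dfn)
lemma Rn_U: "Rn p q \<Longrightarrow> U p \<and> U q \<and> TE p q" unfolding Rn_def U_def by auto

text \<open>At almost every point the value of \<open>p\<close> is a member of the value of
  \<open>q\<close>, hence in \<open>BD q\<close>; elsewhere it may be reset to \<open>emp\<close>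
  without changing the class of \<open>p\<close>.\<close>

lemma normal: assumes "U p" "U q" "TE p q" shows "\<exists>p'. Rn p' q \<and> TQ p p'"
proof -
  define g where "g = lam b (\<lambda>x. if ap (p2 p) x \<in> El (BD q) then ap (p2 p) x else emp)"
  have d: "DT (\<lambda>s. if ap (p2 p) (s 0) \<in> El (BD q) then ap (p2 p) (s 0) else emp)" by (intro dfn)
  have g: "ap g x = (if ap (p2 p) x \<in> El (BD q) then ap (p2 p) x else emp)" if "x \<in> El b" for x
    unfolding g_def by (rule ap_lam[OF d that])
  have a: "p1 p \<in> El v" "p1 q \<in> El v" "pr (p1 p) (p1 q) \<in> El v" using assms v_pr unfolding U_def by auto
  have d: "DP (\<lambda>s. ap (p2 p) (p1 (s 0)) \<in> El (ap (p2 q) (p2 (s 0))))" "DP (\<lambda>s. ap (p2 p) (p1 (s 0)) = ap g (p1 (s 0)))" "DP (\<lambda>s. ap (p2 p) (s 0) = ap g (s 0))"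
    by (intro dfn)+
  have "FO (pr (p1 p) (p1 q)) (\<lambda>z. ap (p2 p) (p1 z) = ap g (p1 z))"
    by (rule FO_mono[OF d(1,2) a(3)]) (use assms(3) b_p1 in \<open>auto simp: TR_def g El_BD\<close>)
  then have 1: "FO (p1 p) (\<lambda>x. ap (p2 p) x = ap g x)" using FO_map[OF in_um(1) d(3) a(3)] by simp
  have dx: "DP (\<lambda>s. ap (p2 p) (p1 (s 0)) = ap g (p2 (s 0)))" by (intro dfn)
  have 2: "TQ p (pr (p1 p) g)" using FO_map[OF in_um(3) dx a(1)] 1 unfolding TR_def by simp
  have "TE (pr (p1 p) g) q" by (rule TE_left[OF _ assms(1,2) TQ_sym[OF assms(1) _ 2] assms(3)]) (use a in auto)
  moreover have "fn g b" unfolding g_def by (rule fn_lam) (intro dfn)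
  ultimately have "Rn (pr (p1 p) g) q" unfolding Rn_def using a assms(2) g by (auto simp: El_BD)
  then show ?thesis using 2 by blast
qed

lemma choice_fun:
  assumes "DP (\<lambda>s. R (s 0) (s 1))" shows "\<exists>e. \<forall>x\<in>El X. (\<exists>y. R x y) \<longrightarrow> R x (ap e x)"
proof -
  have "DP (\<lambda>s. (\<exists>y. R (s 0) y) \<longrightarrow> R (s 0) (s 1))" by (intro dfn DP_app2[OF assms])
  moreover have "\<exists>z. (\<exists>y. R x y) \<longrightarrow> R x z" for x by blast
  ultimately have "\<exists>e. fn e X \<and> (\<forall>x\<in>El X. (\<exists>y. R x y) \<longrightarrow> R x (ap e x))" by (rule AC_rel)
  then show ?thesis by blast
qed

text \<open>A descending sequence chosen in the model is merged into one function \<open>h\<close>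
  with the seeds \<open>t n\<close>, which carry the number \<open>n\<close>; here it matters that
  numerals represent themselves. Membership between values of \<open>h\<close> is well-founded on
  \<open>b\<close> by Foundation, so \<open>R_wf\<close> forbids a descent through the set of these
  seeds.\<close>

lemma wfs_Rn: "wfs Rn"
  unfolding wfs_def
proof (intro conjI allI impI)
  show "DP (\<lambda>s. Rn (s 0) (s 1))" by (intro dfn)
  show "isS {y. Rn y x}" for x
    by (rule isS_subset[of "El (tms v (fun_sp b (BD x)))"]) (auto simp only: Rn_def isS_El, intro dfn)
  fix X assume X: "El X \<noteq> {}"
  show "\<exists>m\<in>El X. \<forall>y\<in>El X. \<not> Rn y m"
  proof (rule ccontr)
    assume "\<not> (\<exists>m\<in>El X. \<forall>y\<in>El X. \<not> Rn y m)"
    then have no: "\<And>m. m \<in> El X \<Longrightarrow> \<exists>y. y \<in> El X \<and> Rn y m" by blast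
    have "DP (\<lambda>s. s 1 \<in> El X \<and> Rn (s 1) (s 0))" by (intro dfn)
    from choice_fun[OF this, of X] obtain c where c: "\<And>m. m \<in> El X \<Longrightarrow> ap c m \<in> El X \<and> Rn (ap c m) m" using no by blast
    obtain x0 where "x0 \<in> El X" using X by blast
    have dc: "DT g \<Longrightarrow> DT (\<lambda>s. ap c (g s))" for g by (intro dfn)
    obtain S where S: "DT (\<lambda>s. S (s 0))" "S emp = x0" "\<And>n. n \<in> El om \<Longrightarrow> S (sc n) = ap c (S n)"
      using iterate[of "ap c" x0, OF dc] by blast
    note [dfn] = DT_app1[OF S(1)]
    have SX: "S n \<in> El X" if "n \<in> El om" for n
      using that by (induction n rule: om_induct) (intro dfn, use S \<open>x0 \<in> El X\<close> c in auto)
    have SR: "Rn (S (sc n)) (S n)" if "n \<in> El om" for n using S(3)[OF that] c SX[OF that] by simp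
    have SU: "U (S n)" if "n \<in> El om" for n using Rn_U[OF SR[OF that]] by blast
    define h where "h = lam b (\<lambda>x. ap (p2 (S (p1 x))) (p2 x))"
    have dh: "DT (\<lambda>s. ap (p2 (S (p1 (s 0)))) (p2 (s 0)))" by (intro dfn)
    have h: "ap h x = ap (p2 (S (p1 x))) (p2 x)" if "x \<in> El b" for x unfolding h_def by (rule ap_lam[OF dh that])
    define t where "t n = pr n (p1 (S n))" for n
    have [dfn]: "DT g \<Longrightarrow> DT (\<lambda>s. t (g s))" for g by (rule DT_app1, unfold t_def, intro dfn)
    have tv: "t n \<in> El v" if "n \<in> El om" for n
      unfolding t_def using SU[OF that] LR_omsub[OF LRv] that v_pr unfolding U_def by blast
    have eq: "TQ (S n) (pr (t n) h)" if n: "n \<in> El om" for n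
    proof -
      have d: "DP (\<lambda>s. s 0 = n)" "DP (\<lambda>s. p1 (s 0) = n)" "DP (\<lambda>s. ap (p2 (S n)) (p2 (s 0)) = ap h (s 0))"
         "DP (\<lambda>s. ap (p2 (S n)) (p1 (s 0)) = ap h (p2 (s 0)))" by (intro dfn)+
      have "FO (t n) (\<lambda>x. p1 x = n)" using FO_map[OF in_um(1) d(1) tv[OF n]] FO_num[OF n] unfolding t_def by simp
      then have "FO (t n) (\<lambda>x. ap (p2 (S n)) (p2 x) = ap h x)"
        by (rule FO_mono[OF d(2,3) tv[OF n]]) (auto simp: h)
      then show ?thesis using FO_map[OF in_um(8) d(4) tv[OF n]] unfolding TR_def by (simp add: t_def)
    qed
    have desc: "TE (pr (t (sc n)) h) (pr (t n) h)" if n: "n \<in> El om" for n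
    proof -
      have U: "U (S n)" "U (S (sc n))" "U (pr (t n) h)" "U (pr (t (sc n)) h)" using SU tv n by auto
      have "TE (S (sc n)) (pr (t n) h)" by (rule TE_right[OF U(2,1,3)]) (use Rn_U[OF SR[OF n]] eq[OF n] in auto)
      from TE_left[OF U(4,2,3) TQ_sym[OF U(2,4) eq[OF om_sc[OF n]]] this] show ?thesis .
    qed
    let ?Z = "\<lambda>z. ap h (p1 z) \<in> El (ap h (p2 z))"
    have dZ: "DP (\<lambda>s. ?Z (s 0))" by (intro dfn)
    have "R_wf b (sep b ?Z) (sep b ?Z)"
      unfolding R_wf_def
    proof (intro conjI allI impI)
      fix Y assume "El Y \<subseteq> El b \<and> Y \<noteq> emp"
      then have "El Y \<noteq> {}" using emp_eq by blast
      have r: "El (rep Y (ap h)) = ap h ` El Y" by (rule El_rep) (intro dfn)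
      then obtain w where w: "w \<in> El (rep Y (ap h))" "El w \<inter> El (rep Y (ap h)) = {}" using found[of "rep Y (ap h)"] \<open>El Y \<noteq> {}\<close> by auto
      then obtain m where m: "m \<in> El Y" "w = ap h m" using r by auto
      have "pr y m \<notin> El (sep b ?Z)" if "y \<in> El Y" for y unfolding sepb[OF dZ] using w(2) m that r by auto
      then show "\<exists>m\<in>El Y. \<forall>y\<in>El Y. pr y m \<notin> El (sep b ?Z)" using m by blast
    qed simp
    then have "R_wf v (ap f (sep b ?Z)) (ap f (sep b ?Z))" by (intro kR[of R_wf]) (auto simp: rels_def sepb[OF dZ])
    then have wf: "\<And>Y. El Y \<subseteq> El v \<Longrightarrow> Y \<noteq> emp \<Longrightarrow> \<exists>m\<in>El Y. \<forall>y\<in>El Y. \<not> FO (pr y m) ?Z" unfolding R_wf_def FO_def by blast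
    have r: "El (rep om t) = t ` El om" by (rule El_rep) (intro dfn)
    have "El (rep om t) \<subseteq> El v" "rep om t \<noteq> emp" using r tv om_emp El_emp by (auto, metis empty_iff imageI)
    from wf[OF this] obtain n where "n \<in> El om" "\<And>y. y \<in> t ` El om \<Longrightarrow> \<not> FO (pr y (t n)) ?Z" unfolding r by blast
    then show False using desc[of n] om_sc[of n] unfolding TR_def by auto
  qed
qed

lemma ex_col: "\<exists>F. DT (\<lambda>s. F (s 0)) \<and> (\<forall>x. El (F x) = {F z |z. Rn z x})"
proof -
  note [dfn] = wfs_DT_ext[OF wfs_Rn]
  have S[simp]: "isS {z. Rn z x}" for x using wfs_Rn unfolding wfs_def by blast
  have G: "DT g \<Longrightarrow> DT h \<Longrightarrow> DT (\<lambda>s. rep (mk {z. Rn z (g s)}) (ap (h s)))" for g h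
    by (rule DT_app2[of "\<lambda>x g. rep (mk {z. Rn z x}) (ap g)"], intro dfn)
  obtain F where F: "DT (\<lambda>s. F (s 0))" "\<And>x. F x = rep (mk {z. Rn z x}) (ap (lam (mk {y. Rn y x}) F))"
    using wfs_rec[OF wfs_Rn, of "\<lambda>x g. rep (mk {z. Rn z x}) (ap g)", OF G] by blast
  have "El (F x) = {F z |z. Rn z x}" for x
  proof -
    have "El (F x) = ap (lam (mk {y. Rn y x}) F) ` El (mk {z. Rn z x})"
      by (subst F(2)) (rule El_rep, intro dfn)
    then show ?thesis using ap_lam[OF F(1), of _ "mk {y. Rn y x}"] by auto
  qed
  then show ?thesis using F(1) by blast
qed

definition "col = (SOME F. DT (\<lambda>s. F (s 0)) \<and> (\<forall>x. El (F x) = {F z |z. Rn z x}))"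
lemma DT_col[dfn]: "DT g \<Longrightarrow> DT (\<lambda>s. col (g s))"
  by (rule DT_app1, unfold col_def) (rule conjunct1[OF someI_ex[OF ex_col]])
lemma El_col: "El (col x) = {col z |z. Rn z x}"
  unfolding col_def by (rule spec[OF conjunct2[OF someI_ex[OF ex_col]]])

lemma col_TQ: "U p \<Longrightarrow> U q \<Longrightarrow> TQ p q \<Longrightarrow> col p = col q"
proof -
  have "U p \<longrightarrow> (\<forall>q. U q \<and> TQ p q \<longrightarrow> col p = col q)" for p
  proof (rule wfs_induct[OF wfs_Rn, of "\<lambda>p. U p \<longrightarrow> (\<forall>q. U q \<and> TQ p q \<longrightarrow> col p = col q)"])
    show "DP (\<lambda>s. U (s 0) \<longrightarrow> (\<forall>q. U q \<and> TQ (s 0) q \<longrightarrow> col (s 0) = col q))" by (intro dfn)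
    fix p assume IH: "\<And>y. Rn y p \<Longrightarrow> U y \<longrightarrow> (\<forall>q. U q \<and> TQ y q \<longrightarrow> col y = col q)"
    show "U p \<longrightarrow> (\<forall>q. U q \<and> TQ p q \<longrightarrow> col p = col q)"
    proof (intro impI allI, elim conjE, rule El_ext, intro equalityI subsetI)
      fix q y assume h: "U p" "U q" "TQ p q" "y \<in> El (col p)"
      then obtain t where t: "Rn t p" "y = col t" unfolding El_col[of p] by blast
      have tU: "U t" "TE t p" using Rn_U[OF t(1)] by auto
      have "TE t q" by (rule TE_right[OF tU(1) h(1,2) tU(2) h(3)])
      then obtain t' where t': "Rn t' q" "TQ t t'" using normal tU(1) h(2) by blast
      then have "col t = col t'" using IH[OF t(1)] tU(1) Rn_U by blast
      then have "y = col t'" using t(2) by simp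
      then show "y \<in> El (col q)" unfolding El_col[of q] using t'(1) by blast
    next
      fix q y assume h: "U p" "U q" "TQ p q" "y \<in> El (col q)"
      then obtain t where t: "Rn t q" "y = col t" unfolding El_col[of q] by blast
      have tU: "U t" "TE t q" using Rn_U[OF t(1)] by auto
      have "TE t p" by (rule TE_right[OF tU(1) h(2,1) tU(2) TQ_sym[OF h(1-3)]])
      then obtain t' where t': "Rn t' p" "TQ t t'" using normal tU(1) h(1) by blast
      have tU': "U t'" using Rn_U[OF t'(1)] by blast
      then have "col t' = col t" using IH[OF t'(1)] tU(1) TQ_sym[OF tU(1) tU' t'(2)] by blast
      then have "y = col t'" using t(2) by simp
      then show "y \<in> El (col p)" unfolding El_col[of p] using t'(1) by blast
    qed
  qed
  then show "U p \<Longrightarrow> U q \<Longrightarrow> TQ p q \<Longrightarrow> col p = col q" by blast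
qed

text \<open>A choice function picks, wherever the two values differ, a member of exactly one of
  them; with the joint seed it represents an element that belongs to only one of the two
  classes.\<close>

lemma separate:
  assumes U: "U p" "U q" and "\<not> TQ p q"
  shows "\<exists>t. U t \<and> TE t p \<noteq> TE t q"
proof -
  define a c g h where "a = p1 p" "c = p1 q" "g = p2 p" "h = p2 q"
  note defs = a_c_g_h_def
  have av: "a \<in> El v" "c \<in> El v" "pr a c \<in> El v" using U v_pr unfolding U_def defs by auto
  let ?X = "\<lambda>z w. (w \<in> El (ap g (p1 z))) \<noteq> (w \<in> El (ap h (p2 z)))"
  have d: "DP (\<lambda>s. ?X (s 0) (s 1))" "DP (\<lambda>s. ap g (p1 (s 0)) = ap h (p2 (s 0)))" by (intro dfn)+
  have dd: "DP (\<lambda>s. ap e (s 0) \<in> El (ap g (p1 (s 0))))" "DP (\<lambda>s. ap e (s 0) \<in> El (ap h (p2 (s 0))))" "DP (\<lambda>s. ?X (s 0) (ap e (s 0)))" for e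
    by (intro dfn)+
  have pq: "TR Q p t = TR Q (pr a g) t" "TR Q t p = TR Q t (pr a g)" "TR Q q t = TR Q (pr c h) t" "TR Q t q = TR Q t (pr c h)" for Q t
    unfolding TR_def defs by simp_all
  have wit: "U (pr (pr a c) e)" for e using av by simp
  have l1: "TE (pr (pr a c) e) p \<longleftrightarrow> FO (pr a c) (\<lambda>z. ap e z \<in> El (ap g (p1 z)))" for e
  proof -
    have "TE (pr (pr a c) e) p \<longleftrightarrow> TR (\<lambda>x y. y \<in> El x) (pr a g) (pr (pr a c) e)"
      unfolding pq using TR_sym[OF D2_mem(1,5), of "pr (pr a c) e" "pr a g"] TR_sym[OF D2_mem(5,1), of "pr a g" "pr (pr a c) e"] av by auto
    then show ?thesis using TR_left[OF D2_mem(5) av(1,2)] by simp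
  qed
  have l2: "TE (pr (pr a c) e) q \<longleftrightarrow> FO (pr a c) (\<lambda>z. ap e z \<in> El (ap h (p2 z)))" for e
  proof -
    have "TE (pr (pr a c) e) q \<longleftrightarrow> TR (\<lambda>x y. y \<in> El x) (pr c h) (pr (pr a c) e)"
      unfolding pq using TR_sym[OF D2_mem(1,5), of "pr (pr a c) e" "pr c h"] TR_sym[OF D2_mem(5,1), of "pr c h" "pr (pr a c) e"] av by auto
    then show ?thesis using TR_right[OF D2_mem(5) av(1,2)] by simp
  qed
  have "\<not> FO (pr a c) (\<lambda>z. ap g (p1 z) = ap h (p2 z))" using assms(3) unfolding TR_def defs by simp
  then have F: "FO (pr a c) (\<lambda>z. ap g (p1 z) \<noteq> ap h (p2 z))" using FO_not[OF d(2) av(3)] by simp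
  obtain e where e: "\<And>z. z \<in> El b \<Longrightarrow> \<exists>w. ?X z w \<Longrightarrow> ?X z (ap e z)" using choice_fun[OF d(1), of b] by blast
  have "FO (pr a c) (\<lambda>z. ?X z (ap e z))"
  proof (rule FO_mono[OF DP_not[OF d(2)] dd(3) av(3) F])
    fix z assume z: "z \<in> El b" "ap g (p1 z) \<noteq> ap h (p2 z)"
    then have "\<exists>w. ?X z w" by (metis El_ext subsetI subset_antisym)
    then show "?X z (ap e z)" by (rule e[OF z(1)])
  qed
  then have "TE (pr (pr a c) e) p \<noteq> TE (pr (pr a c) e) q" using FO_neq[OF dd(1,2) av(3)] l1 l2 by blast
  then show ?thesis using wit by blast
qed

lemma col_inj: "U p \<Longrightarrow> U q \<Longrightarrow> col p = col q \<Longrightarrow> TQ p q"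
proof -
  have "U p \<longrightarrow> (\<forall>q. U q \<and> col p = col q \<longrightarrow> TQ p q)" for p
  proof (rule wfs_induct[OF wfs_Rn, of "\<lambda>p. U p \<longrightarrow> (\<forall>q. U q \<and> col p = col q \<longrightarrow> TQ p q)"])
    show "DP (\<lambda>s. U (s 0) \<longrightarrow> (\<forall>q. U q \<and> col (s 0) = col q \<longrightarrow> TQ (s 0) q))" by (intro dfn)
    fix p assume IH: "\<And>y. Rn y p \<Longrightarrow> U y \<longrightarrow> (\<forall>q. U q \<and> col y = col q \<longrightarrow> TQ y q)"
    show "U p \<longrightarrow> (\<forall>q. U q \<and> col p = col q \<longrightarrow> TQ p q)"
    proof (intro impI allI, elim conjE, rule ccontr)
      fix q assume h: "U p" "U q" "col p = col q" "\<not> TQ p q"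
      obtain t where t: "U t" "TE t p \<noteq> TE t q" using separate[OF h(1,2,4)] by blast
      then consider "TE t p" "\<not> TE t q" | "TE t q" "\<not> TE t p" by blast
      then show False
      proof cases
        case 1
        obtain t' where t': "Rn t' p" "TQ t t'" using normal[OF t(1) h(1) 1(1)] by blast
        then have "col t' \<in> El (col q)" using El_col[of p] h(3) by auto
        then obtain t'' where t'': "Rn t'' q" "col t'' = col t'" using El_col[of q] by auto
        have U: "U t'" "U t''" "TE t'' q" using Rn_U t' t'' by blast+
        have "TQ t' t''" using IH[OF t'(1)] U t''(2) by metis
        then have "TQ t t''" using TQ_trans[OF t(1) U(1,2)] t' by blast
        then show False using TE_left[OF t(1) U(2) h(2)] U(3) 1(2) by blast
      next
        case 2
        obtain t' where t': "Rn t' q" "TQ t t'" using normal[OF t(1) h(2) 2(1)] by blast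
        then have "col t' \<in> El (col p)" using El_col[of q] h(3) by auto
        then obtain t'' where t'': "Rn t'' p" "col t'' = col t'" using El_col[of p] by auto
        have U: "U t'" "U t''" "TE t'' p" using Rn_U t' t'' by blast+
        have "TQ t'' t'" using IH[OF t''(1)] U t''(2) by metis
        then have "TQ t t''" using TQ_trans[OF t(1) U(1,2)] TQ_sym[OF U(2,1)] t' by blast
        then show False using TE_left[OF t(1) U(2) h(1)] U(3) 2(2) by blast
      qed
    qed
  qed
  then show "U p \<Longrightarrow> U q \<Longrightarrow> col p = col q \<Longrightarrow> TQ p q" by blast
qed

lemma col_mem: assumes "U p" "U q" shows "col p \<in> El (col q) \<longleftrightarrow> TE p q"
proof
  assume "col p \<in> El (col q)"
  then obtain t where t: "Rn t q" "col p = col t" unfolding El_col[of q] by blast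
  have "U t" "TE t q" using Rn_U[OF t(1)] by auto
  then show "TE p q" using TE_left[OF assms(1) _ assms(2) col_inj[OF assms(1)]] t(2) by blast
next
  assume "TE p q"
  then obtain t where t: "Rn t q" "TQ p t" using normal assms by blast
  then have "col p = col t" using col_TQ[OF assms(1)] Rn_U by blast
  then show "col p \<in> El (col q)" unfolding El_col[of q] using t by blast
qed

lemma col_eq: "U p \<Longrightarrow> U q \<Longrightarrow> col p = col q \<longleftrightarrow> TQ p q" using col_inj col_TQ by blast

definition "UM = {col p |p. U p}"

lemma DP_UM: "DP (\<lambda>s. s 0 \<in> UM)"
proof -
  have "DP (\<lambda>s. \<exists>p. s 0 = col p \<and> U p)" by (intro dfn)
  then show ?thesis unfolding UM_def by simp
qed

lemma UM_pr: "m \<in> UM \<Longrightarrow> \<exists>c h. c \<in> El v \<and> m = col (pr c h)"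
proof -
  assume "m \<in> UM"
  then obtain p where p: "U p" "m = col p" unfolding UM_def by blast
  have "TQ p (pr (p1 p) (p2 p))" using TQ_refl[OF p(1)] unfolding TR_def by simp
  then have "col p = col (pr (p1 p) (p2 p))" using col_TQ[OF p(1)] p(1) unfolding U_def by simp
  then show ?thesis using p unfolding U_def by blast
qed

section \<open>The theorem of Los and the embedding\<close>

lemma DP_sat: "(\<And>i. DT (F i)) \<Longrightarrow> DP (\<lambda>s. sat E UNIV (\<lambda>i. F i s) \<phi>)" by (rule DP_satM) (intro dfn)

theorem Los: "a \<in> El v \<Longrightarrow> sat E UM (\<lambda>i. col (pr a (g i))) \<phi> \<longleftrightarrow> FO a (\<lambda>x. sat E UNIV (\<lambda>i. ap (g i) x) \<phi>)"
proof (induction \<phi> arbitrary: a g)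
  case (Mem i k)
  then show ?case using col_mem[of "pr a (g i)" "pr a (g k)"] TR_same[OF D2_mem(1)] by (simp add: elts_def)
next
  case (Eq i k)
  then show ?case using col_eq[of "pr a (g i)" "pr a (g k)"] TR_same[OF D2_mem(2)] by simp
next
  case (Neg \<phi>)
  have "DP (\<lambda>s. sat E UNIV (\<lambda>i. ap (g i) (s 0)) \<phi>)" by (intro DP_sat dfn)
  then show ?case using FO_not Neg by simp
next
  case (And \<phi> \<psi>)
  have "DP (\<lambda>s. sat E UNIV (\<lambda>i. ap (g i) (s 0)) \<phi>)" "DP (\<lambda>s. sat E UNIV (\<lambda>i. ap (g i) (s 0)) \<psi>)" by (intro DP_sat dfn)+
  then show ?case using FO_and And by simp
next
  case (Ex y \<phi>)
  have dy: "DT (\<lambda>s. if i = y then s k else ap (g i) (s l))" for i k l by (cases "i = y") (auto intro: dfn)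
  let ?P = "\<lambda>x w. sat E UNIV ((\<lambda>i. ap (g i) x)(y := w)) \<phi>"
  have upd: "(\<lambda>i. ap (g i) x)(y := w) = (\<lambda>i. if i = y then w else ap (g i) x)" for x w by auto
  have dP: "DP (\<lambda>s. ?P (s 0) (s 1))" "DP (\<lambda>s. \<exists>w. ?P (s 0) w)"
    unfolding upd by (intro dfn DP_sat dy)+
  show ?case
  proof
    assume "sat E UM (\<lambda>i. col (pr a (g i))) (Ex y \<phi>)"
    then obtain m where m: "m \<in> UM" "sat E UM ((\<lambda>i. col (pr a (g i)))(y := m)) \<phi>" by auto
    then obtain c h where c: "c \<in> El v" "m = col (pr c h)" using UM_pr by blast
    \<comment> \<open>A witness comes with its own seed \<open>c\<close>, so all functions are moved
      to the joint seed \<open>d\<close>.\<close>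
    define d where "d = pr a c"
    have d: "d \<in> El v" unfolding d_def using v_pr Ex.prems c by blast
    define g' where "g' i = (if i = y then lam b (\<lambda>z. ap h (p2 z)) else lam b (\<lambda>z. ap (g i) (p1 z)))" for i
    have dl: "DT (\<lambda>s. ap h (p2 (s 0)))" "DT (\<lambda>s. ap (g i) (p1 (s 0)))" for i by (intro dfn)+
    have g': "ap (g' i) z = (if i = y then ap h (p2 z) else ap (g i) (p1 z))" if "z \<in> El b" for i z
      unfolding g'_def using ap_lam[OF dl(1) that] ap_lam[OF dl(2) that] by simp
    have "col (pr a (g i)) = col (pr d (g' i))" if "i \<noteq> y" for i
    proof (rule col_TQ)
      show "TQ (pr a (g i)) (pr d (g' i))"
        unfolding d_def TR_left[OF D2_mem(2) Ex.prems c(1)] by (rule FO_all) (use d that in \<open>auto simp: d_def g'\<close>)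
    qed (use d Ex.prems in auto)
    moreover have "col (pr c h) = col (pr d (g' y))"
    proof (rule col_TQ)
      show "TQ (pr c h) (pr d (g' y))"
        unfolding d_def TR_right[OF D2_mem(2) Ex.prems c(1)] by (rule FO_all) (use d in \<open>auto simp: d_def g'\<close>)
    qed (use d c in auto)
    ultimately have "(\<lambda>i. col (pr a (g i)))(y := m) = (\<lambda>i. col (pr d (g' i)))" using c by auto
    then have 1: "FO d (\<lambda>x. sat E UNIV (\<lambda>i. ap (g' i) x) \<phi>)" using m(2) Ex.IH[OF d] by simp
    have 2: "sat E UNIV (\<lambda>i. ap (g' i) x) \<phi> \<Longrightarrow> \<exists>w. ?P (p1 x) w" if "x \<in> El b" for x
      using g'[OF that] by (intro exI[of _ "ap h (p2 x)"]) (simp add: upd)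
    have 3: "DP (\<lambda>s. sat E UNIV (\<lambda>i. ap (g' i) (s 0)) \<phi>)" by (intro DP_sat dfn)
    have 4: "DP (\<lambda>s. \<exists>w. ?P (p1 (s 0)) w)" by (rule DP_app1[OF dP(2)]) (intro dfn)
    have 5: "FO d (\<lambda>x. \<exists>w. ?P (p1 x) w)" by (rule FO_mono[OF 3 4 d 1 2])
    have "FO a (\<lambda>x. \<exists>w. ?P x w)" by (rule iffD2[OF FO_map[OF in_um(1) dP(2) d, unfolded d_def p1] 5[unfolded d_def]])
    then show "FO a (\<lambda>x. sat E UNIV (\<lambda>i. ap (g i) x) (Ex y \<phi>))" by simp
  next
    assume "FO a (\<lambda>x. sat E UNIV (\<lambda>i. ap (g i) x) (Ex y \<phi>))"
    then have F: "FO a (\<lambda>x. \<exists>w. ?P x w)" by simp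
    \<comment> \<open>Conversely, a choice of pointwise witnesses is a function at the same seed
      \<open>a\<close>.\<close>
    obtain e where e: "\<And>x. x \<in> El b \<Longrightarrow> \<exists>w. ?P x w \<Longrightarrow> ?P x (ap e x)" using choice_fun[OF dP(1), of b] by blast
    have "DP (\<lambda>s. ?P (s 0) (ap e (s 0)))" by (rule DP_app2[OF dP(1)]) (intro dfn)+
    from FO_mono[OF dP(2) this Ex.prems F] have "FO a (\<lambda>x. ?P x (ap e x))" using e by blast
    then have "FO a (\<lambda>x. sat E UNIV (\<lambda>i. ap ((g(y := e)) i) x) \<phi>)"
      by (rule back_subst[of "FO a"]) (auto intro!: HOL.ext arg_cong[where f="\<lambda>u. sat E UNIV u \<phi>"])
    then have "sat E UM (\<lambda>i. col (pr a ((g(y := e)) i))) \<phi>" using Ex.IH[OF Ex.prems] by blast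
    moreover have "(\<lambda>i. col (pr a ((g(y := e)) i))) = (\<lambda>i. col (pr a (g i)))(y := col (pr a e))" by auto
    ultimately have "sat E UM ((\<lambda>i. col (pr a (g i)))(y := col (pr a e))) \<phi>" by simp
    moreover have "col (pr a e) \<in> UM" unfolding UM_def using Ex.prems U_pr by blast
    ultimately show "sat E UM (\<lambda>i. col (pr a (g i))) (Ex y \<phi>)" by auto
  qed
qed

definition "cst x = lam b (\<lambda>_. x)"
definition "jj x = col (pr emp (cst x))"
lemma ap_cst: "z \<in> El b \<Longrightarrow> ap (cst x) z = x" unfolding cst_def by (rule ap_lam) (intro dfn)
lemma DT_jj[dfn]: "DT g \<Longrightarrow> DT (\<lambda>s. jj (g s))" by (rule DT_app1, unfold jj_def cst_def, intro dfn)

lemma emp_v: "emp \<in> El v" using LR_emp[OF LRv] by blast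

lemma jj_col: assumes "a \<in> El v" shows "jj x = col (pr a (cst x))"
  unfolding jj_def
proof (rule col_TQ)
  show "TQ (pr emp (cst x)) (pr a (cst x))"
    unfolding TR_def by (rule FO_all) (use assms emp_v v_pr b_p1 ap_cst in auto)
qed (use assms emp_v in auto)

lemma jj_elementary: "elementary_embedding E jj UM"
  unfolding elementary_embedding_def
proof (intro conjI ballI allI subsetI)
  show "definable E UNIV UM" unfolding definable_DP by (rule DP_UM)
  show "y \<in> UM" if "x \<in> UM" "y \<in> El x" for x y
  proof -
    obtain p where "x = col p" using \<open>x \<in> UM\<close> unfolding UM_def by blast
    then obtain z where "y = col z" "Rn z p" using \<open>y \<in> El x\<close> El_col[of p] by blast
    then show ?thesis using Rn_U unfolding UM_def by blast
  qed
  have "DP (\<lambda>s. \<exists>x. s 0 = pr x (jj x))" by (intro dfn)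
  then show "definable E UNIV {pr x (jj x) |x. True}" unfolding definable_DP by simp
  show "y \<in> UM" if "y \<in> range jj" for y using that emp_v U_pr unfolding jj_def UM_def by blast
  fix \<phi> s
  have "sat E UM (jj \<circ> s) \<phi> \<longleftrightarrow> FO emp (\<lambda>x. sat E UNIV (\<lambda>i. ap (cst (s i)) x) \<phi>)"
    using Los[OF emp_v, of "\<lambda>i. cst (s i)" \<phi>] by (simp add: comp_def jj_def)
  also have "\<dots> \<longleftrightarrow> FO emp (\<lambda>x. sat E UNIV s \<phi>)" by (rule FO_cong) (simp add: ap_cst)
  also have "\<dots> \<longleftrightarrow> sat E UNIV s \<phi>"
    using FO_all[OF emp_v, of "\<lambda>x. sat E UNIV s \<phi>"] FO_not[OF _ emp_v, of "\<lambda>x. sat E UNIV s \<phi>"] FO_all[OF emp_v, of "\<lambda>x. \<not> sat E UNIV s \<phi>"]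
    by (auto simp: dfn)
  finally show "sat E UNIV s \<phi> = sat E UM (jj \<circ> s) \<phi>" ..
qed

sublocale emb E jj UM by unfold_locales (rule jj_elementary)

definition "idb = lam b (\<lambda>x. x)"
lemma ap_idb: "z \<in> El b \<Longrightarrow> ap idb z = z" unfolding idb_def by (rule ap_lam) (intro dfn)

text \<open>By induction on membership: members of \<open>a\<close> enter through the relation for
  membership, and conversely \<open>FO_ex\<close> turns a member of the class into the identity at
  some member of \<open>a\<close>. This puts all of \<open>v\<close> into the ultrapower.\<close>

lemma col_id: "a \<in> El v \<Longrightarrow> col (pr a idb) = a"
proof -
  have "a \<in> El v \<longrightarrow> col (pr a idb) = a"
  proof (induction a rule: eps_induct)
    case D show ?case by (intro dfn)
  next
    case (step a)
    show ?case
    proof (intro impI, rule El_ext, intro equalityI subsetI)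
      fix y assume a: "a \<in> El v" and "y \<in> El a"
      then have y: "y \<in> El v" using LR_trans[OF LRv] by blast
      have "TE (pr y idb) (pr a idb)"
      proof -
        have "FO (pr y a) (\<lambda>z. p1 z \<in> El (p2 z))" using FO_Mem[OF v_pr[OF y a]] \<open>y \<in> El a\<close> by simp
        moreover have "FO (pr y a) (\<lambda>z. p1 z \<in> El (p2 z)) = FO (pr y a) (\<lambda>z. ap idb (p1 z) \<in> El (ap idb (p2 z)))"
          by (rule FO_cong) (simp add: ap_idb b_p1)
        ultimately show ?thesis unfolding TR_def by simp
      qed
      then have "col (pr y idb) \<in> El (col (pr a idb))" using col_mem y a by simp
      then show "y \<in> El (col (pr a idb))" using step[OF \<open>y \<in> El a\<close>] y by simp
    next
      fix y assume a: "a \<in> El v" and "y \<in> El (col (pr a idb))"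
      then obtain t where t: "Rn t (pr a idb)" "y = col t" unfolding El_col[of "pr a idb"] by blast
      have tU: "U t" "TE t (pr a idb)" using Rn_U[OF t(1)] by auto
      define c h where "c = p1 t" "h = p2 t"
      have c: "c \<in> El v" using tU(1) unfolding U_def c_h_def by blast
      let ?Z = "\<lambda>q. ap h (p1 q) = p2 q"
      have dZ: "DP (\<lambda>s. ?Z (s 0))" by (intro dfn)
      have d: "DP (\<lambda>s. ap h (p1 (s 0)) \<in> El (ap idb (p2 (s 0))))" "DP (\<lambda>s. \<exists>z\<in>El (p2 (s 0)). ?Z (pr (p1 (s 0)) z))" by (intro dfn)+
      have "FO (pr c a) (\<lambda>z. ap h (p1 z) \<in> El (ap idb (p2 z)))" using tU(2) unfolding TR_def c_h_def by simp
      from FO_mono[OF d v_pr[OF c a] this] have "FO (pr c a) (\<lambda>p. \<exists>z\<in>El (p2 p). ?Z (pr (p1 p) z))" by (simp add: ap_idb b_p1)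
      from FO_ex[OF dZ v_pr[OF c a] this] obtain w where w: "w \<in> El a" "FO (pr c w) ?Z" by auto
      have wv: "w \<in> El v" using LR_trans[OF LRv a] w(1) by blast
      have "FO (pr c w) ?Z = FO (pr c w) (\<lambda>z. ap h (p1 z) = ap idb (p2 z))" by (rule FO_cong) (simp add: ap_idb b_p1)
      then have "TQ t (pr w idb)" using w(2) unfolding TR_def c_h_def by simp
      then have "y = col (pr w idb)" using col_TQ[OF tU(1)] wv t(2) by simp
      then show "y \<in> El a" using step[OF w(1)] wv w(1) by simp
    qed
  qed
  then show "a \<in> El v \<Longrightarrow> col (pr a idb) = a" by blast
qed

lemma v_UM: "El v \<subseteq> UM"
proof
  fix a assume a: "a \<in> El v"
  then have "col (pr a idb) \<in> UM" unfolding UM_def using U_pr by blast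
  then show "a \<in> UM" using col_id[OF a] by simp
qed

theorem FO_jj: assumes a: "a \<in> El v" shows "FO a (\<lambda>x. x \<in> El X) \<longleftrightarrow> a \<in> El (jj X)"
proof -
  have "a \<in> El (jj X) \<longleftrightarrow> col (pr a idb) \<in> El (col (pr a (cst X)))" using col_id[OF a] jj_col[OF a] by simp
  also have "\<dots> \<longleftrightarrow> FO a (\<lambda>x. ap idb x \<in> El (ap (cst X) x))" using col_mem[of "pr a idb" "pr a (cst X)"] TR_same[OF D2_mem(1) a] a by simp
  also have "\<dots> \<longleftrightarrow> FO a (\<lambda>x. x \<in> El X)" by (rule FO_cong) (simp add: ap_idb ap_cst)
  finally show ?thesis ..
qed

theorem k_jj: assumes "El X \<subseteq> El b" shows "El (ap f X) = El (jj X) \<inter> El v"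
proof -
  have "sep b (\<lambda>x. x \<in> El X) = X" by (rule El_ext) (subst El_sep, intro dfn, use assms in auto)
  then show ?thesis using FO_jj[of _ X] kS[OF assms] unfolding FO_def by auto
qed

theorem sat_id: assumes "a \<in> El v" shows "sat E UM (\<lambda>_. a) \<phi> \<longleftrightarrow> FO a (\<lambda>x. sat E UNIV (\<lambda>_. x) \<phi>)"
proof -
  have "FO a (\<lambda>x. sat E UNIV (\<lambda>_. ap idb x) \<phi>) = FO a (\<lambda>x. sat E UNIV (\<lambda>_. x) \<phi>)" by (rule FO_cong) (simp add: ap_idb)
  then show ?thesis using Los[OF assms, of "\<lambda>_. idb" \<phi>] col_id[OF assms] by simp
qed

end

subsection \<open>Limit ranks are \<open>\<Pi>\<^sub>1\<close>-definable\<close>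

context zfc
begin

text \<open>Following Scott and Potter, \<open>r\<close> is a rank if it is the union of the power sets of the members of a
  history \<open>h\<close>, a set whose members arise in the same way from the members of \<open>h\<close> below them.\<close>

definition "hist v h r \<longleftrightarrow> (\<forall>y\<in>El r. \<exists>b\<in>El h. El y \<subseteq> El b) \<and> (\<forall>b\<in>El h. \<forall>y\<in>El v. El y \<subseteq> El b \<longrightarrow> y \<in> El r) \<and>
  (\<forall>a\<in>El h. (\<forall>y\<in>El a. \<exists>b\<in>El h. b \<in> El a \<and> El y \<subseteq> El b) \<and> (\<forall>b\<in>El h. b \<in> El a \<longrightarrow> (\<forall>y\<in>El v. El y \<subseteq> El b \<longrightarrow> y \<in> El a)))"

text \<open>The set \<open>u\<close> bounds the search for subsets in \<open>hist\<close>. The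
  unbounded part of being a limit rank is closure under subsets, which is kept apart. The second
  clause yields \<open>om\<close> through an inductive set.\<close>

definition "LR0 u v \<longleftrightarrow> (\<forall>x\<in>El v. El x \<subseteq> El v) \<and>
  (\<exists>w\<in>El v. (\<exists>e\<in>El w. e = emp) \<and> (\<forall>y\<in>El w. \<exists>z\<in>El w. z = sc y)) \<and>
  (\<forall>x\<in>El v. \<exists>t\<in>El v. \<exists>h\<in>El v. x \<in> El t \<and> hist u h t)"

lemma D0_hist[dz]: "TD f \<Longrightarrow> TD g \<Longrightarrow> TD h \<Longrightarrow> D0 (\<lambda>s. hist (f s) (g s) (h s))"
  by (rule D0_app3[of hist], unfold hist_def, intro dz)
lemma D0_LR0[dz]: "TD f \<Longrightarrow> TD g \<Longrightarrow> D0 (\<lambda>s. LR0 (f s) (g s))"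
  by (rule D0_app2[of LR0], unfold LR0_def, intro dz)

lemma histD:
  assumes "hist v h r"
  shows "y \<in> El r \<Longrightarrow> \<exists>b\<in>El h. El y \<subseteq> El b" "b \<in> El h \<Longrightarrow> y \<in> El v \<Longrightarrow> El y \<subseteq> El b \<Longrightarrow> y \<in> El r"
    "a \<in> El h \<Longrightarrow> y \<in> El a \<Longrightarrow> \<exists>b\<in>El h. b \<in> El a \<and> El y \<subseteq> El b"
    "a \<in> El h \<Longrightarrow> b \<in> El h \<Longrightarrow> b \<in> El a \<Longrightarrow> y \<in> El v \<Longrightarrow> El y \<subseteq> El b \<Longrightarrow> y \<in> El a"
  using assms unfolding hist_def by simp_all

text \<open>Induction on membership shows that each member of the history is its own level. Since
  \<open>v\<close> has all subsets of its members, the bounded quantifiers in \<open>hist\<close>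
  see every subset that matters.\<close>

lemma hist_level:
  assumes v: "\<And>x y. y \<in> El v \<Longrightarrow> El x \<subseteq> El y \<Longrightarrow> x \<in> El v" "\<And>x. x \<in> El v \<Longrightarrow> El x \<subseteq> El v" and h: "h \<in> El v" and H: "hist v h t"
  shows "t = Vs t"
proof -
  have a: "a \<in> El h \<longrightarrow> a = Vs a" for a
  proof (induction a rule: eps_induct)
    case D show ?case by (intro dfn)
  next
    case (step a)
    show ?case
    proof (intro impI El_ext equalityI subsetI)
      fix z assume "a \<in> El h" "z \<in> El a"
      then obtain b where b: "b \<in> El h" "b \<in> El a" "El z \<subseteq> El b" using histD(3)[OF H] by blast
      then have "b = Vs b" using step by blast
      then have "El z \<subseteq> El (Vs b)" using b(3) by simp
      then show "z \<in> El (Vs a)" unfolding El_Vs[of a] using b(2) by blast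
    next
      fix z assume ah: "a \<in> El h" and "z \<in> El (Vs a)"
      then obtain y where y: "y \<in> El a" "El z \<subseteq> El (Vs y)" unfolding El_Vs[of a] by blast
      then obtain b where b: "b \<in> El h" "b \<in> El a" "El y \<subseteq> El b" using histD(3)[OF H ah] by blast
      have "b = Vs b" using step b by blast
      then have "El z \<subseteq> El b" using y(2) Vs_mono[OF b(3)] by auto
      moreover have "z \<in> El v" using v(1)[OF _ \<open>El z \<subseteq> El b\<close>] v(2)[OF h] b(1) by blast
      ultimately show "z \<in> El a" using histD(4)[OF H ah b(1,2)] by blast
    qed
  qed
  show ?thesis
  proof (intro El_ext equalityI subsetI)
    fix z assume "z \<in> El t"
    then obtain b where b: "b \<in> El h" "El z \<subseteq> El b" using histD(1)[OF H] by blast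
    then have bb: "b = Vs b" using a by blast
    have "b \<in> El t" using histD(2)[OF H b(1)] b(1) v(2)[OF h] by blast
    moreover have "El z \<subseteq> El (Vs b)" using b(2) bb by simp
    ultimately show "z \<in> El (Vs t)" unfolding El_Vs[of t] by blast
  next
    fix z assume "z \<in> El (Vs t)"
    then obtain y where y: "y \<in> El t" "El z \<subseteq> El (Vs y)" unfolding El_Vs[of t] by blast
    then obtain b where b: "b \<in> El h" "El y \<subseteq> El b" using histD(1)[OF H] by blast
    have "b = Vs b" using a b by blast
    then have "El z \<subseteq> El b" using y(2) Vs_mono[OF b(2)] by auto
    moreover have "z \<in> El v" using v(1)[OF _ \<open>El z \<subseteq> El b\<close>] v(2)[OF h] b(1) by blast
    ultimately show "z \<in> El t" using histD(2)[OF H b(1)] b by blast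
  qed
qed

lemma LR0_D:
  assumes sub: "\<And>x y. y \<in> El v \<Longrightarrow> El x \<subseteq> El y \<Longrightarrow> x \<in> El v" and L: "LR0 v v" shows "LR v"
proof -
  have tr: "\<And>x. x \<in> El v \<Longrightarrow> El x \<subseteq> El v" using L unfolding LR0_def by simp
  have lev: "\<exists>t\<in>El v. x \<in> El t \<and> t = Vs t" if "x \<in> El v" for x
  proof -
    have "\<exists>t\<in>El v. \<exists>h\<in>El v. x \<in> El t \<and> hist v h t" using L that unfolding LR0_def by simp
    then obtain t h where t: "t \<in> El v" "h \<in> El v" "x \<in> El t" "hist v h t" by auto
    have "t = Vs t" by (rule hist_level[OF sub tr t(2,4)])
    then show ?thesis using t by blast
  qed
  have vv: "v = Vs v"
  proof (intro El_ext equalityI subsetI)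
    fix z assume "z \<in> El v"
    then obtain t where t: "t \<in> El v" "z \<in> El t" "t = Vs t" using lev by blast
    then have "El z \<subseteq> El (Vs t)" using Vs_trans[of z t] by auto
    then show "z \<in> El (Vs v)" unfolding El_Vs[of v] using t(1) by blast
  next
    fix z assume "z \<in> El (Vs v)"
    then obtain y where y: "y \<in> El v" "El z \<subseteq> El (Vs y)" unfolding El_Vs[of v] by blast
    obtain t where t: "t \<in> El v" "y \<in> El t" "t = Vs t" using lev[OF y(1)] by blast
    then have "Vs y \<in> El t" using Vs_mem[OF t(2)] by simp
    then have "Vs y \<in> El v" using tr[OF t(1)] by blast
    then show "z \<in> El v" using sub y(2) by blast
  qed
  obtain w where w: "w \<in> El v" "emp \<in> El w" "\<forall>y\<in>El w. sc y \<in> El w" using L unfolding LR0_def by auto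
  then have "ind w" unfolding ind_def by blast
  then have "El om \<subseteq> El w" using om_iff by blast
  then have om: "om \<in> El v" using sub w(1) by blast
  define d where "d = rk v"
  have od: "Od d" unfolding d_def by simp
  have omd: "om \<in> El d" using rk_mem[OF om] rk_Od[of om] unfolding d_def by simp
  have "Lim d" unfolding Lim_def
  proof (intro conjI ballI)
    show "emp \<in> El d" using Od_trans[OF od omd] om_emp by blast
    fix a assume "a \<in> El d"
    then obtain z where z: "z \<in> El v" "a = rk z \<or> a \<in> El (rk z)" unfolding d_def El_rk[of v] by blast
    obtain t where t: "t \<in> El v" "z \<in> El t" using lev[OF z(1)] by blast
    have "rk z \<in> El (rk t)" using rk_mem[OF t(2)] .
    then have "a \<in> El (rk t)" using z(2) Od_trans[OF Od_rk, of "rk z" t] by blast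
    then have "El (sc a) \<subseteq> El (rk t)" using Od_trans[OF Od_rk, of a t] by auto
    moreover have "rk t \<in> El d" using rk_mem[OF t(1)] unfolding d_def .
    ultimately show "sc a \<in> El d" using Od_sub_mem[of "sc a" d "rk t"] od Od_mem[OF od \<open>a \<in> El d\<close>] by simp
  qed (rule od)
  moreover have "v = Vs d" unfolding d_def using vv Vs_rk[of v] by simp
  ultimately show ?thesis unfolding LR_def using omd by blast
qed

lemma LR_LR0: assumes "LR v" "LR w" "El v \<subseteq> El w" shows "LR0 w v"
proof -
  obtain d where d: "Lim d" "om \<in> El d" "v = Vs d" using assms(1) unfolding LR_def by blast
  have od: "Od d" using d(1) unfolding Lim_def by blast
  show ?thesis unfolding LR0_def
  proof (intro conjI ballI)
    show "El x \<subseteq> El v" if "x \<in> El v" for x using LR_trans[OF assms(1) that] .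
    show "\<exists>w\<in>El v. (\<exists>e\<in>El w. e = emp) \<and> (\<forall>y\<in>El w. \<exists>z\<in>El w. z = sc y)"
      using LR_omsub[OF assms(1)] om_emp om_sc by (intro bexI[of _ om]) auto
    fix x assume x: "x \<in> El v"
    define a where "a = sc (rk x)"
    have a: "a \<in> El d" "Od a" using x Vs_rk_iff[OF od, of x] d unfolding a_def Lim_def by auto
    define h where "h = rep a Vs"
    have h: "El h = Vs ` El a" unfolding h_def by (rule El_rep) (intro dfn)
    have "h \<in> El v" 
    proof -
      have "El h \<subseteq> El (Vs a)" unfolding h using Vs_mem by blast
      then show ?thesis unfolding d(3) El_Vs[of d] using a(1) by blast
    qed
    moreover have "Vs a \<in> El v" unfolding d(3) using Vs_mem[OF a(1)] .
    moreover have "x \<in> El (Vs a)" using Vs_rk_iff[OF a(2), of x] unfolding a_def by simp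
    moreover have "hist w h (Vs a)"
      unfolding hist_def h
    proof (intro conjI ballI impI)
      fix y assume "y \<in> El (Vs a)" then show "\<exists>b\<in>Vs ` El a. El y \<subseteq> El b" unfolding El_Vs[of a] by blast
    next
      fix b y assume "b \<in> Vs ` El a" "El y \<subseteq> El b" then show "y \<in> El (Vs a)" unfolding El_Vs[of a] by blast
    next
      fix c y assume "c \<in> Vs ` El a" "y \<in> El c"
      then obtain e where e: "e \<in> El a" "c = Vs e" by blast
      then obtain g where g: "g \<in> El e" "El y \<subseteq> El (Vs g)" using \<open>y \<in> El c\<close> El_Vs[of e] by blast
      have "g \<in> El a" using Od_trans[OF a(2) e(1)] g(1) by blast
      then show "\<exists>b\<in>Vs ` El a. b \<in> El c \<and> El y \<subseteq> El b" using g e Vs_mem[OF g(1)] by blast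
    next
      fix c b y assume h: "c \<in> Vs ` El a" "b \<in> Vs ` El a" "b \<in> El c" "El y \<subseteq> El b"
      then show "y \<in> El c" using Vs_sub by blast
    qed
    ultimately show "\<exists>t\<in>El v. \<exists>h\<in>El v. x \<in> El t \<and> hist w h t" by blast
  qed
qed

lemma LR_iff: "LR v \<longleftrightarrow> LR0 v v \<and> (\<forall>x. \<forall>y\<in>El v. El x \<subseteq> El y \<longrightarrow> x \<in> El v)"
  using LR_LR0[of v v] LR0_D[of v] LR_sub by blast

text \<open>A limit rank \<open>w\<close> has all subsets of its members as members, so bounding the
  quantifier over subsets by \<open>w\<close> loses nothing.\<close>

lemma LR_in: assumes "LR w" "v \<in> El w" shows "LR v \<longleftrightarrow> LR0 w v \<and> (\<forall>x\<in>El w. \<forall>y\<in>El v. El x \<subseteq> El y \<longrightarrow> x \<in> El v)"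
proof -
  have vw: "El v \<subseteq> El w" using LR_trans assms by blast
  show ?thesis
  proof
    assume "LR v" then show "LR0 w v \<and> (\<forall>x\<in>El w. \<forall>y\<in>El v. El x \<subseteq> El y \<longrightarrow> x \<in> El v)"
      using LR_LR0 assms vw LR_sub by blast
  next
    assume a: "LR0 w v \<and> (\<forall>x\<in>El w. \<forall>y\<in>El v. El x \<subseteq> El y \<longrightarrow> x \<in> El v)"
    have sub: "x \<in> El v" if "y \<in> El v" "El x \<subseteq> El y" for x y
      using a that LR_sub[OF assms(1), of y x] vw by blast
    have hm: "hist v h t" if "hist w h t" for h t
      unfolding hist_def using histD(1,3)[OF that] histD(2,4)[OF that] subsetD[OF vw] by simp
    have "LR0 v v" unfolding LR0_def
    proof (intro conjI)
      show "\<forall>x\<in>El v. El x \<subseteq> El v" using a unfolding LR0_def by simp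
      show "\<exists>w\<in>El v. (\<exists>e\<in>El w. e = emp) \<and> (\<forall>y\<in>El w. \<exists>z\<in>El w. z = sc y)" using a unfolding LR0_def by simp
      show "\<forall>x\<in>El v. \<exists>t\<in>El v. \<exists>h\<in>El v. x \<in> El t \<and> hist v h t"
        using a hm unfolding LR0_def by meson
    qed
    then show "LR v" using LR0_D sub by blast
  qed
qed

lemma PI_LR: "PI (Suc k) (\<lambda>s. LR (s i))"
  unfolding LR_iff by (intro PI_and D0_PI PI_all dz)

lemma DP_LR[dfn]: "DT f \<Longrightarrow> DP (\<lambda>s. LR (f s))"
  by (rule DP_app1[of LR], unfold LR_def, intro dfn)

end

context zfc
begin

subsection \<open>Evaluation certificates\<close>

primrec num :: "nat \<Rightarrow> 'a" where "num 0 = emp" | "num (Suc n) = sc (num n)"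
lemma num_om: "num n \<in> El om" by (induction n) auto
lemma num_inj[simp]: "num m = num n \<longleftrightarrow> m = n"
proof (induction m arbitrary: n)
  case 0 show ?case by (cases n) auto
next
  case (Suc m) then show ?case by (cases n) auto
qed

declare num.simps[simp del]
lemma num_mem[simp]: "num i \<in> El (num j) \<longleftrightarrow> i < j"
  by (induction j) (auto simp: num.simps)
lemma sc_num[simp]: "sc (num k) = num (Suc k)" by (simp add: num.simps)

lemma D0_num[dz]: "TD f \<Longrightarrow> D0 (\<lambda>s. f s = num k)"
proof (induction k arbitrary: f)
  case 0 show ?case unfolding num.simps by (intro dz 0)
next
  case (Suc k)
  have "(x = num (Suc k)) = (\<exists>y\<in>El x. y = num k \<and> x = sc y)" for x
  proof
    assume x: "x = num (Suc k)"
    then have "num k \<in> El x" by simp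
    then show "\<exists>y\<in>El x. y = num k \<and> x = sc y" by (rule bexI[rotated]) (simp add: x)
  qed auto
  moreover have "D0 (\<lambda>s. \<exists>y\<in>El (f s). y = num k \<and> f s = sc y)"
    by (intro dz Suc.IH Suc.prems TD_shift[OF Suc.prems])
  ultimately show ?case by simp
qed

lemma sat_Mem_El: "sat E D s (Mem x y) \<longleftrightarrow> s x \<in> El (s y)" by (simp add: elts_def)

primrec cd :: "fm \<Rightarrow> 'a" where
  "cd (Mem x y) = pr (num 0) (pr (num x) (num y))"
| "cd (Eq x y) = pr (num 2) (pr (num x) (num y))"
| "cd (Neg \<phi>) = pr (num 3) (cd \<phi>)"
| "cd (And \<phi> \<psi>) = pr (num 4) (pr (cd \<phi>) (cd \<psi>))"
| "cd (Ex x \<phi>) = pr (num 5) (pr (num x) (cd \<phi>))"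

lemma cd_inj[simp]: "cd \<phi> = cd \<psi> \<longleftrightarrow> \<phi> = \<psi>"
  by (induction \<phi> arbitrary: \<psi>; case_tac \<psi>) auto

lemma cd_LR: "LR v \<Longrightarrow> cd \<phi> \<in> El v"
  using LR_omsub(2)[of v] num_om by (induction \<phi>) (auto intro!: LR_pr)

primrec sbf :: "fm \<Rightarrow> fm set" where
  "sbf (Mem x y) = {Mem x y}" | "sbf (Eq x y) = {Eq x y}" | "sbf (Neg \<phi>) = insert (Neg \<phi>) (sbf \<phi>)"
| "sbf (And \<phi> \<psi>) = insert (And \<phi> \<psi>) (sbf \<phi> \<union> sbf \<psi>)" | "sbf (Ex x \<phi>) = insert (Ex x \<phi>) (sbf \<phi>)"
primrec vars :: "fm \<Rightarrow> nat set" where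
  "vars (Mem x y) = {x, y}" | "vars (Eq x y) = {x, y}" | "vars (Neg \<phi>) = vars \<phi>"
| "vars (And \<phi> \<psi>) = vars \<phi> \<union> vars \<psi>" | "vars (Ex x \<phi>) = insert x (vars \<phi>)"
lemma fin_sbf: "finite (sbf \<phi>)" and fin_vars: "finite (vars \<phi>)" and self_sbf: "\<phi> \<in> sbf \<phi>" by (induction \<phi>) auto
lemma sbf_trans: "\<psi> \<in> sbf \<phi> \<Longrightarrow> sbf \<psi> \<subseteq> sbf \<phi>" by (induction \<phi>) auto
lemma sbf_vars: "\<psi> \<in> sbf \<phi> \<Longrightarrow> vars \<psi> \<subseteq> vars \<phi>" by (induction \<phi>) auto
lemma fv_vars: "fv \<phi> \<subseteq> vars \<phi>" by (induction \<phi>) auto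

definition "agr i t u \<longleftrightarrow> (\<forall>p\<in>El t. p1 p \<noteq> i \<longrightarrow> p \<in> El u) \<and> (\<forall>p\<in>El u. p1 p \<noteq> i \<longrightarrow> p \<in> El t)"

text \<open>The Tarski clause for the code \<open>k\<close> at the assignment \<open>t\<close>, where \<open>S\<close> is a set of assignments and
  \<open>Q\<close> the satisfaction relation. A certificate \<open>q\<close> for the formula coded by \<open>p1 d\<close> consists of such a
  \<open>Q = p1 q\<close> and \<open>S = p2 q\<close>; the remaining components of \<open>d\<close> are the set of codes of subformulas and
  the set of variables.\<close>

definition "ho k t S Q \<longleftrightarrow>
  (p1 k = num 0 \<and> (\<exists>x\<in>El t. \<exists>y\<in>El t. p1 x = p1 (p2 k) \<and> p1 y = p2 (p2 k) \<and> p2 x \<in> El (p2 y))) \<or>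
  (p1 k = num 2 \<and> (\<exists>x\<in>El t. \<exists>y\<in>El t. p1 x = p1 (p2 k) \<and> p1 y = p2 (p2 k) \<and> p2 x = p2 y)) \<or>
  (p1 k = num 3 \<and> \<not> pr (p2 k) t \<in> El Q) \<or>
  (p1 k = num 4 \<and> pr (p1 (p2 k)) t \<in> El Q \<and> pr (p2 (p2 k)) t \<in> El Q) \<or>
  (p1 k = num 5 \<and> (\<exists>u\<in>El S. agr (p1 (p2 k)) t u \<and> pr (p2 (p2 k)) u \<in> El Q))"
text \<open>Closure under changing one value is what the quantifier clause uses; it is a bounded
  condition that the space of all assignments satisfies.\<close>

definition "full I w S \<longleftrightarrow> (\<forall>t\<in>El S. fn t I \<and> (\<forall>p\<in>El t. p2 p \<in> El w) \<and>
  (\<forall>i\<in>El I. \<forall>a\<in>El w. \<exists>u\<in>El S. agr i t u \<and> pr i a \<in> El u))"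
definition "cert w q d s \<longleftrightarrow> s \<in> El (p2 q) \<and> pr (p1 d) s \<in> El (p1 q) \<and> full (p2 (p2 d)) w (p2 q) \<and>
  (\<forall>k\<in>El (p1 (p2 d)). \<forall>t\<in>El (p2 q). pr k t \<in> El (p1 q) \<longleftrightarrow> ho k t (p2 q) (p1 q))"

lemma D0_agr[dz]: "TD f \<Longrightarrow> TD g \<Longrightarrow> TD h \<Longrightarrow> D0 (\<lambda>s. agr (f s) (g s) (h s))"
  by (rule D0_app3[of agr], unfold agr_def, intro dz)
lemma D0_ho[dz]: "TD f \<Longrightarrow> TD g \<Longrightarrow> TD h \<Longrightarrow> TD k \<Longrightarrow> D0 (\<lambda>s. ho (f s) (g s) (h s) (k s))"
  by (rule D0_app4[of ho], unfold ho_def, intro D0_num dz)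
lemma D0_full[dz]: "TD f \<Longrightarrow> TD g \<Longrightarrow> TD h \<Longrightarrow> D0 (\<lambda>s. full (f s) (g s) (h s))"
  by (rule D0_app3[of full], unfold full_def, intro dz)
lemma D0_cert: "D0 (\<lambda>s. cert (s i) (s j) (s k) (s l))"
  unfolding cert_def by (intro dz)
lemma DP_cert[dfn]: "DT f \<Longrightarrow> DT g \<Longrightarrow> DT h \<Longrightarrow> DT k \<Longrightarrow> DP (\<lambda>s. cert (f s) (g s) (h s) (k s))"
proof (rule DP_app4[of cert])
  show "DP (\<lambda>s. cert (s 0) (s 1) (s 2) (s 3))"
    by (rule DP_FD) (rule FD_mono[OF D0_cert], simp)
qed

definition "dg \<phi> = pr (cd \<phi>) (pr (mk (cd ` sbf \<phi>)) (mk (num ` vars \<phi>)))"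
lemma El_dg[simp]: "El (mk (cd ` sbf \<phi>)) = cd ` sbf \<phi>" "El (mk (num ` vars \<phi>)) = num ` vars \<phi>"
  by (simp_all add: isS_finite fin_sbf fin_vars)

lemma LR_fin: assumes v: "LR v" and "finite F" "F \<subseteq> El v" shows "mk F \<in> El v"
proof -
  obtain d where d: "Lim d" "v = Vs d" using v unfolding LR_def by blast
  show ?thesis using assms(2,3)
  proof (induction rule: finite_induct)
    case empty show ?case using LR_emp[OF v] unfolding emp_def by simp
  next
    case (insert x F)
    have "mk (insert x F) = un (mk F) (upr x x)"
      by (rule El_ext) (use isS_finite[OF insert(1)] isS_insert in auto)
    then show ?case using insert Vs_un[OF d(1)] Vs_upr[OF d(1)] unfolding d(2) by simp
  qed
qed

lemma num_LR: "LR v \<Longrightarrow> num i \<in> El v" using LR_omsub(2) num_om by blast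

lemma dg_LR: "LR v \<Longrightarrow> dg \<phi> \<in> El v"
  unfolding dg_def by (intro LR_pr LR_fin cd_LR) (auto intro: cd_LR num_LR simp: fin_sbf fin_vars)

definition "asg \<phi> \<sigma> = mk ((\<lambda>i. pr (num i) (\<sigma> i)) ` vars \<phi>)"
lemma El_asg: "El (asg \<phi> \<sigma>) = (\<lambda>i. pr (num i) (\<sigma> i)) ` vars \<phi>"
  unfolding asg_def by (intro El_mk isS_finite finite_imageI fin_vars)
lemma asg_LR: "LR v \<Longrightarrow> (\<And>i. i \<in> vars \<phi> \<Longrightarrow> \<sigma> i \<in> El v) \<Longrightarrow> asg \<phi> \<sigma> \<in> El v"
  unfolding asg_def by (rule LR_fin) (auto intro!: LR_pr num_LR simp: fin_vars)
lemma fn_asg: "fn (asg \<phi> \<sigma>) (mk (num ` vars \<phi>))" unfolding fun_on_def El_asg by auto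
lemma ap_asg: assumes "i \<in> vars \<phi>" shows "ap (asg \<phi> \<sigma>) (num i) = \<sigma> i"
proof -
  have "pr (num i) (\<sigma> i) \<in> El (asg \<phi> \<sigma>)" unfolding El_asg using assms by blast
  then show ?thesis using fn_pr[OF fn_asg] by simp
qed
lemma asg_sat: "sat E D (\<lambda>i. ap (asg \<phi> \<sigma>) (num i)) \<phi> = sat E D \<sigma> \<phi>"
  by (rule sat_cong) (use fv_vars ap_asg in blast)

lemma agr_ap: assumes "fn t I" "fn u I" shows "agr i t u \<longleftrightarrow> (\<forall>k\<in>El I. k \<noteq> i \<longrightarrow> ap t k = ap u k)"
  unfolding agr_def fn_El[OF assms(1)] fn_El[OF assms(2)] by auto

lemma ho_sat:
  assumes F: "full (mk (num ` vars \<phi>)) w S" and \<psi>: "\<psi> \<in> sbf \<phi>" and t: "t \<in> El S"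
    and H: "\<And>\<chi> u. \<chi> \<in> sbf \<phi> \<Longrightarrow> size \<chi> < size \<psi> \<Longrightarrow> u \<in> El S \<Longrightarrow> pr (cd \<chi>) u \<in> El Q \<longleftrightarrow> sat E (El w) (\<lambda>i. ap u (num i)) \<chi>"
  shows "ho (cd \<psi>) t S Q \<longleftrightarrow> sat E (El w) (\<lambda>i. ap t (num i)) \<psi>"
proof -
  let ?I = "mk (num ` vars \<phi>)"
  have S: "fn u ?I" "\<And>p. p \<in> El u \<Longrightarrow> p2 p \<in> El w" "\<And>i a. i \<in> El ?I \<Longrightarrow> a \<in> El w \<Longrightarrow> \<exists>z\<in>El S. agr i u z \<and> pr i a \<in> El z"
    if "u \<in> El S" for u using F that unfolding full_def by blast+
  have vI: "num i \<in> El ?I" if "i \<in> vars \<psi>" for i using sbf_vars[OF \<psi>] that by auto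
  have sb: "\<chi> \<in> sbf \<phi>" if "\<chi> \<in> sbf \<psi>" for \<chi> using sbf_trans[OF \<psi>] that by blast
  show ?thesis
  proof (cases \<psi>)
    case (Mem x y)
    show ?thesis using ex_ap2[OF S(1)[OF t] vI S(1)[OF t] vI, of x y "\<lambda>a b. a \<in> El b"] unfolding Mem sat_Mem_El by (simp add: ho_def)
  next
    case (Eq x y)
    show ?thesis using ex_ap2[OF S(1)[OF t] vI S(1)[OF t] vI, of x y "\<lambda>a b. a = b"] unfolding Eq by (simp add: ho_def)
  next
    case (Neg \<chi>) show ?thesis using H[OF sb _ t, of \<chi>] self_sbf unfolding Neg by (simp add: ho_def)
  next
    case (And \<chi> \<xi>) show ?thesis using H[OF sb _ t, of \<chi>] H[OF sb _ t, of \<xi>] self_sbf unfolding And by (simp add: ho_def)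
  next
    case (Ex x \<chi>)
    have x: "num x \<in> El ?I" using vI unfolding Ex by simp
    have h: "pr (cd \<chi>) u \<in> El Q \<longleftrightarrow> sat E (El w) (\<lambda>i. ap u (num i)) \<chi>" if "u \<in> El S" for u
      using H[OF sb _ that, of \<chi>] self_sbf unfolding Ex by simp
    have upd: "sat E (El w) (\<lambda>i. ap u (num i)) \<chi> = sat E (El w) ((\<lambda>i. ap t (num i))(x := ap u (num x))) \<chi>"
      if "u \<in> El S" "agr (num x) t u" for u
    proof (rule sat_cong)
      fix i assume "i \<in> fv \<chi>"
      then have "num i \<in> El ?I" using fv_vars[of \<chi>] vI unfolding Ex by auto
      then show "ap u (num i) = ((\<lambda>i. ap t (num i))(x := ap u (num x))) i"
        using agr_ap[OF S(1)[OF t] S(1)[OF that(1)]] that(2) by auto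
    qed
    have "(\<exists>u\<in>El S. agr (num x) t u \<and> sat E (El w) ((\<lambda>i. ap t (num i))(x := ap u (num x))) \<chi>) \<longleftrightarrow>
      (\<exists>a\<in>El w. sat E (El w) ((\<lambda>i. ap t (num i))(x := a)) \<chi>)" (is "?L \<longleftrightarrow> ?R")
    proof
      assume ?L
      then obtain u where u: "u \<in> El S" "sat E (El w) ((\<lambda>i. ap t (num i))(x := ap u (num x))) \<chi>" by blast
      have "ap u (num x) \<in> El w" using S(2)[OF u(1) fn_el[OF S(1)[OF u(1)] x]] by simp
      then show ?R using u(2) by blast
    next
      assume ?R
      then obtain a where a: "a \<in> El w" "sat E (El w) ((\<lambda>i. ap t (num i))(x := a)) \<chi>" by blast
      obtain u where u: "u \<in> El S" "agr (num x) t u" "pr (num x) a \<in> El u" using S(3)[OF t x a(1)] by blast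
      have "a = ap u (num x)" using fn_pr[OF S(1)[OF u(1)]] u(3) by blast
      then show ?L using u a(2) by blast
    qed
    moreover have "ho (cd \<psi>) t S Q \<longleftrightarrow> (\<exists>u\<in>El S. agr (num x) t u \<and> pr (cd \<chi>) u \<in> El Q)" unfolding Ex by (simp add: ho_def)
    ultimately show ?thesis unfolding Ex sat.simps using h upd by blast
  qed
qed

text \<open>The clauses are unwound along the subformulas of a metatheoretic formula. Nothing is
  claimed about nonstandard codes that the model may contain.\<close>

lemma cert_sound: assumes "cert w q (dg \<phi>) (asg \<phi> \<sigma>)" shows "sat E (El w) \<sigma> \<phi>"
proof -
  have F: "full (mk (num ` vars \<phi>)) w (p2 q)" and a: "asg \<phi> \<sigma> \<in> El (p2 q)" "pr (cd \<phi>) (asg \<phi> \<sigma>) \<in> El (p1 q)"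
    and c: "\<And>\<psi> t. \<psi> \<in> sbf \<phi> \<Longrightarrow> t \<in> El (p2 q) \<Longrightarrow> pr (cd \<psi>) t \<in> El (p1 q) \<longleftrightarrow> ho (cd \<psi>) t (p2 q) (p1 q)"
    using assms unfolding cert_def dg_def by simp_all
  have "pr (cd \<psi>) t \<in> El (p1 q) \<longleftrightarrow> sat E (El w) (\<lambda>i. ap t (num i)) \<psi>" if "\<psi> \<in> sbf \<phi>" "t \<in> El (p2 q)" for \<psi> t
    using that
  proof (induction \<psi> arbitrary: t rule: measure_induct_rule[of size])
    case (less \<psi>)
    show ?case unfolding c[OF less.prems] by (rule ho_sat[OF F less.prems]) (rule less.IH)
  qed
  then show ?thesis using a self_sbf asg_sat by blast
qed

lemma isS_UN_fin: "finite F \<Longrightarrow> (\<And>x. x \<in> F \<Longrightarrow> isS (A x)) \<Longrightarrow> isS (\<Union>x\<in>F. A x)"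
  by (induction rule: finite_induct) (auto intro!: isS_Un)

lemma DP_satE: assumes "\<And>i. DT (F i)" "DT g" shows "DP (\<lambda>s. sat E (El (g s)) (\<lambda>i. F i s) \<phi>)"
  using assms
proof (induction \<phi> arbitrary: F g)
  case (Mem x y) then show ?case by (simp, intro DP_E)
next
  case (Eq x y) then show ?case by (simp, intro dfn)
next
  case (Neg \<phi>)
  have "DP (\<lambda>s. sat E (El (g s)) (\<lambda>n. F n s) \<phi>)" by (rule Neg.IH) (rule Neg.prems)+
  then show ?case by (simp add: DP_not)
next
  case (And \<phi>1 \<phi>2)
  have "DP (\<lambda>s. sat E (El (g s)) (\<lambda>n. F n s) \<phi>1)" by (rule And.IH(1)) (rule And.prems)+
  moreover have "DP (\<lambda>s. sat E (El (g s)) (\<lambda>n. F n s) \<phi>2)" by (rule And.IH(2)) (rule And.prems)+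
  ultimately show ?case by (simp add: DP_and)
next
  case (Ex x \<phi>)
  have "DP (\<lambda>s. \<exists>a\<in>El (g s). sat E (El (g s)) ((\<lambda>n. F n s)(x := a)) \<phi>)"
  proof (intro dfn DT_sub[OF Ex.prems(2)])
    have "DP (\<lambda>s. sat E (El (g (\<lambda>n. s (Suc n)))) (\<lambda>n. (if n = x then (\<lambda>s. s 0) else (\<lambda>s. F n (\<lambda>n. s (Suc n)))) s) \<phi>)"
      by (rule Ex.IH) (auto intro: DT_var DT_sub Ex.prems)
    then show "DP (\<lambda>s. sat E (El (g (\<lambda>n. s (Suc n)))) ((\<lambda>n. F n (\<lambda>n. s (Suc n)))(x := s 0)) \<phi>)"
      by (rule back_subst[of DP]) (auto intro!: HOL.ext arg_cong[where f="\<lambda>u. sat E _ u \<phi>"])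
  qed
  then show ?case by simp
qed

lemma full_fun_sp: "full I w (fun_sp I w)"
  unfolding full_def
proof (intro ballI conjI)
  fix t assume t: "t \<in> El (fun_sp I w)"
  then have f: "fn t I" "\<And>i. i \<in> El I \<Longrightarrow> ap t i \<in> El w" by auto
  show "fn t I" by (rule f(1))
  show "p2 p \<in> El w" if "p \<in> El t" for p using that f unfolding fn_El[OF f(1)] by auto
  fix i a assume i: "i \<in> El I" and a: "a \<in> El w"
  define u where "u = lam I (\<lambda>k. if k = i then a else ap t k)"
  have d: "DT (\<lambda>s. if s 0 = i then a else ap t (s 0))" by (intro dfn)
  have u: "fn u I" "\<And>k. k \<in> El I \<Longrightarrow> ap u k = (if k = i then a else ap t k)"
    unfolding u_def by (rule fn_lam[OF d], rule ap_lam[OF d])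
  have "u \<in> El (fun_sp I w)" using u f a by auto
  moreover have "agr i t u" using agr_ap[OF f(1) u(1)] u(2) by auto
  moreover have "pr i a \<in> El u" using fn_el[OF u(1) i] u(2)[OF i] by simp
  ultimately show "\<exists>u\<in>El (fun_sp I w). agr i t u \<and> pr i a \<in> El u" by blast
qed

lemma cert_complete:
  assumes s: "\<And>i. i \<in> vars \<phi> \<Longrightarrow> \<sigma> i \<in> El w" and st: "sat E (El w) \<sigma> \<phi>"
  shows "\<exists>q. cert w q (dg \<phi>) (asg \<phi> \<sigma>)"
proof -
  define S where "S = fun_sp (mk (num ` vars \<phi>)) w"
  define A where "A \<psi> = {pr (cd \<psi>) t |t. t \<in> El S \<and> sat E (El w) (\<lambda>i. ap t (num i)) \<psi>}" for \<psi>
  define Q where "Q = mk (\<Union>\<psi>\<in>sbf \<phi>. A \<psi>)"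
  have "isS (A \<psi>)" for \<psi>
  proof -
    have "isS (pr (cd \<psi>) ` {t \<in> El S. sat E (El w) (\<lambda>i. ap t (num i)) \<psi>})"
      by (intro isS_image isS_Collect isS_El DP_satE dfn)
    then show ?thesis unfolding A_def by (rule back_subst[of isS]) auto
  qed
  then have Q: "El Q = (\<Union>\<psi>\<in>sbf \<phi>. A \<psi>)" unfolding Q_def by (simp add: isS_UN_fin fin_sbf)
  have Qi: "pr (cd \<psi>) t \<in> El Q \<longleftrightarrow> sat E (El w) (\<lambda>i. ap t (num i)) \<psi>" if "\<psi> \<in> sbf \<phi>" "t \<in> El S" for \<psi> t
    unfolding Q A_def using that by auto
  have F: "full (mk (num ` vars \<phi>)) w S" unfolding S_def by (rule full_fun_sp)
  have aS: "asg \<phi> \<sigma> \<in> El S" unfolding S_def using fn_asg s ap_asg by auto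
  have "pr (cd \<psi>) t \<in> El Q \<longleftrightarrow> ho (cd \<psi>) t S Q" if "\<psi> \<in> sbf \<phi>" "t \<in> El S" for \<psi> t
    unfolding Qi[OF that] by (rule ho_sat[OF F that, symmetric]) (rule Qi)
  moreover have "pr (cd \<phi>) (asg \<phi> \<sigma>) \<in> El Q" using Qi[OF self_sbf aS] asg_sat st by simp
  ultimately have "cert w (pr Q S) (dg \<phi>) (asg \<phi> \<sigma>)" unfolding cert_def dg_def using aS F by simp
  then show ?thesis by blast
qed

end

subsection \<open>Sets that are correct about \<open>\<Sigma>\<^sub>k\<close> formulas\<close>

context zfc
begin

lemma reflect_LR:
  assumes "DP (\<lambda>s. R (s 0) (s 1))" "\<And>c. \<exists>y. R c y"
  shows "\<exists>v. LR v \<and> x \<in> El v \<and> (\<forall>c\<in>El v. \<exists>y\<in>El v. R c y)"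
  using reflect[OF assms, of x] unfolding LR_def by blast

text \<open>\<open>inC k v\<close> makes \<open>v\<close> a \<open>\<Sigma>\<^sub>k\<close>-elementary substructure of the universe. Truth of a \<open>\<Sigma>\<^sub>k\<^sub>+\<^sub>1\<close> formula amounts to
  truth in some \<open>w\<close> with \<open>inC k w\<close>; asking that such a \<open>w\<close> and a certificate for its truth be found in
  \<open>v\<close> keeps the definition \<open>\<Pi>\<^sub>k\<^sub>+\<^sub>1\<close>.\<close>

primrec inC :: "nat \<Rightarrow> 'a \<Rightarrow> bool" where
  "inC 0 v \<longleftrightarrow> (\<forall>x\<in>El v. El x \<subseteq> El v)"
| "inC (Suc k) v \<longleftrightarrow> LR v \<and> inC k v \<and>
     (\<forall>d\<in>El v. \<forall>s\<in>El v. (\<exists>w q. inC k w \<and> cert w q d s) \<longrightarrow> (\<exists>w\<in>El v. \<exists>q\<in>El v. inC k w \<and> cert w q d s))"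

lemma DP_inC[dfn]: "DT f \<Longrightarrow> DP (\<lambda>s. inC k (f s))"
proof (induction k arbitrary: f)
  case 0 show ?case by (rule DP_app1[of "inC 0", OF _ 0], unfold inC.simps, intro dfn)
next
  case (Suc k)
  note [dfn] = Suc.IH
  show ?case by (rule DP_app1[of "inC (Suc k)", OF _ Suc.prems], unfold inC.simps, intro dfn)
qed

lemma inC_0: "inC k v \<Longrightarrow> inC 0 v" by (induction k) auto
lemma inC_trans: "inC k v \<Longrightarrow> x \<in> El v \<Longrightarrow> El x \<subseteq> El v" using inC_0 by auto

lemma inC_union:
  assumes "LR v" "\<And>x. x \<in> El v \<Longrightarrow> \<exists>w. inC k w \<and> x \<in> El w \<and> El w \<subseteq> El v" shows "inC k v"
  using assms(2)
proof (induction k)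
  case 0 show ?case using LR_trans[OF assms(1)] by simp
next
  case (Suc k)
  have "inC k v" by (rule Suc.IH) (use Suc.prems in fastforce)
  moreover have "\<exists>w\<in>El v. \<exists>q\<in>El v. inC k w \<and> cert w q d s"
    if d: "d \<in> El v" "s \<in> El v" and ex: "\<exists>w q. inC k w \<and> cert w q d s" for d s
  proof -
    obtain u where u: "inC (Suc k) u" "pr d s \<in> El u" "El u \<subseteq> El v" using Suc.prems[OF LR_pr[OF assms(1) d]] by blast
    then have L: "LR u" by simp
    have "d \<in> El u" "s \<in> El u" using LR_p1[OF L u(2)] by simp_all
    then have "\<exists>w\<in>El u. \<exists>q\<in>El u. inC k w \<and> cert w q d s" using u(1) ex by simp
    then show ?thesis using u(3) by blast
  qed
  ultimately show ?case using assms(1) by simp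
qed

lemma inC_unbounded: "\<exists>v. LR v \<and> inC k v \<and> x \<in> El v"
proof (induction k arbitrary: x)
  case 0
  have "\<exists>v. LR v \<and> x \<in> El v \<and> (\<forall>c\<in>El v. \<exists>y\<in>El v. c = c)" by (rule reflect_LR) (intro dfn, simp)
  then show ?case using LR_trans by auto
next
  case (Suc k)
  \<comment> \<open>A witness \<open>y\<close> packs a correct set containing \<open>c\<close>
    together with, if they exist, a set and a certificate for the instance that \<open>c\<close>
    codes.\<close>
  define R where "R c y \<longleftrightarrow> inC k (p1 y) \<and> c \<in> El (p1 y) \<and>
     ((\<exists>w q. inC k w \<and> cert w q (p1 c) (p2 c)) \<longrightarrow> inC k (p1 (p2 y)) \<and> cert (p1 (p2 y)) (p2 (p2 y)) (p1 c) (p2 c))" for c y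
  have "\<exists>v. LR v \<and> x \<in> El v \<and> (\<forall>c\<in>El v. \<exists>y\<in>El v. R c y)"
  proof (rule reflect_LR)
    show "DP (\<lambda>s. R (s 0) (s 1))" unfolding R_def by (intro dfn)
    fix c
    obtain u where u: "inC k u" "c \<in> El u" using Suc.IH by blast
    show "\<exists>y. R c y"
    proof (cases "\<exists>w q. inC k w \<and> cert w q (p1 c) (p2 c)")
      case True
      then obtain w q where "inC k w" "cert w q (p1 c) (p2 c)" by blast
      then have "R c (pr u (pr w q))" unfolding R_def using u by simp
      then show ?thesis by blast
    next
      case False
      then have "R c (pr u u)" unfolding R_def p1 p2 using u by blast
      then show ?thesis by blast
    qed
  qed
  then obtain v where v: "LR v" "x \<in> El v" "\<And>c. c \<in> El v \<Longrightarrow> \<exists>y\<in>El v. R c y" by blast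
  have "inC k v"
  proof (rule inC_union[OF v(1)])
    fix c assume "c \<in> El v"
    then obtain y where y: "y \<in> El v" "R c y" using v(3) by blast
    have "p1 y \<in> El v" using LR_p1[OF v(1) y(1)] by blast
    then show "\<exists>w. inC k w \<and> c \<in> El w \<and> El w \<subseteq> El v" using y(2) LR_trans[OF v(1)] unfolding R_def by blast
  qed
  moreover have "\<exists>w\<in>El v. \<exists>q\<in>El v. inC k w \<and> cert w q d s"
    if d: "d \<in> El v" "s \<in> El v" and ex: "\<exists>w q. inC k w \<and> cert w q d s" for d s
  proof -
    obtain y where y: "y \<in> El v" "R (pr d s) y" using v(3)[OF LR_pr[OF v(1) d]] by blast
    have "p1 (p2 y) \<in> El v" "p2 (p2 y) \<in> El v" using LR_p1[OF v(1)] y(1) by blast+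
    then show ?thesis using y(2) ex unfolding R_def by auto
  qed
  ultimately have "inC (Suc k) v" using v(1) unfolding inC.simps by blast
  then show ?case using v(1,2) by blast
qed

definition "correct k \<psi> \<longleftrightarrow> (\<forall>w \<sigma>. inC k w \<longrightarrow> range \<sigma> \<subseteq> El w \<longrightarrow> sat E (El w) \<sigma> \<psi> = sat E UNIV \<sigma> \<psi>)"
lemma correct_Neg: "correct k \<psi> \<Longrightarrow> correct k (Neg \<psi>)" unfolding correct_def by simp

lemma vars_ne: "\<exists>i. i \<in> vars \<phi>" by (induction \<phi>) auto

text \<open>Upwards a witness survives because the matrix is absolute. Downwards, a correct set
  large enough for \<open>v\<close> and the witnesses has a certificate for the formula;
  \<open>inC (Suc k) v\<close> finds a correct set with a certificate inside \<open>v\<close>, and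
  its witnesses work in \<open>v\<close> since both are correct for the matrix.\<close>

lemma correct_Ex_block:
  assumes \<phi>: "\<phi> \<in> Ex_block \<Gamma>" and c: "\<And>\<psi>. \<psi> \<in> \<Gamma> \<Longrightarrow> correct k \<psi>" shows "correct (Suc k) \<phi>"
  unfolding correct_def
proof (intro allI impI)
  fix v and \<sigma> :: "nat \<Rightarrow> 'a" assume v: "inC (Suc k) v" and \<sigma>: "range \<sigma> \<subseteq> El v"
  have vk: "inC k v" "LR v" using v by simp_all
  obtain \<psi> X where \<psi>: "\<psi> \<in> \<Gamma>" and X: "finite X"
    and w: "\<forall>E (D :: 'a set) s. sat E D s \<phi> \<longleftrightarrow> (\<exists>t. (\<forall>i. i \<notin> X \<longrightarrow> t i = s i) \<and> (\<forall>i\<in>X. t i \<in> D) \<and> sat E D t \<psi>)"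
    using Ex_block_witness[OF \<phi>, where 'b = 'a] by blast
  note w = w[rule_format]
  have cw: "sat E (El w) t \<psi> = sat E UNIV t \<psi>" if "inC k w" "range t \<subseteq> El w" for w t using c[OF \<psi>] that unfolding correct_def by blast
  have up: "sat E UNIV \<tau> \<phi>" if h: "inC k u" "range \<tau> \<subseteq> El u" "sat E (El u) \<tau> \<phi>" for u \<tau>
  proof -
    obtain t where t: "\<forall>i. i \<notin> X \<longrightarrow> t i = \<tau> i" "\<forall>i\<in>X. t i \<in> El u" "sat E (El u) t \<psi>" using h(3) unfolding w by blast
    then have "range t \<subseteq> El u" using h(2) by (metis image_subset_iff)
    then show ?thesis unfolding w using t cw[OF h(1)] by blast
  qed
  show "sat E (El v) \<sigma> \<phi> = sat E UNIV \<sigma> \<phi>"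
  proof
    assume "sat E (El v) \<sigma> \<phi>" then show "sat E UNIV \<sigma> \<phi>" by (rule up[OF vk(1) \<sigma>])
  next
    assume "sat E UNIV \<sigma> \<phi>"
    then obtain t where t: "\<forall>i. i \<notin> X \<longrightarrow> t i = \<sigma> i" "sat E UNIV t \<psi>" unfolding w by blast
    have fX: "El (mk (t ` X)) = t ` X" using X by (simp add: isS_finite)
    obtain u where u: "inC k u" "pr v (mk (t ` X)) \<in> El u" "LR u" using inC_unbounded by blast
    have pv: "v \<in> El u" "mk (t ` X) \<in> El u" using LR_p1[OF u(3,2)] by simp_all
    have vu: "El v \<subseteq> El u" "t ` X \<subseteq> El u" using LR_trans[OF u(3)] pv fX by blast+
    have "t i \<in> El u" for i
    proof (cases "i \<in> X")
      case True then show ?thesis using vu(2) by blast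
    next
      case False
      then have "t i = \<sigma> i" using t(1) by blast
      then show ?thesis using \<sigma> vu(1) by auto
    qed
    then have tu: "range t \<subseteq> El u" by blast
    then have "sat E (El u) \<sigma> \<phi>" unfolding w using t cw[OF u(1) tu] by blast
    then obtain q where "cert u q (dg \<phi>) (asg \<phi> \<sigma>)" using cert_complete[of \<phi> \<sigma> u] \<sigma> vu by blast
    moreover have "dg \<phi> \<in> El v" "asg \<phi> \<sigma> \<in> El v" using dg_LR[OF vk(2)] asg_LR[OF vk(2)] \<sigma> by blast+
    ultimately have "\<exists>w\<in>El v. \<exists>q\<in>El v. inC k w \<and> cert w q (dg \<phi>) (asg \<phi> \<sigma>)"
      using u(1) v unfolding inC.simps by blast
    then obtain w' q where w': "w' \<in> El v" "inC k w'" "cert w' q (dg \<phi>) (asg \<phi> \<sigma>)" by blast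
    have \<sigma>': "\<sigma> i \<in> El w'" if "i \<in> vars \<phi>" for i
    proof -
      have "pr (num i) (\<sigma> i) \<in> El (asg \<phi> \<sigma>)" unfolding El_asg using that by blast
      then show ?thesis using w'(3) unfolding cert_def full_def by fastforce
    qed
    obtain j where j: "j \<in> vars \<phi>" using vars_ne by blast
    \<comment> \<open>Only the values at variables of \<open>\<phi>\<close> are known to lie in
      \<open>w'\<close>; the others are replaced by one of them.\<close>
    define \<tau> where "\<tau> i = (if i \<in> vars \<phi> then \<sigma> i else \<sigma> j)" for i
    have \<tau>: "range \<tau> \<subseteq> El w'" unfolding \<tau>_def using \<sigma>' j by auto
    have st: "sat E D \<tau> \<phi> = sat E D \<sigma> \<phi>" for D by (rule sat_cong) (use fv_vars[of \<phi>] in \<open>auto simp: \<tau>_def\<close>)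
    have "sat E (El w') \<tau> \<phi>" unfolding st by (rule cert_sound[OF w'(3)])
    then obtain t' where t': "\<forall>i. i \<notin> X \<longrightarrow> t' i = \<tau> i" "\<forall>i\<in>X. t' i \<in> El w'" "sat E (El w') t' \<psi>" unfolding w by blast
    have r: "range t' \<subseteq> El w'" using t' \<tau> by (metis image_subset_iff)
    have r': "range t' \<subseteq> El v" using r LR_trans[OF vk(2) w'(1)] by blast
    have "sat E (El v) t' \<psi>" using cw[OF w'(2) r] cw[OF vk(1) r'] t'(3) by blast
    then have "sat E (El v) \<tau> \<phi>" unfolding w using t' r' by blast
    then show "sat E (El v) \<sigma> \<phi>" unfolding st .
  qed
qed

lemma All_block_dual: "\<phi> \<in> All_block \<Gamma> \<Longrightarrow> \<exists>\<phi>'\<in>Ex_block (Neg ` \<Gamma>). \<forall>E (D :: 'a set) s. sat E D s \<phi> \<longleftrightarrow> \<not> sat E D s \<phi>'"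
proof (induction rule: All_block.induct)
  case (1 \<phi>) then show ?case by (intro bexI[of _ "Neg \<phi>"]) (auto intro: Ex_block.intros)
next
  case (2 \<phi> x)
  then obtain \<phi>' where "\<phi>' \<in> Ex_block (Neg ` \<Gamma>)" "\<forall>E (D :: 'a set) s. sat E D s \<phi> \<longleftrightarrow> \<not> sat E D s \<phi>'" by blast
  then show ?case by (intro bexI[of _ "Ex x \<phi>'"]) (auto intro: Ex_block.intros)
qed

theorem inC_correct: "\<phi> \<in> Sigma_fm k \<union> Pi_fm k \<Longrightarrow> correct k \<phi>"
proof (induction k arbitrary: \<phi>)
  case 0
  then have f: "\<phi> \<in> Delta0_fm" by simp
  show ?case unfolding correct_def
  proof (intro allI impI)
    fix w and \<sigma> :: "nat \<Rightarrow> 'a" assume w: "inC 0 w" "range \<sigma> \<subseteq> El w"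
    show "sat E (El w) \<sigma> \<phi> = sat E UNIV \<sigma> \<phi>"
    proof (rule Delta0_absolute[OF f _ w(2)])
      show "x \<in> El w \<Longrightarrow> E y x \<Longrightarrow> y \<in> El w" for x y using inC_trans[OF w(1), of x] by (auto simp: elts_def)
    qed
  qed
next
  case (Suc k)
  show ?case
  proof (cases "\<phi> \<in> Sigma_fm (Suc k)")
    case True then show ?thesis using correct_Ex_block[of \<phi> "Pi_fm k"] Suc.IH by auto
  next
    case False
    then have "\<phi> \<in> All_block (Sigma_fm k)" using Suc.prems by simp
    from All_block_dual[OF this] obtain \<phi>' where f: "\<phi>' \<in> Ex_block (Neg ` Sigma_fm k)" "\<And>E (D :: 'a set) s. sat E D s \<phi> \<longleftrightarrow> \<not> sat E D s \<phi>'" by blast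
    have "correct (Suc k) \<phi>'" by (rule correct_Ex_block[OF f(1)]) (use Suc.IH correct_Neg in auto)
    then show ?thesis unfolding correct_def f(2) by blast
  qed
qed

text \<open>Below the existential quantifiers over \<open>v\<close> the notion \<open>inC k\<close>
  is evaluated inside \<open>v\<close>, which is legitimate as \<open>v\<close> is correct for its
  Pi definition. The occurrence in the hypothesis counts as its negation, a Sigma condition of level
  \<open>k\<close>.\<close>

lemma PI_inC: "PI k (\<lambda>s. inC k (s i))"
proof (induction k arbitrary: i)
  case 0
  have "D0 (\<lambda>s. \<forall>x\<in>El (s i). El x \<subseteq> El (s i))" by (intro dz)
  then show ?case by simp
next
  case (Suc k)
  obtain c where c: "c \<in> Pi_fm k" "\<And>s. sat E UNIV s c = inC k (s 0)" using Suc.IH[of 0] unfolding FD_def by blast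
  have cc: "sat E (El v) (\<lambda>_. w) c = inC k w" if "inC k v" "w \<in> El v" for v w
    using inC_correct[of c k] c that unfolding correct_def by auto
  have "inC (Suc k) v \<longleftrightarrow> LR v \<and> inC k v \<and> (\<forall>d s w q. \<not> inC k w \<or>
     (d \<in> El v \<and> s \<in> El v \<and> cert w q d s \<longrightarrow> (\<exists>w\<in>El v. \<exists>q\<in>El v. sat E (El v) (\<lambda>_. w) c \<and> cert w q d s)))" for v
  proof (cases "LR v \<and> inC k v")
    case True
    then have "(\<exists>w\<in>El v. \<exists>q\<in>El v. sat E (El v) (\<lambda>_. w) c \<and> cert w q d s) \<longleftrightarrow> (\<exists>w\<in>El v. \<exists>q\<in>El v. inC k w \<and> cert w q d s)" for d s
      using cc by blast
    then show ?thesis using True by (simp only: inC.simps) blast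
  next
    case False then show ?thesis by auto
  qed
  moreover have "PI (Suc k) (\<lambda>s. LR (s i))" by (rule PI_LR)
  moreover have "PI (Suc k) (\<lambda>s. inC k (s i))" by (rule PI_le[OF Suc.IH]) simp
  moreover have "PI (Suc k) (\<lambda>s. \<forall>d t w q. \<not> inC k w \<or>
     (d \<in> El (s i) \<and> t \<in> El (s i) \<and> cert w q d t \<longrightarrow> (\<exists>w\<in>El (s i). \<exists>q\<in>El (s i). sat E (El (s i)) (\<lambda>_. w) c \<and> cert w q d t)))"
    by (intro PI_all PI_or SG_PI SG_not Suc.IH D0_PI dz D0_cert D0_sat_elts)
  ultimately show ?case by (simp only:) (intro PI_and)
qed

definition "fmC k = (SOME c. c \<in> Pi_fm k \<and> fv c \<subseteq> {0} \<and> (\<forall>s. sat E UNIV s c = inC k (s 0)))"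
lemma fmC: "fmC k \<in> Pi_fm k" "fv (fmC k) \<subseteq> {0}" "sat E UNIV s (fmC k) = inC k (s 0)"
proof -
  obtain c where c: "c \<in> Pi_fm k" "\<And>s. sat E UNIV s c = inC k (s 0)" using PI_inC[of k 0] unfolding FD_def by blast
  have "sub c (\<lambda>_. 0) \<in> Pi_fm k \<and> fv (sub c (\<lambda>_. 0)) \<subseteq> {0} \<and> (\<forall>s. sat E UNIV s (sub c (\<lambda>_. 0)) = inC k (s 0))"
    using sub_Levy[of _ k _ c "\<lambda>_. 0"] c fv_sub[of c "\<lambda>_. 0"] by (auto simp: sat_sub)
  then have "fmC k \<in> Pi_fm k \<and> fv (fmC k) \<subseteq> {0} \<and> (\<forall>s. sat E UNIV s (fmC k) = inC k (s 0))" unfolding fmC_def by (rule someI)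
  then show "fmC k \<in> Pi_fm k" "fv (fmC k) \<subseteq> {0}" "sat E UNIV s (fmC k) = inC k (s 0)" by blast+
qed

lemma inC_inC: "inC k v \<Longrightarrow> w \<in> El v \<Longrightarrow> sat E (El v) (\<lambda>_. w) (fmC k) = inC k w"
  using inC_correct[of "fmC k" k] fmC unfolding correct_def by auto

end

text \<open>That correct sets decide \<open>\<psi>\<close> correctly is expressible and true in the
  universe, so in \<open>M\<close> it applies to every set that \<open>M\<close> takes for
  correct.\<close>

lemma (in emb) inC_M:
  assumes \<psi>: "\<psi> \<in> Pi_fm k" and u: "u \<in> M" "sat E M (\<lambda>_. u) (fmC k)" and t: "range t \<subseteq> El u" "sat E (El u) t \<psi>"
  shows "sat E M t \<psi>"
proof -
  obtain N where N: "fv \<psi> \<subseteq> {..<N}" "N \<noteq> 0"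
  proof -
    obtain N where "fv \<psi> \<subseteq> {..<N}" using fv_bound by blast
    then have "fv \<psi> \<subseteq> {..<Suc N}" by auto
    then show thesis using that by blast
  qed
  have "D0 (\<lambda>s. \<forall>i<N. s (Suc i) \<in> El (s 0))"
  proof (induction N)
    case (Suc N)
    have "D0 (\<lambda>s. (\<forall>i<N. s (Suc i) \<in> El (s 0)) \<and> s (Suc N) \<in> El (s 0))" by (intro dz Suc.IH)
    then show ?case by (simp add: less_Suc_eq all_conj_distrib conj_commute imp_disjL)
  qed (simp add: D0_const)
  then obtain \<delta> where \<delta>: "\<delta> \<in> Delta0_fm" "\<And>s. sat E UNIV s \<delta> = (\<forall>i<N. s (Suc i) \<in> El (s 0))" unfolding FD_def by blast
  define \<theta> where "\<theta> = Neg (And (And (And \<delta> (fmC k)) (rlv 0 (bump \<psi>))) (Neg (sub \<psi> Suc)))"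
  have "sat E UNIV s \<theta>" for s
  proof -
    have "sat E UNIV (\<lambda>n. s (Suc n)) \<psi>" 
      if h: "\<forall>i<N. s (Suc i) \<in> El (s 0)" "inC k (s 0)" "sat E (El (s 0)) (\<lambda>n. s (Suc n)) \<psi>"
    proof -
      define \<tau> where "\<tau> i = (if i < N then s (Suc i) else s (Suc 0))" for i
      have "range \<tau> \<subseteq> El (s 0)" unfolding \<tau>_def using h(1) N(2) by auto
      moreover have st: "sat E D \<tau> \<psi> = sat E D (\<lambda>n. s (Suc n)) \<psi>" for D by (rule sat_cong) (use N in \<open>auto simp: \<tau>_def\<close>)
      ultimately show ?thesis using inC_correct[of \<psi> k] \<psi> h(2,3) unfolding correct_def st[symmetric] by blast
    qed
    then show ?thesis unfolding \<theta>_def by (auto simp: \<delta> fmC sat_sub sat_rlv elts_def)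
  qed
  define s where "s = case_nat u t"
  have s: "range s \<subseteq> M" unfolding s_def using u(1) t(1) M_trans by (fastforce split: nat.splits)
  have "sat E M s \<theta>" by (rule valid_transfer) fact+
  moreover have "sat E M s \<delta>"
  proof -
    have "sat E UNIV s \<delta>" using \<delta>(2)[of s] t(1) unfolding s_def by auto
    moreover have "y \<in> M" if "x \<in> M" "E y x" for x y using M_trans[OF that(1)] that(2) by (auto simp: elts_def)
    ultimately show ?thesis using Delta0_absolute[OF \<delta>(1) _ s, of E] by blast
  qed
  moreover have "sat E M s (fmC k)" 
  proof -
    have "sat E M s (fmC k) = sat E M (\<lambda>_. u) (fmC k)" by (rule sat_cong) (use fmC(2)[of k] in \<open>auto simp: s_def\<close>)
    then show ?thesis using u(2) by blast
  qed
  moreover have "sat E M s (rlv 0 (bump \<psi>))"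
  proof -
    have "{a \<in> M. E a u} = El u" using M_trans[OF u(1)] by (auto simp: elts_def)
    then show ?thesis unfolding sat_rlv s_def using t(2) by simp
  qed
  ultimately show ?thesis unfolding \<theta>_def by (simp add: sat_sub s_def)
qed

subsection \<open>Strong cardinals from homomorphisms\<close>

context zfc
begin

text \<open>\<open>upr x x\<close> is the singleton of \<open>x\<close>, and \<open>j x = x\<close> exactly when \<open>x\<close> is in the image of its singleton.\<close>

definition "crit f k \<longleftrightarrow> Od k \<and> (\<forall>x\<in>El k. x \<in> El (ap f (upr x x))) \<and> k \<notin> El (ap f (upr k k))"

end

lemma (in extender) crit_jj:
  assumes kb: "k \<in> El b" and k: "k \<in> El v" and c: "crit f k"
  shows "critical_point E jj k"
proof -
  have e: "El (ap f (upr x x)) = {jj x} \<inter> El v" if "x \<in> El b" for x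
    using k_jj[of "upr x x"] that by (simp add: j_upr)
  have "jj x = x" if x: "x \<in> El k" for x
  proof -
    have xb: "x \<in> El b" using LR_trans[OF LRb kb] x by blast
    show ?thesis using e[OF xb] c x unfolding crit_def by auto
  qed
  moreover have "jj k \<noteq> k" using e[OF kb] c k unfolding crit_def by auto
  ultimately show ?thesis unfolding critical_point_def using c unfolding crit_def by blast
qed

text \<open>A map of a smaller ordinal onto \<open>k\<close> would have fixed arguments and values,
  hence its image under \<open>j\<close> would still have all values below \<open>k\<close>, though
  it maps onto \<open>j k\<close>.\<close>

lemma (in emb) crit_Card: assumes c: "critical_point E j k" shows "Card E k"
  unfolding Card_def
proof (intro conjI notI)
  show ok: "Od k" using c unfolding critical_point_def by blast
  have jx: "j x = x" if "x \<in> El k" for x using c that unfolding critical_point_def by blast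
  assume "\<exists>b\<in>El k. \<exists>f. fn f b \<and> bij_betw (app E f) (El b) (El k)"
  then obtain b f where b: "b \<in> El k" and f: "fn f b" and bij: "bij_betw (app E f) (El b) (El k)" by blast
  have im: "ap f ` El b = El k" using bij unfolding bij_betw_def using app_ap[OF f] by (metis image_cong)
  have "\<forall>y\<in>El k. \<exists>z\<in>El f. p2 z = y" using im fn_el[OF f] by (metis imageE p2)
  then have J: "\<forall>y\<in>El (j k). \<exists>z\<in>El (j f). p2 z = y"
    using j0_2[of "\<lambda>k f. \<forall>y\<in>El k. \<exists>z\<in>El f. p2 z = y" k f] by (simp add: dz)
  have jf: "fn (j f) b" using j0_2[of fn f b] f jx[OF b] by (simp add: dz)
  have "El (j k) \<subseteq> El k"
  proof
    fix y assume "y \<in> El (j k)"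
    then obtain z where z: "z \<in> El (j f)" "p2 z = y" using J by blast
    then obtain x where x: "x \<in> El b" "z = pr x (ap (j f) x)" unfolding fn_El[OF jf] by blast
    have xk: "x \<in> El k" using Od_trans[OF ok b] x(1) by blast
    have "ap (j f) x = j (ap f x)" using j_ap[OF f x(1)] jx[OF xk] by simp
    also have "\<dots> = ap f x" using jx im x(1) by blast
    finally have "y = ap f x" using x(2) z(2) by simp
    then show "y \<in> El k" using im x(1) by blast
  qed
  moreover have "k \<in> El (j k)" using j_le[OF ok] c unfolding critical_point_def by auto
  ultimately show False by auto
qed

context zfc
begin

text \<open>Truth of a Sigma formula at points of \<open>Vs \<mu>\<close> is witnessed inside a
  correct set \<open>u\<close>. A good map on a rank containing \<open>u\<close> preserves the class
  \<open>inC m\<close>, so the ultrapower takes \<open>u\<close> for correct and accepts the same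
  witnesses.\<close>

theorem good_strong:
  assumes k: "Od k" and G: "\<And>l. LR l \<Longrightarrow> k \<in> El l \<Longrightarrow> \<exists>f. good (inC m) r f l l \<and> crit f k"
  shows "strong E (Sigma_fm (Suc m)) k"
  unfolding strong_def
proof (intro allI impI)
  fix \<mu> assume mu: "Od \<mu>"
  have main: "\<exists>j M. elementary_embedding E j M \<and> critical_point E j k \<and> El (Vs \<mu>) \<subseteq> M \<and>
     extension E UNIV \<phi> \<inter> El (Vs \<mu>) \<subseteq> extension E M \<phi>"
    if \<phi>: "\<phi> \<in> Sigma_fm (Suc m)" for \<phi>
  proof -
    obtain \<psi> X where \<psi>: "\<psi> \<in> Pi_fm m"
      and w: "\<And>E (D :: 'a set) s. sat E D s \<phi> \<longleftrightarrow> (\<exists>t. (\<forall>i. i \<notin> X \<longrightarrow> t i = s i) \<and> (\<forall>i\<in>X. t i \<in> D) \<and> sat E D t \<psi>)"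
      using Ex_block_witness[of \<phi> "Pi_fm m"] \<phi> by auto
    obtain u where u: "LR u" "inC (Suc m) u" "Vs \<mu> \<in> El u" using inC_unbounded by blast
    obtain l where l: "LR l" "pr k u \<in> El l" using inC_unbounded by blast
    have kl: "k \<in> El l" "u \<in> El l" using LR_p1[OF l] by simp_all
    obtain f where f: "good (inC m) r f l l" "crit f k" using G[OF l(1) kl(1)] by blast
    interpret X: extender E "inC m" r f l l
      by unfold_locales (intro dfn, use l f in auto)
    have mM: "El (Vs \<mu>) \<subseteq> El u" "El u \<subseteq> X.UM" using LR_trans[OF u(1,3)] LR_trans[OF l(1) kl(2)] X.v_UM by blast+
    have "X.FO u (\<lambda>x. sat E UNIV (\<lambda>_. x) (fmC m))" using X.FO_A[OF kl(2)] u(2) fmC(3) by simp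
    then have uM: "sat E X.UM (\<lambda>_. u) (fmC m)" using X.sat_id[OF kl(2)] by blast
    have "sat E X.UM (\<lambda>_. x) \<phi>" if x: "x \<in> El (Vs \<mu>)" "sat E UNIV (\<lambda>_. x) \<phi>" for x
    proof -
      have xu: "x \<in> El u" using x(1) mM by blast
      have "sat E (El u) (\<lambda>_. x) \<phi>" using inC_correct[of \<phi> "Suc m"] \<phi> x(2) u(2) xu unfolding correct_def by auto
      then obtain t where t: "\<forall>i. i \<notin> X \<longrightarrow> t i = x" "\<forall>i\<in>X. t i \<in> El u" "sat E (El u) t \<psi>" unfolding w by blast
      have r: "range t \<subseteq> El u" using t(1,2) xu by (metis image_subset_iff)
      have "sat E X.UM t \<psi>" by (rule X.inC_M[OF \<psi> _ uM r t(3)]) (use X.v_UM kl(2) in blast)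
      then show ?thesis unfolding w using t(1,2) mM(2) by blast
    qed
    then have "extension E UNIV \<phi> \<inter> El (Vs \<mu>) \<subseteq> extension E X.UM \<phi>" unfolding extension_def using mM by blast
    then show ?thesis using X.ee X.crit_jj[OF kl(1) kl(1) f(2)] mM by blast
  qed
  obtain \<phi>0 where "\<phi>0 \<in> Sigma_fm (Suc m)" using Sigma_mono[of 0 "Suc m"] Delta0_fm.intros(1) by auto
  then obtain j M where j: "elementary_embedding E j M" "critical_point E j k" using main by blast
  interpret emb E j M by unfold_locales (rule j)
  show "lam_strong E (Sigma_fm (Suc m)) \<mu> k" unfolding lam_strong_def Vset_Vs[OF mu]
    using crit_Card[OF j(2)] main by blast
qed

end

subsection \<open>Encoding relational structures as graphs\<close>

context zfc
begin

abbreviation "uv x \<equiv> pr (num 0) x"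
abbreviation "ev k x y \<equiv> pr (num 2) (pr (num k) (pr x y))"
abbreviation "lb c k \<equiv> pr (num 3) (pr (num k) c)"

text \<open>A vertex \<open>uv x\<close> for each point, \<open>ev k x y\<close> for each related pair and a transitive tournament of
  labels; \<open>c\<close> is extra data carried by the labels.\<close>

definition "vx U R N c z \<longleftrightarrow> ispr z \<and> ((p1 z = num 0 \<and> p2 z \<in> El U) \<or>
  (p1 z = num 2 \<and> ispr (p2 z) \<and> ispr (p2 (p2 z)) \<and> p1 (p2 (p2 z)) \<in> El U \<and> p2 (p2 (p2 z)) \<in> El U \<and>
     (\<exists>k<N. p1 (p2 z) = num k \<and> R k (p1 (p2 (p2 z))) (p2 (p2 (p2 z))))) \<or>
  (p1 z = num 3 \<and> ispr (p2 z) \<and> p2 (p2 z) = c \<and> (\<exists>k<Suc N. p1 (p2 z) = num k)))"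

text \<open>A related pair is a path from the first point through \<open>ev k x y\<close> to the
  second. The label \<open>Suc k\<close> points to all vertices of relation \<open>k\<close>, and
  all points point to the label \<open>0\<close>, so the labels tell the kinds of vertices
  apart.\<close>

definition "ed U R N c a b \<longleftrightarrow> vx U R N c a \<and> vx U R N c b \<and>
  ((p1 a = num 0 \<and> p1 b = num 2 \<and> p2 a = p1 (p2 (p2 b))) \<or>
   (p1 a = num 2 \<and> p1 b = num 0 \<and> p2 b = p2 (p2 (p2 a))) \<or>
   (p1 a = num 3 \<and> p1 b = num 2 \<and> p1 (p2 a) = sc (p1 (p2 b))) \<or>
   (p1 a = num 0 \<and> p1 b = num 3 \<and> p1 (p2 b) = num 0) \<or>
   (p1 a = num 3 \<and> p1 b = num 3 \<and> p1 (p2 a) \<in> El (p1 (p2 b))))"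

definition "gr U R N c = pr (mk {z. vx U R N c z}) (mk {z. ispr z \<and> ed U R N c (p1 z) (p2 z)})"

lemma vx_simps[simp]:
  "vx U R N c (uv x) \<longleftrightarrow> x \<in> El U"
  "vx U R N c (ev k x y) \<longleftrightarrow> k < N \<and> x \<in> El U \<and> y \<in> El U \<and> R k x y"
  "vx U R N c (lb c' k) \<longleftrightarrow> c' = c \<and> k \<le> N"
  unfolding vx_def by auto

lemma vx_cases:
  assumes "vx U R N c z"
  obtains x where "z = uv x" "x \<in> El U" | k x y where "z = ev k x y" "k < N" "x \<in> El U" "y \<in> El U" "R k x y"
    | k where "z = lb c k" "k \<le> N"
proof -
  have z: "z = pr (p1 z) (p2 z)" using assms ispr_D unfolding vx_def by blast
  consider "p1 z = num 0" "p2 z \<in> El U" | k where "p1 z = num 2" "ispr (p2 z)" "ispr (p2 (p2 z))" "p1 (p2 z) = num k" "k < N"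
      "p1 (p2 (p2 z)) \<in> El U" "p2 (p2 (p2 z)) \<in> El U" "R k (p1 (p2 (p2 z))) (p2 (p2 (p2 z)))"
    | k where "p1 z = num 3" "ispr (p2 z)" "p2 (p2 z) = c" "p1 (p2 z) = num k" "k < Suc N"
    using assms unfolding vx_def by blast
  then show thesis
  proof cases
    case 1 then show thesis using z that(1)[of "p2 z"] by simp
  next
    case 2
    then have "z = ev k (p1 (p2 (p2 z))) (p2 (p2 (p2 z)))" using z ispr_D by metis
    then show thesis using 2 that(2) by blast
  next
    case 3
    then have "z = lb c k" using z ispr_D by metis
    then show thesis using 3(5) that(3)[of k] by simp
  qed
qed

lemma ed_simps[simp]:
  "ed U R N c (uv x) (uv y) \<longleftrightarrow> False"
  "ed U R N c (uv x) (ev k x' y) \<longleftrightarrow> vx U R N c (ev k x' y) \<and> x = x'"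
  "ed U R N c (uv x) (lb c' k) \<longleftrightarrow> x \<in> El U \<and> c' = c \<and> k = 0"
  "ed U R N c (ev k x' y) (uv x) \<longleftrightarrow> vx U R N c (ev k x' y) \<and> x = y"
  "ed U R N c (ev k x y) (ev k' x' y') \<longleftrightarrow> False"
  "ed U R N c (ev k x y) (lb c' k') \<longleftrightarrow> False"
  "ed U R N c (lb c' k) (uv x) \<longleftrightarrow> False"
  "ed U R N c (lb c' k) (ev k' x y) \<longleftrightarrow> vx U R N c (ev k' x y) \<and> c' = c \<and> k = Suc k'"
  "ed U R N c (lb c' k) (lb c'' k') \<longleftrightarrow> c' = c \<and> c'' = c \<and> k < k' \<and> k' \<le> N"
  unfolding ed_def by (auto simp del: vx_simps(2)) (simp_all only: vx_simps less_eq_Suc_le)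

lemma ed_vx: "ed U R N c a b \<Longrightarrow> vx U R N c a \<and> vx U R N c b" unfolding ed_def by blast

lemma DP_bex_lt: "(\<And>i. DP (P i)) \<Longrightarrow> DP (\<lambda>s. \<exists>i<(N::nat). P i s)"
  using DP_not[OF DP_ball_lt[of "\<lambda>i s. \<not> P i s" N]] DP_not by simp

lemma DP_vx: assumes R: "\<And>k. DP (\<lambda>s. R k (s 0) (s 1))" and f: "DT f" shows "DP (\<lambda>s. vx U R N c (f s))"
proof (rule DP_app1[OF _ f])
  have [dfn]: "DT f \<Longrightarrow> DT g \<Longrightarrow> DP (\<lambda>s. R k (f s) (g s))" for f g k by (rule DP_app2[OF R])
  show "DP (\<lambda>s. vx U R N c (s 0))" unfolding vx_def by (intro dfn DP_bex_lt)
qed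

lemma DP_ed: assumes R: "\<And>k. DP (\<lambda>s. R k (s 0) (s 1))" shows "DP (\<lambda>s. ed U R N c (s 0) (s 1))"
  unfolding ed_def by (intro dfn DP_vx R)

lemma El_gr:
  assumes R: "\<And>k. DP (\<lambda>s. R k (s 0) (s 1))"
  shows "El (p1 (gr U R N c)) = {z. vx U R N c z}" "El (p2 (gr U R N c)) = {z. ispr z \<and> ed U R N c (p1 z) (p2 z)}"
proof -
  obtain v where v: "LR v" "pr U c \<in> El v" using inC_unbounded by blast
  have Uc: "U \<in> El v" "c \<in> El v" using LR_p1[OF v] by simp_all
  have n: "num k \<in> El v" for k using LR_omsub(2)[OF v(1)] num_om by blast
  have vv: "z \<in> El v" if "vx U R N c z" for z
    using that
  proof (rule vx_cases)
    fix x assume "z = uv x" "x \<in> El U"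
    then show ?thesis using LR_trans[OF v(1) Uc(1)] by (simp add: LR_pr[OF v(1)] n subsetD)
  next
    fix k x y assume "z = ev k x y" "x \<in> El U" "y \<in> El U"
    then show ?thesis using LR_trans[OF v(1) Uc(1)] by (simp add: LR_pr[OF v(1)] n subsetD)
  next
    fix k assume "z = lb c k" then show ?thesis by (simp add: LR_pr[OF v(1)] n Uc(2))
  qed
  have "isS {z \<in> El v. vx U R N c z}" by (intro isS_Collect isS_El DP_vx R dfn)
  then have "isS {z. vx U R N c z}" by (rule back_subst[of isS]) (use vv in blast)
  then show "El (p1 (gr U R N c)) = {z. vx U R N c z}" unfolding gr_def by simp
  have "isS {z \<in> El v. ispr z \<and> ed U R N c (p1 z) (p2 z)}"
    by (intro isS_Collect isS_El dfn DP_app2[OF DP_ed[OF R]])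
  moreover have "z \<in> El v" if h: "ispr z" "ed U R N c (p1 z) (p2 z)" for z
  proof -
    have "pr (p1 z) (p2 z) \<in> El v" using LR_pr[OF v(1)] vv ed_vx[OF h(2)] by blast
    then show ?thesis using ispr_D[OF h(1)] by simp
  qed
  ultimately have "isS {z. ispr z \<and> ed U R N c (p1 z) (p2 z)}" by (elim back_subst[of isS]) blast
  then show "El (p2 (gr U R N c)) = {z. ispr z \<and> ed U R N c (p1 z) (p2 z)}" unfolding gr_def by simp
qed

lemma gr_edge: assumes "\<And>k. DP (\<lambda>s. R k (s 0) (s 1))" shows "pr a b \<in> El (p2 (gr U R N c)) \<longleftrightarrow> ed U R N c a b"
  unfolding El_gr(2)[OF assms] by simp

lemma gr_graph: assumes "\<And>k. DP (\<lambda>s. R k (s 0) (s 1))" shows "is_graph E (gr U R N c)"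
  unfolding is_graph_def
proof (intro exI conjI ballI)
  show "gr U R N c = pr (p1 (gr U R N c)) (p2 (gr U R N c))" unfolding gr_def by simp
  have "lb c 0 \<in> El (p1 (gr U R N c))" unfolding El_gr(1)[OF assms] by simp
  then show "El (p1 (gr U R N c)) \<noteq> {}" by blast
  fix z assume "z \<in> El (p2 (gr U R N c))"
  then have z: "ispr z" "ed U R N c (p1 z) (p2 z)" unfolding El_gr(2)[OF assms] by simp_all
  then show "\<exists>x\<in>El (p1 (gr U R N c)). \<exists>y\<in>El (p1 (gr U R N c)). z = pr x y"
    unfolding El_gr(1)[OF assms] using ed_vx[OF z(2)] ispr_D[OF z(1)] by blast
qed

text \<open>Outside the labels the edges allow no transitive triangle. Once there are three labels,
  each label lies in such a triangle and homomorphisms must send it to a label.\<close>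

lemma ed_triangle:
  assumes "ed U R N c a b" "ed U R N c b d" "ed U R N c a d"
  shows "\<exists>i j k. a = lb c i \<and> b = lb c j \<and> d = lb c k \<and> i < j \<and> j < k \<and> k \<le> N"
proof -
  have v: "vx U R N c a" "vx U R N c b" "vx U R N c d" using assms ed_vx by blast+
  show ?thesis
    by (rule vx_cases[OF v(1)]; rule vx_cases[OF v(2)]; rule vx_cases[OF v(3)]) (use assms in auto)
qed

lemma gr_hm:
  assumes R: "\<And>k. DP (\<lambda>s. R k (s 0) (s 1))" and R': "\<And>k. DP (\<lambda>s. R' k (s 0) (s 1))" and N: "2 \<le> N"
    and h: "hm h (gr U R N c) (gr U' R' N c')" and g: "\<And>x. g x = p2 (ap h (uv x))"
  shows "k \<le> N \<Longrightarrow> ap h (lb c k) = lb c' k" "x \<in> El U \<Longrightarrow> ap h (uv x) = uv (g x) \<and> g x \<in> El U'"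
    "k < N \<Longrightarrow> x \<in> El U \<Longrightarrow> y \<in> El U \<Longrightarrow> R k x y \<Longrightarrow> R' k (g x) (g y) \<and> ap h (ev k x y) = ev k (g x) (g y)"
proof -
  have V: "vx U' R' N c' (ap h z)" if "vx U R N c z" for z
    using h that unfolding hm_iff El_gr(1)[OF R] El_gr(1)[OF R'] by blast
  have D: "ed U' R' N c' (ap h a) (ap h b)" if "ed U R N c a b" for a b
    using h that ed_vx[OF that] unfolding hm_iff gr_edge[OF R] gr_edge[OF R'] El_gr(1)[OF R] by blast
  have L: "\<exists>j\<le>N. ap h (lb c k) = lb c' j" if k: "k \<le> N" for k
  proof -
    have e: "ed U' R' N c' (ap h (lb c i)) (ap h (lb c j))" if "i < j" "j \<le> N" for i j by (rule D) (use that in simp)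
    consider "k = 0" | "k = 1" | "2 \<le> k" by linarith
    then show ?thesis
    proof cases
      case 1
      have "ed U' R' N c' (ap h (lb c 0)) (ap h (lb c 1))" "ed U' R' N c' (ap h (lb c 1)) (ap h (lb c 2))" "ed U' R' N c' (ap h (lb c 0)) (ap h (lb c 2))"
        using e N by simp_all
      from ed_triangle[OF this] show ?thesis unfolding 1 by (meson less_imp_le_nat less_le_trans)
    next
      case 2
      have "ed U' R' N c' (ap h (lb c 0)) (ap h (lb c 1))" "ed U' R' N c' (ap h (lb c 1)) (ap h (lb c 2))" "ed U' R' N c' (ap h (lb c 0)) (ap h (lb c 2))"
        using e N by simp_all
      from ed_triangle[OF this] show ?thesis unfolding 2 by (meson less_imp_le_nat less_le_trans)
    next
      case 3
      have "ed U' R' N c' (ap h (lb c 0)) (ap h (lb c 1))" "ed U' R' N c' (ap h (lb c 1)) (ap h (lb c k))" "ed U' R' N c' (ap h (lb c 0)) (ap h (lb c k))"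
        using e k 3 by simp_all
      from ed_triangle[OF this] show ?thesis by meson
    qed
  qed
  then obtain \<sigma> where \<sigma>: "\<And>k. k \<le> N \<Longrightarrow> \<sigma> k \<le> N \<and> ap h (lb c k) = lb c' (\<sigma> k)" by metis
  \<comment> \<open>A strictly increasing map of a finite order into one of the same size is the
    identity.\<close>
  have mono: "\<sigma> i < \<sigma> j" if "i < j" "j \<le> N" for i j
    using D[of "lb c i" "lb c j"] \<sigma>[of i] \<sigma>[of j] that by simp
  have lo: "k \<le> \<sigma> k" if "k \<le> N" for k
    using that
  proof (induction k)
    case (Suc k) then show ?case using mono[of k "Suc k"] by simp
  qed simp
  have hi: "\<sigma> k + (N - k) \<le> N" if "k \<le> N" for k
    using that
  proof (induction rule: inc_induct)
    case base show ?case using \<sigma>[of N] by simp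
  next
    case (step n) then show ?case using mono[of n "Suc n"] by simp
  qed
  have "\<sigma> k = k" if "k \<le> N" for k using lo[OF that] hi[OF that] that by simp
  then have lab: "ap h (lb c k) = lb c' k" if "k \<le> N" for k using \<sigma>[OF that] that by simp
  then show "k \<le> N \<Longrightarrow> ap h (lb c k) = lb c' k" .
  have pt: "ap h (uv x) = uv (g x) \<and> g x \<in> El U'" if x: "x \<in> El U" for x
  proof -
    have e: "ed U' R' N c' (ap h (uv x)) (lb c' 0)" using D[of "uv x" "lb c 0"] lab[of 0] x by simp
    have "vx U' R' N c' (ap h (uv x))" by (rule V) (use x in simp)
    then show ?thesis by (rule vx_cases) (use e g[of x] in auto)
  qed
  then show "x \<in> El U \<Longrightarrow> ap h (uv x) = uv (g x) \<and> g x \<in> El U'" .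
  show "R' k (g x) (g y) \<and> ap h (ev k x y) = ev k (g x) (g y)" if k: "k < N" and x: "x \<in> El U" and y: "y \<in> El U" and r: "R k x y"
  proof -
    have v: "vx U R N c (ev k x y)" using k x y r by simp
    have e: "ed U' R' N c' (uv (g x)) (ap h (ev k x y))" "ed U' R' N c' (ap h (ev k x y)) (uv (g y))" "ed U' R' N c' (lb c' (Suc k)) (ap h (ev k x y))"
      using D[of "uv x" "ev k x y"] D[of "ev k x y" "uv y"] D[of "lb c (Suc k)" "ev k x y"] pt[OF x] pt[OF y] lab[of "Suc k"] v k by simp_all
    from V[OF v] show ?thesis by (rule vx_cases) (use e in auto)
  qed
qed

lemma gr_hm_ex:
  assumes R: "\<And>k. DP (\<lambda>s. R k (s 0) (s 1))" and R': "\<And>k. DP (\<lambda>s. R' k (s 0) (s 1))" and g: "DT (\<lambda>s. g (s 0))"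
    and U: "\<And>x. x \<in> El U \<Longrightarrow> g x \<in> El U'"
    and RR: "\<And>k x y. k < N \<Longrightarrow> x \<in> El U \<Longrightarrow> y \<in> El U \<Longrightarrow> R k x y \<Longrightarrow> R' k (g x) (g y)"
  shows "\<exists>h. hm h (gr U R N c) (gr U' R' N c')"
proof -
  note [dfn] = DT_app1[OF g]
  define H where "H z = (if p1 z = num 0 then uv (g (p2 z)) else if p1 z = num 2 then
     pr (num 2) (pr (p1 (p2 z)) (pr (g (p1 (p2 (p2 z)))) (g (p2 (p2 (p2 z)))))) else pr (num 3) (pr (p1 (p2 z)) c'))" for z
  have H: "H (uv x) = uv (g x)" "H (ev k x y) = ev k (g x) (g y)" "H (lb d k) = lb c' k" for x y k d unfolding H_def by simp_all
  have dH: "DT (\<lambda>s. H (s 0))" unfolding H_def by (intro dfn)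
  have V: "vx U' R' N c' (H z)" if "vx U R N c z" for z
    using that by (rule vx_cases) (use U RR in \<open>simp_all add: H\<close>)
  have D: "ed U' R' N c' (H a) (H b)" if e: "ed U R N c a b" for a b
  proof -
    have v: "vx U R N c a" "vx U R N c b" using e ed_vx by blast+
    show ?thesis by (rule vx_cases[OF v(1)]; rule vx_cases[OF v(2)]) (use e U RR in \<open>auto simp: H\<close>)
  qed
  have "hm (lam (p1 (gr U R N c)) H) (gr U R N c) (gr U' R' N c')"
    unfolding hm_iff
  proof (intro conjI ballI impI)
    show "fn (lam (p1 (gr U R N c)) H) (p1 (gr U R N c))" by (rule fn_lam[OF dH])
    fix x assume x: "x \<in> El (p1 (gr U R N c))"
    show "ap (lam (p1 (gr U R N c)) H) x \<in> El (p1 (gr U' R' N c'))"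
      using V x unfolding ap_lam[OF dH x] unfolding El_gr(1)[OF R] El_gr(1)[OF R'] by blast
    fix y assume y: "y \<in> El (p1 (gr U R N c))" and e: "pr x y \<in> El (p2 (gr U R N c))"
    show "pr (ap (lam (p1 (gr U R N c)) H) x) (ap (lam (p1 (gr U R N c)) H) y) \<in> El (p2 (gr U' R' N c'))"
      using D e unfolding ap_lam[OF dH x] ap_lam[OF dH y] gr_edge[OF R] gr_edge[OF R'] by blast
  qed
  then show ?thesis by blast
qed

lemma gr_hm_unique:
  assumes R: "\<And>k. DP (\<lambda>s. R k (s 0) (s 1))" and R': "\<And>k. DP (\<lambda>s. R' k (s 0) (s 1))" and N: "2 \<le> N"
    and h: "hm h (gr U R N c) (gr U' R' N c')" "hm h' (gr U R N c) (gr U' R' N c')"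
    and eq: "\<And>x. x \<in> El U \<Longrightarrow> p2 (ap h (uv x)) = p2 (ap h' (uv x))"
  shows "h = h'"
proof -
  have f: "fn h (p1 (gr U R N c))" "fn h' (p1 (gr U R N c))" using h unfolding hm_iff by blast+
  note a = gr_hm[OF R R' N h(1) refl] and b = gr_hm[OF R R' N h(2) refl]
  have "ap h z = ap h' z" if "vx U R N c z" for z
    using that
  proof (rule vx_cases)
    fix x assume z: "z = uv x" "x \<in> El U" show ?thesis using a(2)[OF z(2)] b(2)[OF z(2)] eq[OF z(2)] z(1) by metis
  next
    fix k x y assume z: "z = ev k x y" "k < N" "x \<in> El U" "y \<in> El U" "R k x y"
    show ?thesis using a(3)[OF z(2-5)] b(3)[OF z(2-5)] eq[OF z(3)] eq[OF z(4)] z(1) by metis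
  next
    fix k assume z: "z = lb c k" "k \<le> N" show ?thesis using a(1)[OF z(2)] b(1)[OF z(2)] z(1) by simp
  qed
  then show ?thesis by (intro fn_eqI[OF f]) (simp add: El_gr(1)[OF R])
qed

end

subsection \<open>Closure points\<close>

context zfc
begin

definition "R_wfg W v X Y \<longleftrightarrow> X = Y \<and> (\<forall>S. W S \<and> El S \<subseteq> El v \<and> S \<noteq> emp \<longrightarrow> (\<exists>m\<in>El S. \<forall>y\<in>El S. pr y m \<notin> El X))"

text \<open>The relations of \<open>rels\<close>, with the class and the range of the second-order quantifier in
  \<open>R_wf\<close> as parameters, so that they can be bounded by a set.\<close>

definition Flist :: "(('a \<Rightarrow> bool) \<Rightarrow> ('a \<Rightarrow> bool) \<Rightarrow> 'a \<Rightarrow> 'a \<Rightarrow> 'a \<Rightarrow> 'a \<Rightarrow> bool) list" where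
  "Flist = map (\<lambda>u B W r. R_pull u) um @ [\<lambda>B W r. R_nand, \<lambda>B W r. R_ex, \<lambda>B W r. R_wfg W,
     \<lambda>B W r. R_const (\<lambda>p. p1 p \<in> El (p2 p)), \<lambda>B W r. R_const (\<lambda>p. p2 p = sc (p1 p)), \<lambda>B W r. R_const B,
     \<lambda>B W r. R_const (\<lambda>x. x = r)]"

abbreviation "TT \<equiv> \<lambda>_::'a. True"

lemma rels_Flist: "rels A r = map (\<lambda>F. F A TT r) Flist"
  unfolding rels_def Flist_def R_wf_def[abs_def] R_wfg_def[abs_def] by simp

lemma Flist_cases:
  assumes "F \<in> set Flist"
  obtains u where "u \<in> set um" "F = (\<lambda>B W r. R_pull u)" | "F = (\<lambda>B W r. R_nand)" | "F = (\<lambda>B W r. R_ex)" | "F = (\<lambda>B W r. R_wfg W)"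
    | "F = (\<lambda>B W r. R_const (\<lambda>p. p1 p \<in> El (p2 p)))" | "F = (\<lambda>B W r. R_const (\<lambda>p. p2 p = sc (p1 p)))" | "F = (\<lambda>B W r. R_const B)"
    | "F = (\<lambda>B W r. R_const (\<lambda>x. x = r))"
  using assms unfolding Flist_def by auto

lemma good_iff: "good A r f b v \<longleftrightarrow> fn f (Pw b) \<and> (\<forall>X\<in>El (Pw b). ap f X \<in> El (Pw v)) \<and>
  (\<forall>k<length Flist. \<forall>X\<in>El (Pw b). \<forall>Y\<in>El (Pw b). (Flist ! k) A TT r b X Y \<longrightarrow> (Flist ! k) A TT r v (ap f X) (ap f Y))"
  unfolding good_def rels_Flist by (simp add: all_set_conv_all_nth)

lemma F_cong:
  assumes "F \<in> set Flist" "\<And>x. x \<in> El l \<Longrightarrow> B x = B' x" "\<And>S. El S \<subseteq> El l \<Longrightarrow> W S = W' S"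
  shows "F B W r l X Y = F B' W' r l X Y"
  using assms(1) by (cases rule: Flist_cases) (use assms(2,3) in \<open>auto simp: R_const_def R_wfg_def\<close>)

text \<open>Limit ranks are transitive and closed under pairing and projections, so at points of
  \<open>l\<close> each first-order relation refers to points of \<open>l\<close> only.
  Well-foundedness passes down because \<open>l\<close> has fewer subsets.\<close>

lemma F_restrict:
  assumes F: "F \<in> set Flist" and l: "LR l" "El l \<subseteq> El b" and R: "F A TT r b X Y"
    and X: "El X' = El X \<inter> El l" and Y: "El Y' = El Y \<inter> El l"
  shows "F A TT r l X' Y'"
proof -
  have eq: "X = Y \<Longrightarrow> X' = Y'" using X Y by (intro El_ext) simp
  have wf: "El S \<subseteq> El l \<Longrightarrow> El S \<subseteq> El b" for S using l(2) by blast
  note e = LR_emp[OF l(1)] and p = LR_pr[OF l(1)] and p12 = LR_p1[OF l(1)] and tr = LR_trans[OF l(1)]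
  from F show ?thesis
  proof (cases rule: Flist_cases)
    case (1 u)
    have "x \<in> El Y' \<longleftrightarrow> u x \<in> El X'" if x: "x \<in> El l" for x
    proof -
      have "x \<in> El Y \<longleftrightarrow> u x \<in> El X" using R x l(2) unfolding 1 R_pull_def by blast
      then show ?thesis unfolding X Y using LR_um[OF 1(1) l(1) x] x by simp
    qed
    then show ?thesis unfolding 1 R_pull_def by blast
  next
    case 2
    have "x \<in> El Y' \<longleftrightarrow> \<not> (pr emp x \<in> El X' \<and> pr (sc emp) x \<in> El X')" if x: "x \<in> El l" for x
    proof -
      have "x \<in> El Y \<longleftrightarrow> \<not> (pr emp x \<in> El X \<and> pr (sc emp) x \<in> El X)" using R x l(2) unfolding 2 R_nand_def by blast
      then show ?thesis unfolding X Y using p[OF e(1) x] p[OF e(2) x] x by simp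
    qed
    then show ?thesis unfolding 2 R_nand_def by blast
  next
    case 3
    have "pr (p1 q) z \<in> El l" if "q \<in> El l" "z \<in> El (p2 q)" for q z using p p12 tr that by blast
    moreover have "q \<in> El Y \<longleftrightarrow> (\<exists>z\<in>El (p2 q). pr (p1 q) z \<in> El X)" if "q \<in> El l" for q
      using R that l(2) unfolding 3 R_ex_def by blast
    ultimately have "q \<in> El Y' \<longleftrightarrow> (\<exists>z\<in>El (p2 q). pr (p1 q) z \<in> El X')" if "q \<in> El l" for q
      unfolding X Y using that by simp
    then show ?thesis unfolding 3 R_ex_def by blast
  next
    case 4
    have XY: "X = Y" and W0: "\<forall>S. True \<and> El S \<subseteq> El b \<and> S \<noteq> emp \<longrightarrow> (\<exists>m\<in>El S. \<forall>y\<in>El S. pr y m \<notin> El X)"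
      by (rule conjunct1[OF R[unfolded 4 R_wfg_def]], rule conjunct2[OF R[unfolded 4 R_wfg_def]])
    have W: "\<exists>m\<in>El S. \<forall>y\<in>El S. pr y m \<notin> El X" if "El S \<subseteq> El b" "S \<noteq> emp" for S using W0 that by simp
    have "\<exists>m\<in>El S. \<forall>y\<in>El S. pr y m \<notin> El X'" if S: "El S \<subseteq> El l" "S \<noteq> emp" for S
      using W[OF wf[OF S(1)] S(2)] unfolding X by blast
    then show ?thesis unfolding 4 R_wfg_def using eq[OF XY] by blast
  qed (use R eq l(2) in \<open>auto simp: R_const_def X Y\<close>)
qed

lemma D0_um: assumes "u \<in> set um" shows "D0 (\<lambda>s. u (s i) \<in> El (s j))"
proof -
  have P: "pr a b \<in> El X \<longleftrightarrow> (\<exists>z\<in>El X. ispr z \<and> p1 z = a \<and> p2 z = b)" for a b X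
  proof
    assume "pr a b \<in> El X" then show "\<exists>z\<in>El X. ispr z \<and> p1 z = a \<and> p2 z = b" by (rule bexI[rotated]) simp
  next
    assume "\<exists>z\<in>El X. ispr z \<and> p1 z = a \<and> p2 z = b"
    then show "pr a b \<in> El X" using ispr_D by metis
  qed
  have n: "emp = num 0" "sc (num 0) = num 1" by (simp_all add: num.simps)
  show ?thesis using assms by (rule um_cases) (simp_all only: P n, (intro D0_num dz)+)
qed

lemma D0_F:
  assumes "F \<in> set Flist"
  shows "D0 (\<lambda>s. F (\<lambda>x. sat E (El (s 0)) (\<lambda>_. x) \<phi>) (\<lambda>S. S \<in> El (s 1)) (s 2) (s 3) (s 4) (s 5))"
proof -
  have m: "D0 (\<lambda>s. pr emp (s i) \<in> El (s j))" "D0 (\<lambda>s. pr (sc emp) (s i) \<in> El (s j))" for i j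
    by (rule D0_um[of "\<lambda>x. pr emp x"], simp add: um_def) (rule D0_um[of "\<lambda>x. pr (sc emp) x"], simp add: um_def)
  have wf: "R_wfg (\<lambda>S. S \<in> El t) v X Y \<longleftrightarrow> X = Y \<and> (\<forall>S\<in>El t. El S \<subseteq> El v \<and> S \<noteq> emp \<longrightarrow> (\<exists>m\<in>El S. \<forall>y\<in>El S. pr y m \<notin> El X))" for t v X Y
    unfolding R_wfg_def by blast
  from assms show ?thesis
  proof (cases rule: Flist_cases)
    case (1 u) show ?thesis unfolding 1 R_pull_def by (intro dz D0_um[OF 1(1)])
  next
    case 2 show ?thesis unfolding 2 R_nand_def by (intro dz m)
  next
    case 4 show ?thesis unfolding 4 wf by (intro dz)
  qed (simp_all only: R_ex_def R_const_def, (intro dz D0_sat_elts)+)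
qed

lemma DP_F: "F \<in> set Flist \<Longrightarrow> DP (\<lambda>s. A (s 0)) \<Longrightarrow> DT f \<Longrightarrow> DT g \<Longrightarrow> DT h \<Longrightarrow> DP (\<lambda>s. F A TT r (f s) (g s) (h s))"
proof (rule DP_app3[of "\<lambda>x y z. F A TT r x y z"])
  assume F: "F \<in> set Flist" and A: "DP (\<lambda>s. A (s 0))"
  note [dfn] = DP_app1[OF A]
  from F show "DP (\<lambda>s. F A TT r (s 0) (s 1) (s 2))"
  proof (cases rule: Flist_cases)
    case (1 u)
    note [dfn] = DT_app1[OF DT_um[OF 1(1)]]
    show ?thesis unfolding 1 R_pull_def by (intro dfn)
  qed (simp_all only: R_nand_def R_ex_def R_wfg_def R_const_def, (intro dfn)+)
qed

lemma DP_good[dfn]: "DP (\<lambda>s. A (s 0)) \<Longrightarrow> DT f \<Longrightarrow> DT g \<Longrightarrow> DT h \<Longrightarrow> DP (\<lambda>s. good A r (f s) (g s) (h s))"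
proof (rule DP_app3[of "good A r"])
  assume A: "DP (\<lambda>s. A (s 0))"
  have F: "DP (\<lambda>s. i < length Flist \<longrightarrow> (Flist ! i) A TT r (f s) (g s) (h s))" if "DT f" "DT g" "DT h" for i f g h
    by (cases "i < length Flist") (simp_all add: DP_true DP_F[OF nth_mem A that])
  have "DP (\<lambda>s. \<forall>k<length Flist. k < length Flist \<longrightarrow> (\<forall>X\<in>El (Pw (s 1)). \<forall>Y\<in>El (Pw (s 1)). 
    (k < length Flist \<longrightarrow> (Flist ! k) A TT r (s 1) X Y) \<longrightarrow> (k < length Flist \<longrightarrow> (Flist ! k) A TT r (s 2) (ap (s 0) X) (ap (s 0) Y))))"
    by (intro DP_ball_lt DP_imp F dfn)
  then have "DP (\<lambda>s. \<forall>k<length Flist. \<forall>X\<in>El (Pw (s 1)). \<forall>Y\<in>El (Pw (s 1)). 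
    (Flist ! k) A TT r (s 1) X Y \<longrightarrow> (Flist ! k) A TT r (s 2) (ap (s 0) X) (ap (s 0) Y))"
    by (rule back_subst[of DP]) (auto intro!: HOL.ext)
  then show "DP (\<lambda>s. good A r (s 0) (s 1) (s 2))" unfolding good_iff by (intro dfn)
qed

lemma DP_crit[dfn]: "DT f \<Longrightarrow> DT g \<Longrightarrow> DP (\<lambda>s. crit (f s) (g s))"
  by (rule DP_app2[of crit], unfold crit_def, intro dfn)

text \<open>If no ordinal above \<open>r\<close> is strong, then the failures are witnessed inside every such \<open>v\<close>.\<close>

definition "CC m r v \<longleftrightarrow> LR v \<and> inC m v \<and> r \<in> El v \<and>
  (\<forall>k\<in>El v. Od k \<and> r \<in> El k \<longrightarrow> (\<exists>l\<in>El v. k \<in> El l \<and> LR l \<and> \<not> (\<exists>f\<in>El v. good (inC m) r f l l \<and> crit f k)))"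

lemma DP_CC[dfn]: "DT f \<Longrightarrow> DP (\<lambda>s. CC m r (f s))"
  by (rule DP_app1[of "CC m r"], unfold CC_def, intro dfn)

lemma CC_unbounded:
  assumes "\<And>k. Od k \<Longrightarrow> r \<in> El k \<Longrightarrow> \<exists>l. LR l \<and> k \<in> El l \<and> \<not> (\<exists>f. good (inC m) r f l l \<and> crit f k)"
  shows "\<exists>v. CC m r v \<and> x \<in> El v"
proof -
  \<comment> \<open>\<open>p1 y\<close> makes the closure correct, and \<open>p2 y\<close> is a rank
    on which no good map has the critical point \<open>c\<close>.\<close>
  define R where "R c y \<longleftrightarrow> inC m (p1 y) \<and> c \<in> El (p1 y) \<and> (Od c \<and> r \<in> El c \<longrightarrow>
    LR (p2 y) \<and> c \<in> El (p2 y) \<and> \<not> (\<exists>f. good (inC m) r f (p2 y) (p2 y) \<and> crit f c))" for c y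
  have "\<exists>v. LR v \<and> pr x r \<in> El v \<and> (\<forall>c\<in>El v. \<exists>y\<in>El v. R c y)"
  proof (rule reflect_LR)
    show "DP (\<lambda>s. R (s 0) (s 1))" unfolding R_def by (intro dfn)
    fix c
    obtain u where u: "inC m u" "c \<in> El u" using inC_unbounded by blast
    show "\<exists>y. R c y"
    proof (cases "Od c \<and> r \<in> El c")
      case True
      then obtain l where "LR l" "c \<in> El l" "\<not> (\<exists>f. good (inC m) r f l l \<and> crit f c)" using assms by blast
      then have "R c (pr u l)" unfolding R_def p1 p2 using u by blast
      then show ?thesis by blast
    next
      case False
      then have "R c (pr u u)" unfolding R_def p1 p2 using u by blast
      then show ?thesis by blast
    qed
  qed
  then obtain v where v: "LR v" "pr x r \<in> El v" "\<And>c. c \<in> El v \<Longrightarrow> \<exists>y\<in>El v. R c y" by blast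
  have xr: "x \<in> El v" "r \<in> El v" using LR_p1[OF v(1,2)] by simp_all
  have "inC m v"
  proof (rule inC_union[OF v(1)])
    fix c assume "c \<in> El v"
    then obtain y where y: "y \<in> El v" "R c y" using v(3) by blast
    have "p1 y \<in> El v" using LR_p1[OF v(1) y(1)] by blast
    then show "\<exists>w. inC m w \<and> c \<in> El w \<and> El w \<subseteq> El v" using y(2) LR_trans[OF v(1)] unfolding R_def by blast
  qed
  moreover have "\<exists>l\<in>El v. k \<in> El l \<and> LR l \<and> \<not> (\<exists>f\<in>El v. good (inC m) r f l l \<and> crit f k)" if k: "k \<in> El v" "Od k" "r \<in> El k" for k
  proof -
    obtain y where y: "y \<in> El v" "R k y" using v(3) k(1) by blast
    have "p2 y \<in> El v" using LR_p1[OF v(1) y(1)] by blast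
    then show ?thesis using y(2) k unfolding R_def by blast
  qed
  ultimately have "CC m r v" unfolding CC_def using v(1) xr(2) by blast
  then show ?thesis using xr(1) by blast
qed

text \<open>A critical point below \<open>r\<close> contradicts Kunen's theorem, since \<open>j r = r\<close>. One above \<open>r\<close> is a critical
  point of \<open>X \<mapsto> j X \<inter> l\<close>, a good map excluded by the closure of \<open>b\<close> or \<open>v\<close>.\<close>

theorem good_fixes:
  assumes r: "Od r" and b: "CC m r b" and v: "CC m r v" and g: "good (inC m) r f b v" and lin: "El b \<subseteq> El v \<or> El v \<subseteq> El b"
    and x: "x \<in> El b" "x \<in> El v" and X: "El X \<subseteq> El b"
  shows "x \<in> El (ap f X) \<longleftrightarrow> x \<in> El X"
proof -
  have Lb: "LR b" "inC m b" "r \<in> El b" and Lv: "LR v" "inC m v" "r \<in> El v" using b v unfolding CC_def by blast+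
  interpret X: extender E "inC m" r f b v by unfold_locales (intro dfn, use Lb Lv g in auto)
  let ?j = X.jj
  \<comment> \<open>The smaller of \<open>b\<close> and \<open>v\<close>; both the points to be
    fixed and the witnesses of failure are found in it.\<close>
  obtain t where t: "CC m r t" "El t \<subseteq> El b" "El t \<subseteq> El v" "El b \<inter> El v \<subseteq> El t" using lin b v by blast
  have Lt: "LR t" "r \<in> El t" using t(1) unfolding CC_def by blast+
  have tM: "El t \<subseteq> X.UM" using t(3) X.v_UM by blast
  obtain d where d: "Lim d" "t = Vs d" using Lt(1) unfolding LR_def by blast
  have od: "Od d" using d(1) unfolding Lim_def by blast
  have sg: "El (ap f (upr a a)) = {?j a} \<inter> El v" if "a \<in> El b" for a
    using X.k_jj[of "upr a a"] that by (simp add: X.j_upr)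
  have jr: "?j r = r"
  proof -
    have "sep b (\<lambda>x. x = r) = upr r r" by (rule El_ext) (subst El_sep, intro dfn, use Lb(3) in auto)
    then have "r \<in> El (ap f (upr r r))" using X.FO_r[OF Lv(3)] unfolding X.FO_def by simp
    then show ?thesis using sg[OF Lb(3)] by auto
  qed
  have fixed: "?j k = k" if k0: "Od k" "k \<in> El t" for k
  proof (rule ccontr)
    assume "?j k \<noteq> k"
    then have "\<exists>c. Od c \<and> ?j c \<noteq> c \<and> (\<forall>e\<in>El c. \<not> ?j e \<noteq> e)" by (intro Od_least[of _ k]) (intro dfn X.DT_j, use k0 in auto)
    then obtain c where c: "Od c" "?j c \<noteq> c" "\<And>e. e \<in> El c \<Longrightarrow> ?j e = e" by blast
    have ct: "c \<in> El t" using Od_lin[OF c(1) k0(1)] c(3)[of k] \<open>?j k \<noteq> k\<close> k0(2) LR_trans[OF Lt(1) k0(2)] by blast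
    have cp: "critical_point E ?j c" unfolding critical_point_def using c by blast
    have cr: "c \<noteq> r" using jr c(2) by blast
    consider "c \<in> El r" | "r \<in> El c" using Od_lin[OF c(1) r] cr by blast
    then show False
    proof cases
      case 1
      obtain e where e: "Lim e" "v = Vs e" using Lv(1) unfolding LR_def by blast
      have oe: "Od e" using e(1) unfolding Lim_def by blast
      have "r \<in> El e" using Lv(3) Vs_Od[OF oe r] unfolding e(2) by blast
      then have "sc r \<in> El e" using e(1) unfolding Lim_def by blast
      then have "Vs (sc r) \<in> El v" unfolding e(2) by (rule Vs_mem)
      then have "El (Vs (sc r)) \<subseteq> X.UM" using LR_trans[OF Lv(1)] X.v_UM by blast
      then show False using X.kunen[OF cp r jr] 1 by simp
    next
      case 2
      then obtain l where l: "l \<in> El t" "c \<in> El l" "LR l" "\<not> (\<exists>f\<in>El t. good (inC m) r f l l \<and> crit f c)"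
        using t(1) c(1) ct unfolding CC_def by blast
      have lt: "El l \<subseteq> El t" using LR_trans[OF Lt(1) l(1)] .
      have lb: "El l \<subseteq> El b" "El l \<subseteq> El v" using lt t(2,3) by blast+
      have lM: "El l \<subseteq> X.UM" using lb(2) X.v_UM by blast
      obtain dl where dl: "Lim dl" "l = Vs dl" using l(3) unfolding LR_def by blast
      have lj: "El l \<subseteq> El (?j l)" using X.j_Vs_sub[of dl] dl lM unfolding Lim_def by blast
      define f' where "f' = lam (Pw l) (\<lambda>X. sep l (\<lambda>x. x \<in> El (?j X)))"
      have dT: "DT (\<lambda>s. sep l (\<lambda>x. x \<in> El (?j (s 0))))" by (intro dfn X.DT_j)
      have ff: "fn f' (Pw l)" unfolding f'_def by (rule fn_lam[OF dT])
      have fa: "El (ap f' X) = El (?j X) \<inter> El l" if "El X \<subseteq> El l" for X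
      proof -
        have "ap f' X = sep l (\<lambda>x. x \<in> El (?j X))" unfolding f'_def using ap_lam[OF dT] that by simp
        moreover have "El (sep l (\<lambda>x. x \<in> El (?j X))) = {x \<in> El l. x \<in> El (?j X)}" by (rule El_sep) (intro dfn)
        ultimately show ?thesis by auto
      qed
      have "crit f' c" unfolding crit_def
      proof (intro conjI ballI)
        fix x assume xc: "x \<in> El c"
        then have xl: "x \<in> El l" using LR_trans[OF l(3,2)] by blast
        then have "El (ap f' (upr x x)) = {?j x} \<inter> El l" using fa[of "upr x x"] by (simp add: X.j_upr)
        then show "x \<in> El (ap f' (upr x x))" using c(3)[OF xc] xl by simp
      next
        have "El (ap f' (upr c c)) = {?j c} \<inter> El l" using fa[of "upr c c"] l(2) by (simp add: X.j_upr)
        then show "c \<notin> El (ap f' (upr c c))" using c(2) by auto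
      qed (rule c(1))
      moreover have "good (inC m) r f' l l"
        unfolding good_iff
      proof (intro conjI allI impI ballI)
        show "fn f' (Pw l)" by (rule ff)
        show "ap f' X \<in> El (Pw l)" if "X \<in> El (Pw l)" for X using fa[of X] that by simp
        fix k X Y assume k: "k < length Flist" and X: "X \<in> El (Pw l)" and Y: "Y \<in> El (Pw l)" and F: "(Flist ! k) (inC m) TT r l X Y"
        have Xl: "El X \<subseteq> El l" "El Y \<subseteq> El l" using X Y by simp_all
        define G where "G = Flist ! k"
        have G: "G \<in> set Flist" unfolding G_def using k by simp
        have gG: "G (inC m) TT r v (ap f Z) (ap f Z)" if "El Z \<subseteq> El b" "G (inC m) TT r b Z Z" for Z
          using g k that unfolding good_iff G_def by simp
        \<comment> \<open>Relations that mention neither the class nor the second-order range are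
          bounded, so they pass through \<open>?j\<close> and are then cut down from
          \<open>?j l\<close> to \<open>l\<close>. The two exceptions go through \<open>f\<close>
          itself.\<close>
        have J: "G B W r (?j l) (?j X) (?j Y)" if h: "G B W r l X Y" "\<forall>B W B' W'. G B W = G B' W'" for B W
        proof -
          let ?s = "\<lambda>n::nat. if n = 2 then r else if n = 3 then l else if n = 4 then X else Y"
          have e1: "G (\<lambda>x. sat E (El (?s 0)) (\<lambda>_. x) (Eq 0 0)) (\<lambda>S. S \<in> El (?s 1)) = G B W" using h(2) by iprover
          have e2: "G (\<lambda>x. sat E (El (?j (?s 0))) (\<lambda>_. x) (Eq 0 0)) (\<lambda>S. S \<in> El (?j (?s 1))) = G B W" using h(2) by iprover
          have "G B W (?j (?s 2)) (?j (?s 3)) (?j (?s 4)) (?j (?s 5)) = G B W (?s 2) (?s 3) (?s 4) (?s 5)"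
            using X.j0[OF D0_F[OF G], of ?s "Eq 0 0"] unfolding e1 e2 .
          then show ?thesis using h(1) jr by simp
        qed
        have cut: "G (inC m) TT r l (ap f' X) (ap f' Y)" if h: "\<forall>B W B' W'. G B W = G B' W'"
        proof -
          have "G (inC m) TT r (?j l) (?j X) (?j Y)" by (rule J[OF _ h]) (rule F[folded G_def])
          then show ?thesis by (rule F_restrict[OF G l(3) lj _ fa[OF Xl(1)] fa[OF Xl(2)]])
        qed
        from G have "G (inC m) TT r l (ap f' X) (ap f' Y)"
        proof (cases rule: Flist_cases)
          case 4
          have XY: "X = Y" and wfl: "\<And>S. El S \<subseteq> El l \<Longrightarrow> S \<noteq> emp \<Longrightarrow> \<exists>m\<in>El S. \<forall>y\<in>El S. pr y m \<notin> El X"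
            using F unfolding G_def[symmetric] 4 R_wfg_def by blast+
          \<comment> \<open>\<open>X\<close> relates only points of \<open>l\<close>, so it stays
            well-founded on the larger \<open>b\<close>, where \<open>f\<close> is known to preserve
            this; the result is then cut down to \<open>l\<close>.\<close>
          have "G (inC m) TT r b X X" unfolding 4 R_wfg_def
          proof (intro conjI allI impI refl, elim conjE)
            fix S assume S: "S \<noteq> emp"
            define S' where "S' = sep S (\<lambda>x. x \<in> El l)"
            have S': "El S' = {x \<in> El S. x \<in> El l}" unfolding S'_def by (rule El_sep) (intro dfn)
            have inl: "y \<in> El l \<and> m \<in> El l" if "pr y m \<in> El X" for y m
              using LR_p1[OF l(3), of "pr y m"] that Xl by auto
            show "\<exists>m\<in>El S. \<forall>y\<in>El S. pr y m \<notin> El X"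
            proof (cases "S' = emp")
              case True
              obtain m where "m \<in> El S" using S by (metis emp_eq equals0I)
              then show ?thesis using inl S' True by (metis (no_types, lifting) El_emp empty_iff mem_Collect_eq)
            next
              case False
              then obtain m where "m \<in> El S'" "\<forall>y\<in>El S'. pr y m \<notin> El X" using wfl[of S'] S' by blast
              then show ?thesis using inl S' by blast
            qed
          qed
          then have "G (inC m) TT r v (ap f X) (ap f X)" using gG Xl lb(1) by blast
          moreover have "El (ap f' X) = El (ap f X) \<inter> El l"
            using fa[OF Xl(1)] X.k_jj[of X] Xl(1) lb by blast
          ultimately show ?thesis unfolding XY[symmetric] by (intro F_restrict[OF G l(3) lb(2)])
        next
          case 7
          have XY: "X = Y" and A: "\<And>x. x \<in> El l \<Longrightarrow> x \<in> El X \<longleftrightarrow> inC m x"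
            using F unfolding G_def[symmetric] 7 R_const_def by blast+
          \<comment> \<open>The trace of the class on all of \<open>b\<close>, which
            \<open>f\<close> sends to its trace on \<open>v\<close>. Since \<open>X\<close> is
            \<open>Z\<close> cut down to \<open>l\<close>, \<open>?j X\<close> agrees with
            \<open>?j Z\<close> on \<open>?j l\<close>.\<close>
          define Z where "Z = sep b (\<lambda>x. inC m x)"
          have Z: "El Z = {x \<in> El b. inC m x}" unfolding Z_def by (rule El_sep) (intro dfn)
          have "G (inC m) TT r b Z Z" unfolding 7 R_const_def using Z by simp
          then have "G (inC m) TT r v (ap f Z) (ap f Z)" using gG Z by blast
          then have Zv: "x \<in> El (ap f Z) \<longleftrightarrow> inC m x" if "x \<in> El v" for x using that unfolding 7 R_const_def by blast
          have "(\<forall>x\<in>El X. x \<in> El Z) \<and> (\<forall>x\<in>El l. x \<in> El Z \<longrightarrow> x \<in> El X)" using A Z Xl lb(1) by blast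
          moreover have "((\<forall>x\<in>El (?j X). x \<in> El (?j Z)) \<and> (\<forall>x\<in>El (?j l). x \<in> El (?j Z) \<longrightarrow> x \<in> El (?j X))) =
            ((\<forall>x\<in>El X. x \<in> El Z) \<and> (\<forall>x\<in>El l. x \<in> El Z \<longrightarrow> x \<in> El X))"
            by (rule X.j0_3[of "\<lambda>X Z l. (\<forall>x\<in>El X. x \<in> El Z) \<and> (\<forall>x\<in>El l. x \<in> El Z \<longrightarrow> x \<in> El X)"]) (intro dz)
          ultimately have jXZ: "\<And>x. x \<in> El (?j X) \<Longrightarrow> x \<in> El (?j Z)" "\<And>x. x \<in> El (?j l) \<Longrightarrow> x \<in> El (?j Z) \<Longrightarrow> x \<in> El (?j X)" by simp_all
          have Zb: "El Z \<subseteq> El b" using Z by simp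
          have jZ: "x \<in> El (?j Z) \<longleftrightarrow> inC m x" if "x \<in> El l" for x
          proof -
            have "x \<in> El v" using that lb(2) by blast
            then show ?thesis using Zv[of x] X.k_jj[OF Zb] by simp
          qed
          have "x \<in> El (ap f' X) \<longleftrightarrow> inC m x" if "x \<in> El l" for x
            unfolding fa[OF Xl(1)] using that jZ[OF that] jXZ[of x] subsetD[OF lj that] by auto
          then show ?thesis unfolding 7 R_const_def XY by blast
        qed (rule cut, simp)+
        then show "(Flist ! k) (inC m) TT r l (ap f' X) (ap f' Y)" unfolding G_def .
      qed
      \<comment> \<open>The closure condition excludes only maps that are members of
        \<open>t\<close>, so existence of \<open>f'\<close> alone would give no
        contradiction.\<close>
      moreover have "f' \<in> El t"
      proof -
        have "El f' \<subseteq> El (tms (Pw l) (Pw l))" unfolding fn_El[OF ff] using fa by auto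
        moreover have "tms (Pw l) (Pw l) \<in> El t" unfolding d(2) by (intro Vs_tms Vs_Pw d(1)) (use l(1) d(2) in simp_all)
        ultimately show ?thesis using LR_sub[OF Lt(1)] by blast
      qed
      ultimately show False using l(4) by blast
    qed
  qed
  have "?j x = x"
  proof (rule X.j_fix[OF od])
    show "x \<in> El (Vs d)" using x t(4) d(2) by blast
    fix e assume e: "e \<in> El d"
    then have "e \<in> El t" unfolding d(2) using sub_Vs by blast
    then show "?j e = e" using fixed Od_mem[OF od e] by blast
  qed
  then have "x \<in> El (?j X) \<longleftrightarrow> x \<in> El X" using X.j0_2[of "\<lambda>x y. x \<in> El y" x X] by (simp add: dz)
  then show ?thesis using X.k_jj[OF X] x(2) by simp
qed

end

subsection \<open>A rigid descending sequence of graphs\<close>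

context zfc
begin

text \<open>The singletons of ordinals from \<open>i\<close> on; this relation excludes homomorphisms from earlier graphs to later ones.\<close>

definition "RP i v X Y \<longleftrightarrow> X = Y \<and> (X = emp \<or> (\<exists>x\<in>El v. Od x \<and> (x = i \<or> i \<in> El x) \<and> X = upr x x))"
lemma DP_RP[dfn]: "DT f \<Longrightarrow> DT g \<Longrightarrow> DP (\<lambda>s. RP i v (f s) (g s))"
  by (rule DP_app2[of "RP i v"], unfold RP_def, intro dfn)

definition "RR m r i v k X Y \<longleftrightarrow> (if k < length Flist then (Flist ! k) (inC m) TT r v X Y else RP i v X Y)"
lemma DP_RR: "DP (\<lambda>s. RR m r i v k (s 0) (s 1))"
proof (cases "k < length Flist")
  case True
  have "DP (\<lambda>s. (Flist ! k) (inC m) TT r v (s 0) (s 1))" by (rule DP_F[OF nth_mem[OF True]]) (intro dfn)+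
  then show ?thesis using True by (simp add: RR_def)
next
  case False then show ?thesis by (simp add: RR_def dfn)
qed

definition "CCmin m r i v \<longleftrightarrow> CC m r v \<and> i \<in> El v \<and> \<not> (\<exists>u\<in>El v. CC m r u \<and> i \<in> El u)"
definition "vs m r i = (THE v. CCmin m r i v)"
abbreviation "NR \<equiv> Suc (length Flist)"
text \<open>The labels carry \<open>i\<close>, \<open>v\<close> and \<open>Pw v\<close>, so that all
  data of the construction can be read off from a vertex of the graph. The last of the
  \<open>NR\<close> relations is \<open>RP\<close>.\<close>

definition "Gv m r i v = gr (Pw v) (RR m r i v) NR (pr i (pr v (Pw v)))"
definition "GG m r i = Gv m r i (vs m r i)"

lemma CC_Vs: "CC m r v \<Longrightarrow> \<exists>d. Lim d \<and> Od d \<and> v = Vs d" unfolding CC_def LR_def Lim_def by blast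

lemma CC_lin: assumes "CC m r v" "CC m r u" shows "v = u \<or> (v \<in> El u \<and> El v \<subseteq> El u) \<or> (u \<in> El v \<and> El u \<subseteq> El v)"
proof -
  obtain d e where d: "Od d" "v = Vs d" and e: "Od e" "u = Vs e" using CC_Vs assms by metis
  have L: "LR v" "LR u" using assms unfolding CC_def by blast+
  show ?thesis using Od_lin[OF d(1) e(1)] Vs_mem[of d e] Vs_mem[of e d] LR_trans[OF L(1)] LR_trans[OF L(2)] unfolding d(2) e(2) by blast
qed

lemma CCmin_unique: assumes "CCmin m r i v" "CCmin m r i u" shows "u = v"
  using CC_lin[of m r v u] assms unfolding CCmin_def by blast

lemma CCmin_ex: assumes "CC m r v" "i \<in> El v" shows "\<exists>v. CCmin m r i v"
proof -
  obtain d where d: "Od d" "v = Vs d" using CC_Vs[OF assms(1)] by blast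
  have "\<exists>e. Od e \<and> (CC m r (Vs e) \<and> i \<in> El (Vs e)) \<and> (\<forall>c\<in>El e. \<not> (CC m r (Vs c) \<and> i \<in> El (Vs c)))"
    by (rule Od_least[of _ d]) (intro dfn, use assms d in auto)
  then obtain e where e: "Od e" "CC m r (Vs e)" "i \<in> El (Vs e)" "\<And>c. c \<in> El e \<Longrightarrow> \<not> (CC m r (Vs c) \<and> i \<in> El (Vs c))" by blast
  have "\<not> (CC m r u \<and> i \<in> El u)" if u: "u \<in> El (Vs e)" for u
  proof
    assume c: "CC m r u \<and> i \<in> El u"
    then obtain c where c': "Od c" "u = Vs c" using CC_Vs by blast
    have "\<not> El e \<subseteq> El c" using Vs_mono[of e c] u unfolding c'(2) by (metis irrefl subsetD)
    then have "c \<in> El e" using Od_le[OF c'(1) e(1)] by blast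
    then show False using e(4) c c'(2) by blast
  qed
  then show ?thesis unfolding CCmin_def using e by blast
qed

end

locale nostrong = zfc E for E :: "'a \<Rightarrow> 'a \<Rightarrow> bool" +
  fixes m :: nat and r :: 'a
  assumes m: "m \<noteq> 0" and r: "Od r"
    and bad: "\<And>k. Od k \<Longrightarrow> r \<in> El k \<Longrightarrow> \<exists>l. LR l \<and> k \<in> El l \<and> \<not> (\<exists>f. good (inC m) r f l l \<and> crit f k)"
begin

abbreviation "V i \<equiv> vs m r i"
abbreviation "G i \<equiv> GG m r i"

lemma CCmin_V: "CCmin m r i (V i)"
proof -
  obtain v where "CCmin m r i v" using CC_unbounded[OF bad] CCmin_ex by blast
  then show ?thesis unfolding vs_def using CCmin_unique by (metis theI)
qed
lemma V_eq: "CCmin m r i v \<Longrightarrow> v = V i" using CCmin_unique CCmin_V by blast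
lemma V_CC: "CC m r (V i)" and V_mem: "i \<in> El (V i)" and V_LR: "LR (V i)" using CCmin_V[of i] unfolding CCmin_def CC_def by blast+

lemma V_mono: assumes "Od b" "a \<in> El b \<or> a = b" shows "El (V a) \<subseteq> El (V b)"
proof -
  have "a \<in> El (V b)" using assms LR_trans[OF V_LR V_mem] V_mem by blast
  then have "V b \<notin> El (V a)" using CCmin_V[of a] V_CC unfolding CCmin_def by blast
  then show ?thesis using CC_lin[OF V_CC[of a] V_CC[of b]] by auto
qed

lemma G_graph: "is_graph E (G i)" unfolding GG_def Gv_def by (rule gr_graph[OF DP_RR])

lemma hom_good:
  assumes h: "hm h (G a) (G b)" and lin: "El (V a) \<subseteq> El (V b) \<or> El (V b) \<subseteq> El (V a)"
  shows "El X \<subseteq> El (V a) \<Longrightarrow> x \<in> El (V a) \<Longrightarrow> x \<in> El (V b) \<Longrightarrow> x \<in> El (p2 (ap h (uv X))) \<longleftrightarrow> x \<in> El X"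
    "El X \<subseteq> El (V a) \<Longrightarrow> El (p2 (ap h (uv X))) \<subseteq> El (V b)"
    "RP a (V a) X X \<Longrightarrow> El X \<subseteq> El (V a) \<Longrightarrow> RP b (V b) (p2 (ap h (uv X))) (p2 (ap h (uv X)))"
proof -
  have N: "2 \<le> NR" unfolding Flist_def by simp
  let ?g = "\<lambda>X. p2 (ap h (uv X))"
  note H = gr_hm[OF DP_RR DP_RR N h[unfolded GG_def Gv_def] refl]
  define f where "f = lam (Pw (V a)) ?g"
  have d: "DT (\<lambda>s. ?g (s 0))" by (intro dfn)
  have fa: "ap f X = ?g X" if "El X \<subseteq> El (V a)" for X unfolding f_def using ap_lam[OF d] that by simp
  have gb: "El (?g X) \<subseteq> El (V b)" if "El X \<subseteq> El (V a)" for X using H(2)[of X] that by simp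
  have "good (inC m) r f (V a) (V b)" unfolding good_iff
  proof (intro conjI allI impI ballI)
    show "fn f (Pw (V a))" unfolding f_def by (rule fn_lam[OF d])
    show "ap f X \<in> El (Pw (V b))" if "X \<in> El (Pw (V a))" for X using that gb fa by simp
    fix k X Y assume k: "k < length Flist" and X: "X \<in> El (Pw (V a))" and Y: "Y \<in> El (Pw (V a))" and R: "(Flist ! k) (inC m) TT r (V a) X Y"
    have "RR m r b (V b) k (?g X) (?g Y)" using H(3)[of k X Y] k X Y R by (simp add: RR_def)
    then show "(Flist ! k) (inC m) TT r (V b) (ap f X) (ap f Y)" using k fa X Y by (simp add: RR_def)
  qed
  from good_fixes[OF r V_CC V_CC this lin]
  show "El X \<subseteq> El (V a) \<Longrightarrow> x \<in> El (V a) \<Longrightarrow> x \<in> El (V b) \<Longrightarrow> x \<in> El (?g X) \<longleftrightarrow> x \<in> El X" using fa by metis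
  show "El X \<subseteq> El (V a) \<Longrightarrow> El (?g X) \<subseteq> El (V b)" by (rule gb)
  show "RP a (V a) X X \<Longrightarrow> El X \<subseteq> El (V a) \<Longrightarrow> RP b (V b) (?g X) (?g X)"
    using H(3)[of "length Flist" X X] by (simp add: RR_def)
qed

lemma hom_hm_G: "hom E h (G a) (G b) \<longleftrightarrow> hm h (G a) (G b)"
  using hom_hm graph_pr[OF G_graph] by blast

lemma hom_unique: assumes "Od b" "a \<in> El b \<or> a = b" "hom E h (G b) (G a)" "hom E h' (G b) (G a)" shows "h = h'"
proof -
  have N: "2 \<le> NR" unfolding Flist_def by simp
  have h: "hm h (G b) (G a)" "hm h' (G b) (G a)" using assms(3,4) unfolding hom_hm_G by blast+
  note sub = V_mono[OF assms(1,2)]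
  show ?thesis
  proof (rule gr_hm_unique[OF DP_RR DP_RR N h[unfolded GG_def Gv_def]])
    fix X assume "X \<in> El (Pw (V b))"
    then have X: "El X \<subseteq> El (V b)" by simp
    have *: "El (p2 (ap k (uv X))) = El X \<inter> El (V a)" if "hm k (G b) (G a)" for k
      using hom_good(1)[OF that disjI2[OF sub] X] hom_good(2)[OF that disjI2[OF sub] X] sub by blast
    show "p2 (ap h (uv X)) = p2 (ap h' (uv X))" by (rule El_ext) (simp only: *[OF h(1)] *[OF h(2)])
  qed
qed

lemma hom_ex: assumes "Od b" "a \<in> El b \<or> a = b" shows "\<exists>h. hom E h (G b) (G a)"
proof -
  note sub = V_mono[OF assms]
  let ?g = "\<lambda>X. sep X (\<lambda>x. x \<in> El (V a))"
  have g: "El (?g X) = El X \<inter> El (V a)" for X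
  proof -
    have "El (?g X) = {x \<in> El X. x \<in> El (V a)}" by (rule El_sep) (intro dfn)
    then show ?thesis by auto
  qed
  have "\<exists>h. hm h (G b) (G a)" unfolding GG_def Gv_def
  proof (rule gr_hm_ex[OF DP_RR DP_RR, of ?g])
    show "DT (\<lambda>s. ?g (s 0))" by (intro dfn)
    show "?g X \<in> El (Pw (V a))" for X using g[of X] by simp
    fix k X Y assume R: "RR m r b (V b) k X Y"
    show "RR m r a (V a) k (?g X) (?g Y)"
    proof (cases "k < length Flist")
      case True
      have "(Flist ! k) (inC m) TT r (V a) (?g X) (?g Y)"
        by (rule F_restrict[OF nth_mem[OF True] V_LR sub _ g g]) (use R True in \<open>simp add: RR_def\<close>)
      then show ?thesis using True by (simp add: RR_def)
    next
      case False
      then have R': "RP b (V b) X Y" using R by (simp add: RR_def)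
      \<comment> \<open>Cutting a singleton down to the smaller rank leaves it or empties it, hence
        the empty set in \<open>RP\<close>.\<close>
      have "?g X = emp \<or> (\<exists>x\<in>El (V a). Od x \<and> (x = a \<or> a \<in> El x) \<and> ?g X = upr x x)"
      proof (cases "?g X = emp")
        case ne: False
        then obtain x where x: "x \<in> El X" "x \<in> El (V a)" using g[of X] by (metis IntE emp_eq equals0I)
        then obtain y where y: "Od y" "y = b \<or> b \<in> El y" "X = upr y y" using R' unfolding RP_def by auto
        have xy: "x = y" using x(1) y(3) by simp
        have "x = a \<or> a \<in> El x" using xy y(1,2) assms(2) Od_trans[OF y(1)] by blast
        moreover have "?g X = upr x x" by (rule El_ext) (use g[of X] x y(3) xy in auto)
        ultimately show ?thesis using x(2) y(1) xy by blast
      qed simp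
      then show ?thesis using False R' unfolding RR_def RP_def by simp
    qed
  qed
  then show ?thesis using hom_hm_G by blast
qed

text \<open>By rigidity the image of the singleton of \<open>a\<close> contains \<open>a\<close>,
  but the last relation makes it empty or the singleton of an ordinal not below
  \<open>b\<close>.\<close>

lemma no_hom: assumes "Od a" "Od b" "a \<in> El b" shows "\<not> hom E h (G a) (G b)"
proof
  assume "hom E h (G a) (G b)"
  then have h: "hm h (G a) (G b)" unfolding hom_hm_G .
  note sub = V_mono[OF assms(2) disjI1[OF assms(3)]]
  let ?X = "upr a a"
  have X: "El ?X \<subseteq> El (V a)" using V_mem by simp
  have "RP a (V a) ?X ?X" unfolding RP_def using V_mem assms(1) by blast
  from hom_good(3)[OF h disjI1[OF sub] this X]
  have "p2 (ap h (uv ?X)) = emp \<or> (\<exists>x. (x = b \<or> b \<in> El x) \<and> p2 (ap h (uv ?X)) = upr x x)" unfolding RP_def by blast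
  moreover have "a \<in> El (p2 (ap h (uv ?X)))" using hom_good(1)[OF h disjI1[OF sub] X V_mem] sub V_mem by auto
  ultimately have "a = b \<or> b \<in> El a" by auto
  then show False using assms(3) no2 irrefl by blast
qed

lemma G_inj: assumes "Od a" "Od b" "a \<in> El b" shows "G a \<noteq> G b"
  using no_hom[OF assms] hom_ex[OF assms(1), of a] by auto

end

subsection \<open>The sequence is \<open>\<Pi>\<^sub>m\<close>-definable\<close>

context zfc
begin

lemma D0_Flist:
  assumes F: "F \<in> set Flist" and t: "TD w" "TD t" "TD r" "TD l" "TD f" "TD g"
  shows "D0 (\<lambda>s. F (\<lambda>x. sat E (El (w s)) (\<lambda>_. x) \<phi>) (\<lambda>S. S \<in> El (t s)) (r s) (l s) (f s) (g s))"
proof -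
  have "TD (if i = 0 then w else if i = 1 then t else if i = 2 then r else if i = 3 then l else if i = 4 then f else g)" for i :: nat using t by simp
  from D0_TDs[OF D0_F[OF F, of \<phi>] this, of 6 id id] show ?thesis by simp
qed

lemma D0_ball_lt: "(\<And>i. i < N \<Longrightarrow> D0 (P i)) \<Longrightarrow> D0 (\<lambda>s. \<forall>i<(N::nat). P i s)"
proof (induction N)
  case (Suc N)
  have "D0 (\<lambda>s. (\<forall>i<N. P i s) \<and> P N s)" by (intro D0_and Suc.IH Suc.prems) simp_all
  then show ?case by (simp add: less_Suc_eq all_conj_distrib conj_commute imp_disjL)
qed (simp add: D0_const)

lemma D0_bex_lt: "(\<And>i. i < N \<Longrightarrow> D0 (P i)) \<Longrightarrow> D0 (\<lambda>s. \<exists>i<(N::nat). P i s)"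
  using D0_not[OF D0_ball_lt[of N "\<lambda>i s. \<not> P i s"]] D0_not by simp

lemma LR_Pw: "LR v \<Longrightarrow> x \<in> El v \<Longrightarrow> Pw x \<in> El v" unfolding LR_def using Vs_Pw by blast

abbreviation "Bw m w \<equiv> \<lambda>x. sat E (El w) (\<lambda>_. x) (fmC m)"

definition "Fr k m w t r l X Y \<longleftrightarrow> k < length Flist \<and> (Flist ! k) (Bw m w) (\<lambda>S. S \<in> El t) r l X Y"
lemma D0_Fr[dz]:
  assumes "TD w" "TD t" "TD r" "TD l" "TD f" "TD g" shows "D0 (\<lambda>s. Fr k m (w s) (t s) (r s) (l s) (f s) (g s))"
proof (cases "k < length Flist")
  case True then show ?thesis unfolding Fr_def using D0_Flist[OF nth_mem[OF True] assms] by simp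
next
  case False then show ?thesis unfolding Fr_def by (simp add: D0_const)
qed

text \<open>The clauses of the definition of closure points, with all notions computed inside \<open>w\<close>.\<close>

definition "gd m w r f l \<longleftrightarrow> (\<exists>P\<in>El w. (\<forall>X\<in>El P. El X \<subseteq> El l) \<and> (\<forall>X\<in>El w. El X \<subseteq> El l \<longrightarrow> X \<in> El P) \<and> fn f P \<and>
  (\<forall>p\<in>El f. p2 p \<in> El P) \<and> (\<forall>k<length Flist. \<forall>p\<in>El f. \<forall>q\<in>El f.
    Fr k m w w r l (p1 p) (p1 q) \<longrightarrow> Fr k m w w r l (p2 p) (p2 q)))"
definition "cr f k \<longleftrightarrow> Od k \<and> (\<forall>x\<in>El k. \<exists>p\<in>El f. p1 p = upr x x \<and> x \<in> El (p2 p)) \<and> (\<forall>p\<in>El f. p1 p = upr k k \<longrightarrow> k \<notin> El (p2 p))"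
definition "LRr w l \<longleftrightarrow> LR0 w l \<and> (\<forall>x\<in>El w. \<forall>y\<in>El l. El x \<subseteq> El y \<longrightarrow> x \<in> El l)"
definition "DD m r w v \<longleftrightarrow> r \<in> El v \<and> (\<forall>k\<in>El v. Od k \<and> r \<in> El k \<longrightarrow>
  (\<exists>l\<in>El v. k \<in> El l \<and> LRr w l \<and> \<not> (\<exists>f\<in>El v. gd m w r f l \<and> cr f k)))"

lemma D0_gd[dz]: "TD f \<Longrightarrow> TD g \<Longrightarrow> TD h \<Longrightarrow> TD k \<Longrightarrow> D0 (\<lambda>s. gd m (f s) (g s) (h s) (k s))"
  by (rule D0_app4[of "gd m"], unfold gd_def, intro D0_ball_lt dz)
lemma D0_cr[dz]: "TD f \<Longrightarrow> TD g \<Longrightarrow> D0 (\<lambda>s. cr (f s) (g s))"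
  by (rule D0_app2[of cr], unfold cr_def, intro D0_upr dz)
lemma D0_LRr[dz]: "TD f \<Longrightarrow> TD g \<Longrightarrow> D0 (\<lambda>s. LRr (f s) (g s))"
  by (rule D0_app2[of LRr], unfold LRr_def, intro dz)
lemma D0_DD[dz]: "TD f \<Longrightarrow> TD g \<Longrightarrow> TD h \<Longrightarrow> D0 (\<lambda>s. DD m (f s) (g s) (h s))"
  by (rule D0_app3[of "DD m"], unfold DD_def, intro dz)

lemma fn_ball: "fn f a \<Longrightarrow> (\<forall>p\<in>El f. Q (p1 p) (p2 p)) \<longleftrightarrow> (\<forall>x\<in>El a. Q x (ap f x))" using fn_El[of f a] by auto

text \<open>\<open>w\<close> contains the power set of its member \<open>l\<close> and evaluates
  \<open>inC m\<close> correctly, so the bounded quantifiers have their full range.\<close>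

lemma gd_good: assumes w: "LR w" "inC m w" and l: "l \<in> El w" shows "gd m w r f l \<longleftrightarrow> good (inC m) r f l l"
proof -
  have F: "Fr k m w w r l X Y = (Flist ! k) (inC m) TT r l X Y" if k: "k < length Flist" for k X Y
  proof -
    have "(Flist ! k) (Bw m w) (\<lambda>S. S \<in> El w) r l X Y = (Flist ! k) (inC m) TT r l X Y"
    proof (rule F_cong[OF nth_mem[OF k]])
      show "Bw m w x = inC m x" if "x \<in> El l" for x by (rule inC_inC[OF w(2)]) (rule subsetD[OF LR_trans[OF w(1) l] that])
      show "(S \<in> El w) = True" if "El S \<subseteq> El l" for S using LR_sub[OF w(1) l that] by simp
    qed
    then show ?thesis unfolding Fr_def using k by simp
  qed
  have P: "(\<forall>X\<in>El P. El X \<subseteq> El l) \<and> (\<forall>X\<in>El w. El X \<subseteq> El l \<longrightarrow> X \<in> El P) \<longleftrightarrow> P = Pw l" for P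
  proof
    assume "(\<forall>X\<in>El P. El X \<subseteq> El l) \<and> (\<forall>X\<in>El w. El X \<subseteq> El l \<longrightarrow> X \<in> El P)"
    then show "P = Pw l" using LR_sub[OF w(1) l] by (intro El_ext) auto
  qed simp
  have R: "(\<forall>p\<in>El f. \<forall>q\<in>El f. A (p1 p) (p1 q) \<longrightarrow> A (p2 p) (p2 q)) \<longleftrightarrow>
     (\<forall>X\<in>El (Pw l). \<forall>Y\<in>El (Pw l). A X Y \<longrightarrow> A (ap f X) (ap f Y))" if "fn f (Pw l)" for A
    using fn_ball[OF that, of "\<lambda>x y. \<forall>q\<in>El f. A x (p1 q) \<longrightarrow> A y (p2 q)"]
      fn_ball[OF that, of "\<lambda>x y. A _ x \<longrightarrow> A _ y"] by simp
  have S: "(\<forall>p\<in>El f. p2 p \<in> El (Pw l)) \<longleftrightarrow> (\<forall>X\<in>El (Pw l). ap f X \<in> El (Pw l))" if "fn f (Pw l)"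
    by (rule fn_ball[OF that])
  have "gd m w r f l \<longleftrightarrow> (\<exists>P\<in>El w. P = Pw l \<and> fn f P \<and> (\<forall>p\<in>El f. p2 p \<in> El P) \<and> (\<forall>k<length Flist. \<forall>p\<in>El f. \<forall>q\<in>El f.
    (Flist ! k) (inC m) TT r l (p1 p) (p1 q) \<longrightarrow> (Flist ! k) (inC m) TT r l (p2 p) (p2 q)))"
    unfolding gd_def P[symmetric] using F by simp
  also have "\<dots> \<longleftrightarrow> fn f (Pw l) \<and> (\<forall>p\<in>El f. p2 p \<in> El (Pw l)) \<and> (\<forall>k<length Flist. \<forall>p\<in>El f. \<forall>q\<in>El f.
    (Flist ! k) (inC m) TT r l (p1 p) (p1 q) \<longrightarrow> (Flist ! k) (inC m) TT r l (p2 p) (p2 q))"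
    using LR_Pw[OF w(1) l] by simp
  also have "\<dots> \<longleftrightarrow> good (inC m) r f l l" unfolding good_iff using R S by (simp cong: conj_cong)
  finally show ?thesis .
qed

lemma cr_crit: assumes f: "fn f (Pw l)" and l: "LR l" "k \<in> El l" shows "cr f k \<longleftrightarrow> crit f k"
proof -
  have u: "El (upr x x) \<subseteq> El l" if "x \<in> El k \<or> x = k" for x using LR_trans[OF l] l(2) that by auto
  have 1: "(\<exists>p\<in>El f. p1 p = upr x x \<and> x \<in> El (p2 p)) \<longleftrightarrow> x \<in> El (ap f (upr x x))" if "x \<in> El k \<or> x = k" for x
    using fn_ex[OF f, of "upr x x" "\<lambda>y. x \<in> El y"] u[OF that] by simp
  have "(\<forall>p\<in>El f. p1 p = upr k k \<longrightarrow> k \<notin> El (p2 p)) \<longleftrightarrow> k \<notin> El (ap f (upr k k))" using 1[of k] by blast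
  then show ?thesis unfolding cr_def crit_def using 1 by simp
qed

lemma DD_CC: assumes w: "LR w" "inC m w" and v: "LR v" "El v \<subseteq> El w" shows "CC m r v \<longleftrightarrow> inC m v \<and> DD m r w v"
proof -
  have "LRr w l \<and> \<not> (\<exists>f\<in>El v. gd m w r f l \<and> cr f k) \<longleftrightarrow> LR l \<and> \<not> (\<exists>f\<in>El v. good (inC m) r f l l \<and> crit f k)"
    if "l \<in> El v" "k \<in> El l" for l k
  proof -
    have lw: "l \<in> El w" using that v(2) by blast
    have L: "LRr w l \<longleftrightarrow> LR l" unfolding LRr_def using LR_in[OF w(1) lw] by blast
    have "gd m w r f l \<and> cr f k \<longleftrightarrow> good (inC m) r f l l \<and> crit f k" if "LR l" for f
      using gd_good[OF w lw, of r f] cr_crit[OF _ that \<open>k \<in> El l\<close>, of f] unfolding good_iff by blast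
    then show ?thesis unfolding L by blast
  qed
  then show ?thesis unfolding CC_def DD_def using v(1) by (smt (verit))
qed

definition "RRr m r i v U k X Y \<longleftrightarrow> (if k < length Flist then Fr k m v U r v X Y else RP i v X Y)"

lemma D0_RP[dz]: "TD f \<Longrightarrow> TD g \<Longrightarrow> TD h \<Longrightarrow> TD k \<Longrightarrow> D0 (\<lambda>s. RP (f s) (g s) (h s) (k s))"
  by (rule D0_app4[of RP], unfold RP_def, intro D0_emp D0_upr dz)

lemma D0_RRr: "TD r \<Longrightarrow> TD i \<Longrightarrow> TD v \<Longrightarrow> TD U \<Longrightarrow> TD f \<Longrightarrow> TD g \<Longrightarrow> D0 (\<lambda>s. RRr m (r s) (i s) (v s) (U s) k (f s) (g s))"
  by (cases "k < length Flist") (simp_all add: RRr_def D0_Fr D0_RP)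

lemma RRr_RR: assumes "inC m v" "LR v" "k < length Flist \<or> k = length Flist" shows "RRr m r i v (Pw v) k X Y = RR m r i v k X Y"
proof (cases "k < length Flist")
  case True
  have "(Flist ! k) (Bw m v) (\<lambda>S. S \<in> El (Pw v)) r v X Y = (Flist ! k) (inC m) TT r v X Y"
    by (rule F_cong[OF nth_mem[OF True]]) (use inC_inC[OF assms(1)] in auto)
  then show ?thesis using True by (simp add: RRr_def RR_def Fr_def)
qed (simp add: RRr_def RR_def)

lemma D0_vx:
  assumes "\<And>k f g. TD f \<Longrightarrow> TD g \<Longrightarrow> D0 (\<lambda>s. R s k (f s) (g s))" "TD U" "TD c" "TD z"
  shows "D0 (\<lambda>s. vx (U s) (R s) N (c s) (z s))"
  unfolding vx_def by (intro D0_bex_lt D0_num assms dz)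

lemma D0_ed:
  assumes "\<And>k f g. TD f \<Longrightarrow> TD g \<Longrightarrow> D0 (\<lambda>s. R s k (f s) (g s))" "TD U" "TD c" "TD a" "TD b"
  shows "D0 (\<lambda>s. ed (U s) (R s) N (c s) (a s) (b s))"
  unfolding ed_def by (intro D0_vx D0_num D0_sc assms dz)

text \<open>The closure conditions are evaluated inside \<open>v\<close>, the first component of
  \<open>p2 c\<close>. Unbounded are the correctness of \<open>v\<close>, a Pi condition of level
  \<open>m\<close>, and the identification of the power set of \<open>v\<close> and of the vertices
  and edges of \<open>G\<close>, which are universal over bounded conditions.\<close>

definition "PSI m r c G \<longleftrightarrow> ispr c \<and> ispr (p2 c) \<and> Od (p1 c) \<and> p1 c \<in> El (p1 (p2 c)) \<and> inC m (p1 (p2 c)) \<and>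
  DD m r (p1 (p2 c)) (p1 (p2 c)) \<and>
  (\<forall>u\<in>El (p1 (p2 c)). Bw m (p1 (p2 c)) u \<and> DD m r (p1 (p2 c)) u \<longrightarrow> p1 c \<notin> El u) \<and>
  (\<forall>X. X \<in> El (p2 (p2 c)) \<longleftrightarrow> El X \<subseteq> El (p1 (p2 c))) \<and>
  (\<forall>z. z \<in> El (p1 G) \<longleftrightarrow> vx (p2 (p2 c)) (RRr m r (p1 c) (p1 (p2 c)) (p2 (p2 c))) NR c z) \<and>
  (\<forall>z. z \<in> El (p2 G) \<longleftrightarrow> ispr z \<and> ed (p2 (p2 c)) (RRr m r (p1 c) (p1 (p2 c)) (p2 (p2 c))) NR c (p1 z) (p2 z))"

lemma PI_PSI: "PI (Suc k) (\<lambda>s. PSI (Suc k) (s x) (s y) (s z))"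
  unfolding PSI_def
proof (intro PI_and)
  show "PI (Suc k) (\<lambda>s. inC (Suc k) (p1 (p2 (s y))))"
    by (rule PI_TD[of k "\<lambda>s a. inC (Suc k) a"]) (rule PI_inC, intro dz)
  show "PI (Suc k) (\<lambda>s. \<forall>X. X \<in> El (p2 (p2 (s y))) \<longleftrightarrow> El X \<subseteq> El (p1 (p2 (s y))))"
    by (intro PI_all D0_PI dz)
  show "PI (Suc k) (\<lambda>s. \<forall>u. u \<in> El (p1 (s z)) \<longleftrightarrow> vx (p2 (p2 (s y))) (RRr (Suc k) (s x) (p1 (s y)) (p1 (p2 (s y))) (p2 (p2 (s y)))) NR (s y) u)"
    by (intro PI_all D0_PI D0_iff D0_vx D0_RRr dz)
  show "PI (Suc k) (\<lambda>s. \<forall>u. u \<in> El (p2 (s z)) \<longleftrightarrow> ispr u \<and> ed (p2 (p2 (s y))) (RRr (Suc k) (s x) (p1 (s y)) (p1 (p2 (s y))) (p2 (p2 (s y)))) NR (s y) (p1 u) (p2 u))"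
    by (intro PI_all D0_PI D0_iff D0_and D0_ed D0_RRr dz)
  show "PI (Suc k) (\<lambda>s. \<forall>u\<in>El (p1 (p2 (s y))). Bw (Suc k) (p1 (p2 (s y))) u \<and> DD (Suc k) (s x) (p1 (p2 (s y))) u \<longrightarrow> p1 (s y) \<notin> El u)"
    by (intro D0_PI D0_ball D0_imp D0_and D0_sat_elts dz)
qed (intro D0_PI dz)+

lemma CCmin_iff: assumes m: "m \<noteq> 0"
  shows "CCmin m r i v \<longleftrightarrow> i \<in> El v \<and> inC m v \<and> DD m r v v \<and> (\<forall>u\<in>El v. Bw m v u \<and> DD m r v u \<longrightarrow> i \<notin> El u)"
proof (cases "inC m v")
  case True
  have L: "LR u" if "inC m u" for u using that m by (cases m) auto
  have "CC m r u \<longleftrightarrow> Bw m v u \<and> DD m r v u" if u: "u \<in> El v" for u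
    using DD_CC[OF L[OF True] True L, of u r] inC_inC[OF True u] LR_trans[OF L[OF True] u] L[of u] unfolding CC_def[of m r u] by blast
  moreover have "CC m r v \<longleftrightarrow> DD m r v v" using DD_CC[OF L[OF True] True L[OF True]] True by blast
  ultimately show ?thesis unfolding CCmin_def using True by blast
next
  case False then show ?thesis unfolding CCmin_def CC_def by blast
qed

lemma vx_cong: "(\<And>k x y. k < N \<Longrightarrow> R k x y = R' k x y) \<Longrightarrow> vx U R N c z = vx U R' N c z" unfolding vx_def by (simp cong: conj_cong) 
lemma ed_cong: "(\<And>k x y. k < N \<Longrightarrow> R k x y = R' k x y) \<Longrightarrow> ed U R N c a b = ed U R' N c a b"
  unfolding ed_def using vx_cong[of N R R' U c a] vx_cong[of N R R' U c b] by simp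

lemma PSI_iff: assumes m: "m \<noteq> 0" and G: "ispr G"
  shows "PSI m r c G \<longleftrightarrow> (\<exists>i v. Od i \<and> CCmin m r i v \<and> c = pr i (pr v (Pw v)) \<and> G = Gv m r i v)"
proof
  have L: "LR u" if "inC m u" for u using that m by (cases m) auto
  have R: "vx U (RRr m r i v (Pw v)) NR c z = vx U (RR m r i v) NR c z" "ed U (RRr m r i v (Pw v)) NR c a b = ed U (RR m r i v) NR c a b"
    if "inC m v" for v i c U z a b
    by (rule vx_cong, rule RRr_RR[OF that L[OF that]], simp add: less_Suc_eq) (rule ed_cong, rule RRr_RR[OF that L[OF that]], simp add: less_Suc_eq)
  { assume P: "PSI m r c G"
    define i v where iv: "i = p1 c" "v = p1 (p2 c)"
    have U: "p2 (p2 c) = Pw v" using P unfolding PSI_def iv by (intro El_ext) auto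
    have c: "c = pr i (pr v (Pw v))" using P U unfolding PSI_def iv by (metis ispr_D)
    have min: "Od i" "CCmin m r i v" using P unfolding PSI_def CCmin_iff[OF m] iv by blast+
    have iC: "inC m v" using P unfolding PSI_def iv by blast
    have "El (p1 G) = El (p1 (Gv m r i v))" "El (p2 G) = El (p2 (Gv m r i v))"
      unfolding Gv_def El_gr[OF DP_RR] R[OF iC, symmetric] using P unfolding PSI_def U iv[symmetric] c[symmetric] by blast+
    then have "p1 G = p1 (Gv m r i v)" "p2 G = p2 (Gv m r i v)" using El_ext by blast+
    then have "G = Gv m r i v" using ispr_D[OF G] unfolding Gv_def gr_def by simp
    then show "\<exists>i v. Od i \<and> CCmin m r i v \<and> c = pr i (pr v (Pw v)) \<and> G = Gv m r i v" using c min by blast }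
  { assume "\<exists>i v. Od i \<and> CCmin m r i v \<and> c = pr i (pr v (Pw v)) \<and> G = Gv m r i v"
    then obtain i v where h: "Od i" "CCmin m r i v" "c = pr i (pr v (Pw v))" "G = Gv m r i v" by blast
    have iC: "inC m v" using h(2) unfolding CCmin_def CC_def by blast
    show "PSI m r c G" unfolding PSI_def h(3) p1 p2
      using h(1,2) iC unfolding CCmin_iff[OF m] h(4) Gv_def El_gr[OF DP_RR] R[OF iC] by simp }
qed

text \<open>The first label of a graph; its last component is the data from which the graph is defined.\<close>

definition "lab z \<longleftrightarrow> p1 z = num 3 \<and> p1 (p2 z) = num 0"
lemma D0_lab[dz]: "TD f \<Longrightarrow> D0 (\<lambda>s. lab (f s))" unfolding lab_def by (intro D0_and D0_num dz)

text \<open>The data are found by a search bounded by the graph, where an unbounded search for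
  \<open>i\<close> and \<open>v\<close> would leave the Pi class. Thus the range of the sequence is
  no more complex than the sequence.\<close>

definition "KC m r G \<longleftrightarrow> ispr G \<and> (\<exists>z\<in>El (p1 G). lab z) \<and> (\<forall>z. z \<in> El (p1 G) \<and> lab z \<longrightarrow> PSI m r (p2 (p2 z)) G)"

lemma lab_Gv: "z \<in> El (p1 (Gv m r i v)) \<and> lab z \<longleftrightarrow> z = lb (pr i (pr v (Pw v))) 0"
proof
  assume "z \<in> El (p1 (Gv m r i v)) \<and> lab z"
  then have z: "vx (Pw v) (RR m r i v) NR (pr i (pr v (Pw v))) z" "lab z" unfolding Gv_def El_gr[OF DP_RR] by simp_all
  from z(1) show "z = lb (pr i (pr v (Pw v))) 0" by (rule vx_cases) (use z(2) in \<open>simp_all add: lab_def\<close>)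
next
  assume "z = lb (pr i (pr v (Pw v))) 0"
  then show "z \<in> El (p1 (Gv m r i v)) \<and> lab z" unfolding Gv_def El_gr[OF DP_RR] by (simp add: lab_def)
qed

lemma KC_iff: assumes m: "m \<noteq> 0" shows "KC m r G \<longleftrightarrow> (\<exists>i v. Od i \<and> CCmin m r i v \<and> G = Gv m r i v)"
proof
  assume K: "KC m r G"
  then obtain z where z: "z \<in> El (p1 G)" "lab z" "ispr G" unfolding KC_def by blast
  then have "PSI m r (p2 (p2 z)) G" using K unfolding KC_def by blast
  then show "\<exists>i v. Od i \<and> CCmin m r i v \<and> G = Gv m r i v" unfolding PSI_iff[OF m z(3)] by blast
next
  assume "\<exists>i v. Od i \<and> CCmin m r i v \<and> G = Gv m r i v"
  then obtain i v where h: "Od i" "CCmin m r i v" "G = Gv m r i v" by blast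
  have iG: "ispr G" unfolding h(3) Gv_def gr_def by simp
  show "KC m r G" unfolding KC_def
  proof (intro conjI allI impI iG)
    show "\<exists>z\<in>El (p1 G). lab z" using lab_Gv[of _ m r i v] unfolding h(3) by blast
    fix z assume "z \<in> El (p1 G) \<and> lab z"
    then have "p2 (p2 z) = pr i (pr v (Pw v))" unfolding h(3) lab_Gv by simp
    then show "PSI m r (p2 (p2 z)) G" unfolding PSI_iff[OF m iG] using h by blast
  qed
qed

lemma PI_KC: "PI (Suc k) (\<lambda>s. KC (Suc k) (s x) (s y))"
  unfolding KC_def
proof (intro PI_and)
  have "PI (Suc k) (\<lambda>s. PSI (Suc k) (s (Suc x)) (p2 (p2 (s 0))) (s (Suc y)))"
    by (rule PI_TD[of k "\<lambda>s a. PSI (Suc k) (s (Suc x)) a (s (Suc y))"]) (rule PI_PSI, intro dz)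
  then show "PI (Suc k) (\<lambda>s. \<forall>z. z \<in> El (p1 (s y)) \<and> lab z \<longrightarrow> PSI (Suc k) (s x) (p2 (p2 z)) (s y))"
    by (intro PI_all PI_imp D0_SG D0_and dz)
qed (intro D0_PI dz)+

definition "SC m r x \<longleftrightarrow> ispr x \<and> KC m r (p2 x) \<and> (\<forall>z\<in>El (p1 (p2 x)). lab z \<longrightarrow> p1 (p2 (p2 z)) = p1 x)"

lemma PI_SC: "PI (Suc k) (\<lambda>s. SC (Suc k) (s x) (s y))"
  unfolding SC_def
proof (intro PI_and)
  show "PI (Suc k) (\<lambda>s. KC (Suc k) (s x) (p2 (s y)))"
    by (rule PI_TD[of k "\<lambda>s a. KC (Suc k) (s x) a"]) (rule PI_KC, intro dz)
qed (intro D0_PI dz)+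

lemma PI_definable: assumes "PI k (\<lambda>s. P (s 1) (s 0))" shows "definable E (Pi_fm k) {x. P r x}"
proof -
  obtain \<phi> where \<phi>: "\<phi> \<in> Pi_fm k" "\<And>s. sat E UNIV s \<phi> = P (s 1) (s 0)" using assms unfolding FD_def by blast
  have "{x. P r x} = {x. sat E UNIV ((\<lambda>_. r)(0 := x)) \<phi>}" unfolding \<phi>(2) by simp
  then show ?thesis unfolding definable_def using \<phi>(1) by blast
qed

end

context nostrong
begin

lemma CCmin_V_iff: "CCmin m r i v \<longleftrightarrow> v = V i" using CCmin_V V_eq by blast

lemma KC_G: "{x. KC m r x} = {G i |i. Od i}"
  unfolding KC_iff[OF m] CCmin_V_iff GG_def by blast

lemma SC_G: "{x. SC m r x} = {pr i (G i) |i. Od i}"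
proof (intro equalityI subsetI)
  fix x assume "x \<in> {x. SC m r x}"
  then have x: "ispr x" "KC m r (p2 x)" "\<And>z. z \<in> El (p1 (p2 x)) \<Longrightarrow> lab z \<Longrightarrow> p1 (p2 (p2 z)) = p1 x" unfolding SC_def by blast+
  obtain i where i: "Od i" "p2 x = G i" using x(2) KC_G by blast
  have "lb (pr i (pr (V i) (Pw (V i)))) 0 \<in> El (p1 (p2 x)) \<and> lab (lb (pr i (pr (V i) (Pw (V i)))) 0)"
    unfolding i(2) GG_def lab_Gv by simp
  then have "p1 x = i" using x(3) by fastforce
  then show "x \<in> {pr i (G i) |i. Od i}" using ispr_D[OF x(1)] i by auto
next
  fix x assume "x \<in> {pr i (G i) |i. Od i}"
  then obtain i where i: "Od i" "x = pr i (G i)" by blast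
  have "KC m r (G i)" using KC_G i(1) by blast
  moreover have "p1 (p2 (p2 z)) = i" if "z \<in> El (p1 (G i))" "lab z" for z
    using lab_Gv[of z m r i "V i"] that unfolding GG_def by simp
  ultimately show "x \<in> {x. SC m r x}" unfolding SC_def i(2) by simp
qed

lemma G_definable: "definable_seq E (Pi_fm m) G" "definable E (Pi_fm m) {G i |i. Od i}"
proof -
  obtain k where k: "m = Suc k" using m by (cases m) auto
  show "definable_seq E (Pi_fm m) G" unfolding definable_seq_def SC_G[symmetric]
    unfolding k by (rule PI_definable[of "Suc k" "SC (Suc k)"]) (rule PI_SC)
  show "definable E (Pi_fm m) {G i |i. Od i}" unfolding KC_G[symmetric]
    unfolding k by (rule PI_definable[of "Suc k" "KC (Suc k)"]) (rule PI_KC)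
qed

lemma not_WVP: "\<not> WVP E (Pi_fm m)"
proof -
  have "\<exists>!h. hom E h (G b) (G a)" if "Od b" "a \<in> El b \<or> a = b" for a b
    using hom_ex[OF that] hom_unique[OF that] by blast
  then have "\<forall>a b. Od a \<and> Od b \<and> (a \<in> El b \<or> a = b) \<longrightarrow> (\<exists>!h. hom E h (G b) (G a))" by simp
  moreover have "\<forall>a b. Od a \<and> Od b \<and> a \<in> El b \<longrightarrow> \<not> (\<exists>h. hom E h (G a) (G b))" using no_hom by simp
  moreover have "\<forall>a. Od a \<longrightarrow> is_graph E (G a)" using G_graph by simp
  ultimately have "\<exists>G. definable_seq E (Pi_fm m) G \<and> (\<forall>\<alpha>. Od \<alpha> \<longrightarrow> is_graph E (G \<alpha>)) \<and>
     (\<forall>\<alpha> \<beta>. Od \<alpha> \<and> Od \<beta> \<and> (\<alpha> \<in> El \<beta> \<or> \<alpha> = \<beta>) \<longrightarrow> (\<exists>!h. hom E h (G \<beta>) (G \<alpha>))) \<and>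
     (\<forall>\<alpha> \<beta>. Od \<alpha> \<and> Od \<beta> \<and> \<alpha> \<in> El \<beta> \<longrightarrow> \<not> (\<exists>h. hom E h (G \<alpha>) (G \<beta>)))"
    using G_definable(1) by (intro exI[of _ "GG m r"] conjI)
  then show ?thesis unfolding WVP_def by (simp only: not_not)
qed

lemma not_PRP: "\<not> PRP E (Pi_fm m)"
proof
  assume P: "PRP E (Pi_fm m)"
  let ?C = "{G i |i. Od i}"
  note d = seq_DP[OF G_definable(1)]
  have "proper_class E ?C" by (rule sequence_proper_class[OF d G_inj])
  moreover have "\<forall>\<A>\<in>?C. is_graph E \<A>" using G_graph by blast
  ultimately obtain S where S: "El S \<subseteq> ?C" "\<forall>x\<in>?C. \<exists>h. hom E h (prod_graph E S) x"
    using P G_definable(2) unfolding PRP_def by blast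
  show False
    by (rule no_descending_sequence[OF d G_graph _ _ S(1)]) (use hom_ex no_hom S(2) in blast)+
qed

end

section \<open>Strong cardinals against the rigid sequence, and comparison of the principles\<close>

context zfc
begin

lemma not_proper_nostrong:
  assumes "\<not> proper_class E {\<kappa>. strong E (Sigma_fm (Suc m)) \<kappa>}" "m \<noteq> 0"
  shows "\<exists>r. nostrong E m r"
proof -
  obtain x where x: "{\<kappa>. strong E (Sigma_fm (Suc m)) \<kappa>} \<subseteq> El x" using assms(1) unfolding proper_class_def by blast
  have sx: "El (sep x Od) = {a \<in> El x. Od a}" by (rule El_sep) (intro dfn)
  obtain r where r: "Od r" "\<And>a. a \<in> El x \<Longrightarrow> Od a \<Longrightarrow> a \<in> El r" using Od_bound[of "sep x Od"] unfolding sx by blast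
  have "nostrong E m r"
  proof (unfold_locales, rule assms(2), rule r(1))
    fix k assume k: "Od k" "r \<in> El k"
    have "\<not> strong E (Sigma_fm (Suc m)) k" using x r(2) k no2 by blast
    then show "\<exists>l. LR l \<and> k \<in> El l \<and> \<not> (\<exists>f. good (inC m) r f l l \<and> crit f k)"
      using good_strong[OF k(1), of m r] by blast
  qed
  then show ?thesis ..
qed

lemma strong_anti: "\<Gamma> \<subseteq> \<Delta> \<Longrightarrow> strong E \<Delta> \<kappa> \<Longrightarrow> strong E \<Gamma> \<kappa>"
  unfolding strong_def lam_strong_def by blast
lemma definable_mono: "\<Gamma> \<subseteq> \<Delta> \<Longrightarrow> definable E \<Gamma> A \<Longrightarrow> definable E \<Delta> A" unfolding definable_def by blast
lemma PRP_anti: "\<Gamma> \<subseteq> \<Delta> \<Longrightarrow> PRP E \<Delta> \<Longrightarrow> PRP E \<Gamma>"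
  unfolding PRP_def using definable_mono by blast
lemma SWVP_anti: assumes "\<Gamma> \<subseteq> \<Delta>" "SWVP E \<Delta>" shows "SWVP E \<Gamma>"
  unfolding SWVP_def
proof (rule notI, elim exE)
  fix G assume "definable_seq E \<Gamma> G \<and> (\<forall>a. Od a \<longrightarrow> is_graph E (G a)) \<and>
     (\<forall>a b. Od a \<and> Od b \<and> (a \<in> El b \<or> a = b) \<longrightarrow> (\<exists>h. hom E h (G b) (G a))) \<and>
     (\<forall>a b. Od a \<and> Od b \<and> a \<in> El b \<longrightarrow> \<not> (\<exists>h. hom E h (G a) (G b)))" (is "_ \<and> ?P")
  then have "definable_seq E \<Delta> G \<and> ?P" using definable_mono[OF assms(1)] unfolding definable_seq_def by simp
  then show False using assms(2) unfolding SWVP_def by (elim notE exI)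
qed
lemma WVP_anti: assumes "\<Gamma> \<subseteq> \<Delta>" "WVP E \<Delta>" shows "WVP E \<Gamma>"
  unfolding WVP_def
proof (rule notI, elim exE)
  fix G assume "definable_seq E \<Gamma> G \<and> (\<forall>a. Od a \<longrightarrow> is_graph E (G a)) \<and>
     (\<forall>a b. Od a \<and> Od b \<and> (a \<in> El b \<or> a = b) \<longrightarrow> (\<exists>!h. hom E h (G b) (G a))) \<and>
     (\<forall>a b. Od a \<and> Od b \<and> a \<in> El b \<longrightarrow> \<not> (\<exists>h. hom E h (G a) (G b)))" (is "_ \<and> ?P")
  then have "definable_seq E \<Delta> G \<and> ?P" using definable_mono[OF assms(1)] unfolding definable_seq_def by simp
  then show False using assms(2) unfolding WVP_def by (elim notE exI)
qed
lemma SWVP_WVP: assumes "SWVP E \<Gamma>" shows "WVP E \<Gamma>"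
  unfolding WVP_def
proof (rule notI, elim exE conjE)
  fix G assume G: "definable_seq E \<Gamma> G" "\<forall>a. Od a \<longrightarrow> is_graph E (G a)"
     "\<forall>a b. Od a \<and> Od b \<and> (a \<in> El b \<or> a = b) \<longrightarrow> (\<exists>!h. hom E h (G b) (G a))"
     "\<forall>a b. Od a \<and> Od b \<and> a \<in> El b \<longrightarrow> \<not> (\<exists>h. hom E h (G a) (G b))"
  have "\<forall>a b. Od a \<and> Od b \<and> (a \<in> El b \<or> a = b) \<longrightarrow> (\<exists>h. hom E h (G b) (G a))" using G(3) ex1_implies_ex by metis
  then have "\<exists>G. definable_seq E \<Gamma> G \<and> (\<forall>a. Od a \<longrightarrow> is_graph E (G a)) \<and>
     (\<forall>a b. Od a \<and> Od b \<and> (a \<in> El b \<or> a = b) \<longrightarrow> (\<exists>h. hom E h (G b) (G a))) \<and>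
     (\<forall>a b. Od a \<and> Od b \<and> a \<in> El b \<longrightarrow> \<not> (\<exists>h. hom E h (G a) (G b)))" using G(1,2,4) by (intro exI[of _ G] conjI)
  then show False using assms unfolding SWVP_def by (elim notE)
qed

end

theorem theorem6p15:
  fixes E :: "'a \<Rightarrow> 'a \<Rightarrow> bool" and n :: nat
  assumes "ZFC E" and "n \<ge> 2"
  shows "(proper_class E {\<kappa>. strong E (Sigma_fm n) \<kappa>} \<longleftrightarrow>
            proper_class E {\<kappa>. strong E (Pi_fm (n - 1)) \<kappa>}) \<and>
         (proper_class E {\<kappa>. strong E (Pi_fm (n - 1)) \<kappa>} \<longleftrightarrow> PRP E (Sigma_fm n)) \<and>
         (PRP E (Sigma_fm n) \<longleftrightarrow> PRP E (Pi_fm (n - 1))) \<and>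
         (PRP E (Pi_fm (n - 1)) \<longleftrightarrow> SWVP E (Sigma_fm n)) \<and>
         (SWVP E (Sigma_fm n) \<longleftrightarrow> SWVP E (Pi_fm (n - 1))) \<and>
         (SWVP E (Pi_fm (n - 1)) \<longleftrightarrow> WVP E (Sigma_fm n)) \<and>
         (WVP E (Sigma_fm n) \<longleftrightarrow> WVP E (Pi_fm (n - 1)))"
proof -
  interpret zfc E by unfold_locales (rule assms(1))
  obtain k where k: "n = Suc (Suc k)" using assms(2) by (metis add_2_eq_Suc le_Suc_ex)
  define m where "m = Suc k"
  have nm: "n = Suc m" "n - 1 = m" "m \<noteq> 0" unfolding k m_def by simp_all
  have sub: "Pi_fm m \<subseteq> Sigma_fm (Suc m)" by (rule Pi_Sigma_Suc)
  let ?S = "proper_class E {\<kappa>. strong E (Sigma_fm (Suc m)) \<kappa>}" and ?P = "proper_class E {\<kappa>. strong E (Pi_fm m) \<kappa>}"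
  have 1: "?S \<Longrightarrow> ?P" unfolding proper_class_def using strong_anti[OF sub] by blast
  have 2: "?P \<Longrightarrow> PRP E (Sigma_fm (Suc m))" unfolding m_def by (rule strong_PRP)
  have 3: "PRP E (Sigma_fm (Suc m)) \<Longrightarrow> PRP E (Pi_fm m)" by (rule PRP_anti[OF sub])
  have 4: "PRP E (Sigma_fm (Suc m)) \<Longrightarrow> SWVP E (Sigma_fm (Suc m))" by (rule PRP_SWVP)
  have 5: "SWVP E (Sigma_fm (Suc m)) \<Longrightarrow> SWVP E (Pi_fm m)" by (rule SWVP_anti[OF sub])
  have 6: "SWVP E (Pi_fm m) \<Longrightarrow> WVP E (Pi_fm m)" by (rule SWVP_WVP)
  have 7: "SWVP E (Sigma_fm (Suc m)) \<Longrightarrow> WVP E (Sigma_fm (Suc m))" by (rule SWVP_WVP)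
  have 8: "WVP E (Sigma_fm (Suc m)) \<Longrightarrow> WVP E (Pi_fm m)" by (rule WVP_anti[OF sub])
  \<comment> \<open>Both Pi principles are refuted by the same sequence. For product reflection this
    avoids the passage from an arbitrary Pi sequence to its range, which would raise the
    complexity.\<close>
  have 9: "?S" if "WVP E (Pi_fm m) \<or> PRP E (Pi_fm m)"
  proof (rule ccontr)
    assume "\<not> ?S"
    then obtain r where "nostrong E m r" using not_proper_nostrong nm(3) by blast
    then interpret nostrong E m r .
    show False using that not_WVP not_PRP by blast
  qed
  show ?thesis unfolding nm(2) unfolding nm(1) using 1 2 3 4 5 6 7 8 9 by blast
qed

end
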